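(* Let $L$ be a geometric lattice, and suppose $\mathcal H$ and $\mathcal H'=\mathcal H\cup\{p\}$ ($p\notin\mathcal H$) are partial building sets (with respect to a common building set $\mathcal G$) in $L$. Then there is an injective cdga map $\phi_{\hat B}\colon\hat B(L,\mathcal H)\to\hat B(L,\mathcal H')$, given on generators $g\in\mathcal H$ by $$\phi_{\hat B}(e_g)=\begin{cases}e_g& g\not\le p\\ e_g+e_p& g\le p\end{cases}\qquad \phi_{\hat B}(x_g)=\begin{cases}x_g& g\not\le p\\ x_g+x_p& g\le p.\end{cases}$$ Furthermore, if $\hat 1\in\mathcal H$, there is an injective cdga map $\phi_B\colon B(L,\mathcal H)\to B(L,\mathcal H')$ (induced by $\phi_{\hat B}$).
   Context: All posets are finite. For a meet-semilattice $P$ with least element $\hat 0$, write $P_+=P\setminus\{\hat 0\}$ and $\mathrm{a}(P)$ for its set of atoms. $P$ is locally geometric if every interval $[\hat 0,x]$ is a geometric lattice; $M(P_{\le x})$ denotes the simple matroid on the atoms below $x$ whose lattice of flats is $[\hat 0,x]$. Combinatorial blowup. For $p\in P_+$, let $P_{(p)}=\{x\in P: x\not\ge p,\ p\vee x \text{ exists}\}$ and $\mathrm{Bl}_p(P)=\{x\in P:x\not\ge p\}\cup\{(p,x):x\in P_{(p)}\}$, ordered by: $y>x$ if $y>x$ in $P$; $(p,y)>(p,x)$ if $y>x$ in $P$; $(p,y)>x$ if $y\ge x$ in $P$. Building sets. A subset $\mathcal G\subseteq L_+$ of a geometric lattice $L$ is a building set if for every $x\in L_+$ with $\max \mathcal G_{\le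 x}=\{x_1,\dots,x_k\}$ there is a poset isomorphism $\prod_j[\hat 0,x_j]\to[\hat 0,x]$ sending $(\hat 0,\dots,x_j,\dots,\hat 0)$ to $x_j$. It is always assumed that the maximum $\hat 1$ of $L$ is in $\mathcal G$. A partial building set is a subset $\mathcal H\subseteq\mathcal G$ with $\mathrm{a}(L)\subseteq\mathcal H$ and $\mathcal H^\circ:=\mathcal H\setminus \mathrm{a}(L)$ upward closed in $\mathcal G$. Writing $\mathcal H^\circ=\{p_1,\dots,p_m\}$ with $p_i\ge p_j\Rightarrow i\le j$, set $\mathcal L(L,\mathcal H)=\mathrm{Bl}_{p_m}\circ\cdots\circ\mathrm{Bl}_{p_1}(L)$. This is a locally geometric semilattice whose atoms are identified with $\mathcal H$. Nested sets. $S\subseteq\mathcal H$ is $\mathcal H$-nested if for every set of at least two pairwise incomparable (in $L$) elements of $S$, their join in $L$ is not in $\mathcal H$. $N(L,\mathcal H)$ is the simplicial complex of $\mathcal H$-nested sets; its simplices are exactly the sets of atoms of $\mathcal L(L,\mathcal H)$ having an upper bound there. $S\in N(L,\mathcal H)$ is a circuit if it is a circuit of $M(\mathcal L(L,\mathcal H)_{\le\bigvee S})$, the join being in $\mathcal L(L,\mathcal H)$. The algebras. Fix a linear order $\prec$ on $\mathcal H$ with $p\ge q\Rightarrow p\prec q$. Let $R(\mathcal H)=\mathbb Q[e_g,x_g:g\in\mathcal H]$ be the free graded-commutative algebra with $e_g$ in bidegree $(0,1)$, $x_g$ in bidegree $(2,0)$, with differential $d$ the derivation with $d(e_g)=x_g$,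 $d(x_g)=0$. Write $e_S=e_{g_1}\cdots e_{g_k}$ for $S=\{g_1\prec\dots\prec g_k\}$, $x_T=\prod_{g\in T}x_g$, $\partial e_S=\sum_j(-1)^{j-1}e_{g_1}\cdots\widehat{e_{g_j}}\cdots e_{g_k}$, $c_g=\sum_{h\in\mathcal H,\,h\ge g}x_h$. Then $\hat B(L,\mathcal H)=R(\mathcal H)/I(L,\mathcal H)$, where $I(L,\mathcal H)$ is generated by: (i) $e_Sx_T$ whenever $S\cup T\notin N(L,\mathcal H)$; (ii) $\partial e_S$ whenever $S\in N(L,\mathcal H)$ is a circuit; (iii) $c_g$ for $g\in \mathrm{a}(L)$. If $\hat 1\in\mathcal H$, $B(L,\mathcal H)=\hat B(L,\mathcal H)/(e_{\hat 1})$ as an algebra; $\hat B\cong B\otimes\mathbb Q[e_{\hat 1}]$ and $B(L,\mathcal H)$ is identified with the subalgebra of $\hat B(L,\mathcal H)$ generated by all $x_g$ and by the $e_g$ with $g\neq\hat 1$, with the restricted differential $d$. *)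

theory Defs
  imports
    "HOL-Algebra.Lattice"
    "HOL-Algebra.QuotRing"
    "HOL-Algebra.Generated_Rings"
    "HOL-Algebra.Module"
    "HOL-Library.Poly_Mapping"
    "HOL-Library.Multiset"
    "HOL-Library.FuncSet"
begin

section \<open>Posets and geometric lattices\<close>

definition covers :: "('a, 'm) gorder_scheme \<Rightarrow> 'a \<Rightarrow> 'a \<Rightarrow> bool" where
  "covers P x y \<longleftrightarrow> x \<in> carrier P \<and> y \<in> carrier P \<and> x \<sqsubset>\<^bsub>P\<^esub> y
     \<and> \<not> (\<exists>z\<in>carrier P. x \<sqsubset>\<^bsub>P\<^esub> z \<and> z \<sqsubset>\<^bsub>P\<^esub> y)"

definition atoms :: "('a, 'm) gorder_scheme \<Rightarrow> 'a set" where
  "atoms P = {a. covers P \<bottom>\<^bsub>P\<^esub> a}"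

text \<open>Geometric means finite, atomistic and upper semimodular.\<close>

definition geometric_lattice :: "('a, 'm) gorder_scheme \<Rightarrow> bool" where
  "geometric_lattice L \<longleftrightarrow> bounded_lattice L \<and> finite (carrier L)
     \<and> (\<forall>x\<in>carrier L. \<exists>A\<subseteq>atoms L. is_lub L x A)
     \<and> (\<forall>x\<in>carrier L. \<forall>y\<in>carrier L.
          covers L (x \<sqinter>\<^bsub>L\<^esub> y) x \<longrightarrow> covers L y (x \<squnion>\<^bsub>L\<^esub> y))"


section \<open>The matroid of an interval\<close>

text \<open>The simple matroid \<open>M(P\<^bsub>\<le>x\<^esub>)\<close> has the atoms below \<open>x\<close> as ground set, and its flats are
  the sets \<open>flat P y\<close> for \<open>y \<sqsubseteq> x\<close>.\<close>

definition flat :: "('a, 'm) gorder_scheme \<Rightarrow> 'a \<Rightarrow> 'a set" where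
  "flat P y = {a \<in> atoms P. a \<sqsubseteq>\<^bsub>P\<^esub> y}"

definition matroid_closure :: "('a, 'm) gorder_scheme \<Rightarrow> 'a \<Rightarrow> 'a set \<Rightarrow> 'a set" where
  "matroid_closure P x S
     = \<Inter> {F. \<exists>y\<in>carrier P. y \<sqsubseteq>\<^bsub>P\<^esub> x \<and> F = flat P y \<and> S \<subseteq> F}"

definition matroid_indep :: "('a, 'm) gorder_scheme \<Rightarrow> 'a \<Rightarrow> 'a set \<Rightarrow> bool" where
  "matroid_indep P x S \<longleftrightarrow>
     S \<subseteq> flat P x \<and> (\<forall>a\<in>S. a \<notin> matroid_closure P x (S - {a}))"

definition matroid_circuit :: "('a, 'm) gorder_scheme \<Rightarrow> 'a \<Rightarrow> 'a set \<Rightarrow> bool" where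
  "matroid_circuit P x C \<longleftrightarrow>
     C \<subseteq> flat P x \<and> \<not> matroid_indep P x C \<and> (\<forall>D. D \<subset> C \<longrightarrow> matroid_indep P x D)"


section \<open>Combinatorial blowups\<close>

text \<open>One element type serves all iterated blowups of a poset on \<^typ>\<open>'a\<close>: original elements are
  \<open>Base x\<close>, and \<open>Exc p x\<close> is the element \<open>(p,x)\<close> created by blowing up \<open>p\<close>. Since \<open>p\<close> itself
  leaves the poset when it is blown up, the elements \<open>Exc p x\<close> are always new.\<close>

datatype 'a blowup_elem = Base 'a | Exc "'a blowup_elem" "'a blowup_elem"

definition base_poset :: "('a, 'm) gorder_scheme \<Rightarrow> 'a blowup_elem gorder" where
  "base_poset L = \<lparr>carrier = Base ` carrier L, eq = (=),
     le = (\<lambda>u v. \<exists>x y. u = Base x \<and> v = Base y \<and> x \<sqsubseteq>\<^bsub>L\<^esub> y)\<rparr>"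

definition joinable :: "('a, 'm) gorder_scheme \<Rightarrow> 'a \<Rightarrow> 'a set" where
  "joinable P p = {x \<in> carrier P. \<not> p \<sqsubseteq>\<^bsub>P\<^esub> x \<and> (\<exists>j. is_lub P j {p, x})}"

definition Bl :: "'a blowup_elem \<Rightarrow> 'a blowup_elem gorder \<Rightarrow> 'a blowup_elem gorder" where
  "Bl p P =
     (let old = {x \<in> carrier P. \<not> p \<sqsubseteq>\<^bsub>P\<^esub> x}; new = joinable P p in
      \<lparr>carrier = old \<union> Exc p ` new, eq = (=),
       le = (\<lambda>u v. u \<in> old \<and> v \<in> old \<and> u \<sqsubseteq>\<^bsub>P\<^esub> v
         \<or> (\<exists>x\<in>new. \<exists>y\<in>new. u = Exc p x \<and> v = Exc p y \<and> x \<sqsubseteq>\<^bsub>P\<^esub> y)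
         \<or> (\<exists>y\<in>new. u \<in> old \<and> v = Exc p y \<and> u \<sqsubseteq>\<^bsub>P\<^esub> y))\<rparr>)"


section \<open>Building sets and nested sets\<close>

definition max_below :: "('a, 'm) gorder_scheme \<Rightarrow> 'a set \<Rightarrow> 'a \<Rightarrow> 'a set" where
  "max_below L G x =
     {g \<in> G. g \<sqsubseteq>\<^bsub>L\<^esub> x \<and> (\<forall>h\<in>G. h \<sqsubseteq>\<^bsub>L\<^esub> x \<longrightarrow> g \<sqsubseteq>\<^bsub>L\<^esub> h \<longrightarrow> h = g)}"

definition building_set :: "('a, 'm) gorder_scheme \<Rightarrow> 'a set \<Rightarrow> bool" where
  "building_set L G \<longleftrightarrow> G \<subseteq> carrier L - {\<bottom>\<^bsub>L\<^esub>} \<and> \<top>\<^bsub>L\<^esub> \<in> G \<and>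
     (\<forall>x \<in> carrier L - {\<bottom>\<^bsub>L\<^esub>}.
        let M = max_below L G x; Q = (\<Pi>\<^sub>E m\<in>M. \<lbrace>\<bottom>\<^bsub>L\<^esub>..m\<rbrace>\<^bsub>L\<^esub>) in
        \<exists>f. bij_betw f Q \<lbrace>\<bottom>\<^bsub>L\<^esub>..x\<rbrace>\<^bsub>L\<^esub>
          \<and> (\<forall>u\<in>Q. \<forall>v\<in>Q. f u \<sqsubseteq>\<^bsub>L\<^esub> f v \<longleftrightarrow> (\<forall>m\<in>M. u m \<sqsubseteq>\<^bsub>L\<^esub> v m))
          \<and> (\<forall>m\<in>M. f (\<lambda>n\<in>M. if n = m then m else \<bottom>\<^bsub>L\<^esub>) = m))"

definition partial_building_set ::
    "('a, 'm) gorder_scheme \<Rightarrow> 'a set \<Rightarrow> 'a set \<Rightarrow> bool" where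
  "partial_building_set L G H \<longleftrightarrow> H \<subseteq> G \<and> atoms L \<subseteq> H
     \<and> (\<forall>h\<in>H - atoms L. \<forall>g\<in>G. h \<sqsubseteq>\<^bsub>L\<^esub> g \<longrightarrow> g \<in> H - atoms L)"

text \<open>\<open>blowup_sequence L H ps\<close>: the list \<open>ps\<close> enumerates \<open>H\<^sup>\<circ> = H - atoms L\<close>, larger elements first.\<close>

definition blowup_sequence :: "('a, 'm) gorder_scheme \<Rightarrow> 'a set \<Rightarrow> 'a list \<Rightarrow> bool" where
  "blowup_sequence L H ps \<longleftrightarrow> distinct ps \<and> set ps = H - atoms L
     \<and> (\<forall>i<length ps. \<forall>j<length ps. ps ! j \<sqsubseteq>\<^bsub>L\<^esub> ps ! i \<longrightarrow> i \<le> j)"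

text \<open>\<open>\<L>(L,H) = Bl\<^bsub>p\<^sub>m\<^esub> \<circ> \<dots> \<circ> Bl\<^bsub>p\<^sub>1\<^esub> (L)\<close> for \<open>ps = [p\<^sub>1,\<dots>,p\<^sub>m]\<close>.\<close>

definition iterated_blowup :: "('a, 'm) gorder_scheme \<Rightarrow> 'a list \<Rightarrow> 'a blowup_elem gorder" where
  "iterated_blowup L ps = fold (\<lambda>p. Bl (Base p)) ps (base_poset L)"

text \<open>The identification of \<open>H\<close> with the atoms of \<open>\<L>(L,H)\<close>: a blown up \<open>p\<close> corresponds to
  the new atom \<open>(p,\<zero>)\<close>.\<close>

definition atom_of :: "('a, 'm) gorder_scheme \<Rightarrow> 'a \<Rightarrow> 'a blowup_elem" where
  "atom_of L g = (if g \<in> atoms L then Base g else Exc (Base g) (Base \<bottom>\<^bsub>L\<^esub>))"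

definition nested :: "('a, 'm) gorder_scheme \<Rightarrow> 'a set \<Rightarrow> 'a set set" where
  "nested L H = {S. S \<subseteq> H \<and>
     (\<forall>T\<subseteq>S. 2 \<le> card T
        \<and> (\<forall>s\<in>T. \<forall>t\<in>T. s \<noteq> t \<longrightarrow> \<not> s \<sqsubseteq>\<^bsub>L\<^esub> t \<and> \<not> t \<sqsubseteq>\<^bsub>L\<^esub> s)
        \<longrightarrow> \<Squnion>\<^bsub>L\<^esub> T \<notin> H)}"

definition nested_circuit ::
    "('a, 'm) gorder_scheme \<Rightarrow> 'a set \<Rightarrow> 'a list \<Rightarrow> 'a set \<Rightarrow> bool" where
  "nested_circuit L H ps S \<longleftrightarrow> S \<in> nested L H
     \<and> (let P = iterated_blowup L ps in
        \<exists>j. is_lub P j (atom_of L ` S) \<and> matroid_circuit P j (atom_of L ` S))"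


section \<open>Bigraded differential algebras over the rationals\<close>

record 'm cdga = "(rat, 'm) module" +
  differential :: "'m \<Rightarrow> 'm"
  bidegree :: "nat \<Rightarrow> nat \<Rightarrow> 'm set"

definition cdga_hom :: "'m cdga \<Rightarrow> 'n cdga \<Rightarrow> ('m \<Rightarrow> 'n) set" where
  "cdga_hom A B = {f \<in> ring_hom A B.
     (\<forall>c. \<forall>x\<in>carrier A. f (c \<odot>\<^bsub>A\<^esub> x) = c \<odot>\<^bsub>B\<^esub> f x)
     \<and> (\<forall>x\<in>carrier A. f (differential A x) = differential B (f x))
     \<and> (\<forall>i j. f ` bidegree A i j \<subseteq> bidegree B i j)}"

text \<open>For a scalar- and \<open>d\<close>-stable ideal \<open>I\<close>, the unions below are the single cosets of
  \<open>c \<odot> a\<close> and \<open>d a\<close>.\<close>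

definition quotient_cdga :: "'m cdga \<Rightarrow> 'm set \<Rightarrow> 'm set cdga" where
  "quotient_cdga A I =
     \<lparr>carrier = carrier (A Quot I), monoid.mult = (\<otimes>\<^bsub>A Quot I\<^esub>), one = \<one>\<^bsub>A Quot I\<^esub>,
      zero = \<zero>\<^bsub>A Quot I\<^esub>, add = (\<oplus>\<^bsub>A Quot I\<^esub>),
      smult = (\<lambda>c X. \<Union>a\<in>X. I +>\<^bsub>A\<^esub> (c \<odot>\<^bsub>A\<^esub> a)),
      differential = (\<lambda>X. \<Union>a\<in>X. I +>\<^bsub>A\<^esub> differential A a),
      bidegree = (\<lambda>i j. (\<lambda>a. I +>\<^bsub>A\<^esub> a) ` bidegree A i j)\<rparr>"

definition subalgebra_gen :: "'m cdga \<Rightarrow> 'm set \<Rightarrow> 'm set" where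
  "subalgebra_gen A X = generate_ring A (X \<union> {c \<odot>\<^bsub>A\<^esub> \<one>\<^bsub>A\<^esub> | c. True})"

definition restrict_cdga :: "'m cdga \<Rightarrow> 'm set \<Rightarrow> 'm cdga" where
  "restrict_cdga A X = A\<lparr>carrier := X, bidegree := (\<lambda>i j. bidegree A i j \<inter> X)\<rparr>"


section \<open>The free graded-commutative algebra\<close>

text \<open>\<open>R(H)\<close> is the rational vector space with basis the monomials \<open>e\<^sub>S x\<^sup>m\<close>, encoded as pairs
  \<open>(S, m)\<close> of a finite subset and a multiset of \<open>H\<close>; here \<open>e\<^sub>S\<close> is the product of the
  \<open>e\<^sub>g\<close> (\<open>g \<in> S\<close>) in increasing order with respect to \<open>r\<close>. Reordering \<open>e\<^sub>S e\<^sub>T\<close> produces one sign for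
  each inversion, and \<open>e\<^sub>g\<^sup>2 = 0\<close>.\<close>

type_synonym 'a monomial = "'a set \<times> 'a multiset"

type_synonym 'a gca = "'a monomial \<Rightarrow>\<^sub>0 rat"

definition inversions :: "'a rel \<Rightarrow> 'a set \<Rightarrow> 'a set \<Rightarrow> nat" where
  "inversions r S T = card {(s, t) \<in> S \<times> T. s \<noteq> t \<and> (t, s) \<in> r}"

definition scale :: "rat \<Rightarrow> ('b \<Rightarrow>\<^sub>0 rat) \<Rightarrow> ('b \<Rightarrow>\<^sub>0 rat)" where
  "scale c f = Poly_Mapping.map ((*) c) f"

definition lin_ext :: "('b \<Rightarrow> 'c \<Rightarrow>\<^sub>0 rat) \<Rightarrow> ('b \<Rightarrow>\<^sub>0 rat) \<Rightarrow> ('c \<Rightarrow>\<^sub>0 rat)" where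
  "lin_ext F f = (\<Sum>u\<in>Poly_Mapping.keys f. scale (Poly_Mapping.lookup f u) (F u))"

definition monom_ex :: "'a set \<Rightarrow> 'a multiset \<Rightarrow> 'a gca" where
  "monom_ex S m = Poly_Mapping.single (S, m) 1"

definition mono_mult :: "'a rel \<Rightarrow> 'a monomial \<Rightarrow> 'a monomial \<Rightarrow> 'a gca" where
  "mono_mult r u v = (case (u, v) of ((S, m), (T, n)) \<Rightarrow>
     if S \<inter> T = {} then scale ((-1) ^ inversions r S T) (monom_ex (S \<union> T) (m + n)) else 0)"

text \<open>If \<open>S = {g\<^sub>1 \<prec> \<dots> \<prec> g\<^sub>k}\<close>, then \<open>inversions r {g\<^sub>j} S = j - 1\<close>.\<close>

definition mono_diff :: "'a rel \<Rightarrow> 'a monomial \<Rightarrow> 'a gca" where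
  "mono_diff r u = (case u of (S, m) \<Rightarrow>
     \<Sum>g\<in>S. scale ((-1) ^ inversions r {g} S) (monom_ex (S - {g}) (add_mset g m)))"

definition free_gca :: "'a set \<Rightarrow> 'a rel \<Rightarrow> 'a gca cdga" where
  "free_gca H r =
     \<lparr>carrier = {f. \<forall>(S, m)\<in>Poly_Mapping.keys f. finite S \<and> S \<subseteq> H \<and> set_mset m \<subseteq> H},
      monoid.mult = (\<lambda>f g. lin_ext (\<lambda>u. lin_ext (mono_mult r u) g) f),
      one = monom_ex {} {#}, zero = 0, add = (+),
      smult = scale,
      differential = lin_ext (mono_diff r),
      bidegree = (\<lambda>i j. {f. \<forall>(S, m)\<in>Poly_Mapping.keys f. finite S \<and> S \<subseteq> H \<and> set_mset m \<subseteq> H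
                                \<and> 2 * size m = i \<and> card S = j})\<rparr>"

definition e_gen :: "'a \<Rightarrow> 'a gca" where
  "e_gen g = monom_ex {g} {#}"

definition x_gen :: "'a \<Rightarrow> 'a gca" where
  "x_gen g = monom_ex {} {#g#}"

text \<open>\<open>\<partial>e\<^sub>S\<close>\<close>

definition boundary :: "'a rel \<Rightarrow> 'a set \<Rightarrow> 'a gca" where
  "boundary r S = (\<Sum>g\<in>S. scale ((-1) ^ inversions r {g} S) (monom_ex (S - {g}) {#}))"

subsection \<open>\<open>free_gca\<close> is a ring and \<open>differential\<close> is the derivation with \<open>d e\<^sub>g = x\<^sub>g\<close>, \<open>d x\<^sub>g = 0\<close>\<close>

lemma lookup_scale: "Poly_Mapping.lookup (scale c f) k = c * Poly_Mapping.lookup f k"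
  by (simp add: scale_def Poly_Mapping.map.rep_eq when_def)

lemma scale_add: "scale c (f + g) = scale c f + scale c g"
  by (rule poly_mapping_eqI) (simp add: lookup_scale lookup_add algebra_simps)

lemma scale_add_left: "scale (c + d) f = scale c f + scale d f"
  by (rule poly_mapping_eqI) (simp add: lookup_scale lookup_add algebra_simps)

lemma scale_scale: "scale c (scale d f) = scale (c * d) f"
  by (rule poly_mapping_eqI) (simp add: lookup_scale)

lemma scale_simps [simp]: "scale 0 f = 0" "scale 1 f = f" "scale c 0 = 0"
  by (rule poly_mapping_eqI, simp add: lookup_scale)+

lemma scale_sum: "scale c (sum F A) = (\<Sum>a\<in>A. scale c (F a))"
  by (rule poly_mapping_eqI) (simp add: lookup_scale lookup_sum sum_distrib_left)

lemma lin_ext_superset: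
  assumes "finite K" "Poly_Mapping.keys f \<subseteq> K"
  shows "lin_ext F f = (\<Sum>u\<in>K. scale (Poly_Mapping.lookup f u) (F u))"
  unfolding lin_ext_def using assms
  by (intro sum.mono_neutral_left) (auto simp: in_keys_iff)

lemma lin_ext_add: "lin_ext F (f + g) = lin_ext F f + lin_ext F g"
proof -
  let ?K = "Poly_Mapping.keys f \<union> Poly_Mapping.keys g"
  have "Poly_Mapping.keys (f + g) \<subseteq> ?K" by (rule Poly_Mapping.keys_add)
  then show ?thesis
    by (subst (1 2 3) lin_ext_superset[of ?K])
      (auto simp: lookup_add scale_add_left sum.distrib)
qed

lemma lin_ext_zero [simp]: "lin_ext F 0 = 0"
  by (simp add: lin_ext_def)

lemma lin_ext_scale: "lin_ext F (scale c f) = scale c (lin_ext F f)"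
proof -
  have "Poly_Mapping.keys (scale c f) \<subseteq> Poly_Mapping.keys f"
    by (auto simp: in_keys_iff lookup_scale)
  then show ?thesis
    by (subst (1 2) lin_ext_superset[of "Poly_Mapping.keys f"])
      (auto simp: lookup_scale scale_scale scale_sum)
qed

lemma lin_ext_sum: "lin_ext F (sum g A) = (\<Sum>a\<in>A. lin_ext F (g a))"
  by (induction A rule: infinite_finite_induct) (auto simp: lin_ext_add)

lemma lin_ext_monom_ex [simp]: "lin_ext F (monom_ex S m) = F (S, m)"
  by (simp add: lin_ext_def monom_ex_def)

lemma lin_ext_cong:
  "(\<And>u. u \<in> Poly_Mapping.keys f \<Longrightarrow> F u = G u) \<Longrightarrow> lin_ext F f = lin_ext G f"
  by (simp add: lin_ext_def)

lemma lin_ext_lin_ext: "lin_ext G (lin_ext F f) = lin_ext (\<lambda>u. lin_ext G (F u)) f"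
  by (simp add: lin_ext_def[of F] lin_ext_def[of "\<lambda>u. lin_ext G (F u)"] lin_ext_sum lin_ext_scale)

lemma lin_ext_swap:
  "lin_ext (\<lambda>u. lin_ext (F u) g) f = lin_ext (\<lambda>v. lin_ext (\<lambda>u. F u v) f) g"
  unfolding lin_ext_def scale_sum scale_scale by (subst sum.swap) (simp add: mult.commute)

lemma lin_ext_add_fun: "lin_ext (\<lambda>u. F u + G u) f = lin_ext F f + lin_ext G f"
  by (simp add: lin_ext_def scale_add sum.distrib)

lemma lin_ext_scale_fun: "lin_ext (\<lambda>u. scale c (F u)) f = scale c (lin_ext F f)"
  by (simp add: lin_ext_def scale_sum scale_scale mult.commute)

lemma lin_ext_id: "lin_ext (\<lambda>(S, m). monom_ex S m) f = f"
  by (rule poly_mapping_eqI)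
    (auto simp: lin_ext_def lookup_sum lookup_scale monom_ex_def lookup_single when_def
      in_keys_iff sum.delta if_distrib cong: if_cong)

lemma keys_lin_ext:
  "Poly_Mapping.keys (lin_ext F f) \<subseteq> (\<Union>u\<in>Poly_Mapping.keys f. Poly_Mapping.keys (F u))"
proof
  fix k assume "k \<in> Poly_Mapping.keys (lin_ext F f)"
  then have "(\<Sum>u\<in>Poly_Mapping.keys f. Poly_Mapping.lookup f u * Poly_Mapping.lookup (F u) k) \<noteq> 0"
    by (simp add: in_keys_iff lin_ext_def lookup_sum lookup_scale)
  then show "k \<in> (\<Union>u\<in>Poly_Mapping.keys f. Poly_Mapping.keys (F u))"
    by (metis (no_types, lifting) UN_I in_keys_iff mult_zero_right sum.neutral)
qed

lemma inversions_Un_left: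
  assumes "finite S" "finite T" "finite U" "S \<inter> T = {}"
  shows "inversions r (S \<union> T) U = inversions r S U + inversions r T U"
proof -
  have "{(s, t) \<in> (S \<union> T) \<times> U. s \<noteq> t \<and> (t, s) \<in> r} =
    {(s, t) \<in> S \<times> U. s \<noteq> t \<and> (t, s) \<in> r} \<union> {(s, t) \<in> T \<times> U. s \<noteq> t \<and> (t, s) \<in> r}" by auto
  moreover have "finite {(s, t) \<in> S \<times> U. s \<noteq> t \<and> (t, s) \<in> r}"
     "finite {(s, t) \<in> T \<times> U. s \<noteq> t \<and> (t, s) \<in> r}"
    using assms by (auto intro: finite_subset[of _ "S \<times> U"] finite_subset[of _ "T \<times> U"])
  ultimately show ?thesis
    unfolding inversions_def using assms by (auto intro!: card_Un_disjoint)
qed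

lemma inversions_Un_right:
  assumes "finite S" "finite T" "finite U" "T \<inter> U = {}"
  shows "inversions r S (T \<union> U) = inversions r S T + inversions r S U"
proof -
  have "{(s, t) \<in> S \<times> (T \<union> U). s \<noteq> t \<and> (t, s) \<in> r} =
    {(s, t) \<in> S \<times> T. s \<noteq> t \<and> (t, s) \<in> r} \<union> {(s, t) \<in> S \<times> U. s \<noteq> t \<and> (t, s) \<in> r}" by auto
  moreover have "finite {(s, t) \<in> S \<times> T. s \<noteq> t \<and> (t, s) \<in> r}"
     "finite {(s, t) \<in> S \<times> U. s \<noteq> t \<and> (t, s) \<in> r}"
    using assms by (auto intro: finite_subset[of _ "S \<times> T"] finite_subset[of _ "S \<times> U"])
  ultimately show ?thesis
    unfolding inversions_def using assms by (auto intro!: card_Un_disjoint)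
qed

lemma inversions_empty [simp]: "inversions r {} T = 0" "inversions r S {} = 0"
  by (simp_all add: inversions_def)

lemma mono_mult_assoc:
  assumes "finite (fst u)" "finite (fst v)" "finite (fst w)"
  shows "lin_ext (\<lambda>y. mono_mult r y w) (mono_mult r u v) = lin_ext (mono_mult r u) (mono_mult r v w)"
proof -
  obtain S m T n U k where uvw: "u = (S, m)" "v = (T, n)" "w = (U, k)"
    by (metis surj_pair)
  show ?thesis
    using assms unfolding uvw mono_mult_def
    by (auto simp: lin_ext_scale scale_scale inversions_Un_left inversions_Un_right
        power_add ac_simps Un_assoc Int_Un_distrib Int_Un_distrib2)
qed

lemma keys_scale: "Poly_Mapping.keys (scale c f) \<subseteq> Poly_Mapping.keys f"
  by (auto simp: in_keys_iff lookup_scale)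

lemma keys_mono_mult:
  "Poly_Mapping.keys (mono_mult r (S, m) (T, n)) \<subseteq> {(S \<union> T, m + n)}"
  by (auto simp: mono_mult_def monom_ex_def in_keys_iff lookup_scale lookup_single when_def
      split: if_splits)

lemma carrier_free_gca:
  "f \<in> carrier (free_gca H r) \<longleftrightarrow> (\<forall>S m. (S, m) \<in> Poly_Mapping.keys f \<longrightarrow>
      finite S \<and> S \<subseteq> H \<and> set_mset m \<subseteq> H)"
  by (auto simp: free_gca_def)

lemma free_gca_mult_closed:
  assumes "f \<in> carrier (free_gca H r)" "g \<in> carrier (free_gca H r)"
  shows "f \<otimes>\<^bsub>free_gca H r\<^esub> g \<in> carrier (free_gca H r)"
  unfolding carrier_free_gca
proof (intro allI impI)
  fix S m assume "(S, m) \<in> Poly_Mapping.keys (f \<otimes>\<^bsub>free_gca H r\<^esub> g)"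
  then have "(S, m) \<in> Poly_Mapping.keys (lin_ext (\<lambda>u. lin_ext (mono_mult r u) g) f)"
    by (simp add: free_gca_def)
  then obtain u where u: "u \<in> Poly_Mapping.keys f" "(S, m) \<in> Poly_Mapping.keys (lin_ext (mono_mult r u) g)"
    using keys_lin_ext by fast
  then obtain v where v: "v \<in> Poly_Mapping.keys g" "(S, m) \<in> Poly_Mapping.keys (mono_mult r u v)"
    using keys_lin_ext by fast
  obtain A a B b where "u = (A, a)" "v = (B, b)" by (metis surj_pair)
  with u v assms keys_mono_mult[of r A a B b]
  show "finite S \<and> S \<subseteq> H \<and> set_mset m \<subseteq> H"
    unfolding carrier_free_gca by (metis (no_types, lifting) Pair_inject finite_UnI
      set_mset_union singletonD subsetD Un_least)
qed

lemma free_gca_mult_assoc: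
  assumes "f \<in> carrier (free_gca H r)" "g \<in> carrier (free_gca H r)" "h \<in> carrier (free_gca H r)"
  shows "f \<otimes>\<^bsub>free_gca H r\<^esub> g \<otimes>\<^bsub>free_gca H r\<^esub> h = f \<otimes>\<^bsub>free_gca H r\<^esub> (g \<otimes>\<^bsub>free_gca H r\<^esub> h)"
proof -
  have fin: "finite (fst u)" if "u \<in> Poly_Mapping.keys f \<or> u \<in> Poly_Mapping.keys g \<or> u \<in> Poly_Mapping.keys h" for u
    using that assms unfolding carrier_free_gca by (metis prod.collapse)
  have "lin_ext (\<lambda>y. lin_ext (mono_mult r y) h) (mono_mult r u v)
      = lin_ext (\<lambda>w. lin_ext (mono_mult r u) (mono_mult r v w)) h"
    if "u \<in> Poly_Mapping.keys f" "v \<in> Poly_Mapping.keys g" for u v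
    using that fin by (subst lin_ext_swap) (intro lin_ext_cong mono_mult_assoc; blast)
  then show ?thesis
    by (auto simp: free_gca_def lin_ext_lin_ext intro!: lin_ext_cong)
qed

lemma ring_free_gca: "ring (free_gca H r)"
proof (rule ringI)
  let ?R = "free_gca H r"
  show "abelian_group ?R"
  proof (rule abelian_groupI)
    fix f assume f: "f \<in> carrier ?R"
    then have "- f \<in> carrier ?R" by (auto simp: carrier_free_gca)
    moreover have "- f \<oplus>\<^bsub>?R\<^esub> f = \<zero>\<^bsub>?R\<^esub>" by (simp add: free_gca_def)
    ultimately show "\<exists>y\<in>carrier ?R. y \<oplus>\<^bsub>?R\<^esub> f = \<zero>\<^bsub>?R\<^esub>" by blast
  next
    fix f g assume "f \<in> carrier ?R" "g \<in> carrier ?R"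
    then show "f \<oplus>\<^bsub>?R\<^esub> g \<in> carrier ?R"
      unfolding carrier_free_gca using Poly_Mapping.keys_add[of f g]
      by (simp add: free_gca_def) blast
  qed (simp_all add: free_gca_def add.assoc add.commute)
  show "Group.monoid ?R"
  proof (rule Group.monoidI)
    show "\<one>\<^bsub>?R\<^esub> \<in> carrier ?R" by (auto simp: free_gca_def monom_ex_def)
    fix f assume "f \<in> carrier ?R"
    have "mono_mult r ({}, {#}) = (\<lambda>(S, m). monom_ex S m)" "(\<lambda>u. mono_mult r u ({}, {#})) = (\<lambda>(S, m). monom_ex S m)"
      by (auto simp: mono_mult_def)
    then show "\<one>\<^bsub>?R\<^esub> \<otimes>\<^bsub>?R\<^esub> f = f" "f \<otimes>\<^bsub>?R\<^esub> \<one>\<^bsub>?R\<^esub> = f"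
      by (simp_all add: free_gca_def lin_ext_id)
  qed (fact free_gca_mult_closed free_gca_mult_assoc)+
qed (simp_all add: free_gca_def lin_ext_add lin_ext_add_fun)


lemma inversions_swap:
  assumes "linear_order_on H r" "finite S" "S \<subseteq> H" "g \<in> H" "g \<notin> S"
  shows "inversions r S {g} + inversions r {g} S = card S"
proof -
  have tot: "(g, s) \<in> r \<or> (s, g) \<in> r" and anti: "\<not> ((g, s) \<in> r \<and> (s, g) \<in> r)" if "s \<in> S" for s
    using that assms by (auto simp: order_on_defs total_on_def antisym_def subset_iff)
  have "inversions r S {g} = card {s \<in> S. (g, s) \<in> r}"
    unfolding inversions_def using assms(5)
    by (intro bij_betw_same_card[of fst]) (auto simp: bij_betw_def inj_on_def image_iff)
  moreover have "inversions r {g} S = card {s \<in> S. (s, g) \<in> r}"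
    unfolding inversions_def using assms(5)
    by (intro bij_betw_same_card[of snd]) (auto simp: bij_betw_def inj_on_def image_iff)
  moreover have "card {s \<in> S. (g, s) \<in> r} + card {s \<in> S. (s, g) \<in> r}
      = card ({s \<in> S. (g, s) \<in> r} \<union> {s \<in> S. (s, g) \<in> r})"
    using assms(2) anti by (intro card_Un_disjoint[symmetric]) auto
  moreover have "{s \<in> S. (g, s) \<in> r} \<union> {s \<in> S. (s, g) \<in> r} = S" using tot by auto
  ultimately show ?thesis by simp
qed

lemma inversions_remove_left:
  assumes "finite S" "finite T" "g \<in> S"
  shows "inversions r S T = inversions r {g} T + inversions r (S - {g}) T"
  using inversions_Un_left[of "{g}" "S - {g}" T r] assms by (simp add: insert_absorb)

lemma inversions_remove_right:
  assumes "finite S" "finite T" "g \<in> T"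
  shows "inversions r S T = inversions r S {g} + inversions r S (T - {g})"
  using inversions_Un_right[of S "{g}" "T - {g}" r] assms by (simp add: insert_absorb)

lemma inversions_self [simp]: "inversions r {g} {g} = 0"
proof -
  have "{(s, t) \<in> {g} \<times> {g}. s \<noteq> t \<and> (t, s) \<in> r} = {}" by auto
  then show ?thesis by (simp only: inversions_def card.empty)
qed

lemma minus_one_power_cancel:
  fixes p q a b c u :: nat
  assumes "Suc (p + q) = c" "a + b = p + u"
  shows "(-1) ^ (q + b) + (-1) ^ (c + a + u) = (0 :: 'b :: ring_1)"
proof -
  have eq: "q + b + (c + a + u) = Suc (2 * (p + q + u))" using assms by simp
  have "odd (q + b + (c + a + u))" unfolding eq by simp
  then have "even (q + b) \<noteq> even (c + a + u)" by (metis even_add)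
  then show ?thesis unfolding minus_one_power_iff by (cases "even (q + b)") simp_all
qed

lemma mono_diff_mult:
  assumes r: "linear_order_on H r"
    and S: "finite S" "S \<subseteq> H" and T: "finite T" "T \<subseteq> H"
  shows "lin_ext (mono_diff r) (mono_mult r (S, m) (T, n))
    = lin_ext (\<lambda>w. mono_mult r w (T, n)) (mono_diff r (S, m))
      + scale ((-1) ^ card S) (lin_ext (mono_mult r (S, m)) (mono_diff r (T, n)))"
    (is "?L = ?A + ?B")
proof -
  have A: "?A = (\<Sum>g\<in>S. if (S - {g}) \<inter> T = {} then
      scale ((-1) ^ (inversions r {g} S + inversions r (S - {g}) T))
        (monom_ex ((S - {g}) \<union> T) (add_mset g (m + n))) else 0)"
    by (auto simp: mono_diff_def mono_mult_def lin_ext_sum lin_ext_scale scale_scale power_add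
        intro!: sum.cong)
  have B: "?B = (\<Sum>g\<in>T. if S \<inter> (T - {g}) = {} then
      scale ((-1) ^ (card S + inversions r {g} T + inversions r S (T - {g})))
        (monom_ex (S \<union> (T - {g})) (add_mset g (m + n))) else 0)"
    by (auto simp: mono_diff_def mono_mult_def lin_ext_sum lin_ext_scale scale_scale scale_sum power_add
        intro!: sum.cong)
  consider "S \<inter> T = {}" | g where "S \<inter> T = {g}" | g h where "g \<noteq> h" "g \<in> S \<inter> T" "h \<in> S \<inter> T"
  proof (cases "S \<inter> T = {}")
    case False
    then obtain g where "g \<in> S \<inter> T" by auto
    then show thesis using that(2)[of g] that(3)[of _ g] by auto
  qed (rule that(1))
  then show ?thesis
  proof cases
    case 1
    have L: "?L = (\<Sum>g\<in>S \<union> T. scale ((-1) ^ (inversions r S T + inversions r {g} (S \<union> T)))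
          (monom_ex (S \<union> T - {g}) (add_mset g (m + n))))" (is "_ = sum ?f _")
      using 1 by (simp add: mono_diff_def mono_mult_def lin_ext_scale scale_sum scale_scale power_add)
    have "sum ?f S = ?A"
      unfolding A
    proof (rule sum.cong[OF refl])
      fix g assume g: "g \<in> S"
      have "inversions r S T + inversions r {g} (S \<union> T)
          = 2 * inversions r {g} T + (inversions r {g} S + inversions r (S - {g}) T)"
        using inversions_remove_left[OF S(1) T(1) g, of r] inversions_Un_right[of "{g}" S T r] S T 1
        by simp
      moreover have "S \<union> T - {g} = S - {g} \<union> T" "(S - {g}) \<inter> T = {}" using g 1 by auto
      ultimately show "?f g = (if (S - {g}) \<inter> T = {} then
        scale ((-1) ^ (inversions r {g} S + inversions r (S - {g}) T))
        (monom_ex ((S - {g}) \<union> T) (add_mset g (m + n))) else 0)"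
        by (simp add: power_add)
    qed
    moreover have "sum ?f T = ?B"
      unfolding B
    proof (rule sum.cong[OF refl])
      fix g assume g: "g \<in> T"
      have "inversions r S T = inversions r S {g} + inversions r S (T - {g})"
        by (rule inversions_remove_right[OF S(1) T(1) g])
      moreover have "inversions r {g} (S \<union> T) = inversions r {g} S + inversions r {g} T"
        by (rule inversions_Un_right) (use S T 1 in simp_all)
      moreover have "inversions r S {g} + inversions r {g} S = card S"
        by (rule inversions_swap[OF r S]) (use T g 1 in blast)+
      ultimately have "inversions r S T + inversions r {g} (S \<union> T)
          = card S + inversions r {g} T + inversions r S (T - {g})"
        by linarith
      moreover have "S \<union> T - {g} = S \<union> (T - {g})" "S \<inter> (T - {g}) = {}" using g 1 by auto
      ultimately show "?f g = (if S \<inter> (T - {g}) = {} then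
        scale ((-1) ^ (card S + inversions r {g} T + inversions r S (T - {g})))
        (monom_ex (S \<union> (T - {g})) (add_mset g (m + n))) else 0)"
        by simp
    qed
    ultimately show ?thesis using L S T 1 by (simp add: sum.union_disjoint)
  next
    case (2 g)
    have "g \<in> S \<inter> T" by (simp only: 2 insert_iff simp_thms)
    then have g: "g \<in> S" "g \<in> T" by (simp_all only: Int_iff)
    have uniq: "x = g" if "x \<in> S" "x \<in> T" for x
    proof -
      have "x \<in> S \<inter> T" using that by (rule IntI)
      then show ?thesis unfolding 2 by (rule singletonD)
    qed
    have "?A = (\<Sum>h\<in>S. if h = g then scale ((-1) ^ (inversions r {g} S + inversions r (S - {g}) T))
        (monom_ex (S \<union> T) (add_mset g (m + n))) else 0)"
      unfolding A
    proof (rule sum.cong[OF refl])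
      fix h
      show "(if (S - {h}) \<inter> T = {} then
          scale ((-1) ^ (inversions r {h} S + inversions r (S - {h}) T))
            (monom_ex ((S - {h}) \<union> T) (add_mset h (m + n))) else 0)
        = (if h = g then scale ((-1) ^ (inversions r {g} S + inversions r (S - {g}) T))
            (monom_ex (S \<union> T) (add_mset g (m + n))) else 0)"
      proof (cases "h = g")
        case True
        have "(S - {g}) \<inter> T = {}" "S - {g} \<union> T = S \<union> T" using g by (auto dest: uniq)
        then show ?thesis by (simp only: True if_True simp_thms)
      next
        case False
        then have "(S - {h}) \<inter> T \<noteq> {}" using g by auto
        then show ?thesis by (simp only: False if_False)
      qed
    qed
    then have A': "?A = scale ((-1) ^ (inversions r {g} S + inversions r (S - {g}) T))
        (monom_ex (S \<union> T) (add_mset g (m + n)))"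
      using S g by simp
    have "?B = (\<Sum>h\<in>T. if h = g then scale ((-1) ^ (card S + inversions r {g} T + inversions r S (T - {g})))
        (monom_ex (S \<union> T) (add_mset g (m + n))) else 0)"
      unfolding B
    proof (rule sum.cong[OF refl])
      fix h
      show "(if S \<inter> (T - {h}) = {} then
          scale ((-1) ^ (card S + inversions r {h} T + inversions r S (T - {h})))
            (monom_ex (S \<union> (T - {h})) (add_mset h (m + n))) else 0)
        = (if h = g then scale ((-1) ^ (card S + inversions r {g} T + inversions r S (T - {g})))
            (monom_ex (S \<union> T) (add_mset g (m + n))) else 0)"
      proof (cases "h = g")
        case True
        have "S \<inter> (T - {g}) = {}" "S \<union> (T - {g}) = S \<union> T" using g by (auto dest: uniq)
        then show ?thesis by (simp only: True if_True simp_thms)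
      next
        case False
        then have "S \<inter> (T - {h}) \<noteq> {}" using g by auto
        then show ?thesis by (simp only: False if_False)
      qed
    qed
    then have B': "?B = scale ((-1) ^ (card S + inversions r {g} T + inversions r S (T - {g})))
        (monom_ex (S \<union> T) (add_mset g (m + n)))"
      using T g by simp
    have "inversions r (S - {g}) {g} + inversions r {g} (S - {g}) = card (S - {g})"
      using S g by (intro inversions_swap[OF r]) auto
    moreover have "card S = Suc (card (S - {g}))" by (rule card_Suc_Diff1[OF S(1) g(1), symmetric])
    ultimately have "Suc (inversions r S {g} + inversions r {g} S) = card S"
      using inversions_remove_left[OF S(1) _ g(1), of "{g}" r]
        inversions_remove_right[OF _ S(1) g(1), of "{g}" r]
      unfolding inversions_self by (metis add_0 add_Suc finite.emptyI finite_insert)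
    moreover have "inversions r {g} T + inversions r (S - {g}) T = inversions r S {g} + inversions r S (T - {g})"
      using inversions_remove_left[OF S(1) T(1) g(1), of r] inversions_remove_right[OF S(1) T(1) g(2), of r]
      by linarith
    ultimately have "(-1) ^ (inversions r {g} S + inversions r (S - {g}) T)
        + (-1) ^ (card S + inversions r {g} T + inversions r S (T - {g})) = (0 :: rat)"
      by (rule minus_one_power_cancel)
    then have "?A + ?B = 0"
      unfolding A' B' scale_add_left[symmetric] by simp
    moreover have "?L = 0" using 2 by (simp add: mono_mult_def)
    ultimately show ?thesis by simp
  next
    case (3 g h)
    then have "(S - {x}) \<inter> T \<noteq> {}" "S \<inter> (T - {x}) \<noteq> {}" "S \<inter> T \<noteq> {}" for x
      by (cases "x = g"; blast)+
    then have "?A = 0" "?B = 0" "?L = 0"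
      unfolding A B by (simp_all add: mono_mult_def)
    then show ?thesis by simp
  qed
qed

lemma differential_free_gca:
  assumes r: "linear_order_on H r"
    and f: "f \<in> bidegree (free_gca H r) i j" and g: "g \<in> carrier (free_gca H r)"
  defines "R \<equiv> free_gca H r"
  shows "differential R (f \<otimes>\<^bsub>R\<^esub> g)
    = differential R f \<otimes>\<^bsub>R\<^esub> g \<oplus>\<^bsub>R\<^esub> (((-1) ^ j) \<odot>\<^bsub>R\<^esub> (f \<otimes>\<^bsub>R\<^esub> differential R g))"
proof -
  have "lin_ext (mono_diff r) (mono_mult r u v)
    = lin_ext (\<lambda>w. mono_mult r w v) (mono_diff r u)
      + scale ((-1) ^ j) (lin_ext (mono_mult r u) (mono_diff r v))"
    if "u \<in> Poly_Mapping.keys f" "v \<in> Poly_Mapping.keys g" for u v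
  proof -
    obtain S m T n where uv: "u = (S, m)" "v = (T, n)" by (metis surj_pair)
    have "finite S" "S \<subseteq> H" "card S = j" "finite T" "T \<subseteq> H"
      using that f g unfolding uv by (auto simp: free_gca_def)
    then show ?thesis unfolding uv using mono_diff_mult[OF r] by metis
  qed
  note * = this
  have swap: "lin_ext (\<lambda>v. lin_ext (\<lambda>w. mono_mult r w v) d) g
      = lin_ext (\<lambda>w. lin_ext (mono_mult r w) g) d" for d
    by (rule lin_ext_swap)
  from * have "lin_ext (mono_diff r) (lin_ext (\<lambda>u. lin_ext (mono_mult r u) g) f)
    = lin_ext (\<lambda>u. lin_ext (\<lambda>v. lin_ext (\<lambda>w. mono_mult r w v) (mono_diff r u)
      + scale ((-1) ^ j) (lin_ext (mono_mult r u) (mono_diff r v))) g) f"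
    unfolding lin_ext_lin_ext by (intro lin_ext_cong) blast
  also have "\<dots> = lin_ext (\<lambda>u. lin_ext (\<lambda>w. lin_ext (mono_mult r w) g) (mono_diff r u)
      + scale ((-1) ^ j) (lin_ext (\<lambda>v. lin_ext (mono_mult r u) (mono_diff r v)) g)) f"
    unfolding lin_ext_add_fun lin_ext_scale_fun swap ..
  finally show ?thesis
    by (simp add: R_def free_gca_def lin_ext_lin_ext lin_ext_add_fun lin_ext_scale_fun)
qed

lemma e_gen_mult_monom_ex:
  assumes "g \<notin> S" "\<And>s. s \<in> S \<Longrightarrow> (s, g) \<notin> r"
  shows "e_gen g \<otimes>\<^bsub>free_gca H r\<^esub> monom_ex S m = monom_ex (insert g S) m"
proof -
  have "{(s, t) \<in> {g} \<times> S. s \<noteq> t \<and> (t, s) \<in> r} = {}" using assms by auto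
  then have "inversions r {g} S = 0" by (simp only: inversions_def card.empty)
  then show ?thesis using assms by (simp add: free_gca_def e_gen_def mono_mult_def)
qed

lemma x_gen_mult_monom_ex:
  "x_gen g \<otimes>\<^bsub>free_gca H r\<^esub> monom_ex S m = monom_ex S (add_mset g m)"
  by (simp add: free_gca_def x_gen_def mono_mult_def)

lemma differential_gens:
  "differential (free_gca H r) (e_gen g) = x_gen g" "differential (free_gca H r) (x_gen g) = 0"
  by (simp_all add: free_gca_def e_gen_def x_gen_def mono_diff_def)


section \<open>The algebras of a partial building set\<close>

text \<open>In \<open>r\<close>, the pair \<open>(p, q)\<close> with \<open>p \<noteq> q\<close> means \<open>p \<prec> q\<close>; larger lattice elements come first.\<close>

definition admissible_order :: "('a, 'm) gorder_scheme \<Rightarrow> 'a set \<Rightarrow> 'a rel \<Rightarrow> bool" where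
  "admissible_order L H r \<longleftrightarrow> linear_order_on H r
     \<and> (\<forall>p\<in>H. \<forall>q\<in>H. q \<sqsubseteq>\<^bsub>L\<^esub> p \<longrightarrow> (p, q) \<in> r)"

definition relators ::
    "('a, 'm) gorder_scheme \<Rightarrow> 'a set \<Rightarrow> 'a list \<Rightarrow> 'a rel \<Rightarrow> 'a gca set" where
  "relators L H ps r =
     {monom_ex S (mset_set T) | S T. S \<subseteq> H \<and> T \<subseteq> H \<and> S \<union> T \<notin> nested L H}
     \<union> {boundary r S | S. nested_circuit L H ps S}
     \<union> {(\<Sum>h\<in>{h \<in> H. g \<sqsubseteq>\<^bsub>L\<^esub> h}. x_gen h) | g. g \<in> atoms L}"

definition rel_ideal ::
    "('a, 'm) gorder_scheme \<Rightarrow> 'a set \<Rightarrow> 'a list \<Rightarrow> 'a rel \<Rightarrow> 'a gca set" where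
  "rel_ideal L H ps r = Idl\<^bsub>free_gca H r\<^esub> (relators L H ps r)"

definition B_hat ::
    "('a, 'm) gorder_scheme \<Rightarrow> 'a set \<Rightarrow> 'a list \<Rightarrow> 'a rel \<Rightarrow> 'a gca set cdga" where
  "B_hat L H ps r = quotient_cdga (free_gca H r) (rel_ideal L H ps r)"

definition e_cls ::
    "('a, 'm) gorder_scheme \<Rightarrow> 'a set \<Rightarrow> 'a list \<Rightarrow> 'a rel \<Rightarrow> 'a \<Rightarrow> 'a gca set" where
  "e_cls L H ps r g = rel_ideal L H ps r +>\<^bsub>free_gca H r\<^esub> e_gen g"

definition x_cls ::
    "('a, 'm) gorder_scheme \<Rightarrow> 'a set \<Rightarrow> 'a list \<Rightarrow> 'a rel \<Rightarrow> 'a \<Rightarrow> 'a gca set" where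
  "x_cls L H ps r g = rel_ideal L H ps r +>\<^bsub>free_gca H r\<^esub> x_gen g"

text \<open>\<open>B(L,H)\<close>, realized as the differential subalgebra of \<open>B_hat\<close> that is identified with
  the quotient of \<open>B_hat\<close> by the generator \<open>e\<close> of the top element.\<close>

definition B_alg ::
    "('a, 'm) gorder_scheme \<Rightarrow> 'a set \<Rightarrow> 'a list \<Rightarrow> 'a rel \<Rightarrow> 'a gca set cdga" where
  "B_alg L H ps r = restrict_cdga (B_hat L H ps r)
     (subalgebra_gen (B_hat L H ps r)
        (x_cls L H ps r ` H \<union> e_cls L H ps r ` (H - {\<top>\<^bsub>L\<^esub>})))"

end

theory Submission imports Defs begin

text \<open>The ideal \<open>I(L,H)\<close> is the linear span \<open>J\<close> of explicit multiples of its generators. The substitution \<open>\<phi>\<close> maps \<open>J\<close> into the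
  span \<open>J'\<close> for \<open>H' = H \<union> {p}\<close>: a set that is not nested for \<open>H\<close> is not nested for \<open>H'\<close> after some elements below \<open>p\<close>
  are replaced by \<open>p\<close>, and the extra terms in the image of \<open>\<partial>e\<^sub>C\<close> either cancel or are themselves relations.

  Injectivity follows from a linear, non-multiplicative map \<open>\<Psi>\<close> in the other direction with \<open>\<Psi>(J') \<subseteq> J\<close> and
  \<open>\<Psi>(\<phi>(f)) - f \<in> J\<close>. It imitates the pushforward along a blowdown. For \<open>p \<notin> S\<close>, \<open>\<Psi>(e\<^sub>S f)\<close> is \<open>e\<^sub>S f|\<^bsub>x\<^sub>p=0\<^esub>\<close> minus a correction \<open>e\<^sub>S x\<^sub>T \<tau>(f)\<close>, where \<open>T\<close> is a minimal set of atoms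
  that together with \<open>S\<close> spans \<open>p\<close>, and \<open>\<tau>(f)\<close> trades the factors of \<open>f\<close> below or equal to \<open>p\<close> for powers of \<open>c\<^sub>p\<close>; for fixed \<open>a \<le> p\<close>, \<open>\<Psi>(e\<^sub>p e\<^sub>S f)\<close> is a residue, which replaces \<open>e\<^sub>p\<close> by \<open>e\<^sub>a\<close> if \<open>S \<union> {a}\<close> spans
  \<open>p\<close> and vanishes otherwise.\<close>

section \<open>Geometric lattices\<close>

text \<open>One observation governs everything below \<open>p\<close>: \<open>p\<close> is not in
  \<open>H\<close> and the non-atoms of \<open>H\<close> are upward closed in \<open>G\<close>, so
  all elements of \<open>H\<close> below \<open>p\<close> are atoms. Hence a nested subset of
  \<open>H\<close> fails to be nested for \<open>H'\<close> exactly when its atoms below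
  \<open>p\<close> have join \<open>p\<close>. This is a matroid condition, and the exchange
  property controls every choice made. The corresponding monomials need not vanish in the source,
  but they vanish in the target, so setting \<open>x_p = 0\<close> does not respect the relations.
  Next to a spanning set, however, \<open>x_b\<close> equals \<open>- c_p\<close> for every atom
  \<open>b \<le> p\<close>; this gives such a monomial a normal form modulo \<open>J\<close>, and
  the correction in \<open>\<Psi>\<close> subtracts exactly this normal form.

  As \<open>\<Psi>\<close> is not multiplicative, it has to be tested on all multiples of the
  relations; this is why the ideal is rewritten as a span. Two dependences are removed separately:
  the circuits of the iterated blowup turn out to be the nested circuits of atoms of
  \<open>L\<close>, and a change of sign passes from an auxiliary order, in which \<open>p\<close>
  comes first, to the given one.\<close>

locale geom =
  fixes L :: "'a gorder" (structure)
  assumes geometric: "geometric_lattice L"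

context geom
begin

lemma bounded_lattice_L: "bounded_lattice L"
  using geometric by (simp add: geometric_lattice_def)

lemma le_refl [simp]: "x \<in> carrier L \<Longrightarrow> x \<sqsubseteq> x"
  and le_trans: "x \<sqsubseteq> y \<Longrightarrow> y \<sqsubseteq> z \<Longrightarrow> x \<in> carrier L \<Longrightarrow> y \<in> carrier L \<Longrightarrow> z \<in> carrier L \<Longrightarrow> x \<sqsubseteq> z"
  and le_antisym: "x \<sqsubseteq> y \<Longrightarrow> y \<sqsubseteq> x \<Longrightarrow> x \<in> carrier L \<Longrightarrow> y \<in> carrier L \<Longrightarrow> x = y"
  and lless_eq: "x \<sqsubset> y \<longleftrightarrow> x \<sqsubseteq> y \<and> x \<noteq> y"
  and bottom_closed [simp]: "\<bottom> \<in> carrier L"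
  and bottom_lower [simp]: "x \<in> carrier L \<Longrightarrow> \<bottom> \<sqsubseteq> x"
  and top_closed [simp]: "\<top> \<in> carrier L"
  and top_higher [simp]: "x \<in> carrier L \<Longrightarrow> x \<sqsubseteq> \<top>"
  and meet_closed: "x \<in> carrier L \<Longrightarrow> y \<in> carrier L \<Longrightarrow> x \<sqinter> y \<in> carrier L"
  and meet_left: "x \<in> carrier L \<Longrightarrow> y \<in> carrier L \<Longrightarrow> x \<sqinter> y \<sqsubseteq> x"
  and meet_right: "x \<in> carrier L \<Longrightarrow> y \<in> carrier L \<Longrightarrow> x \<sqinter> y \<sqsubseteq> y"
proof -
  interpret bounded_lattice L by (rule bounded_lattice_L)
  show "x \<in> carrier L \<Longrightarrow> x \<sqsubseteq> x"
    "x \<sqsubseteq> y \<Longrightarrow> y \<sqsubseteq> z \<Longrightarrow> x \<in> carrier L \<Longrightarrow> y \<in> carrier L \<Longrightarrow> z \<in> carrier L \<Longrightarrow> x \<sqsubseteq> z"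
    "x \<sqsubseteq> y \<Longrightarrow> y \<sqsubseteq> x \<Longrightarrow> x \<in> carrier L \<Longrightarrow> y \<in> carrier L \<Longrightarrow> x = y"
    "x \<sqsubset> y \<longleftrightarrow> x \<sqsubseteq> y \<and> x \<noteq> y" "\<bottom> \<in> carrier L" "x \<in> carrier L \<Longrightarrow> \<bottom> \<sqsubseteq> x"
    "\<top> \<in> carrier L" "x \<in> carrier L \<Longrightarrow> x \<sqsubseteq> \<top>"
    "x \<in> carrier L \<Longrightarrow> y \<in> carrier L \<Longrightarrow> x \<sqinter> y \<in> carrier L"
    "x \<in> carrier L \<Longrightarrow> y \<in> carrier L \<Longrightarrow> x \<sqinter> y \<sqsubseteq> x"
    "x \<in> carrier L \<Longrightarrow> y \<in> carrier L \<Longrightarrow> x \<sqinter> y \<sqsubseteq> y"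
    by (fact le_refl le_trans le_antisym lless_eq bottom_closed bottom_lower top_closed top_higher
      meet_closed meet_left meet_right)+
qed

lemma finite_carrier [simp]: "finite (carrier L)"
  using geometric by (simp add: geometric_lattice_def)

lemma finite_sub: "A \<subseteq> carrier L \<Longrightarrow> finite A"
  by (erule finite_subset) simp

lemma Sup_least_Upper:
  assumes "A \<subseteq> carrier L" shows "least L (\<Squnion>A) (Upper L A)"
proof (cases "A = {}")
  case True
  have "least L \<bottom> (Upper L {})" by (simp add: least_def Upper_def)
  then show ?thesis unfolding True Lattice.sup_def by (rule someI)
next
  case False
  interpret bounded_lattice L by (rule bounded_lattice_L)
  show ?thesis using False assms finite_sub by (intro finite_sup_least) auto
qed

lemma Sup_closed [simp]: "A \<subseteq> carrier L \<Longrightarrow> \<Squnion>A \<in> carrier L"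
  using Sup_least_Upper least_closed by blast

lemma Sup_upper [intro]: "A \<subseteq> carrier L \<Longrightarrow> a \<in> A \<Longrightarrow> a \<sqsubseteq> \<Squnion>A"
  using Sup_least_Upper[of A] by (simp add: least_def Upper_def subset_iff)

lemma Sup_le_iff: 
  assumes A: "A \<subseteq> carrier L" and z: "z \<in> carrier L"
  shows "\<Squnion>A \<sqsubseteq> z \<longleftrightarrow> (\<forall>a\<in>A. a \<sqsubseteq> z)"
proof
  assume "\<Squnion>A \<sqsubseteq> z"
  then show "\<forall>a\<in>A. a \<sqsubseteq> z"
    using A z le_trans[OF Sup_upper[OF A]] Sup_closed[OF A] by (meson subsetD)
next
  assume "\<forall>a\<in>A. a \<sqsubseteq> z"
  then have "z \<in> Upper L A" using z by (simp add: Upper_def)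
  then show "\<Squnion>A \<sqsubseteq> z" using Sup_least_Upper[OF A] by (simp add: least_def)
qed

lemma Sup_eqI:
  assumes "A \<subseteq> carrier L" "B \<subseteq> carrier L"
    "\<And>a. a \<in> A \<Longrightarrow> a \<sqsubseteq> \<Squnion>B" "\<And>b. b \<in> B \<Longrightarrow> b \<sqsubseteq> \<Squnion>A"
  shows "\<Squnion>A = \<Squnion>B"
  using assms by (intro le_antisym) (simp_all add: Sup_le_iff)

lemma Sup_mono:
  assumes "A \<subseteq> B" "B \<subseteq> carrier L" shows "\<Squnion>A \<sqsubseteq> \<Squnion>B"
proof -
  have "A \<subseteq> carrier L" using assms by simp
  moreover have "\<forall>a\<in>A. a \<sqsubseteq> \<Squnion>B" using Sup_upper[OF assms(2)] assms(1) by (meson subsetD)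
  ultimately show ?thesis using Sup_le_iff Sup_closed[OF assms(2)] by blast
qed

lemma le_Sup_trans: "A \<subseteq> carrier L \<Longrightarrow> a \<in> A \<Longrightarrow> x \<sqsubseteq> a \<Longrightarrow> x \<in> carrier L \<Longrightarrow> x \<sqsubseteq> \<Squnion>A"
  using le_trans[of x a "\<Squnion>A"] Sup_upper[of A a] Sup_closed[of A] subsetD[of A "carrier L" a] by simp

lemma atom_closed [simp]: "a \<in> atoms L \<Longrightarrow> a \<in> carrier L"
  by (simp add: atoms_def covers_def)

lemma atoms_subset: "atoms L \<subseteq> carrier L" by auto

lemma atom_not_bot: "a \<in> atoms L \<Longrightarrow> a \<noteq> \<bottom>"
  by (auto simp: atoms_def covers_def lless_eq simp del: atom_closed)

lemma le_atom: "a \<in> atoms L \<Longrightarrow> x \<in> carrier L \<Longrightarrow> x \<sqsubseteq> a \<Longrightarrow> x = \<bottom> \<or> x = a"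
  by (auto simp: atoms_def covers_def lless_eq simp del: atom_closed)

lemma le_bottom: "x \<in> carrier L \<Longrightarrow> x \<sqsubseteq> \<bottom> \<longleftrightarrow> x = \<bottom>"
  by (metis bottom_closed bottom_lower le_antisym)

lemma atom_le_atom: "a \<in> atoms L \<Longrightarrow> b \<in> atoms L \<Longrightarrow> a \<sqsubseteq> b \<Longrightarrow> a = b"
  using le_atom atom_not_bot atom_closed by blast

text \<open>Atomisticity gives some set of atoms with join \<open>x\<close>; adding the other atoms
  below \<open>x\<close> does not change the join.\<close>

lemma atoms_below: "x \<in> carrier L \<Longrightarrow> \<Squnion>{a \<in> atoms L. a \<sqsubseteq> x} = x"
proof -
  assume x: "x \<in> carrier L"
  obtain A where A: "A \<subseteq> atoms L" "is_lub L x A"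
    using geometric x unfolding geometric_lattice_def by blast
  have sub: "A \<subseteq> carrier L" "{a \<in> atoms L. a \<sqsubseteq> x} \<subseteq> carrier L" using A atoms_subset by auto
  have up: "\<forall>a\<in>A. a \<sqsubseteq> x" using A(2) sub by (auto simp: least_def)
  then have "A \<subseteq> {a \<in> atoms L. a \<sqsubseteq> x}" using A by auto
  then have "\<forall>a\<in>A. a \<sqsubseteq> \<Squnion>{a \<in> atoms L. a \<sqsubseteq> x}" using sub by auto
  then have "x \<sqsubseteq> \<Squnion>{a \<in> atoms L. a \<sqsubseteq> x}"
    using A(2) sub by (auto simp: least_def Upper_def)
  moreover have "\<Squnion>{a \<in> atoms L. a \<sqsubseteq> x} \<sqsubseteq> x" using x sub by (subst Sup_le_iff) auto
  ultimately show ?thesis using x sub by (intro le_antisym) auto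
qed

text \<open>Semimodularity enters only here: an atom \<open>b\<close> not below \<open>y\<close>
  meets \<open>y\<close> in the bottom element, which \<open>b\<close> covers.\<close>

lemma atom_covers:
  assumes b: "b \<in> atoms L" and y: "y \<in> carrier L" "\<not> b \<sqsubseteq> y" shows "covers L y (\<Squnion>{b, y})"
proof -
  have "b \<sqinter> y = \<bottom>"
    using le_atom[OF b, of "b \<sqinter> y"] y b meet_left meet_right by (metis atom_closed meet_closed)
  then have "covers L (b \<sqinter> y) b" using b by (simp add: atoms_def)
  then have "covers L y (b \<squnion> y)"
    using geometric y b unfolding geometric_lattice_def by auto
  then show ?thesis by (simp add: join_def)
qed

lemma covers_between:
  "covers L x y \<Longrightarrow> z \<in> carrier L \<Longrightarrow> x \<sqsubseteq> z \<Longrightarrow> z \<sqsubseteq> y \<Longrightarrow> z = x \<or> z = y"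
  by (auto simp: covers_def lless_eq)

lemma Sup_insert_Sup:
  "A \<subseteq> carrier L \<Longrightarrow> b \<in> carrier L \<Longrightarrow> \<Squnion>(insert b A) = \<Squnion>{b, \<Squnion>A}"
proof (rule Sup_eqI)
  assume A: "A \<subseteq> carrier L" "b \<in> carrier L"
  show "a \<sqsubseteq> \<Squnion>{b, \<Squnion>A}" if "a \<in> insert b A" for a
  proof (cases "a = b")
    case False
    then have "a \<sqsubseteq> \<Squnion>A" using that A by auto
    moreover have "\<Squnion>A \<sqsubseteq> \<Squnion>{b, \<Squnion>A}" using A by auto
    ultimately show ?thesis using A that by (meson Sup_closed bot.extremum empty_subsetI insert_subset le_trans subsetD)
  qed (use A in auto)
  show "a \<sqsubseteq> \<Squnion>(insert b A)" if "a \<in> {b, \<Squnion>A}" for a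
    using that A by (auto intro: Sup_mono)
qed auto

text \<open>Steinitz exchange: \<open>\<Squnion>(insert b A)\<close> covers
  \<open>\<Squnion>A\<close>, so adding \<open>a\<close> leaves no room for anything in
  between.\<close>

lemma exchange:
  assumes "A \<subseteq> carrier L" "a \<in> atoms L" "b \<in> atoms L" "\<not> a \<sqsubseteq> \<Squnion>A" "a \<sqsubseteq> \<Squnion>(insert b A)"
  shows "\<Squnion>(insert a A) = \<Squnion>(insert b A)"
proof -
  have "\<not> b \<sqsubseteq> \<Squnion>A"
  proof
    assume "b \<sqsubseteq> \<Squnion>A"
    then have "\<Squnion>(insert b A) \<sqsubseteq> \<Squnion>A" using assms by (subst Sup_le_iff) auto
    then show False using assms le_trans[of a "\<Squnion>(insert b A)" "\<Squnion>A"] by simp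
  qed
  then have c: "covers L (\<Squnion>A) (\<Squnion>(insert b A))"
    using atom_covers[OF assms(3), of "\<Squnion>A"] assms(1,3) unfolding Sup_insert_Sup[OF assms(1) atom_closed[OF assms(3)]]
    by simp
  have "\<Squnion>A \<sqsubseteq> \<Squnion>(insert a A)" "\<Squnion>(insert a A) \<sqsubseteq> \<Squnion>(insert b A)"
    using assms by (auto intro!: Sup_mono simp: Sup_le_iff)
  moreover have "\<Squnion>(insert a A) \<in> carrier L" using assms by simp
  ultimately consider "\<Squnion>(insert a A) = \<Squnion>A" | "\<Squnion>(insert a A) = \<Squnion>(insert b A)"
    using covers_between[OF c] by blast
  then show ?thesis
  proof cases
    case 1
    then have "a \<sqsubseteq> \<Squnion>A" using assms by (metis Sup_upper atom_closed insertI1 insert_subset)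
    then show ?thesis using assms by simp
  qed
qed

end

section \<open>Circuits of atoms in a geometric lattice\<close>

definition lcircuit :: "'a gorder \<Rightarrow> 'a set \<Rightarrow> bool" where
  "lcircuit L C \<longleftrightarrow> C \<subseteq> atoms L \<and> (\<exists>a\<in>C. a \<sqsubseteq>\<^bsub>L\<^esub> \<Squnion>\<^bsub>L\<^esub>(C - {a}))
     \<and> (\<forall>D a. D \<subset> C \<longrightarrow> a \<in> D \<longrightarrow> \<not> a \<sqsubseteq>\<^bsub>L\<^esub> \<Squnion>\<^bsub>L\<^esub>(D - {a}))"

context geom
begin

lemma lcircuit_atoms: "lcircuit L C \<Longrightarrow> C \<subseteq> atoms L"
  by (simp add: lcircuit_def)

lemma lcircuit_carrier: "lcircuit L C \<Longrightarrow> C \<subseteq> carrier L"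
  using lcircuit_atoms atoms_subset by blast

text \<open>The definition provides this for one member \<open>a\<close> only. By minimality
  \<open>C - {b}\<close> is independent, so \<open>a\<close> can be exchanged for \<open>b\<close>
  over the remaining atoms.\<close>

lemma lcircuit_le:
  assumes C: "lcircuit L C" and "b \<in> C" shows "b \<sqsubseteq> \<Squnion>(C - {b})"
proof -
  obtain a where a: "a \<in> C" "a \<sqsubseteq> \<Squnion>(C - {a})" using C by (auto simp: lcircuit_def)
  have sub: "C \<subseteq> carrier L" using C by (rule lcircuit_carrier)
  show ?thesis
  proof (cases "a = b")
    case False
    have "C - {b} \<subset> C" using assms by auto
    then have "\<not> a \<sqsubseteq> \<Squnion>(C - {b} - {a})" using C a False by (auto simp: lcircuit_def)
    moreover have "insert b (C - {b} - {a}) = C - {a}" "insert a (C - {b} - {a}) = C - {b}"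
      using assms a False by auto
    moreover have "C - {b} - {a} \<subseteq> carrier L" "a \<in> atoms L" "b \<in> atoms L"
      using a assms lcircuit_atoms[OF C] sub by auto
    ultimately have "\<Squnion>(C - {b}) = \<Squnion>(C - {a})"
      using exchange[of "C - {b} - {a}" a b] a(2) by metis
    then show ?thesis using sub assms False by auto
  qed (use a in simp)
qed

lemma lcircuit_Sup_remove:
  assumes C: "lcircuit L C" shows "\<Squnion>(C - {b}) = \<Squnion>C"
proof (cases "b \<in> C")
  case True
  have sub: "C \<subseteq> carrier L" "C - {b} \<subseteq> carrier L" using lcircuit_carrier[OF C] by auto
  show ?thesis
  proof (rule Sup_eqI[OF sub(2,1)])
    show "a \<sqsubseteq> \<Squnion>C" if "a \<in> C - {b}" for a using that sub by auto
    show "a \<sqsubseteq> \<Squnion>(C - {b})" if "a \<in> C" for a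
      using that sub lcircuit_le[OF C, of b] Sup_upper[OF sub(2), of a] by (cases "a = b") auto
  qed
qed simp

lemma lcircuit_nonempty: "lcircuit L C \<Longrightarrow> C \<noteq> {}" by (auto simp: lcircuit_def)

lemma Sup_empty: "\<Squnion>{} = \<bottom>" using le_bottom[of "\<Squnion>{}"] Sup_le_iff[of "{}" "\<bottom>"] by auto

lemma Sup_singleton [simp]: "x \<in> carrier L \<Longrightarrow> \<Squnion>{x} = x"
  by (intro le_antisym) (auto simp: Sup_le_iff)

text \<open>The matroid of a geometric lattice is simple: atoms are not the bottom element, and
  distinct atoms are incomparable. In particular a circuit is large enough to be tested in the
  definition of nested sets.\<close>

lemma lcircuit_card:
  assumes C: "lcircuit L C" shows "finite C" "3 \<le> card C"
proof -
  have sub: "C \<subseteq> carrier L" using C by (rule lcircuit_carrier)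
  show fin: "finite C" by (rule finite_sub[OF sub])
  show "3 \<le> card C"
  proof (rule ccontr)
    assume "\<not> 3 \<le> card C"
    obtain a where a: "a \<in> C" using lcircuit_nonempty[OF C] by auto
    have "card (C - {a}) < 2" using a fin \<open>\<not> 3 \<le> card C\<close> by simp
    then have "card (C - {a}) = 0 \<or> card (C - {a}) = 1" by linarith
    then have "C - {a} = {} \<or> (\<exists>b. C - {a} = {b})" using fin by (auto simp: card_1_singleton_iff)
    then consider "C - {a} = {}" | b where "C - {a} = {b}" by auto
    then show False
    proof cases
      case 1
      then have "a \<sqsubseteq> \<bottom>" using lcircuit_le[OF C a] by (simp only: Sup_empty)
      then show False using a lcircuit_atoms[OF C] atom_not_bot le_bottom by (meson atom_closed subsetD)
    next
      case 2
      then have "a \<sqsubseteq> b" "a \<noteq> b" "b \<in> C" using lcircuit_le[OF C a] sub by auto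
      then show False using atom_le_atom a lcircuit_atoms[OF C] by blast
    qed
  qed
qed

text \<open>A dependent subset with the fewest elements is a circuit.\<close>

lemma dependent_has_lcircuit:
  assumes "A \<subseteq> atoms L" "a \<in> A" "a \<sqsubseteq> \<Squnion>(A - {a})"
  shows "\<exists>C\<subseteq>A. lcircuit L C"
proof -
  let ?P = "\<lambda>C. C \<subseteq> A \<and> (\<exists>a\<in>C. a \<sqsubseteq> \<Squnion>(C - {a}))"
  have "?P A" using assms by auto
  moreover have fin: "finite A" using assms atoms_subset finite_sub by blast
  ultimately obtain C where C: "?P C" "\<And>D. ?P D \<Longrightarrow> card C \<le> card D"
    using arg_min_nat_lemma[of ?P A card] by blast
  have "\<not> a \<sqsubseteq> \<Squnion>(D - {a})" if "D \<subset> C" "a \<in> D" for D a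
  proof
    assume "a \<sqsubseteq> \<Squnion>(D - {a})"
    then have "?P D" using that C by blast
    then have "card C \<le> card D" by (rule C(2))
    moreover have "finite C" using C(1) fin finite_subset by blast
    ultimately show False using psubset_card_mono[OF _ that(1)] by simp
  qed
  then have "lcircuit L C" using C assms by (auto simp: lcircuit_def)
  then show ?thesis using C by auto
qed

section \<open>Spanning an element by atoms\<close>

definition atoms_in :: "'a \<Rightarrow> 'a set \<Rightarrow> 'a set" where
  "atoms_in q S = {a \<in> S. a \<in> atoms L \<and> a \<sqsubseteq> q}"

text \<open>Non-atoms and atoms not below \<open>q\<close> are ignored, so that the whole index set
  of a monomial may be inserted for \<open>S\<close>.\<close>

definition spans :: "'a \<Rightarrow> 'a set \<Rightarrow> bool" where
  "spans q S \<longleftrightarrow> \<Squnion>(atoms_in q S) = q"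

lemma atoms_in_carrier [simp]: "atoms_in q S \<subseteq> carrier L" by (auto simp: atoms_in_def)
lemma finite_atoms_in [simp]: "finite (atoms_in q S)" by (rule finite_sub) simp
lemma atoms_in_mono: "S \<subseteq> T \<Longrightarrow> atoms_in q S \<subseteq> atoms_in q T" by (auto simp: atoms_in_def)
lemma Sup_atoms_in_le: "q \<in> carrier L \<Longrightarrow> \<Squnion>(atoms_in q S) \<sqsubseteq> q"
  by (subst Sup_le_iff) (auto simp: atoms_in_def)

lemma spans_iff:
  "q \<in> carrier L \<Longrightarrow> spans q S \<longleftrightarrow> (\<forall>z\<in>carrier L. (\<forall>a\<in>S. a \<in> atoms L \<longrightarrow> a \<sqsubseteq> q \<longrightarrow> a \<sqsubseteq> z) \<longrightarrow> q \<sqsubseteq> z)"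
proof
  assume q: "q \<in> carrier L"
  { assume s: "spans q S"
    show "\<forall>z\<in>carrier L. (\<forall>a\<in>S. a \<in> atoms L \<longrightarrow> a \<sqsubseteq> q \<longrightarrow> a \<sqsubseteq> z) \<longrightarrow> q \<sqsubseteq> z"
    proof (intro ballI impI)
      fix z assume "z \<in> carrier L" "\<forall>a\<in>S. a \<in> atoms L \<longrightarrow> a \<sqsubseteq> q \<longrightarrow> a \<sqsubseteq> z"
      then have "\<Squnion>(atoms_in q S) \<sqsubseteq> z" by (subst Sup_le_iff) (auto simp: atoms_in_def)
      then show "q \<sqsubseteq> z" using s by (simp add: spans_def)
    qed }
  { assume *: "\<forall>z\<in>carrier L. (\<forall>a\<in>S. a \<in> atoms L \<longrightarrow> a \<sqsubseteq> q \<longrightarrow> a \<sqsubseteq> z) \<longrightarrow> q \<sqsubseteq> z"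
    have "q \<sqsubseteq> \<Squnion>(atoms_in q S)"
    proof (rule *[rule_format])
      fix a assume "a \<in> S" "a \<in> atoms L" "a \<sqsubseteq> q"
      then show "a \<sqsubseteq> \<Squnion>(atoms_in q S)" by (intro Sup_upper) (auto simp: atoms_in_def)
    qed simp
    then show "spans q S" unfolding spans_def using q Sup_atoms_in_le by (intro le_antisym) auto }
qed

lemma spansD:
  "spans q S \<Longrightarrow> q \<in> carrier L \<Longrightarrow> z \<in> carrier L \<Longrightarrow> (\<And>a. a \<in> S \<Longrightarrow> a \<in> atoms L \<Longrightarrow> a \<sqsubseteq> q \<Longrightarrow> a \<sqsubseteq> z) \<Longrightarrow> q \<sqsubseteq> z"
  using spans_iff by blast

lemma spans_mono: "spans q S \<Longrightarrow> S \<subseteq> T \<Longrightarrow> q \<in> carrier L \<Longrightarrow> spans q T"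
  by (subst (asm) spans_iff, assumption, subst spans_iff) blast+

text \<open>The relevant atoms of \<open>S\<close> matter only through their join. This is applied
  when a member of a circuit is deleted without changing that join.\<close>

lemma spans_cong:
  assumes "\<Squnion>(atoms_in q S) = \<Squnion>(atoms_in q S')" "q \<in> carrier L"
  shows "spans q (S \<union> T) \<longleftrightarrow> spans q (S' \<union> T)"
proof -
  have "\<Squnion>(atoms_in q (S \<union> T)) \<sqsubseteq> \<Squnion>(atoms_in q (S' \<union> T))"
    if "\<Squnion>(atoms_in q S) = \<Squnion>(atoms_in q S')" for S S'
  proof (subst Sup_le_iff)
    show "\<forall>a\<in>atoms_in q (S \<union> T). a \<sqsubseteq> \<Squnion>(atoms_in q (S' \<union> T))"
    proof
      fix a assume a: "a \<in> atoms_in q (S \<union> T)"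
      show "a \<sqsubseteq> \<Squnion>(atoms_in q (S' \<union> T))"
      proof (cases "a \<in> T")
        case True
        then have "a \<in> atoms_in q (S' \<union> T)" using a by (auto simp: atoms_in_def)
        then show ?thesis by (intro Sup_upper) auto
      next
        case False
        then have "a \<in> atoms_in q S" using a by (auto simp: atoms_in_def)
        then have "a \<sqsubseteq> \<Squnion>(atoms_in q S')" using that by (metis Sup_upper atoms_in_carrier)
        moreover have "\<Squnion>(atoms_in q S') \<sqsubseteq> \<Squnion>(atoms_in q (S' \<union> T))"
          by (intro Sup_mono atoms_in_mono) auto
        ultimately show ?thesis using a by (meson Sup_closed atoms_in_carrier le_trans subsetD)
      qed
    qed
  qed auto
  from this[of S S'] this[of S' S] have "\<Squnion>(atoms_in q (S \<union> T)) = \<Squnion>(atoms_in q (S' \<union> T))"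
    using assms by (intro le_antisym) auto
  then show ?thesis by (simp add: spans_def)
qed

lemma spans_insert_exchange:
  assumes q: "q \<in> carrier L" and b: "b \<in> atoms L" "b \<sqsubseteq> q" "b' \<in> atoms L" "b' \<sqsubseteq> q"
    and sp: "spans q (insert b S)" and nb: "\<not> b' \<sqsubseteq> \<Squnion>(atoms_in q S)"
  shows "spans q (insert b' S)"
proof -
  have 1: "atoms_in q (insert b S) = insert b (atoms_in q S)"
    "atoms_in q (insert b' S) = insert b' (atoms_in q S)" using b by (auto simp: atoms_in_def)
  show ?thesis
    using exchange[of "atoms_in q S" b' b] assms unfolding spans_def 1 by auto
qed

end

section \<open>Building sets and nested sets\<close>

locale building = geom L for L :: "'a gorder" (structure) +
  fixes G :: "'a set"
  assumes building: "building_set L G" and atoms_G: "atoms L \<subseteq> G"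
begin

lemma G_closed: "g \<in> G \<Longrightarrow> g \<in> carrier L" and G_not_bottom: "g \<in> G \<Longrightarrow> g \<noteq> \<bottom>"
  using building by (auto simp: building_set_def)

lemma G_carrier: "G \<subseteq> carrier L" using G_closed by auto

lemma max_below_exists:
  assumes "g \<in> G" "g \<sqsubseteq> x" shows "\<exists>m\<in>max_below L G x. g \<sqsubseteq> m"
proof -
  let ?P = "\<lambda>h. h \<in> G \<and> g \<sqsubseteq> h \<and> h \<sqsubseteq> x"
  let ?up = "\<lambda>h. {y \<in> carrier L. h \<sqsubseteq> y}"
  have "?P g" using assms G_closed by auto
  \<comment> \<open>An element of \<open>G\<close> with the fewest elements above it is
    maximal.\<close>
  then obtain h where h: "?P h" "\<And>k. ?P k \<Longrightarrow> card (?up h) \<le> card (?up k)"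
    using arg_min_nat_lemma[of ?P g "\<lambda>h. card (?up h)"] by blast
  have "k = h" if k: "k \<in> G" "k \<sqsubseteq> x" "h \<sqsubseteq> k" for k
  proof (rule ccontr)
    assume "k \<noteq> h"
    have c: "h \<in> carrier L" "k \<in> carrier L" "g \<in> carrier L" using h k assms G_closed by auto
    have "g \<sqsubseteq> k" using le_trans[of g h k] h k c by simp
    then have "card (?up h) \<le> card (?up k)" using h k by auto
    moreover have "\<not> k \<sqsubseteq> h" using \<open>k \<noteq> h\<close> le_antisym k c by blast
    then have "?up k \<subset> ?up h" using c k(3) le_trans[of h k] by auto
    ultimately show False using psubset_card_mono[of "?up h" "?up k"] by simp
  qed
  then show ?thesis using h by (auto simp: max_below_def)
qed

lemma max_below_le: "m \<in> max_below L G x \<Longrightarrow> m \<sqsubseteq> x"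
  and max_below_G: "m \<in> max_below L G x \<Longrightarrow> m \<in> G"
  by (auto simp: max_below_def)

text \<open>The product isomorphism, read from the interval to the product: \<open>u y m\<close> is
  the component of \<open>y\<close> in the factor below \<open>m\<close>.\<close>

lemma building_coordinates:
  assumes x: "x \<in> carrier L" "x \<noteq> \<bottom>"
  defines "M \<equiv> max_below L G x"
  obtains u :: "'a \<Rightarrow> 'a \<Rightarrow> 'a" where
    "\<And>y z. y \<in> carrier L \<Longrightarrow> z \<in> carrier L \<Longrightarrow> y \<sqsubseteq> x \<Longrightarrow> z \<sqsubseteq> x \<Longrightarrow> y \<sqsubseteq> z \<longleftrightarrow> (\<forall>m\<in>M. u y m \<sqsubseteq> u z m)"
    "\<And>y m. y \<in> carrier L \<Longrightarrow> y \<sqsubseteq> x \<Longrightarrow> m \<in> M \<Longrightarrow> u y m \<in> carrier L \<and> u y m \<sqsubseteq> m"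
    "\<And>v. (\<And>m. m \<in> M \<Longrightarrow> v m \<in> carrier L \<and> v m \<sqsubseteq> m) \<Longrightarrow> \<exists>y\<in>carrier L. y \<sqsubseteq> x \<and> (\<forall>m\<in>M. u y m = v m)"
    "\<And>m n. m \<in> M \<Longrightarrow> n \<in> M \<Longrightarrow> u m n = (if n = m then m else \<bottom>)"
proof -
  define Q where "Q = (\<Pi>\<^sub>E m\<in>M. \<lbrace>\<bottom>..m\<rbrace>)"
  have int: "\<lbrace>\<bottom>..m\<rbrace> = {y \<in> carrier L. y \<sqsubseteq> m}" for m
    by (auto simp: at_least_at_most_def)
  obtain f where f: "bij_betw f Q \<lbrace>\<bottom>..x\<rbrace>" "\<forall>u\<in>Q. \<forall>v\<in>Q. f u \<sqsubseteq> f v \<longleftrightarrow> (\<forall>m\<in>M. u m \<sqsubseteq> v m)"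
    "\<forall>m\<in>M. f (\<lambda>n\<in>M. if n = m then m else \<bottom>) = m"
  proof -
    have "\<forall>x\<in>carrier L - {\<bottom>}. \<exists>f. bij_betw f (\<Pi>\<^sub>E m\<in>max_below L G x. \<lbrace>\<bottom>..m\<rbrace>) \<lbrace>\<bottom>..x\<rbrace>
      \<and> (\<forall>u\<in>(\<Pi>\<^sub>E m\<in>max_below L G x. \<lbrace>\<bottom>..m\<rbrace>). \<forall>v\<in>(\<Pi>\<^sub>E m\<in>max_below L G x. \<lbrace>\<bottom>..m\<rbrace>).
           f u \<sqsubseteq> f v \<longleftrightarrow> (\<forall>m\<in>max_below L G x. u m \<sqsubseteq> v m))
      \<and> (\<forall>m\<in>max_below L G x. f (\<lambda>n\<in>max_below L G x. if n = m then m else \<bottom>) = m)"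
      using building unfolding building_set_def Let_def by simp
    moreover have "x \<in> carrier L - {\<bottom>}" using x by simp
    ultimately show ?thesis using that unfolding M_def Q_def by blast
  qed
  define u where "u = (\<lambda>y. inv_into Q f y)"
  have u: "u y \<in> Q" "f (u y) = y" if "y \<in> carrier L" "y \<sqsubseteq> x" for y
  proof -
    have "y \<in> f ` Q" using f(1) that by (simp add: bij_betw_def int)
    then show "u y \<in> Q" "f (u y) = y" unfolding u_def by (rule inv_into_into, rule f_inv_into_f)
  qed
  have uf: "u (f v) = v" if "v \<in> Q" for v
    using f(1) that unfolding u_def by (auto simp: bij_betw_def)
  have fQ: "f v \<in> carrier L \<and> f v \<sqsubseteq> x" if "v \<in> Q" for v
    using f(1) that by (auto simp: bij_betw_def int)
  show thesis
  proof (rule that[of u])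
    show "y \<sqsubseteq> z \<longleftrightarrow> (\<forall>m\<in>M. u y m \<sqsubseteq> u z m)"
      if "y \<in> carrier L" "z \<in> carrier L" "y \<sqsubseteq> x" "z \<sqsubseteq> x" for y z
      using f(2) u that by metis
    show "u y m \<in> carrier L \<and> u y m \<sqsubseteq> m" if "y \<in> carrier L" "y \<sqsubseteq> x" "m \<in> M" for y m
      using u(1)[OF that(1,2)] that(3) by (auto simp: Q_def PiE_iff int)
    show "\<exists>y\<in>carrier L. y \<sqsubseteq> x \<and> (\<forall>m\<in>M. u y m = v m)"
      if v: "\<And>m. m \<in> M \<Longrightarrow> v m \<in> carrier L \<and> v m \<sqsubseteq> m" for v
    proof -
      have "restrict v M \<in> Q" using v by (auto simp: Q_def int)
      then show ?thesis using uf[of "restrict v M"] fQ[of "restrict v M"] by (metis restrict_apply')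
    qed
    show "u m n = (if n = m then m else \<bottom>)" if "m \<in> M" "n \<in> M" for m n
    proof -
      have "(\<lambda>n\<in>M. if n = m then m else \<bottom>) \<in> Q"
        using that G_closed max_below_G by (auto simp: Q_def int M_def)
      from uf[OF this] have "u m = (\<lambda>n\<in>M. if n = m then m else \<bottom>)" using f(3) that(1) by simp
      then show ?thesis using that by simp
    qed
  qed
qed

text \<open>The components of \<open>w\<close> are bounded by those of \<open>m\<close> and of
  \<open>m'\<close>, which differ from the bottom element in different places.\<close>

lemma max_below_disjoint:
  assumes x: "x \<in> carrier L" "x \<noteq> \<bottom>" and m: "m \<in> max_below L G x" "m' \<in> max_below L G x" "m \<noteq> m'"
    and w: "w \<in> carrier L" "w \<sqsubseteq> m" "w \<sqsubseteq> m'"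
  shows "w = \<bottom>"
proof -
  let ?M = "max_below L G x"
  obtain u where u: "\<And>y z. y \<in> carrier L \<Longrightarrow> z \<in> carrier L \<Longrightarrow> y \<sqsubseteq> x \<Longrightarrow> z \<sqsubseteq> x \<Longrightarrow> y \<sqsubseteq> z \<longleftrightarrow> (\<forall>m\<in>?M. u y m \<sqsubseteq> u z m)"
    "\<And>y m. y \<in> carrier L \<Longrightarrow> y \<sqsubseteq> x \<Longrightarrow> m \<in> ?M \<Longrightarrow> u y m \<in> carrier L \<and> u y m \<sqsubseteq> m"
    "\<And>v. (\<And>m. m \<in> ?M \<Longrightarrow> v m \<in> carrier L \<and> v m \<sqsubseteq> m) \<Longrightarrow> \<exists>y\<in>carrier L. y \<sqsubseteq> x \<and> (\<forall>m\<in>?M. u y m = v m)"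
    "\<And>m n. m \<in> ?M \<Longrightarrow> n \<in> ?M \<Longrightarrow> u m n = (if n = m then m else \<bottom>)"
    using building_coordinates[OF x] by blast
  have mc: "m \<in> carrier L" "m' \<in> carrier L" "m \<sqsubseteq> x" "m' \<sqsubseteq> x"
    using m max_below_G max_below_le G_closed by auto
  have wx: "w \<sqsubseteq> x" using le_trans[of w m x] w mc x by simp
  have 0: "u w n \<sqsubseteq> u m n" "u w n \<sqsubseteq> u m' n" if "n \<in> ?M" for n
    using u(1)[of w m] u(1)[of w m'] w wx mc that by auto
  have "u w n = \<bottom>" if "n \<in> ?M" for n
    using 0[OF that] u(4)[OF m(1) that] u(4)[OF m(2) that] m(3) u(2)[OF w(1) wx that] le_bottom
    by (auto split: if_splits)
  then have "w \<sqsubseteq> \<bottom>" using u(1)[of w \<bottom>] u(2)[of \<bottom>] w wx x by auto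
  then show ?thesis using le_bottom w by simp
qed

text \<open>The maximal elements of \<open>G\<close> below the join that dominate \<open>g\<close>
  and \<open>h\<close> share the lower bound \<open>w\<close>. By disjointness of the factors they
  coincide, and their common value is the join.\<close>

lemma G_Sup:
  assumes g: "g \<in> G" "h \<in> G" and w: "w \<in> carrier L" "w \<noteq> \<bottom>" "w \<sqsubseteq> g" "w \<sqsubseteq> h"
  shows "\<Squnion>{g, h} \<in> G"
proof -
  let ?x = "\<Squnion>{g, h}"
  have c: "g \<in> carrier L" "h \<in> carrier L" "{g, h} \<subseteq> carrier L" using g G_closed by auto
  have x: "?x \<in> carrier L" using c by simp
  have le: "g \<sqsubseteq> ?x" "h \<sqsubseteq> ?x" using c by auto
  have "?x \<noteq> \<bottom>" using le(1) g G_not_bottom le_bottom c by auto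
  obtain m m' where m: "m \<in> max_below L G ?x" "g \<sqsubseteq> m" "m' \<in> max_below L G ?x" "h \<sqsubseteq> m'"
    using max_below_exists g le by meson
  have mc: "m \<in> carrier L" "m' \<in> carrier L" using m max_below_G G_closed by auto
  have "w \<sqsubseteq> m" "w \<sqsubseteq> m'" using le_trans[of w g m] le_trans[of w h m'] w m mc c by auto
  then have "m = m'" using max_below_disjoint[OF x \<open>?x \<noteq> \<bottom>\<close>] m w by metis
  then have "?x \<sqsubseteq> m" using m c mc by (subst Sup_le_iff) auto
  then have "?x = m" using max_below_le[OF m(1)] le_antisym x mc by blast
  then show ?thesis using max_below_G m by simp
qed

text \<open>A circuit is connected: it cannot be distributed over several factors in the product
  decomposition below its join. So its join is itself a maximal element of \<open>G\<close>
  there.\<close>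

lemma lcircuit_Sup_G:
  assumes C: "lcircuit L C" shows "\<Squnion>C \<in> G"
proof -
  let ?x = "\<Squnion>C"
  let ?M = "max_below L G ?x"
  have sub: "C \<subseteq> carrier L" "C \<subseteq> atoms L" using C by (simp_all add: lcircuit_carrier lcircuit_atoms)
  have x: "?x \<in> carrier L" using sub by simp
  obtain a where a: "a \<in> C" using lcircuit_nonempty[OF C] by auto
  have le: "c \<sqsubseteq> ?x" if "c \<in> C" for c using that sub by auto
  have x0: "?x \<noteq> \<bottom>" using le[OF a] le_bottom atom_not_bot a sub by (metis subsetD)
  obtain u where u: "\<And>y z. y \<in> carrier L \<Longrightarrow> z \<in> carrier L \<Longrightarrow> y \<sqsubseteq> ?x \<Longrightarrow> z \<sqsubseteq> ?x \<Longrightarrow> y \<sqsubseteq> z \<longleftrightarrow> (\<forall>m\<in>?M. u y m \<sqsubseteq> u z m)"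
    "\<And>y m. y \<in> carrier L \<Longrightarrow> y \<sqsubseteq> ?x \<Longrightarrow> m \<in> ?M \<Longrightarrow> u y m \<in> carrier L \<and> u y m \<sqsubseteq> m"
    "\<And>v. (\<And>m. m \<in> ?M \<Longrightarrow> v m \<in> carrier L \<and> v m \<sqsubseteq> m) \<Longrightarrow> \<exists>y\<in>carrier L. y \<sqsubseteq> ?x \<and> (\<forall>m\<in>?M. u y m = v m)"
    "\<And>m n. m \<in> ?M \<Longrightarrow> n \<in> ?M \<Longrightarrow> u m n = (if n = m then m else \<bottom>)"
    using building_coordinates[OF x x0] by blast
  obtain m where m: "m \<in> ?M" "a \<sqsubseteq> m" using max_below_exists[of a ?x] a sub atoms_G le by blast
  have mc: "n \<in> carrier L \<and> n \<sqsubseteq> ?x" if "n \<in> ?M" for n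
    using that max_below_G max_below_le G_closed by auto
  define D where "D = {c \<in> C. c \<sqsubseteq> m}"
  \<comment> \<open>Otherwise the part of the circuit inside the factor of \<open>m\<close> is a
    proper and hence independent subset, although the product decomposition shows that
    \<open>a\<close> depends on this part alone.\<close>
  have "D = C"
  proof (rule ccontr)
    assume "D \<noteq> C"
    then have "D \<subset> C" by (auto simp: D_def)
    moreover have "a \<in> D" using a m by (simp add: D_def)
    ultimately have n: "\<not> a \<sqsubseteq> \<Squnion>(D - {a})" using C by (auto simp: lcircuit_def)
    define z where "z = \<Squnion>(D - {a})"
    have Dc: "D - {a} \<subseteq> carrier L" using sub by (auto simp: D_def)
    have zc: "z \<in> carrier L" using Dc by (simp add: z_def)
    have zm: "z \<sqsubseteq> m" unfolding z_def using Dc mc[OF m(1)] by (subst Sup_le_iff) (auto simp: D_def)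
    have zx: "z \<sqsubseteq> ?x" using le_trans[of z m ?x] zc zm mc[OF m(1)] x by simp
    have off: "u c k = \<bottom>" if "c \<in> carrier L" "c \<sqsubseteq> n" "n \<in> ?M" "k \<in> ?M" "k \<noteq> n" for c n k
    proof -
      have cx: "c \<sqsubseteq> ?x" using le_trans[of c n ?x] that mc[OF that(3)] x by simp
      have "u c k \<sqsubseteq> \<bottom>" using u(1)[of c n] that mc[OF that(3)] cx u(4)[OF that(3,4)] by auto
      then show ?thesis using u(2)[OF that(1) cx that(4)] le_bottom by simp
    qed
    \<comment> \<open>The component of \<open>y\<close> is that of \<open>z\<close> in the factor of
      \<open>m\<close> and maximal in all others, so that \<open>y\<close> bounds all of
      \<open>C - {a}\<close>, whichever factors its atoms lie in.\<close>
    obtain y where y: "y \<in> carrier L" "y \<sqsubseteq> ?x" "\<forall>n\<in>?M. u y n = (if n = m then u z m else n)"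
      using u(3)[of "\<lambda>n. if n = m then u z m else n"] u(2)[OF zc zx m(1)] mc by fastforce
    have "c \<sqsubseteq> y" if c: "c \<in> C - {a}" for c
    proof -
      have cc: "c \<in> carrier L" "c \<sqsubseteq> ?x" using c sub le by auto
      have "u c n \<sqsubseteq> u y n" if n: "n \<in> ?M" for n
      proof (cases "n = m")
        case False
        then show ?thesis using u(2)[OF cc n] y(3) n by simp
      next
        case True
        show ?thesis
        proof (cases "c \<sqsubseteq> m")
          case True
          then have "c \<sqsubseteq> z" using c Dc unfolding z_def by (intro Sup_upper) (auto simp: D_def)
          then show ?thesis using u(1)[of c z] cc zc zx \<open>n = m\<close> n y(3) by auto
        next
          case False
          obtain k where k: "k \<in> ?M" "c \<sqsubseteq> k" using max_below_exists[of c ?x] c sub atoms_G le by blast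
          then have "u c n = \<bottom>" using off[of c k n] cc n False \<open>n = m\<close> by auto
          then show ?thesis using u(2)[OF y(1,2) n] by simp
        qed
      qed
      then show ?thesis using u(1)[of c y] cc y by auto
    qed
    then have "\<Squnion>(C - {a}) \<sqsubseteq> y" using sub y by (subst Sup_le_iff) auto
    moreover have "a \<sqsubseteq> \<Squnion>(C - {a})" by (rule lcircuit_le[OF C a])
    moreover have ac: "a \<in> carrier L" "\<Squnion>(C - {a}) \<in> carrier L"
      using a sub Sup_closed[of "C - {a}"] Diff_subset[of C "{a}"] by (blast, metis subset_trans)
    ultimately have "a \<sqsubseteq> y" using le_trans y(1) by blast
    then have *: "u a n \<sqsubseteq> u y n" if "n \<in> ?M" for n using u(1)[of a y] ac y le[OF a] that by auto
    have "u a n \<sqsubseteq> u z n" if n: "n \<in> ?M" for n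
    proof (cases "n = m")
      case True then show ?thesis using *[OF n] y(3) n by simp
    next
      case False
      then show ?thesis using off[of a m n] ac m n u(2)[OF zc zx n] by simp
    qed
    then have "a \<sqsubseteq> z" using u(1)[of a z] ac zc zx le[OF a] by auto
    then show False using n by (simp add: z_def)
  qed
  then have "?x \<sqsubseteq> m" using sub mc[OF m(1)] by (subst Sup_le_iff) (auto simp: D_def)
  then have "?x = m" using mc[OF m(1)] x le_antisym by blast
  then show ?thesis using max_below_G m by simp
qed

end

section \<open>Nested sets and partial building sets\<close>

definition antichain :: "('a, 'm) gorder_scheme \<Rightarrow> 'a set \<Rightarrow> bool" where
  "antichain L T \<longleftrightarrow> (\<forall>s\<in>T. \<forall>t\<in>T. s \<noteq> t \<longrightarrow> \<not> s \<sqsubseteq>\<^bsub>L\<^esub> t)"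

lemma nested_iff:
  "S \<in> nested L H \<longleftrightarrow> S \<subseteq> H \<and> (\<forall>T\<subseteq>S. 2 \<le> card T \<and> antichain L T \<longrightarrow> \<Squnion>\<^bsub>L\<^esub>T \<notin> H)"
proof -
  have "antichain L T \<longleftrightarrow> (\<forall>s\<in>T. \<forall>t\<in>T. s \<noteq> t \<longrightarrow> \<not> s \<sqsubseteq>\<^bsub>L\<^esub> t \<and> \<not> t \<sqsubseteq>\<^bsub>L\<^esub> s)" for T
    unfolding antichain_def by metis
  then show ?thesis unfolding nested_def by simp
qed

lemma not_nestedI:
  "T \<subseteq> S \<Longrightarrow> 2 \<le> card T \<Longrightarrow> antichain L T \<Longrightarrow> \<Squnion>\<^bsub>L\<^esub>T \<in> H \<Longrightarrow> S \<notin> nested L H"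
  unfolding nested_iff by blast

lemma not_nestedE:
  assumes "S \<notin> nested L H" "S \<subseteq> H"
  obtains T where "T \<subseteq> S" "2 \<le> card T" "antichain L T" "\<Squnion>\<^bsub>L\<^esub>T \<in> H"
  using assms unfolding nested_iff by blast

lemma nested_mono:
  assumes "T \<in> nested L H" "S \<subseteq> T" shows "S \<in> nested L H"
proof -
  have "T \<subseteq> H" "\<And>U. U \<subseteq> T \<Longrightarrow> 2 \<le> card U \<Longrightarrow> antichain L U \<Longrightarrow> \<Squnion>\<^bsub>L\<^esub>U \<notin> H"
    using assms(1) by (simp_all add: nested_iff)
  moreover have "S \<subseteq> H" using assms(2) \<open>T \<subseteq> H\<close> by (rule subset_trans)
  ultimately show ?thesis unfolding nested_iff using subset_trans[OF _ assms(2)] by simp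
qed

lemma not_nested_mono: "S \<notin> nested L H \<Longrightarrow> S \<subseteq> T \<Longrightarrow> T \<notin> nested L H"
  using nested_mono by blast

lemma two_le_cardD:
  assumes "2 \<le> card T" obtains s t where "s \<in> T" "t \<in> T" "s \<noteq> t"
proof -
  have "T \<noteq> {}" using assms by auto
  then obtain s where s: "s \<in> T" by auto
  have "T \<noteq> {s}" using assms by auto
  then show thesis using s that by auto
qed

lemma two_le_cardI: "finite T \<Longrightarrow> s \<in> T \<Longrightarrow> t \<in> T \<Longrightarrow> s \<noteq> t \<Longrightarrow> 2 \<le> card T"
  using card_mono[of T "{s, t}"] by simp

locale pbs = geom L for L :: "'a gorder" (structure) +
  fixes G H :: "'a set"
  assumes building_G: "building_set L G" and partial: "partial_building_set L G H"

sublocale pbs \<subseteq> building L G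
  using building_G partial by unfold_locales (auto simp: partial_building_set_def)

context pbs
begin

lemma H_G: "H \<subseteq> G" and atoms_H: "atoms L \<subseteq> H"
  using partial by (auto simp: partial_building_set_def)

lemma H_carrier: "H \<subseteq> carrier L" using H_G G_carrier by auto

lemma finite_H: "finite H" using H_carrier by (rule finite_sub)

lemma H_up: "h \<in> H \<Longrightarrow> h \<notin> atoms L \<Longrightarrow> g \<in> G \<Longrightarrow> h \<sqsubseteq> g \<Longrightarrow> g \<in> H"
  using partial unfolding partial_building_set_def by blast

text \<open>Below an atom there is only one element besides the bottom, so an atom is not the join
  of two different elements of \<open>G\<close>. If the join of an antichain is in \<open>H\<close>,
  it is therefore a non-atom, and upward closure applies to it.\<close>

lemma antichain_Sup_not_atom:
  assumes "T \<subseteq> G" "2 \<le> card T" "antichain L T" shows "\<Squnion>T \<notin> atoms L"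
proof
  assume A: "\<Squnion>T \<in> atoms L"
  obtain s t where st: "s \<in> T" "t \<in> T" "s \<noteq> t" using assms by (auto elim: two_le_cardD)
  have Tc: "T \<subseteq> carrier L" using assms G_carrier by auto
  have "s \<sqsubseteq> \<Squnion>T" "t \<sqsubseteq> \<Squnion>T" using st Tc by auto
  then have "s = \<Squnion>T" "t = \<Squnion>T" using le_atom[OF A] st Tc assms G_not_bottom by blast+
  then show False using st by simp
qed

lemma atoms_antichain: "C \<subseteq> atoms L \<Longrightarrow> antichain L C"
  using atom_le_atom unfolding antichain_def by blast

lemma lcircuit_Sup_notin:
  assumes "lcircuit L C" "C \<in> nested L H" shows "\<Squnion>C \<notin> H"
  using assms lcircuit_card[OF assms(1)] atoms_antichain[OF lcircuit_atoms[OF assms(1)]]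
  by (auto simp: nested_iff)

text \<open>Upward closure would put \<open>\<Squnion>C\<close>, which is in \<open>G\<close>, into
  \<open>H\<close>. So no blown up element lies below \<open>\<Squnion>C\<close>, and this join
  survives in the iterated blowup.\<close>

lemma lcircuit_no_H_below:
  assumes "lcircuit L C" "C \<in> nested L H" "h \<in> H" "h \<notin> atoms L" shows "\<not> h \<sqsubseteq> \<Squnion>C"
  using H_up[OF assms(3,4) lcircuit_Sup_G[OF assms(1)]] lcircuit_Sup_notin[OF assms(1,2)] by blast

text \<open>As \<open>b\<close> lies below \<open>h\<close> and \<open>q\<close>, the element \<open>h \<squnion> q\<close> is in \<open>H\<close>; it is the join of \<open>h\<close> with elements of \<open>S\<close>.\<close>

lemma spans_not_nested:
  assumes q: "q \<in> G" and b: "b \<in> atoms L" "b \<sqsubseteq> q" and sp: "spans q (insert b S)"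
    and h: "h \<in> H" "b \<sqsubseteq> h" "h \<noteq> b" "\<not> q \<sqsubseteq> h"
  shows "insert h S \<notin> nested L H"
proof -
  let ?A = "{t \<in> atoms_in q S. \<not> t \<sqsubseteq> h}"
  let ?V = "insert h ?A"
  have qc: "q \<in> carrier L" and hc: "h \<in> carrier L" using q h G_closed H_carrier by auto
  have h_na: "h \<notin> atoms L" using atom_le_atom b h by blast
  have Vc: "?V \<subseteq> carrier L" using hc by (auto simp: atoms_in_def)
  have "\<exists>t. t \<in> ?A"
  proof (rule ccontr)
    assume "\<not> ?thesis"
    then have "q \<sqsubseteq> h" using h by (intro spansD[OF sp qc hc]) (auto simp: atoms_in_def)
    then show False using h by simp
  qed
  then obtain t where t: "t \<in> ?A" ..
  have "finite ?V" using Vc by (rule finite_sub)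
  then have "2 \<le> card ?V" using t hc by (intro two_le_cardI[of _ h t]) auto
  moreover have "antichain L ?V"
  proof -
    have "\<not> h \<sqsubseteq> t" if "t \<in> ?A" for t
      using that le_atom[of t h] hc h_na G_not_bottom H_G h by (auto simp: atoms_in_def)
    then show ?thesis using atom_le_atom unfolding antichain_def atoms_in_def by blast
  qed
  moreover have "\<Squnion>?V = \<Squnion>{h, q}"
  proof (rule Sup_eqI[OF Vc])
    show "{h, q} \<subseteq> carrier L" using qc hc by simp
    show "a \<sqsubseteq> \<Squnion>{h, q}" if "a \<in> ?V" for a
    proof -
      have "a = h \<or> a \<sqsubseteq> q" using that by (auto simp: atoms_in_def)
      then show ?thesis using le_Sup_trans[of "{h, q}" q a] Sup_upper[of "{h, q}" h] qc hc that Vc by auto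
    qed
    have hV: "h \<sqsubseteq> \<Squnion>?V" using Vc by (intro Sup_upper) auto
    have "q \<sqsubseteq> \<Squnion>?V"
    proof (rule spansD[OF sp qc])
      fix a assume a: "a \<in> insert b S" "a \<in> atoms L" "a \<sqsubseteq> q"
      show "a \<sqsubseteq> \<Squnion>?V"
      proof (cases "a \<sqsubseteq> h")
        case True
        then show ?thesis using le_Sup_trans[OF Vc, of h a] a by auto
      next
        case False
        then show ?thesis using a h Vc by (intro Sup_upper) (auto simp: atoms_in_def)
      qed
    qed (use Vc in simp)
    then show "a \<sqsubseteq> \<Squnion>?V" if "a \<in> {h, q}" for a using that hV by auto
  qed
  moreover have "\<Squnion>{h, q} \<in> H"
  proof (rule H_up[OF h(1) h_na])
    show "\<Squnion>{h, q} \<in> G" using G_Sup[of h q b] q h H_G b atom_not_bot by auto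
    show "h \<sqsubseteq> \<Squnion>{h, q}" using qc hc by (intro Sup_upper) auto
  qed
  ultimately show ?thesis by (intro not_nestedI[of ?V]) (auto simp: atoms_in_def)
qed

lemma lcircuit_spans:
  assumes "lcircuit L C" "C - {b} \<subseteq> S" shows "spans (\<Squnion>C) S"
proof -
  have sub: "C \<subseteq> carrier L" using lcircuit_carrier assms by blast
  have "\<Squnion>(C - {b}) \<sqsubseteq> z" if "z \<in> carrier L" "\<forall>a\<in>S. a \<in> atoms L \<longrightarrow> a \<sqsubseteq> \<Squnion>C \<longrightarrow> a \<sqsubseteq> z" for z
    using that assms sub lcircuit_atoms[OF assms(1)] Sup_upper[OF sub] by (subst Sup_le_iff) blast+
  then show ?thesis using sub by (subst spans_iff) (auto simp: lcircuit_Sup_remove[OF assms(1)])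
qed

end

section \<open>Adding one element to a partial building set\<close>

locale blow = geom L for L :: "'a gorder" (structure) +
  fixes G H :: "'a set" and p :: 'a
  assumes pbs_H: "pbs L G H" and pbs_H': "pbs L G (insert p H)" and p_notin: "p \<notin> H"

sublocale blow \<subseteq> pbs L G H by (rule pbs_H)
sublocale blow \<subseteq> p': pbs L G "insert p H" by (rule pbs_H')

context blow
begin

abbreviation "H' \<equiv> insert p H"

lemma p_G: "p \<in> G" and p_closed [simp]: "p \<in> carrier L" and p_not_atom: "p \<notin> atoms L"
  using p'.H_G p'.H_carrier p_notin atoms_H by auto

text \<open>Upward closure would carry a non-atom of \<open>H\<close> below \<open>p\<close> up to
  \<open>p\<close>, which is in \<open>G\<close>. What \<open>H\<close> contains below
  \<open>p\<close> is therefore the ground set of a matroid.\<close>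

lemma H_le_p: "h \<in> H \<Longrightarrow> h \<sqsubseteq> p \<Longrightarrow> h \<in> atoms L"
  using H_up[OF _ _ p_G] p_notin by blast

lemma H'_up: "h \<in> H' \<Longrightarrow> h \<notin> atoms L \<Longrightarrow> g \<in> G \<Longrightarrow> h \<sqsubseteq> g \<Longrightarrow> g \<noteq> p \<Longrightarrow> g \<in> H"
  using p'.H_up by blast

lemma Sup_Sup_p:
  assumes V: "V \<subseteq> carrier L" "v \<in> V" "v \<sqsubseteq> p" "v \<noteq> \<bottom>" and VG: "\<Squnion>V \<in> G"
  shows "\<Squnion>{\<Squnion>V, p} \<in> G"
  using G_Sup[OF VG p_G, of v] V by auto

text \<open>Elements spanning \<open>p\<close> replace \<open>p\<close> and everything below it in a set with join in \<open>H'\<close>.\<close>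

lemma not_nested_spanning:
  assumes V: "V \<subseteq> H'" "2 \<le> card V" "antichain L V" "\<Squnion>V \<in> H'" "\<Squnion>V \<noteq> p"
    and Z: "spans p Z" "{v \<in> V. \<not> v \<sqsubseteq> p} \<subseteq> Z"
  shows "Z \<notin> nested L H"
proof -
  define W where "W = {v \<in> V. \<not> v \<sqsubseteq> p}"
  have Vc: "V \<subseteq> carrier L" using V(1) p'.H_carrier by blast
  have Vfin: "finite V" using Vc by (rule finite_sub)
  have na: "\<Squnion>V \<notin> atoms L" using p'.antichain_Sup_not_atom V p'.H_G by blast
  have Sc: "\<Squnion>V \<in> carrier L" using Vc by simp
  \<comment> \<open>If all of \<open>V\<close> were below \<open>p\<close>, so would be its join,
    which is in \<open>H'\<close> but is neither an atom nor \<open>p\<close>.\<close>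
  have "W \<noteq> {}"
  proof
    assume "W = {}"
    then have "\<Squnion>V \<sqsubseteq> p" using Vc by (subst Sup_le_iff) (auto simp: W_def)
    then show False using V(4,5) na H_le_p by auto
  qed
  show ?thesis
  proof (cases "W = V")
    case True
    then show ?thesis using V Z unfolding W_def by (intro not_nestedI[of V]) auto
  next
    case False
    then obtain v0 where v0: "v0 \<in> V" "v0 \<sqsubseteq> p" by (auto simp: W_def)
    have v0b: "v0 \<noteq> \<bottom>" using v0 V(1) p'.H_G G_not_bottom by blast
    \<comment> \<open>The join of \<open>V\<close> and \<open>p\<close> is to be written with
      members of \<open>Z\<close>. Atoms below a member of \<open>W\<close> are left out: they would
      spoil the antichain and contribute nothing to the join.\<close>
    define B where "B = {b \<in> atoms_in p Z. \<forall>w\<in>W. \<not> b \<sqsubseteq> w}"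
    have Wc: "W \<subseteq> carrier L" using Vc by (auto simp: W_def)
    have Bc: "B \<subseteq> carrier L" by (auto simp: B_def atoms_in_def)
    have UZ: "W \<union> B \<subseteq> Z" using Z by (auto simp: W_def B_def atoms_in_def)
    have Uc: "W \<union> B \<subseteq> carrier L" using Wc Bc by simp
    have p_le: "p \<sqsubseteq> \<Squnion>(W \<union> B)"
    proof (rule spansD[OF Z(1)])
      fix a assume a: "a \<in> Z" "a \<in> atoms L" "a \<sqsubseteq> p"
      show "a \<sqsubseteq> \<Squnion>(W \<union> B)"
      proof (cases "\<exists>w\<in>W. a \<sqsubseteq> w")
        case True
        then show ?thesis using le_Sup_trans[OF Uc _ _ atom_closed[OF a(2)]] by blast
      next
        case False
        then have "a \<in> B" using a by (auto simp: B_def atoms_in_def)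
        then show ?thesis using Uc by auto
      qed
    qed (use Uc in auto)
    have Sup: "\<Squnion>(W \<union> B) = \<Squnion>{\<Squnion>V, p}"
    proof (rule Sup_eqI[OF Uc])
      have VpC: "{\<Squnion>V, p} \<subseteq> carrier L" using Sc by simp
      show "{\<Squnion>V, p} \<subseteq> carrier L" by (rule VpC)
      show "a \<sqsubseteq> \<Squnion>{\<Squnion>V, p}" if "a \<in> W \<union> B" for a
      proof -
        have "a \<sqsubseteq> \<Squnion>V \<or> a \<sqsubseteq> p" using that Vc by (auto simp: W_def B_def atoms_in_def)
        moreover have "a \<in> carrier L" using that Uc by blast
        ultimately show ?thesis using le_Sup_trans[OF VpC, of "\<Squnion>V" a] le_Sup_trans[OF VpC, of p a] by blast
      qed
      have "\<Squnion>V \<sqsubseteq> \<Squnion>(W \<union> B)"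
      proof -
        have "v \<sqsubseteq> \<Squnion>(W \<union> B)" if "v \<in> V" for v
        proof (cases "v \<sqsubseteq> p")
          case True
          then show ?thesis using le_trans[OF True p_le] that Vc Uc by auto
        next
          case False
          then show ?thesis using that Uc by (auto simp: W_def)
        qed
        then show ?thesis using Vc Uc by (subst Sup_le_iff) auto
      qed
      then show "a \<sqsubseteq> \<Squnion>(W \<union> B)" if "a \<in> {\<Squnion>V, p}" for a using that p_le by auto
    qed
    have VG: "\<Squnion>V \<in> G" using V(4) p'.H_G by auto
    have "\<Squnion>V \<sqsubseteq> \<Squnion>{\<Squnion>V, p}" using Sc by auto
    moreover have "\<Squnion>{\<Squnion>V, p} \<noteq> p"
    proof
      assume "\<Squnion>{\<Squnion>V, p} = p"
      then have "\<Squnion>V \<sqsubseteq> p" using calculation by simp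
      then have "\<forall>v\<in>V. v \<sqsubseteq> p" using Sup_le_iff[OF Vc p_closed] by simp
      then show False using \<open>W \<noteq> {}\<close> by (auto simp: W_def)
    qed
    ultimately have inH: "\<Squnion>(W \<union> B) \<in> H"
      unfolding Sup using H'_up[OF V(4) na Sup_Sup_p[OF Vc v0 v0b VG]] by simp
    obtain w where w: "w \<in> W" using \<open>W \<noteq> {}\<close> by auto
    have anti: "antichain L (W \<union> B)"
      unfolding antichain_def
    proof (intro ballI impI)
      fix s t assume st: "s \<in> W \<union> B" "t \<in> W \<union> B" "s \<noteq> t"
      show "\<not> s \<sqsubseteq> t"
      proof (cases "s \<in> W")
        case sW: True
        show ?thesis
        proof (cases "t \<in> W")
          case True
          then show ?thesis using sW st V(3) by (auto simp: W_def antichain_def)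
        next
          case False
          then have "t \<in> B" using st by simp
          then have t: "t \<in> carrier L" "t \<sqsubseteq> p" using Bc by (auto simp: B_def atoms_in_def)
          then show ?thesis using le_trans[of s t p] sW Wc by (auto simp: W_def)
        qed
      next
        case False
        then have "s \<in> B" using st by simp
        then show ?thesis using st atom_le_atom by (auto simp: B_def atoms_in_def)
      qed
    qed
    have "2 \<le> card (W \<union> B)"
    proof (cases "W = {w}")
      case True
      have "\<exists>b. b \<in> B"
      proof (rule ccontr)
        assume "\<not> ?thesis"
        \<comment> \<open>All atoms spanning \<open>p\<close> would lie below the single element
          \<open>w\<close>, hence so would \<open>v0\<close>, although \<open>V\<close> is an
          antichain.\<close>
        then have "p \<sqsubseteq> w" using w Wc True
          by (intro spansD[OF Z(1)]) (auto simp: B_def atoms_in_def)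
        moreover have "v0 \<in> carrier L" "w \<in> carrier L" using v0 w Wc Vc by auto
        ultimately have "v0 \<sqsubseteq> w" using le_trans[OF v0(2)] by simp
        moreover have "v0 \<noteq> w" using v0 w by (auto simp: W_def)
        ultimately show False using V(3) v0 w by (auto simp: W_def antichain_def)
      qed
      then obtain b where b: "b \<in> B" ..
      then have "b \<noteq> w" using w by (auto simp: B_def W_def atoms_in_def)
      then show ?thesis using two_le_cardI[OF finite_sub[OF Uc], of w b] w b by auto
    next
      case False
      then obtain w' where "w' \<in> W" "w' \<noteq> w" using w by auto
      then show ?thesis using two_le_cardI[OF finite_sub[OF Uc], of w w'] w by auto
    qed
    then show ?thesis using not_nestedI[OF UZ _ anti inH] by simp
  qed
qed

text \<open>Here \<open>p\<close> replaces the elements below it in a set with join in \<open>H\<close>.\<close>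

lemma not_nested_replace:
  assumes U: "U \<subseteq> H" "U \<notin> nested L H" and Z: "p \<in> Z" "{u \<in> U. \<not> u \<sqsubseteq> p} \<subseteq> Z"
  shows "Z \<notin> nested L H'"
proof -
  obtain V where V: "V \<subseteq> U" "2 \<le> card V" "antichain L V" "\<Squnion>V \<in> H"
    using not_nestedE[OF U(2,1)] by blast
  define W where "W = {v \<in> V. \<not> v \<sqsubseteq> p}"
  have VH: "V \<subseteq> H" using V U by blast
  have Vc: "V \<subseteq> carrier L" using VH H_carrier by blast
  have na: "\<Squnion>V \<notin> atoms L" using antichain_Sup_not_atom V VH H_G by blast
  have Sc: "\<Squnion>V \<in> carrier L" using Vc by simp
  have "W \<noteq> {}"
  proof
    assume "W = {}"
    then have "\<Squnion>V \<sqsubseteq> p" using Vc by (subst Sup_le_iff) (auto simp: W_def)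
    then show False using V(4) na H_le_p by auto
  qed
  show ?thesis
  proof (cases "W = V")
    case True
    then show ?thesis using V Z unfolding W_def by (intro not_nestedI[of V]) auto
  next
    case False
    then obtain v0 where v0: "v0 \<in> V" "v0 \<sqsubseteq> p" by (auto simp: W_def)
    have v0b: "v0 \<noteq> \<bottom>" using v0 VH H_G G_not_bottom by blast
    have Wc: "W \<subseteq> carrier L" using Vc by (auto simp: W_def)
    have Uc: "insert p W \<subseteq> carrier L" using Wc by simp
    have UZ: "insert p W \<subseteq> Z" using Z V by (auto simp: W_def)
    have p_le: "p \<sqsubseteq> \<Squnion>(insert p W)" using Uc by auto
    have Sup: "\<Squnion>(insert p W) = \<Squnion>{\<Squnion>V, p}"
    proof (rule Sup_eqI[OF Uc])
      have VpC: "{\<Squnion>V, p} \<subseteq> carrier L" using Sc by simp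
      show "{\<Squnion>V, p} \<subseteq> carrier L" by (rule VpC)
      show "a \<sqsubseteq> \<Squnion>{\<Squnion>V, p}" if "a \<in> insert p W" for a
      proof -
        have "a \<sqsubseteq> \<Squnion>V \<or> a \<sqsubseteq> p" using that Vc by (auto simp: W_def)
        moreover have "a \<in> carrier L" using that Uc by blast
        ultimately show ?thesis using le_Sup_trans[OF VpC, of "\<Squnion>V" a] le_Sup_trans[OF VpC, of p a] by blast
      qed
      have "\<Squnion>V \<sqsubseteq> \<Squnion>(insert p W)"
      proof -
        have "v \<sqsubseteq> \<Squnion>(insert p W)" if "v \<in> V" for v
        proof (cases "v \<sqsubseteq> p")
          case True
          then show ?thesis using le_trans[OF True p_le] that Vc Uc by auto
        next
          case False
          then show ?thesis using that Uc by (intro Sup_upper) (auto simp: W_def)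
        qed
        then show ?thesis using Vc Uc by (subst Sup_le_iff) auto
      qed
      then show "a \<sqsubseteq> \<Squnion>(insert p W)" if "a \<in> {\<Squnion>V, p}" for a using that p_le by auto
    qed
    have VG: "\<Squnion>V \<in> G" using V(4) H_G by auto
    have "\<Squnion>V \<sqsubseteq> \<Squnion>{\<Squnion>V, p}" using Sc by auto
    then have inH: "\<Squnion>(insert p W) \<in> H'"
      unfolding Sup using H_up[OF V(4) na Sup_Sup_p[OF Vc v0 v0b VG]] by simp
    obtain w where w: "w \<in> W" using \<open>W \<noteq> {}\<close> by auto
    have anti: "antichain L (insert p W)"
      unfolding antichain_def
    proof (intro ballI impI)
      fix s t assume st: "s \<in> insert p W" "t \<in> insert p W" "s \<noteq> t"
      show "\<not> s \<sqsubseteq> t"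
      proof (cases "s \<in> W")
        case True
        then show ?thesis using st V(3) by (auto simp: W_def antichain_def)
      next
        case False
        then have s: "s = p" "t \<in> V" "\<not> t \<sqsubseteq> p" using st by (auto simp: W_def)
        show ?thesis
        proof
          \<comment> \<open>As \<open>v0\<close> lies below \<open>p\<close>, having
            \<open>p\<close> below \<open>t\<close> would make two members of \<open>V\<close>
            comparable.\<close>
          assume "s \<sqsubseteq> t"
          then have "v0 \<sqsubseteq> t" using le_trans[OF v0(2), of t] v0 s Vc by auto
          moreover have "v0 \<noteq> t" using v0 s by auto
          ultimately show False using V(3) v0 s by (auto simp: antichain_def)
        qed
      qed
    qed
    have "2 \<le> card (insert p W)"
    proof -
      have "\<not> w \<sqsubseteq> p" using w by (auto simp: W_def)
      then have "p \<noteq> w" using le_refl[OF p_closed] by metis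
      then show ?thesis using two_le_cardI[OF finite_sub[OF Uc], of p w] w by auto
    qed
    then show ?thesis using not_nestedI[OF UZ _ anti inH] by simp
  qed
qed

lemma nested_H'_imp: "S \<subseteq> H \<Longrightarrow> S \<in> nested L H' \<Longrightarrow> S \<in> nested L H"
  by (simp add: nested_iff)

text \<open>Since \<open>p\<close> is neither the bottom element nor an atom, at least two atoms are
  needed to span it; they form an antichain with join \<open>p\<close>.\<close>

lemma spans_not_nested_H':
  assumes "spans p S" "S \<subseteq> H'" shows "S \<notin> nested L H'"
proof -
  have "atoms_in p S \<subseteq> atoms L" by (auto simp: atoms_in_def)
  moreover have "2 \<le> card (atoms_in p S)"
  proof (rule ccontr)
    assume "\<not> 2 \<le> card (atoms_in p S)"
    then have "card (atoms_in p S) = 0 \<or> card (atoms_in p S) = 1" by linarith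
    then have "atoms_in p S = {} \<or> (\<exists>a. atoms_in p S = {a})" by (auto simp: card_1_singleton_iff)
    then consider "atoms_in p S = {}" | a where "atoms_in p S = {a}" by auto
    then show False
    proof cases
      case 1
      then have "p = \<bottom>" using assms by (simp add: spans_def Sup_empty)
      then show False using p_G G_not_bottom by blast
    next
      case 2
      then have "a \<in> atoms L" by (auto simp: atoms_in_def)
      then show False using 2 assms p_not_atom by (auto simp: spans_def)
    qed
  qed
  ultimately show ?thesis using assms atoms_antichain
    by (intro not_nestedI[of "atoms_in p S"]) (auto simp: spans_def atoms_in_def)
qed

text \<open>Passing from \<open>H\<close> to \<open>H'\<close> newly forbids only antichains with
  join \<open>p\<close>; their members, being elements of \<open>H\<close> below \<open>p\<close>,
  are atoms.\<close>

lemma not_nested_H'_cases: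
  assumes "S \<subseteq> H" "S \<notin> nested L H'" shows "S \<notin> nested L H \<or> spans p S"
proof -
  obtain V where V: "V \<subseteq> S" "2 \<le> card V" "antichain L V" "\<Squnion>V \<in> H'"
    using not_nestedE[OF assms(2)] assms(1) by blast
  show ?thesis
  proof (cases "\<Squnion>V = p")
    case True
    have Vc: "V \<subseteq> carrier L" using V assms H_carrier by blast
    have "v \<in> atoms_in p S" if "v \<in> V" for v
    proof -
      have "v \<sqsubseteq> p" using Sup_upper[OF Vc that] True by simp
      then show ?thesis using that V(1) assms H_le_p by (auto simp: atoms_in_def)
    qed
    then have "p \<sqsubseteq> \<Squnion>(atoms_in p S)" using Sup_mono[of V "atoms_in p S"] True by auto
    then have "spans p S" unfolding spans_def using Sup_atoms_in_le le_antisym p_closed by simp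
    then show ?thesis ..
  next
    case False
    then show ?thesis using not_nestedI[OF V(1-3)] V(4) by simp
  qed
qed

lemma not_nested_with_p_cases:
  assumes S: "S \<subseteq> H" "insert p S \<notin> nested L H'"
  obtains "spans p S"
    | V where "V \<subseteq> insert p S" "2 \<le> card V" "antichain L V" "\<Squnion>V \<in> H'" "\<Squnion>V \<noteq> p"
proof -
  obtain V where V: "V \<subseteq> insert p S" "2 \<le> card V" "antichain L V" "\<Squnion>V \<in> H'"
    using not_nestedE[OF S(2)] S(1) by blast
  show thesis
  proof (cases "\<Squnion>V = p")
    case True
    have "insert p S \<subseteq> carrier L" using S(1) H_carrier by auto
    then have Vc: "V \<subseteq> carrier L" using V(1) by (rule subset_trans[rotated])
    \<comment> \<open>With join \<open>p\<close>, every other member of \<open>V\<close> would be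
      comparable to \<open>p\<close>.\<close>
    have "p \<notin> V"
    proof
      assume "p \<in> V"
      moreover obtain s t where "s \<in> V" "t \<in> V" "s \<noteq> t" using V(2) by (auto elim: two_le_cardD)
      ultimately obtain s where "s \<in> V" "s \<noteq> p" by metis
      then show False using V(3) \<open>p \<in> V\<close> Sup_upper[OF Vc, of s] True by (auto simp: antichain_def)
    qed
    then have VS: "V \<subseteq> S" using V by auto
    have "v \<in> atoms_in p S" if "v \<in> V" for v
    proof -
      have "v \<sqsubseteq> p" using Sup_upper[OF Vc that] True by simp
      then show ?thesis using that VS S H_le_p by (auto simp: atoms_in_def)
    qed
    then have "p \<sqsubseteq> \<Squnion>(atoms_in p S)" using Sup_mono[of V "atoms_in p S"] True by auto
    then have "spans p S" unfolding spans_def using Sup_atoms_in_le le_antisym p_closed by simp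
    then show ?thesis by (rule that(1))
  next
    case False
    then show ?thesis using V that(2) by blast
  qed
qed

text \<open>A circuit that spans \<open>p\<close> has a join above \<open>p\<close>. This join is in
  \<open>G\<close>, so upward closure puts it into \<open>H\<close> unless it is \<open>p\<close>,
  and then the circuit was not nested before.\<close>

lemma lcircuit_nested_H':
  assumes "lcircuit L C" "C \<in> nested L H" "\<Squnion>C \<noteq> p" shows "C \<in> nested L H'"
proof (rule ccontr)
  assume "C \<notin> nested L H'"
  moreover have CH: "C \<subseteq> H" using assms(2) by (simp add: nested_iff)
  ultimately have "spans p C" using not_nested_H'_cases assms(2) by blast
  then have "p \<sqsubseteq> \<Squnion>C"
    using lcircuit_carrier[OF assms(1)] by (intro spansD[of p C]) auto
  then have "\<Squnion>C \<in> H" using H'_up[OF _ p_not_atom lcircuit_Sup_G[OF assms(1)]] assms(3) by simp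
  then show False using lcircuit_Sup_notin assms by blast
qed

text \<open>Circuits on both sides of \<open>p\<close>. The substitution affects some but not all of
  their members, so cancellation in pairs fails; instead the extra terms are all non-nested.\<close>

definition mixed :: "'a set \<Rightarrow> bool" where
  "mixed C \<longleftrightarrow> lcircuit L C \<and> (\<exists>c\<in>C. c \<sqsubseteq> p) \<and> (\<exists>c\<in>C. \<not> c \<sqsubseteq> p)"

text \<open>Deleting one \<open>g\<close> does not lower the join of the circuit, so
  \<open>p\<close> and the remaining atoms not below \<open>p\<close> have the same join as
  \<open>\<Squnion>C\<close> and \<open>p\<close>. This join is in \<open>G\<close> because both lie
  above the atom \<open>c0\<close>, and in \<open>H\<close> because it exceeds
  \<open>p\<close>.\<close>

lemma mixed_antichain:
  fixes g assumes C: "mixed C"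
  defines "V \<equiv> insert p {c \<in> C - {g}. \<not> c \<sqsubseteq> p}"
  shows "2 \<le> card V" "antichain L V" "\<Squnion>V \<in> H" "V \<subseteq> H'" "\<Squnion>V \<noteq> p"
proof -
  have lc: "lcircuit L C" using C by (simp add: mixed_def)
  have sub: "C \<subseteq> carrier L" "C \<subseteq> atoms L" using lc by (simp_all add: lcircuit_carrier lcircuit_atoms)
  have Vc: "V \<subseteq> carrier L" using sub by (auto simp: V_def)
  obtain c0 c1 where c0: "c0 \<in> C" "c0 \<sqsubseteq> p" and c1: "c1 \<in> C" "\<not> c1 \<sqsubseteq> p" using C by (auto simp: mixed_def)
  have Cc: "\<Squnion>C \<in> carrier L" using sub by simp
  have "\<exists>v. v \<in> V \<and> v \<noteq> p"
  proof (rule ccontr)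
    assume "\<not> ?thesis"
    then have "\<Squnion>(C - {g}) \<sqsubseteq> p" using sub by (subst Sup_le_iff) (auto simp: V_def)
    then have "\<forall>c\<in>C. c \<sqsubseteq> p" using sub by (simp add: lcircuit_Sup_remove[OF lc] Sup_le_iff)
    then show False using c1 by blast
  qed
  then obtain v where v: "v \<in> V" "v \<noteq> p" by blast
  show "2 \<le> card V" using two_le_cardI[OF finite_sub[OF Vc], of p v] v by (auto simp: V_def)
  show "antichain L V"
    unfolding antichain_def
  proof (intro ballI impI)
    fix s t assume st: "s \<in> V" "t \<in> V" "s \<noteq> t"
    show "\<not> s \<sqsubseteq> t"
    proof (cases "s = p")
      case True
      then have "t \<in> atoms L" using st sub by (auto simp: V_def)
      then show ?thesis using le_atom[of t p] True st p_G G_not_bottom by auto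
    next
      case False
      then have "s \<in> atoms L" "\<not> s \<sqsubseteq> p" using st sub by (auto simp: V_def)
      then show ?thesis using st sub atom_le_atom by (auto simp: V_def)
    qed
  qed
  show "V \<subseteq> H'" using sub atoms_H by (auto simp: V_def)
  have CpC: "{\<Squnion>C, p} \<subseteq> carrier L" using Cc by simp
  have Sup: "\<Squnion>V = \<Squnion>{\<Squnion>C, p}"
  proof (rule Sup_eqI[OF Vc CpC])
    show "a \<sqsubseteq> \<Squnion>{\<Squnion>C, p}" if "a \<in> V" for a
    proof -
      have "a \<sqsubseteq> \<Squnion>C \<or> a \<sqsubseteq> p" using that sub by (auto simp: V_def)
      then show ?thesis using le_Sup_trans[OF CpC, of _ a] that Vc by auto
    qed
    have pV: "p \<sqsubseteq> \<Squnion>V" using Vc by (intro Sup_upper) (auto simp: V_def)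
    have "c \<sqsubseteq> \<Squnion>V" if "c \<in> C - {g}" for c
    proof (cases "c \<sqsubseteq> p")
      case True
      then show ?thesis using le_trans[OF True pV] that sub Vc by auto
    next
      case False
      then show ?thesis using that Vc by (intro Sup_upper) (auto simp: V_def)
    qed
    moreover have "C - {g} \<subseteq> carrier L" using sub by auto
    ultimately have "\<Squnion>(C - {g}) \<sqsubseteq> \<Squnion>V" using Vc by (simp add: Sup_le_iff)
    then have "\<Squnion>C \<sqsubseteq> \<Squnion>V" by (simp add: lcircuit_Sup_remove[OF lc])
    then show "a \<sqsubseteq> \<Squnion>V" if "a \<in> {\<Squnion>C, p}" for a using that pV by auto
  qed
  have "c0 \<noteq> \<bottom>" using c0 sub atom_not_bot by blast
  then have G: "\<Squnion>V \<in> G" unfolding Sup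
    using Sup_Sup_p[OF sub(1) c0 _ lcircuit_Sup_G[OF lc]] by simp
  show ne: "\<Squnion>V \<noteq> p"
  proof
    assume *: "\<Squnion>V = p"
    have "c1 \<sqsubseteq> \<Squnion>C" using sub c1 by auto
    moreover have "\<Squnion>C \<sqsubseteq> \<Squnion>V" unfolding Sup using CpC by auto
    ultimately have "c1 \<sqsubseteq> p" using le_trans[of c1 "\<Squnion>C" p] * c1 sub Cc by auto
    then show False using c1 by simp
  qed
  have "p \<sqsubseteq> \<Squnion>V" using Vc by (intro Sup_upper) (auto simp: V_def)
  then show "\<Squnion>V \<in> H" using H'_up[OF _ p_not_atom G] ne by simp
qed

lemma mixed_not_nested_H':
  assumes "mixed C" "p \<in> Z" "{c \<in> C - {g}. \<not> c \<sqsubseteq> p} \<subseteq> Z"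
  shows "Z \<notin> nested L H'"
  using mixed_antichain[OF assms(1), of g] assms(2,3)
  by (intro not_nestedI[of "insert p {c \<in> C - {g}. \<not> c \<sqsubseteq> p}"]) auto

lemma mixed_not_nested_spanning:
  assumes "mixed C" "spans p Z" "C - {g} \<subseteq> Z"
  shows "Z \<notin> nested L H"
proof (rule not_nested_spanning[OF _ _ _ _ _ assms(2)])
  note m = mixed_antichain[OF assms(1), of g]
  show "insert p {c \<in> C - {g}. \<not> c \<sqsubseteq> p} \<subseteq> H'" "2 \<le> card (insert p {c \<in> C - {g}. \<not> c \<sqsubseteq> p})"
    "antichain L (insert p {c \<in> C - {g}. \<not> c \<sqsubseteq> p})" "\<Squnion>(insert p {c \<in> C - {g}. \<not> c \<sqsubseteq> p}) \<noteq> p"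
    using m by blast+
  show "\<Squnion>(insert p {c \<in> C - {g}. \<not> c \<sqsubseteq> p}) \<in> H'" using m(3) by blast
  show "{v \<in> insert p {c \<in> C - {g}. \<not> c \<sqsubseteq> p}. \<not> v \<sqsubseteq> p} \<subseteq> Z" using assms(3) by auto
qed

end

section \<open>The ideal of relations as a linear span\<close>

type_synonym 'a pol = "'a multiset \<Rightarrow>\<^sub>0 rat"

definition xm :: "'a multiset \<Rightarrow> 'a pol" where
  "xm m = Poly_Mapping.single m 1"

text \<open>\<open>iota S f\<close> is the element \<open>f e\<^sub>S\<close>.\<close>

definition iota :: "'a set \<Rightarrow> 'a pol \<Rightarrow> 'a gca" where
  "iota S f = lin_ext (\<lambda>m. monom_ex S m) f"

section \<open>Linear maps and polynomials\<close>

definition linear_map :: "(('b \<Rightarrow>\<^sub>0 rat) \<Rightarrow> ('c \<Rightarrow>\<^sub>0 rat)) \<Rightarrow> bool" where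
  "linear_map F \<longleftrightarrow> (\<forall>x y. F (x + y) = F x + F y) \<and> (\<forall>c x. F (scale c x) = scale c (F x))"

lemma linear_mapI:
  "(\<And>x y. F (x + y) = F x + F y) \<Longrightarrow> (\<And>c x. F (scale c x) = scale c (F x)) \<Longrightarrow> linear_map F"
  by (simp add: linear_map_def)

lemma scale_minus_one: "scale (- 1) f = - f"
  by (rule poly_mapping_eqI) (simp add: lookup_scale)

lemma scale_commute: "scale c (scale d f) = scale d (scale c f)"
  by (simp add: scale_scale mult.commute)

lemma scale_uminus: "scale (- c) f = - scale c f" "scale c (- f) = - scale c f"
  by (rule poly_mapping_eqI, simp add: lookup_scale)+

lemma
  assumes "linear_map F"
  shows linear_map_add: "F (x + y) = F x + F y"
    and linear_map_scale: "F (scale c x) = scale c (F x)"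
    and linear_map_zero: "F 0 = 0"
    and linear_map_uminus: "F (- x) = - F x"
    and linear_map_diff: "F (x - y) = F x - F y"
proof -
  show a: "F (x + y) = F x + F y" for x y using assms by (simp add: linear_map_def)
  show s: "F (scale c x) = scale c (F x)" for c x using assms by (simp add: linear_map_def)
  show "F 0 = 0" using s[of 0 0] by simp
  show m: "F (- x) = - F x" for x using s[of "- 1" x] by (simp add: scale_minus_one)
  show "F (x - y) = F x - F y" using a[of x "- y"] m by simp
qed

lemma linear_map_sum: "linear_map F \<Longrightarrow> F (\<Sum>a\<in>A. g a) = (\<Sum>a\<in>A. F (g a))"
  by (induction A rule: infinite_finite_induct) (simp_all add: linear_map_zero linear_map_add)

lemma linear_lin_ext: "linear_map (lin_ext F)"
  by (rule linear_mapI) (simp_all add: lin_ext_add lin_ext_scale)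

lemma linear_map_comp: "linear_map F \<Longrightarrow> linear_map G \<Longrightarrow> linear_map (\<lambda>x. F (G x))"
  by (simp add: linear_map_def)

lemma linear_map_add_fun: "linear_map F \<Longrightarrow> linear_map G \<Longrightarrow> linear_map (\<lambda>x. F x + G x)"
  by (simp add: linear_map_def scale_add algebra_simps)

lemma linear_map_scale_fun: "linear_map F \<Longrightarrow> linear_map (\<lambda>x. scale c (F x))"
  by (simp add: linear_map_def scale_add scale_scale mult.commute)

lemma linear_map_diff_fun: "linear_map F \<Longrightarrow> linear_map G \<Longrightarrow> linear_map (\<lambda>x. F x - G x)"
  by (rule linear_mapI)
    (simp_all add: linear_map_add linear_map_scale, rule poly_mapping_eqI,
      simp add: lookup_scale lookup_minus algebra_simps)

lemma linear_map_sum_fun: "(\<And>a. a \<in> A \<Longrightarrow> linear_map (F a)) \<Longrightarrow> linear_map (\<lambda>x. \<Sum>a\<in>A. F a x)"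
  by (rule linear_mapI) (simp_all add: linear_map_add linear_map_scale sum.distrib scale_sum)

lemma linear_map_const_zero: "linear_map (\<lambda>x. 0)"
  by (simp add: linear_map_def)

lemma linear_map_id: "linear_map (\<lambda>x. x)"
  by (simp add: linear_map_def)

lemma scale_conv_mult: "scale c f = Poly_Mapping.single 0 c * (f :: 'a pol)"
  unfolding scale_def by (rule mult_map_scale_conv_mult)

lemma scale_mult_left: "scale c f * g = scale c (f * (g :: 'a pol))"
  and scale_mult_right: "f * scale c g = scale c (f * (g :: 'a pol))"
  by (simp_all add: scale_conv_mult ac_simps)

lemma linear_map_mult: "linear_map (\<lambda>f :: 'a pol. g * f)" "linear_map (\<lambda>f :: 'a pol. f * g)"
  by (rule linear_mapI; simp add: scale_mult_left scale_mult_right algebra_simps)+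

lemma xm_add: "xm (m + n) = xm m * xm n"
  by (simp add: xm_def mult_single)

lemma xm_empty [simp]: "xm {#} = 1"
  by (simp add: xm_def flip: single_one)

lemma lin_ext_xm: "lin_ext xm f = f"
  by (rule poly_mapping_eqI)
    (auto simp: lin_ext_def lookup_sum lookup_scale xm_def lookup_single when_def
      in_keys_iff sum.delta if_distrib cong: if_cong)

lemma linear_map_expand: "linear_map F \<Longrightarrow> F f = lin_ext (\<lambda>m. F (xm m)) f"
proof -
  assume F: "linear_map F"
  have "F f = F (lin_ext xm f)" by (simp add: lin_ext_xm)
  also have "\<dots> = lin_ext (\<lambda>m. F (xm m)) f"
    by (simp add: lin_ext_def linear_map_sum[OF F] linear_map_scale[OF F])
  finally show ?thesis .
qed

lemma linear_iota: "linear_map (iota S)"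
  unfolding iota_def by (rule linear_lin_ext)

lemmas iota_simps = linear_map_add[OF linear_iota] linear_map_scale[OF linear_iota]
  linear_map_zero[OF linear_iota] linear_map_uminus[OF linear_iota] linear_map_diff[OF linear_iota]
  linear_map_sum[OF linear_iota]

lemma iota_xm: "iota S (xm m) = monom_ex S m"
  by (simp add: iota_def xm_def lin_ext_def)

text \<open>Lets a map that is given on monomials be evaluated at \<open>e_S f\<close> for every
  polynomial \<open>f\<close>.\<close>

lemma lin_ext_iota:
  assumes "linear_map (h S)"
  shows "lin_ext (\<lambda>(S, m). h S (xm m)) (iota S f) = h S f"
  unfolding iota_def lin_ext_lin_ext by (simp add: linear_map_expand[OF assms, of f, symmetric])

definition polys :: "'a set \<Rightarrow> 'a pol set" where
  "polys H = {f. \<forall>m\<in>Poly_Mapping.keys f. set_mset m \<subseteq> H}"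

lemma polys_add [intro]: "f \<in> polys H \<Longrightarrow> g \<in> polys H \<Longrightarrow> f + g \<in> polys H"
  using Poly_Mapping.keys_add[of f g] by (auto simp: polys_def)

lemma polys_scale [intro]: "f \<in> polys H \<Longrightarrow> scale c f \<in> polys H"
  using keys_scale[of c f] by (auto simp: polys_def)

lemma polys_uminus [intro]: "f \<in> polys H \<Longrightarrow> - f \<in> polys H"
  by (simp add: polys_def)

lemma polys_zero [simp, intro]: "0 \<in> polys H"
  by (simp add: polys_def)

lemma polys_xm [intro]: "set_mset m \<subseteq> H \<Longrightarrow> xm m \<in> polys H"
  by (simp add: polys_def xm_def)

lemma polys_one [simp, intro]: "1 \<in> polys H"
  using polys_xm[of "{#}" H] by simp

lemma polys_sum [intro]: "(\<And>a. a \<in> A \<Longrightarrow> F a \<in> polys H) \<Longrightarrow> sum F A \<in> polys H"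
  by (induction A rule: infinite_finite_induct) auto

lemma polys_induct [consumes 1, case_names xm add scale zero]:
  assumes "f \<in> polys H" "\<And>m. set_mset m \<subseteq> H \<Longrightarrow> P (xm m)" "\<And>f g. P f \<Longrightarrow> P g \<Longrightarrow> P (f + g)"
    "\<And>c f. P f \<Longrightarrow> P (scale c f)" "P 0"
  shows "P f"
proof -
  have "P (\<Sum>m\<in>A. scale (c m) (xm m))" if "A \<subseteq> Poly_Mapping.keys f" for A c
  proof -
    have "finite A" using that by (rule finite_subset) simp
    then show ?thesis using that
      by (induction A) (use assms in \<open>auto simp: polys_def\<close>)
  qed
  then have "P (lin_ext xm f)" unfolding lin_ext_def by blast
  then show ?thesis by (simp add: lin_ext_xm)
qed

lemma polys_mult [intro]:
  assumes "f \<in> polys H" "g \<in> polys H" shows "f * g \<in> polys H"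
  using assms(1)
proof (induction rule: polys_induct)
  case (xm m)
  show ?case using assms(2)
  proof (induction rule: polys_induct)
    case (xm n)
    then show ?case using polys_xm[of "m + n" H] \<open>set_mset m \<subseteq> H\<close> by (simp add: xm_add)
  qed (auto simp: scale_mult_right distrib_left)
qed (auto simp: scale_mult_left distrib_right)

lemma pol_induct [case_names xm add scale zero]:
  assumes "\<And>m. P (xm m)" "\<And>f g. P f \<Longrightarrow> P g \<Longrightarrow> P (f + g)" "\<And>c f. P f \<Longrightarrow> P (scale c f)" "P 0"
  shows "P (f :: 'a pol)"
  by (rule polys_induct[of f UNIV P]) (use assms in \<open>auto simp: polys_def\<close>)

section \<open>Multiplication and differential on the elements \<open>iota S f\<close>\<close>

definition mul :: "'a rel \<Rightarrow> 'a gca \<Rightarrow> 'a gca \<Rightarrow> 'a gca" where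
  "mul r f g = lin_ext (\<lambda>u. lin_ext (mono_mult r u) g) f"

definition dif :: "'a rel \<Rightarrow> 'a gca \<Rightarrow> 'a gca" where
  "dif r = lin_ext (mono_diff r)"

lemma free_gca_simps [simp]:
  "f \<otimes>\<^bsub>free_gca H r\<^esub> g = mul r f g" "f \<oplus>\<^bsub>free_gca H r\<^esub> g = f + g" "\<zero>\<^bsub>free_gca H r\<^esub> = 0"
  "c \<odot>\<^bsub>free_gca H r\<^esub> f = scale c f" "\<one>\<^bsub>free_gca H r\<^esub> = iota {} 1"
  "differential (free_gca H r) = dif r"
  by (simp_all add: free_gca_def mul_def dif_def flip: iota_xm)

lemma linear_mul: "linear_map (mul r f)" "linear_map (\<lambda>f. mul r f g)"
  unfolding mul_def by (rule linear_mapI; simp add: lin_ext_add lin_ext_add_fun lin_ext_scale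
    lin_ext_scale_fun)+

lemma linear_dif: "linear_map (dif r)"
  unfolding dif_def by (rule linear_lin_ext)

lemma mul_iota:
  "mul r (iota S f) (iota T g)
    = (if S \<inter> T = {} then scale ((-1) ^ inversions r S T) (iota (S \<union> T) (f * g)) else 0)"
proof (induction f rule: pol_induct)
  case (xm m)
  show ?case
  proof (induction g rule: pol_induct)
    case (xm n)
    show ?case by (simp add: iota_xm mul_def mono_mult_def flip: xm_add)
  qed (simp_all add: iota_simps linear_map_add[OF linear_mul(1)] linear_map_scale[OF linear_mul(1)]
      linear_map_zero[OF linear_mul(1)] scale_mult_right scale_commute[of "(-1) ^ _"] distrib_left scale_add)
qed (simp_all add: iota_simps linear_map_add[OF linear_mul(2)] linear_map_scale[OF linear_mul(2)]
      linear_map_zero[OF linear_mul(2)] scale_mult_left scale_commute[of "(-1) ^ _"] distrib_right scale_add)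

lemma dif_iota:
  "dif r (iota S f) = (\<Sum>g\<in>S. scale ((-1) ^ inversions r {g} S) (iota (S - {g}) (xm {#g#} * f)))"
proof (induction f rule: pol_induct)
  case (xm m)
  show ?case by (simp add: iota_xm dif_def mono_diff_def flip: xm_add)
next
  case (add f g)
  then show ?case by (simp add: iota_simps linear_map_add[OF linear_dif] distrib_left scale_add sum.distrib)
next
  case (scale c f)
  then show ?case
    by (simp add: iota_simps linear_map_scale[OF linear_dif] scale_mult_right scale_sum scale_commute[of "(-1) ^ _"])
qed (simp add: iota_simps linear_map_zero[OF linear_dif])

lemma carrier_add: "f \<in> carrier (free_gca H r) \<Longrightarrow> g \<in> carrier (free_gca H r) \<Longrightarrow> f + g \<in> carrier (free_gca H r)"
  using Poly_Mapping.keys_add[of f g] unfolding carrier_free_gca by blast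

lemma carrier_scale: "f \<in> carrier (free_gca H r) \<Longrightarrow> scale c f \<in> carrier (free_gca H r)"
  using keys_scale[of c f] by (auto simp: carrier_free_gca)

lemma carrier_zero: "0 \<in> carrier (free_gca H r)"
  by (simp add: carrier_free_gca)

lemma iota_in_carrier:
  assumes "finite S" "S \<subseteq> H" "f \<in> polys H" shows "iota S f \<in> carrier (free_gca H r)"
  using assms(3)
proof (induction rule: polys_induct)
  case (xm m)
  then show ?case using assms by (simp add: iota_xm carrier_free_gca monom_ex_def)
qed (auto simp: iota_simps carrier_zero intro: carrier_add carrier_scale)

lemma gca_expand: "f = (\<Sum>(S, m)\<in>Poly_Mapping.keys f. scale (Poly_Mapping.lookup f (S, m)) (iota S (xm m)))"
proof -
  have "f = lin_ext (\<lambda>(S, m). monom_ex S m) f" by (simp add: lin_ext_id)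
  then show ?thesis unfolding lin_ext_def by (simp add: iota_xm split_def)
qed

lemma carrier_induct [consumes 1, case_names mono add scale zero]:
  assumes f: "f \<in> carrier (free_gca H r)"
    and mono: "\<And>S m. finite S \<Longrightarrow> S \<subseteq> H \<Longrightarrow> set_mset m \<subseteq> H \<Longrightarrow> P (iota S (xm m))"
    and add: "\<And>f g. P f \<Longrightarrow> P g \<Longrightarrow> P (f + g)" and sc: "\<And>c f. P f \<Longrightarrow> P (scale c f)" and zero: "P 0"
  shows "P f"
proof -
  have "P (\<Sum>(S, m)\<in>A. scale (c (S, m)) (iota S (xm m)))" if "A \<subseteq> Poly_Mapping.keys f" for A c
  proof -
    have "finite A" using that by (rule finite_subset) simp
    then show ?thesis using that
    proof (induction A)
      case (insert u A)
      obtain S m where u: "u = (S, m)" by (metis surj_pair)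
      have "finite S" "S \<subseteq> H" "set_mset m \<subseteq> H" using f insert.prems u by (auto simp: carrier_free_gca)
      then show ?case using insert u by (auto intro!: add sc mono)
    qed (simp add: zero)
  qed
  from this[OF subset_refl, of "Poly_Mapping.lookup f"] show ?thesis by (subst gca_expand[of f])
qed

section \<open>Linear spans and the multiples of the relations\<close>

inductive_set lspan :: "('b \<Rightarrow>\<^sub>0 rat) set \<Rightarrow> ('b \<Rightarrow>\<^sub>0 rat) set" for X where
  base: "x \<in> X \<Longrightarrow> x \<in> lspan X"
| zero: "0 \<in> lspan X"
| add: "x \<in> lspan X \<Longrightarrow> y \<in> lspan X \<Longrightarrow> x + y \<in> lspan X"
| scale: "x \<in> lspan X \<Longrightarrow> scale c x \<in> lspan X"

lemma lspan_uminus: "x \<in> lspan X \<Longrightarrow> - x \<in> lspan X"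
  using lspan.scale[of x X "- 1"] by (simp add: scale_minus_one)

lemma lspan_diff: "x \<in> lspan X \<Longrightarrow> y \<in> lspan X \<Longrightarrow> x - y \<in> lspan X"
  using lspan.add[OF _ lspan_uminus, of x X y] by simp

lemma lspan_sum: "(\<And>a. a \<in> A \<Longrightarrow> F a \<in> lspan X) \<Longrightarrow> sum F A \<in> lspan X"
  by (induction A rule: infinite_finite_induct) (auto intro: lspan.zero lspan.add)

lemma lspan_linear:
  assumes "linear_map F" "x \<in> lspan X" "\<And>y. y \<in> X \<Longrightarrow> F y \<in> lspan Y" shows "F x \<in> lspan Y"
  using assms(2) by induction (auto simp: linear_map_add[OF assms(1)] linear_map_scale[OF assms(1)]
      linear_map_zero[OF assms(1)] intro: assms(3) lspan.intros)

text \<open>For \<open>C \<subseteq> D\<close> this is \<open>f\<close> times the image of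
  \<open>e_D\<close> under the odd derivation with \<open>e_g \<mapsto> 1\<close> for
  \<open>g \<in> C\<close> and \<open>e_g \<mapsto> 0\<close> otherwise. For \<open>D = C\<close>
  and \<open>f = 1\<close> it is the boundary.\<close>

definition contraction :: "'a rel \<Rightarrow> 'a set \<Rightarrow> 'a set \<Rightarrow> 'a pol \<Rightarrow> 'a gca" where
  "contraction r C D f = (\<Sum>g\<in>C. scale ((-1) ^ inversions r {g} D) (iota (D - {g}) f))"

text \<open>The element \<open>c_q\<close>, formed for every \<open>q\<close> of the lattice:
  besides atoms, \<open>p\<close> and joins of circuits will be inserted, which lie outside
  \<open>H\<close>.\<close>

definition csum :: "'a gorder \<Rightarrow> 'a set \<Rightarrow> 'a \<Rightarrow> 'a pol" where
  "csum L H q = (\<Sum>h\<in>{h \<in> H. q \<sqsubseteq>\<^bsub>L\<^esub> h}. xm {#h#})"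

text \<open>\<open>nested_circuit_iff\<close> below identifies these with the circuits of the matroids of the iterated blowup.\<close>

definition circuit :: "'a gorder \<Rightarrow> 'a set \<Rightarrow> 'a set \<Rightarrow> bool" where
  "circuit L H C \<longleftrightarrow> lcircuit L C \<and> C \<in> nested L H"

text \<open>Up to sign, \<open>dependent\<close> and \<open>circ\<close> are the products \<open>f e\<^sub>T \<partial>e\<^sub>C\<close> with \<open>D = C \<union> T\<close>, where \<open>T\<close> meets \<open>C\<close>
  in one element or not at all; the product is zero when they meet in more than one element.\<close>

inductive_set rel_gens :: "'a gorder \<Rightarrow> 'a set \<Rightarrow> 'a rel \<Rightarrow> 'a gca set" for L H r where
  non_nested: "S \<subseteq> H \<Longrightarrow> set_mset m \<subseteq> H \<Longrightarrow> f \<in> polys H \<Longrightarrow> S \<union> set_mset m \<notin> nested L H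
    \<Longrightarrow> iota S (xm m * f) \<in> rel_gens L H r"
| dependent: "circuit L H C \<Longrightarrow> C \<subseteq> D \<Longrightarrow> D \<subseteq> H \<Longrightarrow> f \<in> polys H \<Longrightarrow> iota D f \<in> rel_gens L H r"
| circ: "circuit L H C \<Longrightarrow> C \<subseteq> D \<Longrightarrow> D \<subseteq> H \<Longrightarrow> f \<in> polys H \<Longrightarrow> contraction r C D f \<in> rel_gens L H r"
| lin: "g \<in> atoms L \<Longrightarrow> S \<subseteq> H \<Longrightarrow> f \<in> polys H \<Longrightarrow> iota S (csum L H g * f) \<in> rel_gens L H r"

abbreviation rel_span :: "'a gorder \<Rightarrow> 'a set \<Rightarrow> 'a rel \<Rightarrow> 'a gca set" where
  "rel_span L H r \<equiv> lspan (rel_gens L H r)"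

lemma csum_polys [intro]: "csum L H q \<in> polys H"
  unfolding csum_def by (intro polys_sum polys_xm) simp

lemma minus_one_power_even: "even (a + b) \<Longrightarrow> (-1) ^ a = ((-1) ^ b :: rat)"
  by (simp add: minus_one_power_iff)

lemma minus_one_power_odd: "odd (a + b) \<Longrightarrow> (-1) ^ a = - ((-1) ^ b :: rat)"
  by (simp add: minus_one_power_iff)

text \<open>Since \<open>e_g\<close> squares to zero, three cases remain. If \<open>U\<close> and
  \<open>D\<close> are disjoint, \<open>e_U\<close> moves past the derivation. If they share exactly
  one element and it is in \<open>C\<close>, only the summand that has lost this element survives.
  Otherwise nothing does. The second case is the reason for the generators
  \<open>dependent\<close>.\<close>

lemma mul_iota_contraction:
  assumes r: "linear_order_on H r" and fin: "finite H" and UD: "U \<subseteq> H" "D \<subseteq> H" and C: "C \<subseteq> D"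
  shows "U \<inter> D = {} \<Longrightarrow> mul r (iota U k) (contraction r C D f)
      = scale ((-1) ^ (inversions r U D + card U)) (contraction r C (U \<union> D) (k * f))"
    and "U \<inter> D = {x} \<Longrightarrow> x \<in> C \<Longrightarrow> mul r (iota U k) (contraction r C D f)
      = scale ((-1) ^ (inversions r {x} D + inversions r U (D - {x}))) (iota (U \<union> D) (k * f))"
    and "U \<inter> D \<noteq> {} \<Longrightarrow> (\<And>x. x \<in> C \<Longrightarrow> U \<inter> D \<noteq> {x}) \<Longrightarrow> mul r (iota U k) (contraction r C D f) = 0"
proof -
  have finU: "finite U" "finite D" "finite C" 
    using finite_subset[OF UD(1) fin] finite_subset[OF UD(2) fin] finite_subset[OF C] by auto
  have eq: "mul r (iota U k) (contraction r C D f) = (\<Sum>g\<in>C. if U \<inter> (D - {g}) = {} then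
      scale ((-1) ^ (inversions r {g} D + inversions r U (D - {g}))) (iota (U \<union> (D - {g})) (k * f)) else 0)"
    unfolding contraction_def linear_map_sum[OF linear_mul(1)] linear_map_scale[OF linear_mul(1)] mul_iota
    by (intro sum.cong) (simp_all add: scale_scale power_add)
  { assume d: "U \<inter> D = {}"
    show "mul r (iota U k) (contraction r C D f)
      = scale ((-1) ^ (inversions r U D + card U)) (contraction r C (U \<union> D) (k * f))"
      unfolding eq unfolding contraction_def scale_sum scale_scale
    proof (rule sum.cong[OF refl])
      fix g assume g: "g \<in> C"
      have gU: "g \<in> H" "g \<notin> U" "g \<in> D" using g C UD d by auto
      have "inversions r {g} (U \<union> D) = inversions r {g} U + inversions r {g} D"
        by (rule inversions_Un_right) (use finU d in auto)
      moreover have "inversions r U D = inversions r U {g} + inversions r U (D - {g})"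
        by (rule inversions_remove_right[OF finU(1,2) gU(3)])
      moreover have "inversions r U {g} + inversions r {g} U = card U"
        by (rule inversions_swap[OF r]) (use finU UD gU in auto)
      ultimately have "even (inversions r {g} D + inversions r U (D - {g})
          + (inversions r U D + card U + inversions r {g} (U \<union> D)))" by presburger
      then have sg: "(- 1) ^ (inversions r {g} D + inversions r U (D - {g}))
          = ((- 1) ^ (inversions r U D + card U + inversions r {g} (U \<union> D)) :: rat)"
        by (rule minus_one_power_even)
      moreover have "U \<inter> (D - {g}) = {}" "U \<union> (D - {g}) = U \<union> D - {g}" using d gU by auto
      ultimately show "(if U \<inter> (D - {g}) = {} then
          scale ((-1) ^ (inversions r {g} D + inversions r U (D - {g}))) (iota (U \<union> (D - {g})) (k * f)) else 0)
        = scale ((- 1) ^ (inversions r U D + card U) * (- 1) ^ inversions r {g} (U \<union> D))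
           (iota (U \<union> D - {g}) (k * f))" by (simp add: power_add)
    qed }
  { assume d: "U \<inter> D = {x}" "x \<in> C"
    have "(\<Sum>g\<in>C. if U \<inter> (D - {g}) = {} then
      scale ((-1) ^ (inversions r {g} D + inversions r U (D - {g}))) (iota (U \<union> (D - {g})) (k * f)) else 0)
      = (\<Sum>g\<in>C. if g = x then scale ((-1) ^ (inversions r {x} D + inversions r U (D - {x}))) (iota (U \<union> D) (k * f)) else 0)"
    proof (rule sum.cong[OF refl])
      fix g assume "g \<in> C"
      have "U \<inter> (D - {g}) = {} \<longleftrightarrow> g = x" using d(1) by blast
      moreover have "U \<union> (D - {x}) = U \<union> D" using d(1) by blast
      ultimately show "(if U \<inter> (D - {g}) = {} then
        scale ((-1) ^ (inversions r {g} D + inversions r U (D - {g}))) (iota (U \<union> (D - {g})) (k * f)) else 0)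
        = (if g = x then scale ((-1) ^ (inversions r {x} D + inversions r U (D - {x}))) (iota (U \<union> D) (k * f)) else 0)"
        by simp
    qed
    then show "mul r (iota U k) (contraction r C D f)
      = scale ((-1) ^ (inversions r {x} D + inversions r U (D - {x}))) (iota (U \<union> D) (k * f))"
      unfolding eq using d finU by simp }
  { assume d: "U \<inter> D \<noteq> {}" "\<And>x. x \<in> C \<Longrightarrow> U \<inter> D \<noteq> {x}"
    have "U \<inter> (D - {g}) \<noteq> {}" if "g \<in> C" for g using d(1) d(2)[OF that] by blast
    then show "mul r (iota U k) (contraction r C D f) = 0" unfolding eq by simp }
qed

lemma mul_contraction_iota:
  assumes fin: "finite H" and UD: "U \<subseteq> H" "D \<subseteq> H" and C: "C \<subseteq> D"
  shows "D \<inter> U = {} \<Longrightarrow> mul r (contraction r C D f) (iota U k)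
      = scale ((-1) ^ inversions r D U) (contraction r C (D \<union> U) (f * k))"
    and "D \<inter> U = {x} \<Longrightarrow> x \<in> C \<Longrightarrow> mul r (contraction r C D f) (iota U k)
      = scale ((-1) ^ (inversions r {x} D + inversions r (D - {x}) U)) (iota (D \<union> U) (f * k))"
    and "D \<inter> U \<noteq> {} \<Longrightarrow> (\<And>x. x \<in> C \<Longrightarrow> D \<inter> U \<noteq> {x}) \<Longrightarrow> mul r (contraction r C D f) (iota U k) = 0"
proof -
  have finU: "finite U" "finite D" "finite C" 
    using finite_subset[OF UD(1) fin] finite_subset[OF UD(2) fin] finite_subset[OF C] by auto
  have eq: "mul r (contraction r C D f) (iota U k) = (\<Sum>g\<in>C. if (D - {g}) \<inter> U = {} then
      scale ((-1) ^ (inversions r {g} D + inversions r (D - {g}) U)) (iota ((D - {g}) \<union> U) (f * k)) else 0)"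
    unfolding contraction_def linear_map_sum[OF linear_mul(2)] linear_map_scale[OF linear_mul(2)] mul_iota
    by (intro sum.cong) (simp_all add: scale_scale power_add)
  { assume d: "D \<inter> U = {}"
    show "mul r (contraction r C D f) (iota U k)
      = scale ((-1) ^ inversions r D U) (contraction r C (D \<union> U) (f * k))"
      unfolding eq unfolding contraction_def scale_sum scale_scale
    proof (rule sum.cong[OF refl])
      fix g assume g: "g \<in> C"
      have gU: "g \<notin> U" "g \<in> D" using g C UD d by auto
      have "inversions r {g} (D \<union> U) = inversions r {g} D + inversions r {g} U"
        by (rule inversions_Un_right) (use finU d in auto)
      moreover have "inversions r D U = inversions r {g} U + inversions r (D - {g}) U"
        by (rule inversions_remove_left[OF finU(2,1) gU(2)])
      ultimately have "even (inversions r {g} D + inversions r (D - {g}) U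
          + (inversions r D U + inversions r {g} (D \<union> U)))" by presburger
      then have sg: "(- 1) ^ (inversions r {g} D + inversions r (D - {g}) U)
          = ((- 1) ^ (inversions r D U + inversions r {g} (D \<union> U)) :: rat)"
        by (rule minus_one_power_even)
      moreover have "(D - {g}) \<inter> U = {}" "(D - {g}) \<union> U = D \<union> U - {g}" using d gU by auto
      ultimately show "(if (D - {g}) \<inter> U = {} then
          scale ((-1) ^ (inversions r {g} D + inversions r (D - {g}) U)) (iota ((D - {g}) \<union> U) (f * k)) else 0)
        = scale ((- 1) ^ inversions r D U * (- 1) ^ inversions r {g} (D \<union> U))
           (iota (D \<union> U - {g}) (f * k))" by (simp add: power_add)
    qed }
  { assume d: "D \<inter> U = {x}" "x \<in> C"
    have "(\<Sum>g\<in>C. if (D - {g}) \<inter> U = {} then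
      scale ((-1) ^ (inversions r {g} D + inversions r (D - {g}) U)) (iota ((D - {g}) \<union> U) (f * k)) else 0)
      = (\<Sum>g\<in>C. if g = x then scale ((-1) ^ (inversions r {x} D + inversions r (D - {x}) U)) (iota (D \<union> U) (f * k)) else 0)"
    proof (rule sum.cong[OF refl])
      fix g assume "g \<in> C"
      have "(D - {g}) \<inter> U = {} \<longleftrightarrow> g = x" using d(1) by blast
      moreover have "(D - {x}) \<union> U = D \<union> U" using d(1) by blast
      ultimately show "(if (D - {g}) \<inter> U = {} then
        scale ((-1) ^ (inversions r {g} D + inversions r (D - {g}) U)) (iota ((D - {g}) \<union> U) (f * k)) else 0)
        = (if g = x then scale ((-1) ^ (inversions r {x} D + inversions r (D - {x}) U)) (iota (D \<union> U) (f * k)) else 0)"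
        by simp
    qed
    then show "mul r (contraction r C D f) (iota U k)
      = scale ((-1) ^ (inversions r {x} D + inversions r (D - {x}) U)) (iota (D \<union> U) (f * k))"
      unfolding eq using d finU by simp }
  { assume d: "D \<inter> U \<noteq> {}" "\<And>x. x \<in> C \<Longrightarrow> D \<inter> U \<noteq> {x}"
    have "(D - {g}) \<inter> U \<noteq> {}" if "g \<in> C" for g using d(1) d(2)[OF that] by blast
    then show "mul r (contraction r C D f) (iota U k) = 0" unfolding eq by simp }
qed

text \<open>The generators already carry arbitrary polynomial factors and index sets, so multiplying
  one by a monomial gives a generator up to sign, or zero.\<close>

lemma rel_span_mul_left:
  assumes r: "linear_order_on H r" and fin: "finite H"
    and u: "u \<in> carrier (free_gca H r)" and w: "w \<in> rel_span L H r"
  shows "mul r u w \<in> rel_span L H r"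
  using u
proof (induction rule: carrier_induct)
  case (mono U n)
  note n = polys_xm[OF mono(3)]
  show ?case
  proof (rule lspan_linear[OF linear_mul(1) w])
    fix y assume "y \<in> rel_gens L H r"
    then show "mul r (iota U (xm n)) y \<in> rel_span L H r"
    proof cases
      case (non_nested S m f)
      have eq: "xm n * (xm m * f) = xm m * (xm n * f)" by (simp add: ac_simps)
      have mem: "iota (U \<union> S) (xm m * (xm n * f)) \<in> rel_gens L H r"
        by (rule rel_gens.non_nested) (use non_nested mono n not_nested_mono[of "S \<union> set_mset m" L H "U \<union> S \<union> set_mset m"] in auto)
      show ?thesis unfolding non_nested(1) mul_iota eq
        using mem by (simp add: lspan.base lspan.scale lspan.zero)
    next
      case (dependent C D f)
      have "iota (U \<union> D) (xm n * f) \<in> rel_gens L H r"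
        by (rule rel_gens.dependent) (use dependent mono n in auto)
      then show ?thesis using dependent by (auto simp: mul_iota intro: lspan.intros)
    next
      case (circ C D f)
      note * = mul_iota_contraction[OF r fin mono(2) \<open>D \<subseteq> H\<close> \<open>C \<subseteq> D\<close>, where k = "xm n" and f = f]
      consider "U \<inter> D = {}" | x where "U \<inter> D = {x}" "x \<in> C" | "U \<inter> D \<noteq> {}" "\<And>x. x \<in> C \<Longrightarrow> U \<inter> D \<noteq> {x}"
        by blast
      then show ?thesis
      proof cases
        case 1
        have "contraction r C (U \<union> D) (xm n * f) \<in> rel_gens L H r"
          by (rule rel_gens.circ) (use circ mono n in auto)
        then show ?thesis using *(1)[OF 1] circ by (auto intro: lspan.intros)
      next
        case 2
        have "iota (U \<union> D) (xm n * f) \<in> rel_gens L H r"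
          by (rule rel_gens.dependent) (use circ mono n in auto)
        then show ?thesis using *(2)[OF 2] circ by (auto intro: lspan.intros)
      next
        case 3
        then show ?thesis using *(3) circ by (auto intro: lspan.intros)
      qed
    next
      case (lin g S f)
      have eq: "xm n * (csum L H g * f) = csum L H g * (xm n * f)" by (simp add: ac_simps)
      have mem: "iota (U \<union> S) (csum L H g * (xm n * f)) \<in> rel_gens L H r"
        by (rule rel_gens.lin) (use lin mono n in auto)
      show ?thesis unfolding lin(1) mul_iota eq
        using mem by (simp add: lspan.base lspan.scale lspan.zero)
    qed
  qed
qed (auto simp: linear_map_add[OF linear_mul(2)] linear_map_scale[OF linear_mul(2)]
    linear_map_zero[OF linear_mul(2)] intro: lspan.intros)

lemma rel_span_mul_right:
  assumes fin: "finite H" and u: "u \<in> carrier (free_gca H r)" and w: "w \<in> rel_span L H r"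
  shows "mul r w u \<in> rel_span L H r"
  using u
proof (induction rule: carrier_induct)
  case (mono U n)
  note n = polys_xm[OF mono(3)]
  show ?case
  proof (rule lspan_linear[OF linear_mul(2) w])
    fix y assume "y \<in> rel_gens L H r"
    then show "mul r y (iota U (xm n)) \<in> rel_span L H r"
    proof cases
      case (non_nested S m f)
      have eq: "xm m * f * xm n = xm m * (xm n * f)" by (simp add: ac_simps)
      have mem: "iota (S \<union> U) (xm m * (xm n * f)) \<in> rel_gens L H r"
        by (rule rel_gens.non_nested) (use non_nested mono n not_nested_mono[of "S \<union> set_mset m" L H "S \<union> U \<union> set_mset m"] in auto)
      show ?thesis unfolding non_nested(1) mul_iota eq
        using mem by (simp add: lspan.base lspan.scale lspan.zero)
    next
      case (dependent C D f)
      have "iota (D \<union> U) (f * xm n) \<in> rel_gens L H r"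
        by (rule rel_gens.dependent) (use dependent mono n in auto)
      then show ?thesis using dependent by (auto simp: mul_iota intro: lspan.intros)
    next
      case (circ C D f)
      note * = mul_contraction_iota[OF fin mono(2) \<open>D \<subseteq> H\<close> \<open>C \<subseteq> D\<close>, where k = "xm n" and f = f and r = r]
      consider "D \<inter> U = {}" | x where "D \<inter> U = {x}" "x \<in> C" | "D \<inter> U \<noteq> {}" "\<And>x. x \<in> C \<Longrightarrow> D \<inter> U \<noteq> {x}"
        by blast
      then show ?thesis
      proof cases
        case 1
        have "contraction r C (D \<union> U) (f * xm n) \<in> rel_gens L H r"
          by (rule rel_gens.circ) (use circ mono n in auto)
        then show ?thesis using *(1)[OF 1] circ by (auto intro: lspan.intros)
      next
        case 2
        have "iota (D \<union> U) (f * xm n) \<in> rel_gens L H r"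
          by (rule rel_gens.dependent) (use circ mono n in auto)
        then show ?thesis using *(2)[OF 2] circ by (auto intro: lspan.intros)
      next
        case 3
        then show ?thesis using *(3) circ by (auto intro: lspan.intros)
      qed
    next
      case (lin g S f)
      have eq: "csum L H g * f * xm n = csum L H g * (f * xm n)" by (simp add: ac_simps)
      have mem: "iota (S \<union> U) (csum L H g * (f * xm n)) \<in> rel_gens L H r"
        by (rule rel_gens.lin) (use lin mono n in auto)
      show ?thesis unfolding lin(1) mul_iota eq
        using mem by (simp add: lspan.base lspan.scale lspan.zero)
    qed
  qed
qed (auto simp: linear_map_add[OF linear_mul(1)] linear_map_scale[OF linear_mul(1)]
    linear_map_zero[OF linear_mul(1)] intro: lspan.intros)

lemma contraction_carrier:
  assumes "finite H" "D \<subseteq> H" "f \<in> polys H" shows "contraction r C D f \<in> carrier (free_gca H r)"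
  unfolding contraction_def
proof (induction C rule: infinite_finite_induct)
  case (insert g C)
  have "iota (D - {g}) f \<in> carrier (free_gca H r)"
    using assms finite_subset[of "D - {g}" H] by (intro iota_in_carrier) auto
  then show ?case using insert by (auto intro: carrier_add carrier_scale)
qed (simp_all add: carrier_zero)

lemma rel_span_carrier: "finite H \<Longrightarrow> w \<in> rel_span L H r \<Longrightarrow> w \<in> carrier (free_gca H r)"
proof -
  assume fin: "finite H"
  have gens: "y \<in> carrier (free_gca H r)" if "y \<in> rel_gens L H r" for y
    using that by cases (use fin finite_subset[OF _ fin] in \<open>auto intro!: iota_in_carrier contraction_carrier\<close>)
  assume "w \<in> rel_span L H r"
  from this gens show ?thesis
    by (induction rule: lspan.induct) (auto intro: carrier_add carrier_scale carrier_zero)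
qed

lemma ideal_rel_span:
  assumes r: "linear_order_on H r" and fin: "finite H"
  shows "ideal (rel_span L H r) (free_gca H r)"
proof (rule idealI[OF ring_free_gca])
  interpret ring "free_gca H r" by (rule ring_free_gca)
  show "subgroup (rel_span L H r) (add_monoid (free_gca H r))"
  proof (rule subgroup.intro)
    show "inv\<^bsub>add_monoid (free_gca H r)\<^esub> x \<in> rel_span L H r" if x: "x \<in> rel_span L H r" for x
    proof -
      have "- x \<in> rel_span L H r" by (rule lspan_uminus[OF x])
      moreover have "\<ominus>\<^bsub>free_gca H r\<^esub> x = - x"
        by (rule minus_equality) (use x calculation rel_span_carrier[OF fin] in auto)
      ultimately show ?thesis by (simp add: a_inv_def)
    qed
  qed (use rel_span_carrier[OF fin] in \<open>auto intro: lspan.intros simp: lspan.zero\<close>)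
qed (use rel_span_mul_left[OF r fin] rel_span_mul_right[OF fin] in auto)

lemma x_gen_iota: "x_gen g = iota {} (xm {#g#})" and e_gen_iota: "e_gen g = iota {g} 1"
  using iota_xm[of "{g}" "{#}"] by (simp_all add: x_gen_def e_gen_def iota_xm)

lemma boundary_contraction: "boundary r C = contraction r C C 1"
  by (simp add: boundary_def contraction_def flip: iota_xm)

lemma rel_ideal_eq:
  assumes r: "linear_order_on H r" and fin: "finite H"
    and circ: "\<And>S. nested_circuit L H ps S \<longleftrightarrow> circuit L H S"
  shows "rel_ideal L H ps r = rel_span L H r"
proof
  let ?R = "free_gca H r"
  interpret R: ring ?R by (rule ring_free_gca)
  have circH: "C \<subseteq> H" "C \<subseteq> atoms L" "C \<noteq> {}" if "circuit L H C" for C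
    using that by (auto simp: circuit_def nested_def lcircuit_def)
  have sub: "relators L H ps r \<subseteq> rel_span L H r"
  proof
    fix y assume "y \<in> relators L H ps r"
    then consider S T where "y = monom_ex S (mset_set T)" "S \<subseteq> H" "T \<subseteq> H" "S \<union> T \<notin> nested L H"
      | S where "y = boundary r S" "circuit L H S"
      | g where "y = (\<Sum>h\<in>{h \<in> H. g \<sqsubseteq>\<^bsub>L\<^esub> h}. x_gen h)" "g \<in> atoms L"
      unfolding relators_def circ by blast
    then show "y \<in> rel_span L H r"
    proof cases
      case 1
      have "finite T" using 1 fin finite_subset by blast
      then have "iota S (xm (mset_set T) * 1) \<in> rel_gens L H r"
        using 1 by (intro rel_gens.non_nested) auto
      then show ?thesis using 1 by (simp add: iota_xm lspan.base)
    next
      case 2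
      then show ?thesis unfolding 2 boundary_contraction using circH
        by (intro lspan.base rel_gens.circ) auto
    next
      case 3
      then have "iota {} (csum L H g * 1) \<in> rel_gens L H r" by (intro rel_gens.lin) auto
      then show ?thesis using 3 by (simp add: csum_def iota_simps x_gen_iota lspan.base)
    qed
  qed
  then show "rel_ideal L H ps r \<subseteq> rel_span L H r"
    unfolding rel_ideal_def by (intro R.genideal_minimal ideal_rel_span r fin)
  have relc: "relators L H ps r \<subseteq> carrier ?R" using sub rel_span_carrier[OF fin] by blast
  interpret I: ideal "rel_ideal L H ps r" ?R
    unfolding rel_ideal_def by (rule R.genideal_ideal[OF relc])
  have rel: "y \<in> rel_ideal L H ps r" if "y \<in> relators L H ps r" for y
    using that R.genideal_self[OF relc] by (auto simp: rel_ideal_def)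
  have add: "x + y \<in> rel_ideal L H ps r" if "x \<in> rel_ideal L H ps r" "y \<in> rel_ideal L H ps r" for x y
    using I.a_closed[OF that] by simp
  have mulI: "mul r u x \<in> rel_ideal L H ps r" "mul r x u \<in> rel_ideal L H ps r"
    if "x \<in> rel_ideal L H ps r" "u \<in> carrier ?R" for x u
    using I.I_l_closed[OF that] I.I_r_closed[OF that] by simp_all
  have zero: "0 \<in> rel_ideal L H ps r" using I.zero_closed by simp
  \<comment> \<open>An ideal of the ring is closed under scalars because a scalar acts as
    multiplication by a constant polynomial.\<close>
  have sc: "scale c x \<in> rel_ideal L H ps r" if x: "x \<in> rel_ideal L H ps r" for c x
  proof -
    have "mul r (iota {} (scale c 1)) x = scale c (mul r (iota {} 1) x)"
      by (simp add: iota_simps linear_map_scale[OF linear_mul(2)])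
    moreover have "mul r (iota {} 1) x = x" using R.l_one[of x] I.a_subset x by auto
    ultimately show ?thesis using mulI(1)[OF x, of "iota {} (scale c 1)"]
      by (auto intro: iota_in_carrier)
  qed
  have sc': "scale ((-1) ^ n) x \<in> rel_ideal L H ps r \<Longrightarrow> x \<in> rel_ideal L H ps r" for n x
    using sc[of "scale ((-1) ^ n) x" "(-1) ^ n"] by (simp add: scale_scale flip: power_add mult_2)
  have iotac: "iota S f \<in> carrier ?R" if "S \<subseteq> H" "f \<in> polys H" for S f
    using that finite_subset[OF _ fin] by (intro iota_in_carrier) auto
  have cc: "contraction r C D f \<in> rel_ideal L H ps r"
    if C: "circuit L H C" "C \<subseteq> D" "D \<subseteq> H" "f \<in> polys H" for C D f
  proof -
    have "boundary r C \<in> rel_ideal L H ps r" by (rule rel) (use C circ in \<open>auto simp: relators_def\<close>)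
    then have "mul r (iota (D - C) f) (contraction r C C 1) \<in> rel_ideal L H ps r"
      using C by (intro mulI iotac) (auto simp: boundary_contraction)
    moreover have "mul r (iota (D - C) f) (contraction r C C 1)
      = scale ((-1) ^ (inversions r (D - C) C + card (D - C))) (contraction r C (D - C \<union> C) (f * 1))"
      by (rule mul_iota_contraction[OF r fin]) (use C circH in auto)
    moreover have "D - C \<union> C = D" using C by auto
    ultimately show ?thesis using sc' by simp
  qed
  show "rel_span L H r \<subseteq> rel_ideal L H ps r"
  proof
    fix w assume "w \<in> rel_span L H r"
    then show "w \<in> rel_ideal L H ps r"
    proof induction
      case (base y)
      then show ?case
      proof cases
        case (non_nested S m f)
        let ?T = "set_mset m"
        \<comment> \<open>Only squarefree products \<open>x_T\<close> occur among the given
          relations; the remaining factors of \<open>m\<close> are multiplied on.\<close>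
        have m: "m = mset_set ?T + (m - mset_set ?T)" by (simp add: mset_set_set_mset_msubset)
        have "monom_ex S (mset_set ?T) \<in> rel_ideal L H ps r"
          by (rule rel) (use non_nested in \<open>auto simp: relators_def\<close>)
        moreover have "iota {} (xm (m - mset_set ?T) * f) \<in> carrier ?R"
          using non_nested by (intro iotac polys_mult polys_xm) (auto dest: in_diffD)
        ultimately have "mul r (iota S (xm (mset_set ?T))) (iota {} (xm (m - mset_set ?T) * f)) \<in> rel_ideal L H ps r"
          by (intro mulI) (simp_all add: iota_xm)
        moreover have "xm (mset_set ?T) * (xm (m - mset_set ?T) * f) = xm m * f"
          using xm_add[of "mset_set ?T" "m - mset_set ?T"] m by (simp add: mult.assoc[symmetric])
        ultimately show ?thesis using non_nested by (simp add: mul_iota)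
      next
        case (dependent C D f)
        then obtain g where g: "g \<in> C" using circH by blast
        \<comment> \<open>Multiplication by \<open>e_g\<close> with \<open>g \<in> C\<close> kills
          every summand except the one that has lost \<open>e_g\<close>, which becomes
          \<open>e_D\<close> up to sign.\<close>
        have "mul r (iota {g} 1) (contraction r C D f) \<in> rel_ideal L H ps r"
          using dependent g by (intro mulI cc iotac) auto
        moreover have "mul r (iota {g} 1) (contraction r C D f)
          = scale ((-1) ^ (inversions r {g} D + inversions r {g} (D - {g}))) (iota ({g} \<union> D) (1 * f))"
          by (rule mul_iota_contraction[OF r fin]) (use dependent g in auto)
        moreover have "{g} \<union> D = D" using g dependent by auto
        ultimately show ?thesis using dependent sc' by simp
      next
        case (circ C D f)
        then show ?thesis using cc by simp
      next
        case (lin g S f)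
        have "iota {} (csum L H g) \<in> rel_ideal L H ps r"
          by (rule rel) (use lin in \<open>auto simp: relators_def csum_def iota_simps x_gen_iota\<close>)
        then have "mul r (iota {} (csum L H g)) (iota S f) \<in> rel_ideal L H ps r"
          using lin by (intro mulI iotac)
        then show ?thesis using lin by (simp add: mul_iota)
      qed
    qed (auto intro: add sc zero)
  qed
qed

text \<open>Deleting two elements of \<open>D\<close> in either order gives opposite signs, as in
  the proof that a boundary has no boundary.\<close>

lemma inversions_remove_swap:
  assumes r: "linear_order_on H r" and D: "finite D" "D \<subseteq> H" and gs: "g \<in> D" "s \<in> D" "g \<noteq> s"
  shows "(-1) ^ inversions r {g} D * (-1) ^ inversions r {s} (D - {g})
    = - ((-1) ^ inversions r {s} D * (-1) ^ inversions r {g} (D - {s}) :: rat)"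
proof -
  have "inversions r {g} D = inversions r {g} {s} + inversions r {g} (D - {s})"
    by (rule inversions_remove_right) (use D gs in auto)
  moreover have "inversions r {s} D = inversions r {s} {g} + inversions r {s} (D - {g})"
    by (rule inversions_remove_right) (use D gs in auto)
  moreover have "inversions r {g} {s} + inversions r {s} {g} = card {g}"
    by (rule inversions_swap[OF r]) (use D gs in auto)
  moreover have "card {g} = 1" by simp
  ultimately have "odd (inversions r {g} D + inversions r {s} (D - {g})
      + (inversions r {s} D + inversions r {g} (D - {s})))" by presburger
  then show ?thesis unfolding power_add[symmetric] by (rule minus_one_power_odd)
qed

lemma sum_antisymmetric:
  fixes F :: "'a \<Rightarrow> 'a \<Rightarrow> 'b \<Rightarrow>\<^sub>0 rat"
  assumes "finite C" "\<And>g s. g \<in> C \<Longrightarrow> s \<in> C \<Longrightarrow> g \<noteq> s \<Longrightarrow> F g s = - F s g"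
  shows "(\<Sum>g\<in>C. \<Sum>s\<in>C - {g}. F g s) = 0"
proof -
  have eq: "(\<Sum>s\<in>C - {g}. F g s) = (\<Sum>s\<in>C. if s = g then 0 else F g s)" for g
  proof -
    have "(\<Sum>s\<in>C - {g}. F g s) = (\<Sum>s\<in>C - {g}. if s = g then 0 else F g s)"
      by (rule sum.cong) simp_all
    also have "\<dots> = (\<Sum>s\<in>C. if s = g then 0 else F g s)"
      by (rule sum.mono_neutral_left) (simp_all add: assms(1))
    finally show ?thesis .
  qed
  let ?X = "\<Sum>g\<in>C. \<Sum>s\<in>C. if s = g then 0 else F g s"
  have "?X = (\<Sum>s\<in>C. \<Sum>g\<in>C. if s = g then 0 else F g s)" by (rule sum.swap)
  also have "\<dots> = (\<Sum>s\<in>C. \<Sum>g\<in>C. - (if g = s then 0 else F s g))"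
  proof (intro sum.cong refl)
    fix s g assume "s \<in> C" "g \<in> C"
    then show "(if s = g then 0 else F g s) = - (if g = s then 0 else F s g)"
      using assms(2)[of g s] by (cases "s = g") simp_all
  qed
  also have "\<dots> = - ?X" by (simp add: sum_negf)
  finally have X: "?X = - ?X" .
  have "Poly_Mapping.lookup ?X k = 0" for k
    using arg_cong[OF X, of "\<lambda>f. Poly_Mapping.lookup f k"] unfolding lookup_uminus by linarith
  then have "?X = 0" by (intro poly_mapping_eqI) simp
  then show ?thesis unfolding eq .
qed

context pbs
begin

lemma rel_span_non_nested:
  "S \<subseteq> H \<Longrightarrow> set_mset m \<subseteq> H \<Longrightarrow> f \<in> polys H \<Longrightarrow> S \<union> set_mset m \<notin> nested L H
    \<Longrightarrow> iota S (xm m * f) \<in> rel_span L H r"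
  by (intro lspan.base rel_gens.non_nested)

text \<open>Of the terms of \<open>csum b\<close>, only \<open>x\<^sub>b\<close> and those of \<open>csum q\<close> survive, by \<open>spans_not_nested\<close>.\<close>

lemma rel_span_spanning:
  assumes q: "q \<in> G" "q \<notin> atoms L" and b: "b \<in> atoms L" "b \<sqsubseteq> q"
    and S: "S \<subseteq> H" "set_mset m \<subseteq> H" and sp: "spans q (insert b (S \<union> set_mset m))" and f: "f \<in> polys H"
  shows "iota S (xm m * (xm {#b#} + csum L H q) * f) \<in> rel_span L H r"
proof -
  have qc: "q \<in> carrier L" using q G_closed by simp
  have bH: "b \<in> H" using b atoms_H by auto
  let ?A = "{h \<in> H. b \<sqsubseteq> h}" and ?B = "{h \<in> H. q \<sqsubseteq> h}"
  let ?N = "?A - {b} - ?B"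
  have fin: "finite ?A" "finite ?B" using finite_H by auto
  have BA: "?B \<subseteq> ?A - {b}"
  proof
    fix h assume h: "h \<in> ?B"
    then have hc: "h \<in> carrier L" using H_carrier by auto
    have "b \<sqsubseteq> h" using le_trans[OF b(2), of h] h hc b qc by simp
    moreover have "h \<noteq> b" using h le_atom[OF b(1) qc] q G_not_bottom b by auto
    ultimately show "h \<in> ?A - {b}" using h by simp
  qed
  have "csum L H b = xm {#b#} + (\<Sum>h\<in>?A - {b}. xm {#h#})"
    unfolding csum_def using fin bH b by (subst sum.remove[of _ b]) auto
  also have "(\<Sum>h\<in>?A - {b}. xm {#h#}) = csum L H q + (\<Sum>h\<in>?N. xm {#h#})"
    unfolding csum_def using sum.subset_diff[OF BA, of "\<lambda>h. xm {#h#}"] fin by (simp add: add.commute)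
  finally have "xm m * (xm {#b#} + csum L H q) * f
    = csum L H b * (xm m * f) - (\<Sum>h\<in>?N. xm (add_mset h m) * f)"
    using xm_add[of "{#_#}" m] by (simp add: algebra_simps sum_distrib_left sum_distrib_right)
  then have eq: "iota S (xm m * (xm {#b#} + csum L H q) * f)
    = iota S (csum L H b * (xm m * f)) - (\<Sum>h\<in>?N. iota S (xm (add_mset h m) * f))"
    by (simp only: iota_simps)
  have "iota S (csum L H b * (xm m * f)) \<in> rel_span L H r"
    using b S f by (intro lspan.base rel_gens.lin) auto
  moreover have "(\<Sum>h\<in>?N. iota S (xm (add_mset h m) * f)) \<in> rel_span L H r"
  proof (intro lspan_sum rel_span_non_nested S f)
    fix h assume h: "h \<in> ?N"
    then show "set_mset (add_mset h m) \<subseteq> H" using S by auto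
    have "insert h (S \<union> set_mset m) \<notin> nested L H"
      using h b by (intro spans_not_nested[OF q(1) b sp]) auto
    then show "S \<union> set_mset (add_mset h m) \<notin> nested L H" by simp
  qed
  ultimately show ?thesis unfolding eq by (rule lspan_diff)
qed

lemma circuitD:
  assumes "circuit L H C"
  shows "lcircuit L C" "C \<in> nested L H" "C \<subseteq> H" "C \<subseteq> atoms L" "finite C" "\<Squnion>C \<in> G" "\<Squnion>C \<notin> H" "\<Squnion>C \<notin> atoms L"
proof -
  show l: "lcircuit L C" "C \<in> nested L H" using assms by (simp_all add: circuit_def)
  show "C \<subseteq> atoms L" "finite C" "\<Squnion>C \<in> G" "\<Squnion>C \<notin> H"
    using l lcircuit_atoms lcircuit_card lcircuit_Sup_G lcircuit_Sup_notin by blast+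
  then show "C \<subseteq> H" "\<Squnion>C \<notin> atoms L" using atoms_H by auto
qed

text \<open>A circuit without one member still spans its join. So next to an \<open>e_S\<close> that
  contains all of \<open>C\<close> except \<open>b\<close> and possibly one further member,
  \<open>x_b\<close> equals \<open>- c_q\<close> with \<open>q = \<Squnion>C\<close>, a value
  independent of \<open>b\<close>.\<close>

lemma rel_span_circuit:
  assumes C: "circuit L H C" and b: "b \<in> C" and S: "S \<subseteq> H" "C - {g} \<subseteq> insert b S" and f: "f \<in> polys H"
  shows "iota S ((xm {#b#} + csum L H (\<Squnion>C)) * f) \<in> rel_span L H r"
proof -
  note c = circuitD[OF C]
  have "spans (\<Squnion>C) (insert b (S \<union> set_mset {#}))" using lcircuit_spans[OF c(1) S(2)] by simp
  moreover have "b \<sqsubseteq> \<Squnion>C" using b lcircuit_carrier[OF c(1)] by auto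
  ultimately show ?thesis
    using rel_span_spanning[OF c(6,8), of b S "{#}" f r] b c S f by auto
qed

lemma contraction_circuit_rel_span:
  "circuit L H C \<Longrightarrow> C \<subseteq> D \<Longrightarrow> D \<subseteq> H \<Longrightarrow> f \<in> polys H \<Longrightarrow> contraction r C D f \<in> rel_span L H r"
  by (intro lspan.base rel_gens.circ)

lemma dependent_rel_span:
  "circuit L H C \<Longrightarrow> C \<subseteq> D \<Longrightarrow> D \<subseteq> H \<Longrightarrow> f \<in> polys H \<Longrightarrow> iota D f \<in> rel_span L H r"
  by (intro lspan.base rel_gens.dependent)

text \<open>The differential of \<open>\<partial>e_C\<close> is a double sum over pairs of members
  of \<open>C\<close> with factors \<open>x_s\<close>. By \<open>rel_span_circuit\<close> all these
  factors may be replaced by the same \<open>- c_q\<close> with \<open>q = \<Squnion>C\<close>,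
  after which the double sum is antisymmetric.\<close>

lemma dif_rel_span:
  assumes r: "linear_order_on H r" and w: "w \<in> rel_span L H r"
  shows "dif r w \<in> rel_span L H r"
proof (rule lspan_linear[OF linear_dif w])
  let ?x = "\<lambda>g. xm {#g#}"
  have xH: "?x g \<in> polys H" if "g \<in> H" for g using that by auto
  have xm_split: "?x g * (xm m * f) = xm (add_mset g m) * f" for g m f
    using xm_add[of "{#g#}" m] by (simp add: mult.assoc)
  fix y assume "y \<in> rel_gens L H r"
  then show "dif r y \<in> rel_span L H r"
  proof cases
    case (non_nested S m f)
    show ?thesis unfolding non_nested(1) dif_iota xm_split
    proof (intro lspan_sum lspan.scale rel_span_non_nested)
      fix g assume g: "g \<in> S"
      have "S - {g} \<union> set_mset (add_mset g m) = S \<union> set_mset m" using g by auto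
      then show "S - {g} \<union> set_mset (add_mset g m) \<notin> nested L H" using non_nested by simp
    qed (use non_nested in auto)
  next
    case (lin g S f)
    show ?thesis unfolding lin(1) dif_iota
    proof (intro lspan_sum lspan.scale)
      fix s assume s: "s \<in> S"
      have eq: "?x s * (csum L H g * f) = csum L H g * (?x s * f)" by (simp add: ac_simps)
      have "iota (S - {s}) (csum L H g * (?x s * f)) \<in> rel_span L H r"
        using lin s by (intro lspan.base rel_gens.lin polys_mult xH) auto
      then show "iota (S - {s}) (?x s * (csum L H g * f)) \<in> rel_span L H r" unfolding eq .
    qed
  next
    case (dependent C D f)
    note c = circuitD[OF dependent(2)]
    let ?q = "csum L H (\<Squnion>C)" and ?sg = "\<lambda>g. (-1) ^ inversions r {g} D :: rat"
    have finD: "finite D" using finite_subset[OF dependent(4) finite_H] .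
    have "dif r y = (\<Sum>g\<in>C. scale (?sg g) (iota (D - {g}) (?x g * f)))
        + (\<Sum>g\<in>D - C. scale (?sg g) (iota (D - {g}) (?x g * f)))"
      unfolding dependent(1) dif_iota using sum.subset_diff[OF dependent(3) finD] by (simp add: add.commute)
    \<comment> \<open>Adding and subtracting \<open>c_q\<close> for \<open>q = \<Squnion>C\<close>
      splits off a multiple of the contraction along \<open>C\<close>.\<close>
    also have "(\<Sum>g\<in>C. scale (?sg g) (iota (D - {g}) (?x g * f)))
        = (\<Sum>g\<in>C. scale (?sg g) (iota (D - {g}) ((?x g + ?q) * f))) - contraction r C D (?q * f)"
      unfolding contraction_def by (simp add: distrib_right iota_simps scale_add sum.distrib)
    finally have eq: "dif r y = (\<Sum>g\<in>C. scale (?sg g) (iota (D - {g}) ((?x g + ?q) * f)))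
        - contraction r C D (?q * f) + (\<Sum>g\<in>D - C. scale (?sg g) (iota (D - {g}) (?x g * f)))" .
    have "(\<Sum>g\<in>C. scale (?sg g) (iota (D - {g}) ((?x g + ?q) * f))) \<in> rel_span L H r"
      using dependent by (intro lspan_sum lspan.scale rel_span_circuit[OF dependent(2)]) auto
    moreover have "contraction r C D (?q * f) \<in> rel_span L H r"
      using dependent by (intro contraction_circuit_rel_span) auto
    moreover have "(\<Sum>g\<in>D - C. scale (?sg g) (iota (D - {g}) (?x g * f))) \<in> rel_span L H r"
      using dependent by (intro lspan_sum lspan.scale dependent_rel_span[OF dependent(2)] polys_mult xH) auto
    ultimately show ?thesis unfolding eq by (intro lspan.add lspan_diff)
  next
    case (circ C D f)
    note c = circuitD[OF circ(2)]
    let ?q = "csum L H (\<Squnion>C)"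
    let ?sg = "\<lambda>g s. (-1) ^ inversions r {g} D * (-1) ^ inversions r {s} (D - {g}) :: rat"
    have finD: "finite D" using finite_subset[OF circ(4) finite_H] .
    have sw: "?sg g s = - ?sg s g" if "g \<in> D" "s \<in> D" "g \<noteq> s" for g s
      by (rule inversions_remove_swap[OF r finD circ(4) that])
    let ?F = "\<lambda>g s f. scale (?sg g s) (iota (D - {g} - {s}) f)"
    have "dif r y = (\<Sum>g\<in>C. \<Sum>s\<in>D - {g}. ?F g s (?x s * f))"
      unfolding circ(1) contraction_def
      by (simp add: linear_map_sum[OF linear_dif] linear_map_scale[OF linear_dif] dif_iota scale_sum scale_scale)
    also have "\<dots> = (\<Sum>g\<in>C. (\<Sum>s\<in>C - {g}. ?F g s (?x s * f)) + (\<Sum>s\<in>D - C. ?F g s (?x s * f)))"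
    proof (rule sum.cong[OF refl])
      fix g assume g: "g \<in> C"
      have "C - {g} \<subseteq> D - {g}" "D - {g} - (C - {g}) = D - C" using circ g by auto
      then show "(\<Sum>s\<in>D - {g}. ?F g s (?x s * f))
          = (\<Sum>s\<in>C - {g}. ?F g s (?x s * f)) + (\<Sum>s\<in>D - C. ?F g s (?x s * f))"
        using sum.subset_diff[of "C - {g}" "D - {g}"] finD by (simp add: add.commute)
    qed
    also have "\<dots> = (\<Sum>g\<in>C. \<Sum>s\<in>C - {g}. ?F g s (?x s * f)) + (\<Sum>g\<in>C. \<Sum>s\<in>D - C. ?F g s (?x s * f))"
      by (rule sum.distrib)
    also have "(\<Sum>g\<in>C. \<Sum>s\<in>C - {g}. ?F g s (?x s * f))
        = (\<Sum>g\<in>C. \<Sum>s\<in>C - {g}. ?F g s ((?x s + ?q) * f)) - (\<Sum>g\<in>C. \<Sum>s\<in>C - {g}. ?F g s (?q * f))"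
      by (simp add: distrib_right iota_simps scale_add sum.distrib)
    \<comment> \<open>Once the polynomial factors agree, exchanging \<open>g\<close> and
      \<open>s\<close> changes only the sign.\<close>
    also have "(\<Sum>g\<in>C. \<Sum>s\<in>C - {g}. ?F g s (?q * f)) = 0"
    proof (rule sum_antisymmetric[OF c(5)])
      fix g s assume gs: "g \<in> C" "s \<in> C" "g \<noteq> s"
      have eq: "D - {g} - {s} = D - {s} - {g}" by auto
      have D: "g \<in> D" "s \<in> D" using gs circ by auto
      show "?F g s (?q * f) = - ?F s g (?q * f)"
        unfolding sw[OF D gs(3)] scale_uminus eq ..
    qed
    also have "(\<Sum>g\<in>C. \<Sum>s\<in>D - C. ?F g s (?x s * f)) = (\<Sum>s\<in>D - C. \<Sum>g\<in>C. ?F g s (?x s * f))"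
      by (rule sum.swap)
    \<comment> \<open>For fixed \<open>s\<close> outside the circuit, the sum over \<open>g\<close>
      is again a contraction along \<open>C\<close>, now in \<open>D - {s}\<close>. The minus sign
      comes from removing \<open>s\<close> before \<open>g\<close>.\<close>
    also have "\<dots> = (\<Sum>s\<in>D - C. scale (- ((-1) ^ inversions r {s} D)) (contraction r C (D - {s}) (?x s * f)))"
    proof (rule sum.cong[OF refl])
      fix s assume s: "s \<in> D - C"
      have "?F g s (?x s * f) = scale (- ((-1) ^ inversions r {s} D))
          (scale ((-1) ^ inversions r {g} (D - {s})) (iota (D - {s} - {g}) (?x s * f)))" if g: "g \<in> C" for g
      proof -
        have eq: "D - {g} - {s} = D - {s} - {g}" by auto
        have D: "g \<in> D" "s \<in> D" "g \<noteq> s" using g s circ by auto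
        show ?thesis unfolding sw[OF D] eq scale_scale by simp
      qed
      then show "(\<Sum>g\<in>C. ?F g s (?x s * f))
          = scale (- ((-1) ^ inversions r {s} D)) (contraction r C (D - {s}) (?x s * f))"
        unfolding contraction_def scale_sum by (intro sum.cong refl)
    qed
    finally have eq: "dif r y = (\<Sum>g\<in>C. \<Sum>s\<in>C - {g}. ?F g s ((?x s + ?q) * f)) - 0
      + (\<Sum>s\<in>D - C. scale (- ((-1) ^ inversions r {s} D)) (contraction r C (D - {s}) (?x s * f)))" .
    have "?F g s ((?x s + ?q) * f) \<in> rel_span L H r" if "g \<in> C" "s \<in> C - {g}" for g s
      using that circ by (intro lspan.scale rel_span_circuit[OF circ(2), of _ _ g]) auto
    then have "(\<Sum>g\<in>C. \<Sum>s\<in>C - {g}. ?F g s ((?x s + ?q) * f)) \<in> rel_span L H r"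
      by (intro lspan_sum)
    moreover have "(\<Sum>s\<in>D - C. scale (- ((-1) ^ inversions r {s} D)) (contraction r C (D - {s}) (?x s * f))) \<in> rel_span L H r"
      using circ by (intro lspan_sum lspan.scale contraction_circuit_rel_span polys_mult xH) auto
    ultimately show ?thesis unfolding eq by (auto intro: lspan.add)
  qed
qed

end

section \<open>The substitution\<close>

definition subst :: "('a \<Rightarrow> 'a pol) \<Rightarrow> 'a pol \<Rightarrow> 'a pol" where
  "subst \<theta> = lin_ext (\<lambda>m. \<Prod>g\<in>#m. \<theta> g)"

lemma linear_subst: "linear_map (subst \<theta>)"
  unfolding subst_def by (rule linear_lin_ext)

lemmas subst_simps = linear_map_add[OF linear_subst] linear_map_scale[OF linear_subst]
  linear_map_zero[OF linear_subst] linear_map_uminus[OF linear_subst] linear_map_diff[OF linear_subst]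
  linear_map_sum[OF linear_subst]

lemma subst_xm: "subst \<theta> (xm m) = (\<Prod>g\<in>#m. \<theta> g)"
  by (simp add: subst_def xm_def lin_ext_def)

lemma subst_var [simp]: "subst \<theta> (xm {#g#}) = \<theta> g"
  by (simp add: subst_xm)

lemma subst_one [simp]: "subst \<theta> 1 = 1"
  using subst_xm[of \<theta> "{#}"] by simp

lemma subst_mult: "subst \<theta> (f * g) = subst \<theta> f * subst \<theta> g"
proof (induction f rule: pol_induct)
  case (xm m)
  show ?case
  proof (induction g rule: pol_induct)
    case (xm n)
    show ?case by (simp add: subst_xm flip: xm_add)
  qed (simp_all add: subst_simps scale_mult_right distrib_left)
qed (simp_all add: subst_simps scale_mult_left distrib_right)

lemma subst_polys:
  assumes "f \<in> polys H" "\<And>h. h \<in> H \<Longrightarrow> \<theta> h \<in> polys K" shows "subst \<theta> f \<in> polys K"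
  using assms(1)
proof (induction rule: polys_induct)
  case (xm m)
  then show ?case
  proof (induction m)
    case (add g m)
    then show ?case using assms(2) by (auto simp: subst_xm intro!: polys_mult)
  qed (simp add: subst_xm)
qed (auto simp: subst_simps)

lemma parity_aux:
  fixes a b c d e i j k n N :: nat
  assumes "i = a + b" "i = c + d" "c = 0 + e" "j = 0 + k" "e + k = n" "N = Suc n"
  shows "odd (j + b + (N + (a + d)))"
proof -
  have eq: "j + b + (N + (a + d)) = Suc (2 * (d + n))" using assms by presburger
  show ?thesis unfolding eq by simp
qed

text \<open>The graded Leibniz rule for the odd derivation with \<open>e_g \<mapsto> 1\<close> for
  \<open>g \<in> A\<close> and \<open>e_g \<mapsto> 0\<close> otherwise. The substantial case is
  that of a single common element, lying in \<open>A\<close>: then \<open>e_S e_T\<close> vanishes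
  and the two summands have to cancel.\<close>

lemma contraction_Leibniz:
  assumes r: "linear_order_on H r" and fin: "finite H" and ST: "S \<subseteq> H" "T \<subseteq> H"
  shows "mul r (contraction r (S \<inter> A) S f) (iota T g)
      + scale ((-1) ^ card S) (mul r (iota S f) (contraction r (T \<inter> A) T g))
    = (if S \<inter> T = {} then scale ((-1) ^ inversions r S T) (contraction r ((S \<union> T) \<inter> A) (S \<union> T) (f * g)) else 0)"
proof -
  note L = mul_contraction_iota[OF fin ST(2) ST(1) Int_lower1, where f = f and k = g and r = r]
  note R = mul_iota_contraction[OF r fin ST Int_lower1, where f = g and k = f]
  have finST: "finite S" "finite T" using finite_subset[OF ST(1) fin] finite_subset[OF ST(2) fin] by auto
  consider "S \<inter> T = {}" | x where "S \<inter> T = {x}" "x \<in> A"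
    | "S \<inter> T \<noteq> {}" "\<And>x. x \<in> A \<Longrightarrow> S \<inter> T \<noteq> {x}" by blast
  then show ?thesis
  proof cases
    case 1
    have "(-1) ^ card S * (-1) ^ (inversions r S T + card S) = ((-1) ^ inversions r S T :: rat)"
      unfolding power_add[symmetric] by (rule minus_one_power_even) presburger
    moreover have "contraction r ((S \<union> T) \<inter> A) (S \<union> T) (f * g)
      = contraction r (S \<inter> A) (S \<union> T) (f * g) + contraction r (T \<inter> A) (S \<union> T) (f * g)"
      unfolding contraction_def Int_Un_distrib2 by (rule sum.union_disjoint) (use finST 1 in auto)
    ultimately show ?thesis using L(1)[OF 1] R(1)[OF 1] 1 by (simp add: scale_scale scale_add)
  next
    case 2
    have x: "x \<in> S" "x \<in> T" using 2 by auto
    have "inversions r S T = inversions r {x} T + inversions r (S - {x}) T"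
      by (rule inversions_remove_left[OF finST x(1)])
    moreover have "inversions r S T = inversions r S {x} + inversions r S (T - {x})"
      by (rule inversions_remove_right[OF finST x(2)])
    moreover have "inversions r S {x} = 0 + inversions r (S - {x}) {x}"
      using inversions_remove_left[of S "{x}" x r] finST x by simp
    moreover have "inversions r {x} S = 0 + inversions r {x} (S - {x})"
      using inversions_remove_right[of "{x}" S x r] finST x by simp
    moreover have "inversions r (S - {x}) {x} + inversions r {x} (S - {x}) = card (S - {x})"
      by (rule inversions_swap[OF r]) (use finST x ST in auto)
    moreover have "card S = Suc (card (S - {x}))" by (rule card_Suc_Diff1[OF finST(1) x(1), symmetric])
    ultimately have "odd (inversions r {x} S + inversions r (S - {x}) T
        + (card S + (inversions r {x} T + inversions r S (T - {x}))))"
      by (rule parity_aux)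
    then have "(-1) ^ (inversions r {x} S + inversions r (S - {x}) T)
      = - ((-1) ^ (card S + (inversions r {x} T + inversions r S (T - {x}))) :: rat)"
      by (rule minus_one_power_odd)
    moreover have "x \<in> S \<inter> A" "x \<in> T \<inter> A" "S \<inter> T \<noteq> {}" using x 2 by auto
    ultimately show ?thesis using L(2)[OF 2(1)] R(2)[OF 2(1)]
      by (simp add: scale_scale scale_uminus power_add)
  next
    case 3
    then have "mul r (contraction r (S \<inter> A) S f) (iota T g) = 0" "mul r (iota S f) (contraction r (T \<inter> A) T g) = 0"
      using L(3) R(3) by auto
    then show ?thesis using 3 by simp
  qed
qed

section \<open>Definition of the substitution; compatibility with product and differential\<close>

locale blow_order = blow L G H p for L :: "'a gorder" (structure) and G H p +
  fixes r :: "'a rel"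
  assumes r: "linear_order_on H r"
begin

text \<open>Putting \<open>p\<close> first spares the sign in \<open>e\<^sub>p e\<^sub>S\<close>.\<close>

definition r0 :: "'a rel" where "r0 = r \<union> {p} \<times> H'"

lemma linear_r0: "linear_order_on H' r0"
  using r p_notin unfolding r0_def order_on_defs refl_on_def total_on_def antisym_def trans_def by blast

lemma inv_r0: "S \<subseteq> H \<Longrightarrow> T \<subseteq> H \<Longrightarrow> inversions r0 S T = inversions r S T"
proof -
  assume ST: "S \<subseteq> H" "T \<subseteq> H"
  have "{(s, t) \<in> S \<times> T. s \<noteq> t \<and> (t, s) \<in> r0} = {(s, t) \<in> S \<times> T. s \<noteq> t \<and> (t, s) \<in> r}"
    using ST p_notin by (auto simp: r0_def)
  then show ?thesis by (simp only: inversions_def)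
qed

lemma inv_r0_p: "T \<subseteq> H \<Longrightarrow> inversions r0 {p} T = 0"
proof -
  assume T: "T \<subseteq> H"
  have "(t, p) \<notin> r" if "t \<in> H" for t
    using r p_notin by (auto simp: order_on_defs refl_on_def)
  then have "{(s, t) \<in> {p} \<times> T. s \<noteq> t \<and> (t, s) \<in> r0} = {}"
    using T p_notin by (auto simp: r0_def)
  then show ?thesis by (simp only: inversions_def card.empty)
qed

lemma finite_H_sub: "S \<subseteq> H \<Longrightarrow> finite S" using finite_H finite_subset by blast

lemma inv_r0_right_p: "S \<subseteq> H \<Longrightarrow> inversions r0 S {p} = card S"
  using inversions_swap[OF linear_r0, of S p] inv_r0_p[of S] finite_H_sub[of S] p_notin by auto

lemma inv_r0_insert:
  assumes "g \<in> H" "D \<subseteq> H" shows "inversions r0 {g} (insert p D) = Suc (inversions r {g} D)"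
proof -
  have "inversions r0 {g} ({p} \<union> D) = inversions r0 {g} {p} + inversions r0 {g} D"
    by (rule inversions_Un_right) (use assms finite_H_sub p_notin in auto)
  then show ?thesis using inv_r0_right_p[of "{g}"] inv_r0[of "{g}" D] assms by simp
qed

lemma contraction_r0: "C \<subseteq> H \<Longrightarrow> D \<subseteq> H \<Longrightarrow> contraction r0 C D f = contraction r C D f"
  unfolding contraction_def by (intro sum.cong refl) (auto simp: inv_r0)

definition shift :: "'a \<Rightarrow> 'a pol" where
  "shift g = (if g \<sqsubseteq> p then xm {#g#} + xm {#p#} else xm {#g#})"

abbreviation sigma :: "'a pol \<Rightarrow> 'a pol" where "sigma \<equiv> subst shift"

definition below :: "'a set" where "below = {s. s \<sqsubseteq> p}"

text \<open>Expands \<open>\<Prod>\<^sub>s (e\<^sub>s + [s \<le> p] e\<^sub>p)\<close>, using \<open>e\<^sub>p\<^sup>2 = 0\<close>.\<close>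

definition Phi0 :: "'a set \<Rightarrow> 'a pol \<Rightarrow> 'a gca" where
  "Phi0 S f = iota S (sigma f)
     + (\<Sum>s\<in>S \<inter> below. scale ((-1) ^ inversions r {s} S) (iota (insert p (S - {s})) (sigma f)))"

definition Phi :: "'a gca \<Rightarrow> 'a gca" where
  "Phi = lin_ext (\<lambda>(S, m). Phi0 S (xm m))"

lemma linear_Phi: "linear_map Phi"
  unfolding Phi_def by (rule linear_lin_ext)

lemmas Phi_simps = linear_map_add[OF linear_Phi] linear_map_scale[OF linear_Phi]
  linear_map_zero[OF linear_Phi] linear_map_uminus[OF linear_Phi] linear_map_diff[OF linear_Phi]
  linear_map_sum[OF linear_Phi]

lemma linear_iota_sigma: "linear_map (\<lambda>f. iota S (sigma f))"
  by (rule linear_map_comp[OF linear_iota linear_subst])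

lemma Phi_iota: "Phi (iota S f) = Phi0 S f"
  unfolding Phi_def
  by (rule lin_ext_iota, unfold Phi0_def)
    (intro linear_map_add_fun linear_map_sum_fun linear_map_scale_fun linear_iota_sigma)

lemma sigma_polys: "f \<in> polys H \<Longrightarrow> sigma f \<in> polys H'"
  by (rule subst_polys) (auto simp: shift_def intro!: polys_add polys_xm)

text \<open>After the polynomial substitution, \<open>Phi\<close> is
  \<open>1 + e_p \<partial>\<close>, with \<open>\<partial>\<close> the odd derivation that sends
  \<open>e_s\<close> to 1 if \<open>s \<le> p\<close> and to 0 otherwise.\<close>

lemma Phi0_mul: "S \<subseteq> H \<Longrightarrow> Phi0 S f
    = iota S (sigma f) + mul r0 (iota {p} 1) (contraction r0 (S \<inter> below) S (sigma f))"
  unfolding Phi0_def contraction_def linear_map_sum[OF linear_mul(1)] linear_map_scale[OF linear_mul(1)]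
  by (intro arg_cong2[of _ _ _ _ "(+)"] refl sum.cong)
    (use p_notin in \<open>auto simp: mul_iota inv_r0 inv_r0_p subset_iff\<close>)

lemma Phi_carrier: "f \<in> carrier (free_gca H r) \<Longrightarrow> Phi f \<in> carrier (free_gca H' r0)"
proof (induction rule: carrier_induct)
  case (mono S m)
  have "iota S (sigma (xm m)) \<in> carrier (free_gca H' r0)"
    using mono by (intro iota_in_carrier sigma_polys polys_xm) auto
  moreover have "(\<Sum>s\<in>S \<inter> below. scale ((-1) ^ inversions r {s} S) (iota (insert p (S - {s})) (sigma (xm m))))
    \<in> carrier (free_gca H' r0)"
  proof -
    have "(\<Sum>s\<in>A. scale ((-1) ^ inversions r {s} S) (iota (insert p (S - {s})) (sigma (xm m))))
      \<in> carrier (free_gca H' r0)" for A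
      using mono by (induction A rule: infinite_finite_induct)
        (auto intro!: carrier_zero carrier_add carrier_scale iota_in_carrier sigma_polys polys_xm)
    then show ?thesis .
  qed
  ultimately show ?case by (simp add: Phi_iota Phi0_def carrier_add)
qed (auto simp: Phi_simps intro: carrier_add carrier_scale carrier_zero)

lemma finite_H': "finite H'" using finite_H by simp

text \<open>The product of \<open>u + e_p \<partial>u\<close> and \<open>v + e_p \<partial>v\<close>
  has no term with two factors \<open>e_p\<close>, and its part with one such factor is
  \<open>e_p \<partial>(uv)\<close> by the Leibniz rule.\<close>

lemma Phi_mul_iota:
  assumes ST: "S \<subseteq> H" "T \<subseteq> H" and fg: "f \<in> polys H" "g \<in> polys H"
  shows "Phi (mul r (iota S f) (iota T g)) = mul r0 (Phi (iota S f)) (Phi (iota T g))"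
proof -
  let ?R = "free_gca H' r0"
  interpret R: ring ?R by (rule ring_free_gca)
  define P eS eT cS cT where "P = (iota {p} 1 :: 'a gca)" and "eS = iota S (sigma f)" and "eT = iota T (sigma g)"
    and "cS = contraction r0 (S \<inter> below) S (sigma f)" and "cT = contraction r0 (T \<inter> below) T (sigma g)"
  note defs = P_def eS_def eT_def cS_def cT_def
  have fin: "finite S" "finite T" using finite_H_sub ST by auto
  have ST': "S \<subseteq> H'" "T \<subseteq> H'" using ST by auto
  have c: "P \<in> carrier ?R" "eS \<in> carrier ?R" "eT \<in> carrier ?R" "cS \<in> carrier ?R" "cT \<in> carrier ?R"
    unfolding defs using fin ST' fg sigma_polys finite_H'
    by (auto intro!: iota_in_carrier contraction_carrier)
  have assoc: "mul r0 (mul r0 a b) d = mul r0 a (mul r0 b d)"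
    if "a \<in> carrier ?R" "b \<in> carrier ?R" "d \<in> carrier ?R" for a b d
    using R.m_assoc[OF that] by simp
  have closed: "mul r0 a b \<in> carrier ?R" if "a \<in> carrier ?R" "b \<in> carrier ?R" for a b
    using R.m_closed[OF that] by simp
  note add = linear_map_add[OF linear_mul(1)] linear_map_add[OF linear_mul(2)]
  note sc = linear_map_scale[OF linear_mul(1)] linear_map_scale[OF linear_mul(2)]
  have comm: "mul r0 eS P = scale ((-1) ^ card S) (mul r0 P eS)"
    unfolding defs using ST p_notin
    by (simp add: mul_iota inv_r0_right_p inv_r0_p subset_iff)
  \<comment> \<open>Both outer factors are \<open>e_p\<close>, whose square is zero.\<close>
  have "mul r0 P (mul r0 cS P) = 0"
    unfolding defs contraction_def linear_map_sum[OF linear_mul(2)] linear_map_sum[OF linear_mul(1)] sc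
    by (intro sum.neutral) (auto simp: mul_iota sc linear_map_zero[OF linear_mul(1)] scale_simps(3))
  then have zero: "mul r0 (mul r0 P cS) (mul r0 P cT) = 0"
    using c by (simp add: assoc[symmetric] closed) (simp add: assoc closed linear_map_zero[OF linear_mul(2)])
  have "mul r0 (Phi (iota S f)) (Phi (iota T g)) = mul r0 (eS + mul r0 P cS) (eT + mul r0 P cT)"
    using ST by (simp add: Phi_iota Phi0_mul defs)
  also have "\<dots> = mul r0 eS eT + mul r0 (mul r0 P cS) eT + mul r0 eS (mul r0 P cT)"
    unfolding add zero by simp
  also have "mul r0 eS (mul r0 P cT) = scale ((-1) ^ card S) (mul r0 (mul r0 P eS) cT)"
    using c by (simp add: assoc[symmetric] comm sc)
  also have "mul r0 eS eT + mul r0 (mul r0 P cS) eT + scale ((-1) ^ card S) (mul r0 (mul r0 P eS) cT)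
    = mul r0 eS eT + mul r0 P (mul r0 cS eT + scale ((-1) ^ card S) (mul r0 eS cT))"
    using c by (simp add: assoc add sc)
  also have "mul r0 cS eT + scale ((-1) ^ card S) (mul r0 eS cT)
    = (if S \<inter> T = {} then scale ((-1) ^ inversions r0 S T)
        (contraction r0 ((S \<union> T) \<inter> below) (S \<union> T) (sigma f * sigma g)) else 0)"
    unfolding defs by (rule contraction_Leibniz[OF linear_r0 finite_H' ST'])
  finally have *: "mul r0 (Phi (iota S f)) (Phi (iota T g)) = mul r0 eS eT + mul r0 P
    (if S \<inter> T = {} then scale ((-1) ^ inversions r0 S T)
        (contraction r0 ((S \<union> T) \<inter> below) (S \<union> T) (sigma f * sigma g)) else 0)" .
  show ?thesis
  proof (cases "S \<inter> T = {}")
    case True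
    have "S \<union> T \<subseteq> H" using ST by simp
    then show ?thesis using True ST unfolding *
      by (simp add: mul_iota Phi_simps Phi_iota Phi0_mul subst_mult inv_r0 defs sc scale_add)
  next
    case False
    then show ?thesis unfolding * by (simp add: mul_iota defs Phi_simps linear_map_zero[OF linear_mul(1)])
  qed
qed

lemma Phi_mul:
  assumes "u \<in> carrier (free_gca H r)" "v \<in> carrier (free_gca H r)"
  shows "Phi (mul r u v) = mul r0 (Phi u) (Phi v)"
  using assms(1)
proof (induction rule: carrier_induct)
  case (mono S m)
  show ?case using assms(2)
  proof (induction rule: carrier_induct)
    case (mono T n)
    then show ?case using \<open>S \<subseteq> H\<close> \<open>set_mset m \<subseteq> H\<close> by (intro Phi_mul_iota polys_xm)
  qed (simp_all add: Phi_simps linear_map_add[OF linear_mul(1)] linear_map_scale[OF linear_mul(1)]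
      linear_map_zero[OF linear_mul(1)])
qed (simp_all add: Phi_simps linear_map_add[OF linear_mul(2)] linear_map_scale[OF linear_mul(2)]
    linear_map_zero[OF linear_mul(2)])

lemma Phi_one: "Phi (iota {} 1) = iota {} 1"
  by (simp add: Phi_iota Phi0_def)

lemma Phi_e: "Phi (iota {g} 1) = (if g \<sqsubseteq> p then iota {g} 1 + iota {p} 1 else iota {g} 1)"
proof -
  have "{g} \<inter> below = (if g \<sqsubseteq> p then {g} else {})" by (auto simp: below_def)
  then show ?thesis by (simp add: Phi_iota Phi0_def)
qed

lemma Phi_x: "Phi (iota {} (xm {#g#})) = (if g \<sqsubseteq> p then iota {} (xm {#g#}) + iota {} (xm {#p#}) else iota {} (xm {#g#}))"
  by (simp add: Phi_iota Phi0_def shift_def iota_simps)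

text \<open>When \<open>e_g\<close> is peeled off, both sides obey the same Leibniz rule, since
  \<open>Phi\<close> is multiplicative, and they agree on the generators.\<close>

lemma Phi_dif_iota:
  assumes "finite S" "S \<subseteq> H" "f \<in> polys H"
  shows "Phi (dif r (iota S f)) = dif r0 (Phi (iota S f))"
  using assms(1,2)
proof (induction S)
  case empty
  then show ?case by (simp add: dif_iota Phi_simps Phi_iota Phi0_def)
next
  case (insert g S)
  let ?R = "free_gca H r" and ?R' = "free_gca H' r0"
  let ?e = "iota {g} 1" and ?v = "iota S f"
  let ?s = "(-1) ^ inversions r {g} S :: rat"
  have S: "S \<subseteq> H" "g \<in> H" "finite S" using insert by auto
  have c: "?e \<in> carrier ?R" "?v \<in> carrier ?R" using S assms by (auto intro!: iota_in_carrier)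
  have dv: "dif r ?v \<in> carrier ?R"
    unfolding dif_iota
  proof -
    have "(\<Sum>h\<in>A. scale ((-1) ^ inversions r {h} S) (iota (S - {h}) (xm {#h#} * f))) \<in> carrier ?R" if "A \<subseteq> S" for A
      using finite_subset[OF that S(3)] that S assms
      by (induction A) (auto intro!: carrier_zero carrier_add carrier_scale iota_in_carrier polys_mult polys_xm)
    then show "(\<Sum>h\<in>S. scale ((-1) ^ inversions r {h} S) (iota (S - {h}) (xm {#h#} * f))) \<in> carrier ?R" by blast
  qed
  have e1: "?e \<in> bidegree ?R 0 1"
    using S iota_xm[of "{g}" "{#}"] by (simp add: free_gca_def monom_ex_def)
  \<comment> \<open>The sign in the Leibniz rule depends on the degree of the left factor, so the
    image of \<open>e_g\<close> has to be known to be homogeneous of degree one.\<close>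
  have Pe1: "Phi ?e \<in> bidegree ?R' 0 1"
  proof -
    have "Phi ?e = (if g \<sqsubseteq> p then monom_ex {g} {#} + monom_ex {p} {#} else monom_ex {g} {#})"
      by (simp add: Phi_e flip: iota_xm)
    moreover have "\<forall>u\<in>Poly_Mapping.keys (monom_ex {g} {#} + monom_ex {p} {#} :: 'a gca). u = ({g}, {#}) \<or> u = ({p}, {#})"
      using Poly_Mapping.keys_add[of "monom_ex {g} {#} :: 'a gca" "monom_ex {p} {#}"] by (auto simp: monom_ex_def)
    ultimately show ?thesis using S by (auto simp: free_gca_def monom_ex_def)
  qed
  have ev: "iota (insert g S) f = scale ?s (mul r ?e ?v)"
    using insert by (simp add: mul_iota scale_scale flip: power_add mult_2)
  have "dif r (mul r ?e ?v) = mul r (dif r ?e) ?v + scale (- 1) (mul r ?e (dif r ?v))"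
    using differential_free_gca[OF r e1 c(2)] by simp
  moreover have de: "dif r ?e = iota {} (xm {#g#})" by (simp add: dif_iota)
  moreover have "iota {} (xm {#g#}) \<in> carrier ?R" using S by (intro iota_in_carrier) auto
  moreover have cc: "mul r a b \<in> carrier ?R" if "a \<in> carrier ?R" "b \<in> carrier ?R" for a b
    using that free_gca_mult_closed[of a H r b] by simp
  ultimately have "Phi (dif r (mul r ?e ?v))
      = mul r0 (Phi (iota {} (xm {#g#}))) (Phi ?v) + scale (- 1) (mul r0 (Phi ?e) (Phi (dif r ?v)))"
    using c dv by (simp add: Phi_simps Phi_mul)
  also have "Phi (dif r ?v) = dif r0 (Phi ?v)" by (rule insert.IH) (use S in simp)
  also have "Phi (iota {} (xm {#g#})) = dif r0 (Phi ?e)"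
    unfolding Phi_x Phi_e by (simp add: linear_map_add[OF linear_dif] dif_iota)
  also have "mul r0 (dif r0 (Phi ?e)) (Phi ?v) + scale (- 1) (mul r0 (Phi ?e) (dif r0 (Phi ?v)))
      = dif r0 (mul r0 (Phi ?e) (Phi ?v))"
    using differential_free_gca[OF linear_r0 Pe1 Phi_carrier[OF c(2)]] by simp
  also have "\<dots> = dif r0 (Phi (mul r ?e ?v))" using c by (simp add: Phi_mul)
  finally show ?case unfolding ev by (simp add: linear_map_scale[OF linear_dif] Phi_simps)
qed

lemma Phi_dif: "u \<in> carrier (free_gca H r) \<Longrightarrow> Phi (dif r u) = dif r0 (Phi u)"
proof (induction rule: carrier_induct)
  case (mono S m)
  then show ?case by (intro Phi_dif_iota polys_xm)
qed (simp_all add: Phi_simps linear_map_add[OF linear_dif] linear_map_scale[OF linear_dif] linear_map_zero[OF linear_dif])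

end

section \<open>Relations under the substitution\<close>

lemma xm_insert: "xm (add_mset g m) = xm {#g#} * xm m"
  using xm_add[of "{#g#}" m] by simp

context blow_order
begin

text \<open>Contains all monomials of \<open>sigma (xm m)\<close>.\<close>

definition replaced :: "'a multiset \<Rightarrow> 'a multiset set" where
  "replaced m = {n. size n = size m \<and> (n = m \<or> p \<in># n) \<and> {h \<in> set_mset m. \<not> h \<sqsubseteq> p} \<subseteq> set_mset n
     \<and> set_mset n \<subseteq> insert p (set_mset m)}"

lemma sigma_xm: "sigma (xm m) \<in> lspan (xm ` replaced m)"
proof (induction m)
  case empty
  have "{#} \<in> replaced {#}" by (auto simp: replaced_def)
  then have "xm {#} \<in> lspan (xm ` replaced {#})" by (intro lspan.base imageI)
  then show ?case by simp
next
  case (add g m)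
  have eq: "sigma (xm (add_mset g m)) = shift g * sigma (xm m)"
    unfolding xm_insert[of g m] subst_mult by simp
  have base: "xm {#g#} * y \<in> lspan (xm ` replaced (add_mset g m))"
    "g \<sqsubseteq> p \<Longrightarrow> xm {#p#} * y \<in> lspan (xm ` replaced (add_mset g m))" if y: "y \<in> xm ` replaced m" for y
  proof -
    obtain n where n: "n \<in> replaced m" "y = xm n" using y by auto
    have "add_mset g n \<in> replaced (add_mset g m)" using n by (auto simp: replaced_def)
    then show "xm {#g#} * y \<in> lspan (xm ` replaced (add_mset g m))"
      unfolding n xm_insert[symmetric] by (intro lspan.base imageI)
    assume "g \<sqsubseteq> p"
    then have "add_mset p n \<in> replaced (add_mset g m)" using n by (auto simp: replaced_def)
    then show "xm {#p#} * y \<in> lspan (xm ` replaced (add_mset g m))"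
      unfolding n xm_insert[symmetric] by (intro lspan.base imageI)
  qed
  have "xm {#g#} * sigma (xm m) \<in> lspan (xm ` replaced (add_mset g m))"
    by (rule lspan_linear[OF linear_map_mult(1) add base(1)])
  moreover have "xm {#p#} * sigma (xm m) \<in> lspan (xm ` replaced (add_mset g m))" if "g \<sqsubseteq> p"
    by (rule lspan_linear[OF linear_map_mult(1) add base(2)[OF _ that]])
  ultimately show ?case unfolding eq
    by (cases "g \<sqsubseteq> p") (simp_all add: shift_def[of g] distrib_right lspan.add)
qed

lemma linear_iota_mult: "linear_map (\<lambda>g. iota S (g * f))"
  by (rule linear_map_comp[OF linear_iota linear_map_mult(2)])

lemma rel_span_sigma:
  assumes S: "S \<subseteq> H'" "set_mset m \<subseteq> H" "f \<in> polys H'"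
    and nn: "\<And>n. n \<in> replaced m \<Longrightarrow> S \<union> set_mset n \<notin> nested L H'"
  shows "iota S (sigma (xm m) * f) \<in> rel_span L H' r0"
proof (rule lspan_linear[OF linear_iota_mult sigma_xm])
  fix y assume "y \<in> xm ` replaced m"
  then obtain n where n: "n \<in> replaced m" "y = xm n" by auto
  have "set_mset n \<subseteq> H'" using n(1) S(2) by (auto simp: replaced_def)
  then show "iota S (y * f) \<in> rel_span L H' r0"
    unfolding n(2) using S nn[OF n(1)] by (intro p'.rel_span_non_nested)
qed

lemma rel_span_non_nested':
  "S \<subseteq> H' \<Longrightarrow> f \<in> polys H' \<Longrightarrow> S \<notin> nested L H' \<Longrightarrow> iota S f \<in> rel_span L H' r0"
  using p'.rel_span_non_nested[of S "{#}" f r0] by simp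

lemma circuit_H':
  assumes "circuit L H C" "\<Squnion>C \<noteq> p" shows "circuit L H' C"
  using assms lcircuit_nested_H' by (simp add: circuit_def)

text \<open>A circuit whose join is the new element \<open>p\<close> is no longer nested, nor is any
  set that contains all but one of its members, because these still span \<open>p\<close>.\<close>

lemma circuit_eq_p:
  assumes C: "circuit L H C" "\<Squnion>C = p" and S: "C - {g} \<subseteq> S" "S \<subseteq> H'"
  shows "S \<notin> nested L H'"
  using lcircuit_spans[OF circuitD(1)[OF C(1)] S(1)] C(2) spans_not_nested_H' S(2) by simp

lemma circuit_cases:
  assumes "circuit L H C"
  obtains "C \<subseteq> below" | "C \<inter> below = {}" | "mixed C"
  using assms unfolding circuit_def mixed_def below_def by blast

text \<open>The sign is that of moving \<open>s\<close> past \<open>p\<close>, which is the first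
  element in \<open>r0\<close>.\<close>

lemma scale_sum_contraction:
  assumes "C \<subseteq> D" "D \<subseteq> H"
  shows "(\<Sum>s\<in>C. scale ((-1) ^ inversions r {s} D) (iota (insert p (D - {s})) k))
    = - contraction r0 C (insert p D) k"
  unfolding contraction_def sum_negf[symmetric]
proof (rule sum.cong[OF refl])
  fix s assume s: "s \<in> C"
  have "insert p D - {s} = insert p (D - {s})" using s assms p_notin by auto
  moreover have "inversions r0 {s} (insert p D) = Suc (inversions r {s} D)"
    by (rule inv_r0_insert) (use s assms in auto)
  ultimately show "scale ((-1) ^ inversions r {s} D) (iota (insert p (D - {s})) k)
    = - scale ((-1) ^ inversions r0 {s} (insert p D)) (iota (insert p D - {s}) k)"
    by (simp add: scale_uminus)
qed

text \<open>Besides the term with \<open>e_D\<close>, there are terms in which \<open>e_p\<close>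
  replaces \<open>e_s\<close> for some \<open>s \<le> p\<close>. For \<open>s\<close> outside
  \<open>C\<close> they still contain the circuit. For \<open>s\<close> in \<open>C\<close> they
  form a contraction if all of \<open>C\<close> is below \<open>p\<close>, and they are non-nested
  if \<open>C\<close> is mixed. If \<open>\<Squnion>C = p\<close>, every term is non-nested.\<close>

lemma Phi_dependent:
  assumes C: "circuit L H C" "C \<subseteq> D" "D \<subseteq> H" and f: "f \<in> polys H"
  shows "Phi (iota D f) \<in> rel_span L H' r0"
proof -
  let ?k = "sigma f" and ?sg = "\<lambda>s. (-1) ^ inversions r {s} D :: rat"
  have k: "?k \<in> polys H'" using f by (rule sigma_polys)
  have finD: "finite D" using C by (simp add: finite_H_sub)
  have D: "D \<subseteq> H'" using C by auto
  note c = circuitD[OF C(1)]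
  have sub: "insert p (D - {s}) \<subseteq> H'" for s using D by auto
  show ?thesis
  proof (cases "\<Squnion>C = p")
    case True
    then have "iota (insert p (D - {s})) ?k \<in> rel_span L H' r0" for s
      using C D by (intro rel_span_non_nested' sub k circuit_eq_p[OF C(1), of s]) auto
    \<comment> \<open>Here all of \<open>C\<close> is present, so it is immaterial which member
      \<open>circuit_eq_p\<close> leaves out.\<close>
    moreover have "iota D ?k \<in> rel_span L H' r0"
      using C D True by (intro rel_span_non_nested' D k circuit_eq_p[OF C(1), of undefined]) auto
    ultimately show ?thesis unfolding Phi_iota Phi0_def
      by (intro lspan.add lspan_sum lspan.scale)
  next
    case False
    have C': "circuit L H' C" using circuit_H'[OF C(1) False] .
    have "(\<Sum>s\<in>D \<inter> below. scale (?sg s) (iota (insert p (D - {s})) ?k))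
      = (\<Sum>s\<in>C \<inter> below. scale (?sg s) (iota (insert p (D - {s})) ?k))
        + (\<Sum>s\<in>(D - C) \<inter> below. scale (?sg s) (iota (insert p (D - {s})) ?k))"
      using finD C(2) by (subst sum.union_disjoint[symmetric])
        (auto intro!: sum.cong finite_subset[OF _ finD])
    moreover have "(\<Sum>s\<in>(D - C) \<inter> below. scale (?sg s) (iota (insert p (D - {s})) ?k)) \<in> rel_span L H' r0"
      using C by (intro lspan_sum lspan.scale p'.dependent_rel_span[OF C'] sub k) auto
    moreover have "(\<Sum>s\<in>C \<inter> below. scale (?sg s) (iota (insert p (D - {s})) ?k)) \<in> rel_span L H' r0"
      using C(1)
    proof (cases rule: circuit_cases)
      case 1
      then have eq: "C \<inter> below = C" by auto
      have "contraction r0 C (insert p D) ?k \<in> rel_span L H' r0"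
        using C D by (intro p'.contraction_circuit_rel_span[OF C'] k) auto
      then show ?thesis unfolding eq scale_sum_contraction[OF C(2,3)] by (rule lspan_uminus)
    next
      case 2
      then show ?thesis by (simp add: lspan.zero)
    next
      case 3
      show ?thesis
        using C by (intro lspan_sum lspan.scale rel_span_non_nested' sub k mixed_not_nested_H'[OF 3, of _ undefined])
          (auto simp: below_def)
    qed
    moreover have "iota D ?k \<in> rel_span L H' r0"
      using C by (intro p'.dependent_rel_span[OF C'] D k)
    ultimately show ?thesis unfolding Phi_iota Phi0_def by (auto intro: lspan.add)
  qed
qed

text \<open>The extra terms form a double sum over a deleted \<open>g \<in> C\<close> and a replaced
  \<open>s \<le> p\<close>. Pairs inside \<open>C\<close> cancel unless \<open>C\<close> is mixed,
  in which case all extra terms are non-nested. For fixed \<open>s\<close> outside \<open>C\<close>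
  the sum over \<open>g\<close> is a contraction, or consists of non-nested terms if
  \<open>\<Squnion>C = p\<close>.\<close>

lemma Phi_contraction:
  assumes C: "circuit L H C" "C \<subseteq> D" "D \<subseteq> H" and f: "f \<in> polys H"
  shows "Phi (contraction r C D f) \<in> rel_span L H' r0"
proof -
  let ?k = "sigma f"
  let ?sg = "\<lambda>g s. (-1) ^ inversions r {g} D * (-1) ^ inversions r {s} (D - {g}) :: rat"
  let ?F = "\<lambda>g s. scale (?sg g s) (iota (insert p (D - {g} - {s})) ?k)"
  have k: "?k \<in> polys H'" using f by (rule sigma_polys)
  have finD: "finite D" using C by (simp add: finite_H_sub)
  have D: "D \<subseteq> H'" "D \<subseteq> H" using C by auto
  note c = circuitD[OF C(1)]
  have sub: "insert p (D - {g} - {s}) \<subseteq> H'" for g s using D by auto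
  have sw: "?sg g s = - ?sg s g" if "g \<in> D" "s \<in> D" "g \<noteq> s" for g s
    by (rule inversions_remove_swap[OF r finD D(2) that])
  have Fsw: "?F g s = - ?F s g" if "g \<in> D" "s \<in> D" "g \<noteq> s" for g s
  proof -
    have eq: "D - {g} - {s} = D - {s} - {g}" by auto
    show ?thesis unfolding sw[OF that] scale_uminus eq ..
  qed
  have first: "(\<Sum>g\<in>C. scale ((-1) ^ inversions r {g} D) (iota (D - {g}) ?k)) \<in> rel_span L H' r0"
  proof (cases "\<Squnion>C = p")
    case True
    show ?thesis
    proof (intro lspan_sum lspan.scale rel_span_non_nested' k)
      fix g assume "g \<in> C"
      show "D - {g} \<subseteq> H'" using D by auto
      then show "D - {g} \<notin> nested L H'" using C by (intro circuit_eq_p[OF C(1) True, of g]) auto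
    qed
  next
    case False
    have "contraction r0 C D ?k \<in> rel_span L H' r0"
      using C by (intro p'.contraction_circuit_rel_span[OF circuit_H'[OF C(1) False]] D k)
    moreover have "contraction r0 C D ?k = contraction r C D ?k"
      using c D by (intro contraction_r0) auto
    ultimately show ?thesis by (simp add: contraction_def)
  qed
  have "Phi (contraction r C D f) = (\<Sum>g\<in>C. scale ((-1) ^ inversions r {g} D) (iota (D - {g}) ?k)
      + (\<Sum>s\<in>(D - {g}) \<inter> below. ?F g s))"
    unfolding contraction_def Phi_simps Phi_iota Phi0_def by (simp add: scale_add scale_sum scale_scale)
  also have "\<dots> = (\<Sum>g\<in>C. scale ((-1) ^ inversions r {g} D) (iota (D - {g}) ?k))
      + (\<Sum>g\<in>C. \<Sum>s\<in>(D - {g}) \<inter> below. ?F g s)" by (rule sum.distrib)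
  also have "(\<Sum>g\<in>C. \<Sum>s\<in>(D - {g}) \<inter> below. ?F g s) \<in> rel_span L H' r0 \<Longrightarrow> \<dots> \<in> rel_span L H' r0"
    using first by (rule lspan.add)
  finally have red: "(\<Sum>g\<in>C. \<Sum>s\<in>(D - {g}) \<inter> below. ?F g s) \<in> rel_span L H' r0
      \<Longrightarrow> Phi (contraction r C D f) \<in> rel_span L H' r0" .
  show ?thesis
  proof (rule red, cases "mixed C")
    case True
    show "(\<Sum>g\<in>C. \<Sum>s\<in>(D - {g}) \<inter> below. ?F g s) \<in> rel_span L H' r0"
      using C by (intro lspan_sum lspan.scale rel_span_non_nested' sub k)
        (rule mixed_not_nested_H'[OF True], auto simp: below_def)
  next
    case False
    then have C01: "C \<subseteq> below \<or> C \<inter> below = {}" using circuit_cases[OF C(1)] by blast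
    have "(\<Sum>s\<in>(D - {g}) \<inter> below. ?F g s)
        = (\<Sum>s\<in>C - {g}. if s \<in> below then ?F g s else 0) + (\<Sum>s\<in>(D - C) \<inter> below. ?F g s)" if g: "g \<in> C" for g
    proof -
      have "(D - {g}) \<inter> below = (C - {g}) \<inter> below \<union> (D - C) \<inter> below" using g C by auto
      then have "(\<Sum>s\<in>(D - {g}) \<inter> below. ?F g s)
          = (\<Sum>s\<in>(C - {g}) \<inter> below. ?F g s) + (\<Sum>s\<in>(D - C) \<inter> below. ?F g s)"
        using finD c(5) by (simp add: sum.union_disjoint[symmetric] Int_Diff disjoint_iff)
      also have "(\<Sum>s\<in>(C - {g}) \<inter> below. ?F g s) = (\<Sum>s\<in>C - {g}. if s \<in> below then ?F g s else 0)"
        using c(5) by (simp add: sum.inter_restrict)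
      finally show ?thesis .
    qed
    then have "(\<Sum>g\<in>C. \<Sum>s\<in>(D - {g}) \<inter> below. ?F g s)
        = (\<Sum>g\<in>C. \<Sum>s\<in>C - {g}. if s \<in> below then ?F g s else 0) + (\<Sum>g\<in>C. \<Sum>s\<in>(D - C) \<inter> below. ?F g s)"
      by (simp add: sum.distrib)
    \<comment> \<open>As \<open>C\<close> lies entirely inside or entirely outside
      \<open>below\<close>, the condition on \<open>s\<close> is symmetric in \<open>g\<close> and
      \<open>s\<close>, and the terms cancel in pairs.\<close>
    also have "(\<Sum>g\<in>C. \<Sum>s\<in>C - {g}. if s \<in> below then ?F g s else 0) = 0"
    proof (rule sum_antisymmetric[OF c(5)])
      fix g s assume gs: "g \<in> C" "s \<in> C" "g \<noteq> s"
      have "s \<in> below \<longleftrightarrow> g \<in> below" using C01 gs by auto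
      then show "(if s \<in> below then ?F g s else 0) = - (if g \<in> below then ?F s g else 0)"
        using Fsw[of g s] gs C by auto
    qed
    finally have eq: "(\<Sum>g\<in>C. \<Sum>s\<in>(D - {g}) \<inter> below. ?F g s) = (\<Sum>g\<in>C. \<Sum>s\<in>(D - C) \<inter> below. ?F g s)" by simp
    show "(\<Sum>g\<in>C. \<Sum>s\<in>(D - {g}) \<inter> below. ?F g s) \<in> rel_span L H' r0"
    proof (cases "\<Squnion>C = p")
      case True
      show ?thesis unfolding eq
      proof (intro lspan_sum lspan.scale rel_span_non_nested' sub k)
        fix g s assume "g \<in> C" "s \<in> (D - C) \<inter> below"
        then show "insert p (D - {g} - {s}) \<notin> nested L H'"
          using C sub by (intro circuit_eq_p[OF C(1) True, of g]) auto
      qed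
    next
      case False
      have "(\<Sum>g\<in>C. \<Sum>s\<in>(D - C) \<inter> below. ?F g s) = (\<Sum>s\<in>(D - C) \<inter> below. \<Sum>g\<in>C. ?F g s)"
        by (rule sum.swap)
      also have "\<dots> = (\<Sum>s\<in>(D - C) \<inter> below. scale ((-1) ^ inversions r {s} D)
          (contraction r0 C (insert p (D - {s})) ?k))"
      proof (rule sum.cong[OF refl])
        fix s assume s: "s \<in> (D - C) \<inter> below"
        have "(\<Sum>g\<in>C. ?F g s) = (\<Sum>g\<in>C. scale (- ((-1) ^ inversions r {s} D))
          (scale ((-1) ^ inversions r {g} (D - {s})) (iota (insert p (D - {s} - {g})) ?k)))"
        proof (rule sum.cong[OF refl])
          fix g assume g: "g \<in> C"
          have "?F g s = - ?F s g" using g s C by (intro Fsw) auto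
          then show "?F g s = scale (- ((-1) ^ inversions r {s} D))
            (scale ((-1) ^ inversions r {g} (D - {s})) (iota (insert p (D - {s} - {g})) ?k))"
            by (simp add: scale_uminus scale_scale)
        qed
        also have "\<dots> = scale (- ((-1) ^ inversions r {s} D)) (- contraction r0 C (insert p (D - {s})) ?k)"
          unfolding scale_sum[symmetric] using s C by (subst scale_sum_contraction) auto
        finally show "(\<Sum>g\<in>C. ?F g s)
          = scale ((-1) ^ inversions r {s} D) (contraction r0 C (insert p (D - {s})) ?k)"
          by (simp add: scale_uminus)
      qed
      also have "\<dots> \<in> rel_span L H' r0"
        using C sub by (intro lspan_sum lspan.scale p'.contraction_circuit_rel_span[OF circuit_H'[OF C(1) False]] k) auto
      finally show ?thesis unfolding eq .
    qed
  qed
qed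

text \<open>An \<open>h \<in> H\<close> between \<open>g\<close> and \<open>p\<close> is an atom,
  hence \<open>g\<close> itself. So \<open>x_p\<close> is added exactly once if
  \<open>g \<le> p\<close>, and this is the new summand of \<open>csum\<close>.\<close>

lemma sigma_csum:
  assumes g: "g \<in> atoms L" shows "sigma (csum L H g) = csum L H' g"
proof -
  let ?A = "{h \<in> H. g \<sqsubseteq> h}"
  have gc: "g \<in> carrier L" and gH: "g \<in> H" using g atoms_H by auto
  have fin: "finite ?A" using finite_H by simp
  have one: "h = g" if "h \<in> ?A" "h \<sqsubseteq> p" for h
    using that H_le_p atom_le_atom[OF g] by blast
  have "sigma (csum L H g) = (\<Sum>h\<in>?A. shift h)"
    by (simp add: csum_def subst_simps)
  also have "\<dots> = (\<Sum>h\<in>?A. xm {#h#} + (if h = g then (if g \<sqsubseteq> p then xm {#p#} else 0) else 0))"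
    by (intro sum.cong refl) (use one in \<open>auto simp: shift_def\<close>)
  also have "\<dots> = csum L H g + (if g \<sqsubseteq> p then xm {#p#} else 0)"
    using fin gH gc by (simp add: sum.distrib csum_def)
  also have "\<dots> = csum L H' g"
  proof (cases "g \<sqsubseteq> p")
    case True
    then have "{h \<in> H'. g \<sqsubseteq> h} = insert p ?A" by auto
    then show ?thesis using True fin p_notin by (simp add: csum_def add.commute)
  next
    case False
    then have "{h \<in> H'. g \<sqsubseteq> h} = ?A" by auto
    then show ?thesis using False by (simp add: csum_def)
  qed
  finally show ?thesis .
qed

lemma Phi_rel_span:
  assumes "w \<in> rel_span L H r" shows "Phi w \<in> rel_span L H' r0"
proof (rule lspan_linear[OF linear_Phi assms])
  fix y assume "y \<in> rel_gens L H r"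
  then show "Phi y \<in> rel_span L H' r0"
  proof cases
    case (non_nested S m f)
    let ?U = "S \<union> set_mset m"
    have U: "?U \<subseteq> H" "?U \<notin> nested L H" using non_nested by auto
    have k: "sigma f \<in> polys H'" using non_nested by (intro sigma_polys)
    have "iota S (sigma (xm m) * sigma f) \<in> rel_span L H' r0"
    proof (rule rel_span_sigma[OF _ _ k])
      fix n assume n: "n \<in> replaced m"
      show "S \<union> set_mset n \<notin> nested L H'"
      proof (cases "n = m")
        case True
        then show ?thesis using nested_H'_imp[OF U(1)] U(2) by blast
      next
        case False
        \<comment> \<open>A monomial of \<open>sigma (xm m)\<close> other than \<open>m\<close>
          contains \<open>p\<close>, which stands in for all the elements that were
          replaced.\<close>
        then show ?thesis using n by (intro not_nested_replace[OF U]) (auto simp: replaced_def)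
      qed
    qed (use non_nested in auto)
    moreover have "iota (insert p (S - {s})) (sigma (xm m) * sigma f) \<in> rel_span L H' r0"
      if s: "s \<in> S \<inter> below" for s
    proof (rule rel_span_sigma[OF _ _ k])
      fix n assume n: "n \<in> replaced m"
      then show "insert p (S - {s}) \<union> set_mset n \<notin> nested L H'"
        using s by (intro not_nested_replace[OF U]) (auto simp: replaced_def below_def)
    qed (use non_nested in auto)
    ultimately show ?thesis unfolding non_nested(1) Phi_iota Phi0_def subst_mult
      by (intro lspan.add lspan_sum lspan.scale)
  next
    case (dependent C D f)
    then show ?thesis using Phi_dependent by simp
  next
    case (circ C D f)
    then show ?thesis using Phi_contraction by simp
  next
    case (lin g S f)
    have k: "sigma f \<in> polys H'" using lin by (intro sigma_polys)
    have A: "iota T (csum L H' g * sigma f) \<in> rel_span L H' r0" if "T \<subseteq> H'" for T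
      using that lin k by (intro lspan.base rel_gens.lin)
    have S: "S \<subseteq> H'" and Ss: "insert p (S - {s}) \<subseteq> H'" for s using lin by auto
    show ?thesis unfolding lin(1) Phi_iota Phi0_def subst_mult sigma_csum[OF lin(2)]
      by (intro lspan.add lspan_sum lspan.scale A S Ss)
  qed
qed

end

section \<open>The left inverse modulo relations\<close>

text \<open>The recursion is forced by \<open>tau_mult_below\<close>, the values at \<open>q = 0\<close> by \<open>spanning_rewrite\<close>: \<open>Psi\<close> has to kill
  the monomials that are nested for \<open>H\<close> but not for \<open>H'\<close>.\<close>

fun theta :: "nat \<Rightarrow> nat \<Rightarrow> nat \<Rightarrow> rat" where
  "theta k n 0 = (if k \<le> n then (-1) ^ (n - k) else 0)"
| "theta k n (Suc q) = - theta k (Suc n) q - theta k n q"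

text \<open>Makes the truncated exponent \<open>nb m + count m p - k\<close> in \<open>tau\<close>
  harmless.\<close>

lemma theta_small: "n + q < k \<Longrightarrow> theta k n q = 0"
  by (induction q arbitrary: n) auto

text \<open>From \<open>k \<le> n\<close> on, the values at \<open>q = 0\<close> alternate in sign,
  so the recursion gives zero, and zero propagates. Needed for monomials that are divisible by
  \<open>x_p\<close> and span \<open>p\<close>.\<close>

lemma theta_large: "k \<le> n \<Longrightarrow> theta k n (Suc q) = 0"
  by (induction q arbitrary: n) (auto simp: Suc_diff_le)

lemma polys_power: "f \<in> polys K \<Longrightarrow> f ^ n \<in> polys K"
  by (induction n) auto

context blow_order
begin

section \<open>Completing a set of atoms to a spanning set of \<open>p\<close>\<close>

definition completes :: "'a set \<Rightarrow> 'a set \<Rightarrow> bool" where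
  "completes S T \<longleftrightarrow> T \<subseteq> atoms_in p (atoms L) \<and> spans p (S \<union> T) \<and> (\<forall>t\<in>T. \<not> spans p (S \<union> (T - {t})))"

definition completion :: "'a set \<Rightarrow> 'a set" where
  "completion S = (SOME T. completes S T)"

text \<open>The corank, in the interval below \<open>p\<close>, of the atoms of \<open>S\<close>
  below \<open>p\<close>.\<close>

definition kappa :: "'a set \<Rightarrow> nat" where
  "kappa S = card (completion S)"

lemma spans_atoms: "spans p (atoms L)"
  using atoms_below[of p] by (simp add: spans_def atoms_in_def)

lemma spans_atoms_in: "spans p (S \<union> Z) \<Longrightarrow> spans p (S \<union> atoms_in p Z)"
proof -
  have "atoms_in p (S \<union> atoms_in p Z) = atoms_in p (S \<union> Z)" by (auto simp: atoms_in_def)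
  then show "spans p (S \<union> Z) \<Longrightarrow> ?thesis" by (simp add: spans_def)
qed

text \<open>Finding the completion inside a given \<open>Z\<close> matters in
  \<open>nb_kappa\<close>, where it is taken from the factors of a monomial.\<close>

lemma completes_exists:
  assumes "spans p (S \<union> Z)" obtains T where "T \<subseteq> atoms_in p Z" "completes S T"
proof -
  let ?P = "\<lambda>T. T \<subseteq> atoms_in p Z \<and> spans p (S \<union> T)"
  have "?P (atoms_in p Z)" using spans_atoms_in[OF assms] by simp
  then obtain T where T: "?P T" "\<And>U. ?P U \<Longrightarrow> card T \<le> card U"
    using arg_min_nat_lemma[of ?P _ card] by blast
  have fin: "finite T" using finite_subset[OF conjunct1[OF T(1)] finite_atoms_in] .
  have "\<not> spans p (S \<union> (T - {t}))" if "t \<in> T" for t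
  proof
    assume "spans p (S \<union> (T - {t}))"
    then have "card T \<le> card (T - {t})" using T(1) by (intro T(2)) auto
    then show False using card_Diff1_less[OF fin that] by linarith
  qed
  then have "completes S T" using T(1) by (auto simp: completes_def atoms_in_def)
  then show thesis using T(1) that by blast
qed

lemma completes_completion: "completes S (completion S)"
proof -
  have "spans p (S \<union> atoms L)" using spans_mono[OF spans_atoms] by simp
  then obtain T where "completes S T" by (rule completes_exists)
  then show ?thesis unfolding completion_def by (rule someI)
qed

lemma completesD:
  assumes "completes S T"
  shows "T \<subseteq> H" "finite T" "spans p (S \<union> T)" "\<And>t. t \<in> T \<Longrightarrow> t \<in> atoms L" "\<And>t. t \<in> T \<Longrightarrow> t \<sqsubseteq> p"
    "\<And>t. t \<in> T \<Longrightarrow> \<not> spans p (S \<union> (T - {t}))"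
proof -
  have "T \<subseteq> atoms_in p (atoms L)" using assms by (simp add: completes_def)
  then show "finite T" using finite_subset[OF _ finite_atoms_in] by blast
qed (use assms atoms_H in \<open>auto simp: completes_def atoms_in_def\<close>)

text \<open>The chosen completions themselves agree, not just their classes modulo the relations,
  because being a completion depends on \<open>S\<close> only through that join.\<close>

lemma completion_cong:
  assumes "\<Squnion>(atoms_in p S) = \<Squnion>(atoms_in p S')" shows "completion S = completion S'"
  unfolding completion_def completes_def using spans_cong[OF assms p_closed] by simp

lemma kappa_zero_iff: "kappa S = 0 \<longleftrightarrow> spans p S"
proof -
  note c = completesD[OF completes_completion[of S]]
  show ?thesis
  proof
    assume "kappa S = 0"
    then show "spans p S" using c(2,3) by (simp add: kappa_def)
  next
    assume s: "spans p S"
    have "completion S = {}"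
    proof (rule ccontr)
      assume "completion S \<noteq> {}"
      then obtain t where t: "t \<in> completion S" by auto
      have "spans p (S \<union> (completion S - {t}))" using spans_mono[OF s] by simp
      then show False using c(6)[OF t] by simp
    qed
    then show "kappa S = 0" by (simp add: kappa_def)
  qed
qed

definition cp :: "'a pol" where "cp = csum L H p"

lemma cp_polys [intro]: "cp \<in> polys H"
  unfolding cp_def by (rule csum_polys)

lemma spanning_cp:
  assumes "b \<in> atoms L" "b \<sqsubseteq> p" "S \<subseteq> H" "set_mset m \<subseteq> H" "spans p (insert b (S \<union> set_mset m))" "f \<in> polys H"
  shows "iota S (xm m * (xm {#b#} + cp) * f) \<in> rel_span L H r"
  unfolding cp_def using rel_span_spanning[OF p_G p_not_atom] assms by blast

definition xs :: "'a set \<Rightarrow> 'a pol" where "xs T = xm (mset_set T)"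

lemma xs_insert: "finite T \<Longrightarrow> b \<notin> T \<Longrightarrow> xs (insert b T) = xs T * xm {#b#}"
  unfolding xs_def using xm_add[of "mset_set T" "{#b#}"] by simp

lemma xs_polys: "finite T \<Longrightarrow> T \<subseteq> H \<Longrightarrow> xs T \<in> polys H"
  unfolding xs_def by (intro polys_xm) simp

text \<open>The exchange property makes \<open>Psi\<close> independent of the choice of a completion, modulo the relations.\<close>

lemma completes_step:
  assumes T: "completes S T" and T': "completes S T'" and b: "b \<in> T" "b \<notin> T'"
  obtains b' where "b' \<in> T'" "b' \<notin> T" "completes S (insert b' (T - {b}))"
proof -
  let ?S0 = "S \<union> (T - {b})"
  note t = completesD[OF T] and t' = completesD[OF T']
  have ns: "\<not> spans p ?S0" using t(6)[OF b(1)] .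
  \<comment> \<open>If all of \<open>T'\<close> were below the join of the atoms left without
    \<open>b\<close>, these atoms would already span \<open>p\<close>.\<close>
  have "\<exists>b'\<in>T'. \<not> b' \<sqsubseteq> \<Squnion>(atoms_in p ?S0)"
  proof (rule ccontr)
    assume *: "\<not> ?thesis"
    have "p \<sqsubseteq> \<Squnion>(atoms_in p ?S0)"
    proof (rule spansD[OF t'(3)])
      fix a assume a: "a \<in> S \<union> T'" "a \<in> atoms L" "a \<sqsubseteq> p"
      show "a \<sqsubseteq> \<Squnion>(atoms_in p ?S0)"
      proof (cases "a \<in> T'")
        case False
        then have "a \<in> atoms_in p ?S0" using a by (auto simp: atoms_in_def)
        then show ?thesis by (intro Sup_upper) auto
      qed (use * in blast)
    qed auto
    then have "spans p ?S0" unfolding spans_def using Sup_atoms_in_le le_antisym by simp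
    then show False using ns by simp
  qed
  then obtain b' where b': "b' \<in> T'" "\<not> b' \<sqsubseteq> \<Squnion>(atoms_in p ?S0)" by blast
  have b'a: "b' \<in> atoms L" "b' \<sqsubseteq> p" using t' b' by auto
  have ba: "b \<in> atoms L" "b \<sqsubseteq> p" using t b by auto
  have "b' \<notin> atoms_in p ?S0" using b'(2) Sup_upper[of "atoms_in p ?S0" b'] by auto
  then have nb': "b' \<notin> S" "b' \<notin> T - {b}" using b'a by (auto simp: atoms_in_def)
  then have nT: "b' \<notin> T" using b' b by auto
  have eqT: "insert b ?S0 = S \<union> T" using b by auto
  have "spans p (insert b' ?S0)"
    by (rule spans_insert_exchange[OF p_closed ba b'a _ b'(2)]) (use t(3) eqT in simp)
  then have sp: "spans p (S \<union> insert b' (T - {b}))" by simp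
  have "\<not> spans p (S \<union> (insert b' (T - {b}) - {u}))" if u: "u \<in> insert b' (T - {b})" for u
  proof
    assume su: "spans p (S \<union> (insert b' (T - {b}) - {u}))"
    show False
    proof (cases "u = b'")
      case True
      then have "S \<union> (insert b' (T - {b}) - {u}) = ?S0" using nb' by auto
      then show False using su ns by simp
    next
      case False
      then have uT: "u \<in> T" "u \<noteq> b" using u by auto
      let ?S1 = "S \<union> (T - {b} - {u})"
      have ua: "u \<in> atoms L" "u \<sqsubseteq> p" using t uT by auto
      have su': "spans p (insert b' ?S1)" using su False by (simp add: insert_Diff_if)
      show False
      proof (cases "u \<sqsubseteq> \<Squnion>(atoms_in p ?S1)")
        case False
        have "spans p (insert u ?S1)" by (rule spans_insert_exchange[OF p_closed b'a ua su' False])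
        moreover have "insert u ?S1 = ?S0" using uT by auto
        ultimately show False using ns by simp
      next
        case True
        have "p \<sqsubseteq> \<Squnion>(atoms_in p (S \<union> (T - {u})))"
        proof (rule spansD[OF t(3)])
          fix a assume a: "a \<in> S \<union> T" "a \<in> atoms L" "a \<sqsubseteq> p"
          show "a \<sqsubseteq> \<Squnion>(atoms_in p (S \<union> (T - {u})))"
          proof (cases "a = u")
            case True
            have "\<Squnion>(atoms_in p ?S1) \<sqsubseteq> \<Squnion>(atoms_in p (S \<union> (T - {u})))"
              by (intro Sup_mono atoms_in_mono) auto
            then show ?thesis using le_trans[OF \<open>u \<sqsubseteq> \<Squnion>(atoms_in p ?S1)\<close>] True ua by simp
          next
            case False
            then have "a \<in> atoms_in p (S \<union> (T - {u}))" using a by (auto simp: atoms_in_def)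
            then show ?thesis by (intro Sup_upper) auto
          qed
        qed auto
        then have "spans p (S \<union> (T - {u}))" unfolding spans_def using Sup_atoms_in_le le_antisym by simp
        then show False using t(6)[OF uT(1)] by simp
      qed
    qed
  qed
  then have "completes S (insert b' (T - {b}))"
    using sp T b'a atoms_H by (auto simp: completes_def atoms_in_def)
  then show thesis using that b' nT by blast
qed

text \<open>Induction on the number of elements of \<open>T\<close> outside \<open>T'\<close>. An
  exchange step replaces \<open>b\<close> by \<open>b'\<close>; next to \<open>T - {b}\<close> both
  \<open>x_b\<close> and \<open>x_b'\<close> equal \<open>- c_p\<close>, so the two products agree
  modulo the relations.\<close>

lemma completes_unique:
  assumes f: "f \<in> polys H"
  shows "completes S T \<Longrightarrow> completes S T' \<Longrightarrow>
    card T = card T' \<and> (S \<subseteq> H \<longrightarrow> iota S (xs T * f) - iota S (xs T' * f) \<in> rel_span L H r)"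
proof (induction "card (T - T')" arbitrary: T)
  case 0
  note t = completesD[OF 0(2)] and t' = completesD[OF 0(3)]
  have sub: "T \<subseteq> T'" using 0(1) t(2) by auto
  have "T = T'"
  proof (rule ccontr)
    assume "T \<noteq> T'"
    then obtain u where u: "u \<in> T'" "u \<notin> T" using sub by auto
    have "spans p (S \<union> (T' - {u}))" by (rule spans_mono[OF t(3)]) (use sub u in auto)
    then show False using t'(6)[OF u(1)] by simp
  qed
  then show ?case by (simp add: lspan.zero)
next
  case (Suc n)
  note t = completesD[OF Suc(3)]
  have "T - T' \<noteq> {}" using Suc(2) by (metis card.empty nat.distinct(1))
  then obtain b where b: "b \<in> T" "b \<notin> T'" by auto
  obtain b' where b': "b' \<in> T'" "b' \<notin> T" "completes S (insert b' (T - {b}))"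
    using completes_step[OF Suc(3,4) b] by blast
  let ?T1 = "insert b' (T - {b})"
  note t1 = completesD[OF b'(3)]
  have "?T1 - T' = (T - T') - {b}" using b b' by auto
  moreover have "b \<in> T - T'" "finite (T - T')" using b t(2) by auto
  ultimately have n: "n = card (?T1 - T')" using Suc(2) by simp
  have IH: "card ?T1 = card T'" "S \<subseteq> H \<Longrightarrow> iota S (xs ?T1 * f) - iota S (xs T' * f) \<in> rel_span L H r"
    using Suc(1)[OF n b'(3) Suc(4)] by auto
  have fin: "finite (T - {b})" using t(2) by simp
  have "card ?T1 = Suc (card (T - {b}))" using b' fin by (intro card_insert_disjoint) auto
  then have card: "card ?T1 = card T" using card_Suc_Diff1[OF t(2) b(1)] by (rule trans)
  have sub: "set_mset (mset_set (T - {b})) \<subseteq> H" using fin t(1) by auto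
  have e: "xs T = xs (T - {b}) * xm {#b#}" using xs_insert[OF fin, of b] b by (simp add: insert_absorb)
  have e1: "xs ?T1 = xs (T - {b}) * xm {#b'#}" using xs_insert[OF fin, of b'] b' by simp
  have eq: "insert b (S \<union> set_mset (mset_set (T - {b}))) = S \<union> T"
    "insert b' (S \<union> set_mset (mset_set (T - {b}))) = S \<union> ?T1" using fin b by auto
  have "iota S (xs T * f) - iota S (xs T' * f) \<in> rel_span L H r" if S: "S \<subseteq> H"
  proof -
    have "iota S (xs (T - {b}) * (xm {#b#} + cp) * f) \<in> rel_span L H r"
      unfolding xs_def using t b eq by (intro spanning_cp S sub f) auto
    moreover have "iota S (xs (T - {b}) * (xm {#b'#} + cp) * f) \<in> rel_span L H r"
      unfolding xs_def using t1 eq by (intro spanning_cp S sub f) auto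
    ultimately have "iota S (xs (T - {b}) * (xm {#b#} + cp) * f) - iota S (xs (T - {b}) * (xm {#b'#} + cp) * f)
      \<in> rel_span L H r" by (rule lspan_diff)
    then have "iota S (xs T * f) - iota S (xs ?T1 * f) \<in> rel_span L H r"
      unfolding e e1 iota_simps(5)[symmetric] by (simp add: algebra_simps)
    then have "iota S (xs T * f) - iota S (xs ?T1 * f) + (iota S (xs ?T1 * f) - iota S (xs T' * f)) \<in> rel_span L H r"
      using IH(2)[OF S] by (rule lspan.add)
    then show ?thesis by simp
  qed
  then show ?case using IH(1) card by simp
qed

lemma completes_card: "completes S T \<Longrightarrow> completes S T' \<Longrightarrow> card T = card T'"
  using completes_unique[OF polys_zero] by blast

section \<open>The polynomial maps that enter the left inverse\<close>

definition nb :: "'a multiset \<Rightarrow> nat" where "nb m = size {#g \<in># m. g \<sqsubseteq> p \<and> g \<noteq> p#}"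
definition rest :: "'a multiset \<Rightarrow> 'a multiset" where "rest m = {#g \<in># m. \<not> g \<sqsubseteq> p#}"

lemma rest_subset: "set_mset m \<subseteq> H' \<Longrightarrow> set_mset (rest m) \<subseteq> H"
  by (auto simp: rest_def)

text \<open>A monomial with \<open>n\<close> factors strictly below \<open>p\<close> and
  \<open>q\<close> factors \<open>x_p\<close> keeps its other factors and receives
  \<open>c_p\<close> to the power \<open>n + q - k\<close>. The degree drops by \<open>k\<close>; in
  \<open>Psi0\<close>, where \<open>k = kappa S\<close>, the factor \<open>xs (completion S)\<close>
  restores it.\<close>

definition tau :: "nat \<Rightarrow> 'a pol \<Rightarrow> 'a pol" where
  "tau k = lin_ext (\<lambda>m. scale (theta k (nb m) (count m p)) (xm (rest m) * cp ^ (nb m + count m p - k)))"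

lemma linear_tau: "linear_map (tau k)"
  unfolding tau_def by (rule linear_lin_ext)

lemmas tau_simps = linear_map_add[OF linear_tau] linear_map_scale[OF linear_tau]
  linear_map_zero[OF linear_tau] linear_map_uminus[OF linear_tau] linear_map_diff[OF linear_tau]
  linear_map_sum[OF linear_tau]

lemma tau_xm: "tau k (xm m) = scale (theta k (nb m) (count m p)) (xm (rest m) * cp ^ (nb m + count m p - k))"
  by (simp add: tau_def xm_def lin_ext_def)

lemma tau_polys: "f \<in> polys H' \<Longrightarrow> tau k f \<in> polys H"
proof (induction rule: polys_induct)
  case (xm m)
  then show ?case unfolding tau_xm
    by (intro polys_scale polys_mult polys_xm rest_subset polys_power cp_polys)
qed (auto simp: tau_simps)

lemma tau_mult_not_below: "\<not> h \<sqsubseteq> p \<Longrightarrow> tau k (xm {#h#} * f) = xm {#h#} * tau k f"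
proof (induction f rule: pol_induct)
  case (xm m)
  have "nb (add_mset h m) = nb m" "rest (add_mset h m) = add_mset h (rest m)" "count (add_mset h m) p = count m p"
    using xm by (auto simp: nb_def rest_def)
  then show ?case unfolding xm_insert[symmetric] tau_xm
    by (simp add: xm_insert[of h "rest m"] scale_mult_right mult.assoc)
qed (simp_all add: tau_simps distrib_left scale_mult_right)

text \<open>The map is built so that \<open>x_b + x_p\<close>, the image of \<open>x_b\<close> under
  the substitution, acts as \<open>- c_p\<close>. On coefficients this is the recursion of
  \<open>theta\<close>.\<close>

lemma tau_mult_below:
  assumes b: "b \<sqsubseteq> p" "b \<noteq> p"
  shows "tau k (xm {#b#} * f) + tau k (xm {#p#} * f) = - cp * tau k f"
proof (induction f rule: pol_induct)
  case (xm m)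
  let ?n = "nb m" and ?q = "count m p"
  have 1: "nb (add_mset b m) = Suc ?n" "rest (add_mset b m) = rest m" "count (add_mset b m) p = ?q"
    using b by (auto simp: nb_def rest_def)
  have 2: "nb (add_mset p m) = ?n" "rest (add_mset p m) = rest m" "count (add_mset p m) p = Suc ?q"
    by (auto simp: nb_def rest_def)
  have "tau k (xm {#b#} * xm m) + tau k (xm {#p#} * xm m)
    = scale (theta k (Suc ?n) ?q + theta k ?n (Suc ?q)) (xm (rest m) * cp ^ (Suc (?n + ?q) - k))"
    unfolding xm_insert[symmetric] tau_xm 1 2 by (simp only: add_Suc add_Suc_right scale_add_left)
  also have "\<dots> = scale (- theta k ?n ?q) (xm (rest m) * cp ^ (Suc (?n + ?q) - k))" by simp
  also have "\<dots> = - cp * tau k (xm m)"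
  proof (cases "k \<le> ?n + ?q")
    case True
    then have "cp ^ (Suc (?n + ?q) - k) = cp * cp ^ (?n + ?q - k)" by (simp add: Suc_diff_le)
    then show ?thesis unfolding tau_xm by (simp add: scale_uminus scale_mult_right ac_simps)
  next
    case False
    then show ?thesis unfolding tau_xm by (simp add: theta_small)
  qed
  finally show ?case .
qed (simp_all add: tau_simps algebra_simps scale_mult_right scale_mult_left scale_add[symmetric] scale_uminus)

lemma tau_one: "tau k 1 = (if k = 0 then 1 else 0)"
  using tau_xm[of k "{#}"] by (simp add: nb_def rest_def)

definition kill_p :: "'a pol \<Rightarrow> 'a pol" where
  "kill_p = subst (\<lambda>g. if g = p then 0 else xm {#g#})"

text \<open>Applied to the coefficient of \<open>e_p\<close>. Again \<open>x_b + x_p\<close> goes to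
  \<open>- c_p\<close> for an atom \<open>b \<le> p\<close>, so that the \<open>c_b\<close> of
  \<open>H'\<close> goes to the \<open>c_b\<close> of \<open>H\<close> minus
  \<open>x_b + c_p\<close>, and the latter is a relation next to a spanning set.\<close>

definition ups :: "'a pol \<Rightarrow> 'a pol" where
  "ups = subst (\<lambda>g. if g = p then - cp else if g \<sqsubseteq> p then 0 else xm {#g#})"

lemma kill_p_polys: "f \<in> polys H' \<Longrightarrow> kill_p f \<in> polys H"
  unfolding kill_p_def by (rule subst_polys) auto

lemma ups_polys: "f \<in> polys H' \<Longrightarrow> ups f \<in> polys H"
  unfolding ups_def by (rule subst_polys) auto

definition a0 :: 'a where "a0 = (SOME a. a \<in> atoms L \<and> a \<sqsubseteq> p)"

lemma a0: "a0 \<in> atoms L" "a0 \<sqsubseteq> p" "a0 \<in> H"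
proof -
  have "\<exists>a. a \<in> atoms L \<and> a \<sqsubseteq> p"
  proof (rule ccontr)
    assume "\<not> ?thesis"
    then have "{a \<in> atoms L. a \<sqsubseteq> p} = {}" by auto
    then have "\<Squnion>{} = p" using atoms_below[OF p_closed] by (simp only:)
    then have "p = \<bottom>" by (simp only: Sup_empty)
    then show False using p_G G_not_bottom by blast
  qed
  then have "a0 \<in> atoms L \<and> a0 \<sqsubseteq> p" unfolding a0_def by (rule someI_ex)
  then show "a0 \<in> atoms L" "a0 \<sqsubseteq> p" "a0 \<in> H" using atoms_H by auto
qed

section \<open>The left inverse\<close>

definition PsiE :: "'a set \<Rightarrow> 'a pol \<Rightarrow> 'a gca" where
  "PsiE S f = (if spans p (insert a0 S) then mul r (iota {a0} 1) (iota S f) else 0)"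

text \<open>Since \<open>p\<close> comes first in \<open>r0\<close>, the monomial with an index set
  \<open>S\<close> containing \<open>p\<close> is \<open>e_p\<close> times the one with index set
  \<open>S - {p}\<close>, without a sign.\<close>

definition Psi0 :: "'a set \<Rightarrow> 'a pol \<Rightarrow> 'a gca" where
  "Psi0 S f = (if p \<in> S then PsiE (S - {p}) (ups f)
     else iota S (kill_p f) - iota S (xs (completion S) * tau (kappa S) f))"

definition Psi :: "'a gca \<Rightarrow> 'a gca" where
  "Psi = lin_ext (\<lambda>(S, m). Psi0 S (xm m))"

lemma linear_Psi: "linear_map Psi"
  unfolding Psi_def by (rule linear_lin_ext)

lemmas Psi_simps = linear_map_add[OF linear_Psi] linear_map_scale[OF linear_Psi]
  linear_map_zero[OF linear_Psi] linear_map_uminus[OF linear_Psi] linear_map_diff[OF linear_Psi]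
  linear_map_sum[OF linear_Psi]

lemma linear_PsiE: "linear_map (PsiE S)"
proof (cases "spans p (insert a0 S)")
  case True
  then have "PsiE S = (\<lambda>f. mul r (iota {a0} 1) (iota S f))" by (auto simp: PsiE_def)
  then show ?thesis using linear_map_comp[OF linear_mul(1) linear_iota] by simp
next
  case False
  then have "PsiE S = (\<lambda>f. 0)" by (auto simp: PsiE_def)
  then show ?thesis using linear_map_const_zero by simp
qed

lemma linear_Psi0: "linear_map (Psi0 S)"
proof (cases "p \<in> S")
  case True
  then have "Psi0 S = (\<lambda>f. PsiE (S - {p}) (ups f))" by (auto simp: Psi0_def)
  then show ?thesis unfolding ups_def using linear_map_comp[OF linear_PsiE linear_subst] by simp
next
  case False
  have "linear_map (\<lambda>f. iota S (kill_p f) - iota S (xs (completion S) * tau (kappa S) f))"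
    unfolding kill_p_def
    by (intro linear_map_diff_fun linear_map_comp[OF linear_iota linear_subst]
        linear_map_comp[OF linear_map_comp[OF linear_iota linear_map_mult(1)] linear_tau])
  moreover have "Psi0 S = (\<lambda>f. iota S (kill_p f) - iota S (xs (completion S) * tau (kappa S) f))"
    using False by (auto simp: Psi0_def)
  ultimately show ?thesis by simp
qed

lemma Psi_iota: "Psi (iota S f) = Psi0 S f"
  unfolding Psi_def by (rule lin_ext_iota[where h = Psi0, OF linear_Psi0])

abbreviation J :: "'a gca set" where "J \<equiv> rel_span L H r"

lemma completion_mult_polys: "f \<in> polys H \<Longrightarrow> xs (completion S) * f \<in> polys H"
  using completesD[OF completes_completion] by (intro polys_mult xs_polys)

lemma PsiE_J:
  assumes "spans p (insert a0 S) \<Longrightarrow> a0 \<notin> S \<Longrightarrow> iota (insert a0 S) f \<in> J"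
  shows "PsiE S f \<in> J"
  using assms by (auto simp: PsiE_def mul_iota lspan.zero intro: lspan.scale)

text \<open>The join of a subset of \<open>C\<close>, if it were in \<open>H\<close>, would be an
  element of \<open>H\<close> below \<open>p\<close>, hence an atom, and so not the join of an
  antichain with two elements.\<close>

lemma lcircuit_below_nested:
  assumes "lcircuit L C" "C \<subseteq> below" shows "circuit L H C"
proof -
  have CH: "C \<subseteq> H" using lcircuit_atoms[OF assms(1)] atoms_H by auto
  have "C \<in> nested L H"
  proof (rule ccontr)
    assume "C \<notin> nested L H"
    then obtain V where V: "V \<subseteq> C" "2 \<le> card V" "antichain L V" "\<Squnion>V \<in> H" using CH by (auto elim: not_nestedE)
    then have "\<Squnion>V \<sqsubseteq> p" using CH H_carrier assms(2) by (subst Sup_le_iff) (auto simp: below_def)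
    then have "\<Squnion>V \<in> atoms L" using V H_le_p by simp
    moreover have "V \<subseteq> G" using V CH H_G by auto
    ultimately show False using antichain_Sup_not_atom V by blast
  qed
  then show ?thesis using assms by (simp add: circuit_def)
qed

text \<open>The atom \<open>a\<close> lies below \<open>p\<close>, which is the join of the atoms of
  \<open>S\<close> below \<open>p\<close>, and therefore depends on them.\<close>

lemma dependent_spanning:
  assumes S: "S \<subseteq> H" "spans p S" and a: "a \<in> atoms L" "a \<sqsubseteq> p" "a \<notin> S"
  obtains C where "circuit L H C" "C \<subseteq> insert a (atoms_in p S)"
proof -
  let ?A = "insert a (atoms_in p S)"
  have "?A - {a} = atoms_in p S" using a by (auto simp: atoms_in_def)
  then have "a \<sqsubseteq> \<Squnion>(?A - {a})" using S a by (simp add: spans_def)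
  then obtain C where C: "C \<subseteq> ?A" "lcircuit L C"
    using dependent_has_lcircuit[of ?A a] a by (auto simp: atoms_in_def)
  then have "C \<subseteq> below" using a by (auto simp: atoms_in_def below_def)
  then show thesis using that lcircuit_below_nested C by blast
qed

lemma dependent_spanning_J:
  assumes S: "S \<subseteq> H" "spans p S" and a: "a \<in> atoms L" "a \<sqsubseteq> p" "a \<notin> S" and f: "f \<in> polys H"
  shows "iota (insert a S) f \<in> J"
proof -
  obtain C where C: "circuit L H C" "C \<subseteq> insert a (atoms_in p S)" using dependent_spanning[OF S a] .
  show ?thesis
    by (rule dependent_rel_span[OF C(1) _ _ f]) (use C S a atoms_H in \<open>auto simp: atoms_in_def\<close>)
qed

lemma nb_rest_add [simp]: "nb (m + n) = nb m + nb n" "rest (m + n) = rest m + rest n"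
  by (simp_all add: nb_def rest_def)

text \<open>As \<open>S\<close> and \<open>t\<close> already span \<open>p\<close>, the factor
  \<open>x_g + c_p\<close> gives a relation for every atom \<open>g \<le> p\<close>; the factors of
  \<open>m\<close> below \<open>p\<close> are traded for \<open>- c_p\<close> one by one.\<close>

lemma spanning_rewrite:
  assumes S: "S \<subseteq> H" "set_mset t \<subseteq> H" "spans p (S \<union> set_mset t)" and m: "set_mset m \<subseteq> H" and f: "f \<in> polys H"
  shows "iota S (xm t * xm m * f) - iota S (xm t * ((- cp) ^ nb m * xm (rest m)) * f) \<in> J"
  using m f
proof (induction m arbitrary: f)
  case empty
  then show ?case by (simp add: nb_def rest_def lspan.zero)
next
  case (add g m)
  have gH: "g \<in> H" "set_mset m \<subseteq> H" using add by auto
  have gx: "xm {#g#} * f \<in> polys H" using gH add.prems by (intro polys_mult polys_xm) auto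
  have cf: "- cp * f \<in> polys H" using add.prems by (intro polys_mult polys_uminus cp_polys)
  have base: "xm t * xm (add_mset g m) * f = xm t * xm m * (xm {#g#} * f)"
    by (simp add: xm_insert[of g m] ac_simps)
  show ?case
  proof (cases "g \<sqsubseteq> p")
    case False
    then have n: "nb (add_mset g m) = nb m" "rest (add_mset g m) = add_mset g (rest m)"
      by (auto simp: nb_def rest_def)
    have "xm t * ((- cp) ^ nb m * xm (rest m)) * (xm {#g#} * f)
      = xm t * ((- cp) ^ nb (add_mset g m) * xm (rest (add_mset g m))) * f"
      unfolding n by (simp add: xm_insert[of g "rest m"] ac_simps)
    then show ?thesis using add.IH[OF gH(2) gx] unfolding base by simp
  next
    case True
    then have ga: "g \<in> atoms L" "g \<noteq> p" using H_le_p gH p_notin by auto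
    have n: "nb (add_mset g m) = Suc (nb m)" "rest (add_mset g m) = rest m"
      using True ga by (auto simp: nb_def rest_def)
    have "iota S (xm t * (xm {#g#} + cp) * (xm m * f)) \<in> J"
      using gH add.prems S by (intro spanning_cp ga True polys_mult polys_xm spans_mono[OF S(3)]) auto
    moreover have "xm t * (xm {#g#} + cp) * (xm m * f) = xm t * xm (add_mset g m) * f - xm t * xm m * (- cp * f)"
      unfolding base by (simp add: algebra_simps)
    ultimately have "iota S (xm t * xm (add_mset g m) * f) - iota S (xm t * xm m * (- cp * f)) \<in> J"
      by (simp add: iota_simps)
    from lspan.add[OF this add.IH[OF gH(2) cf]]
    have "iota S (xm t * xm (add_mset g m) * f)
      - iota S (xm t * ((- cp) ^ nb m * xm (rest m)) * (- cp * f)) \<in> J" by simp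
    moreover have "xm t * ((- cp) ^ nb m * xm (rest m)) * (- cp * f)
      = xm t * ((- cp) ^ nb (add_mset g m) * xm (rest (add_mset g m))) * f"
      unfolding n by (simp add: ac_simps)
    ultimately show ?thesis by simp
  qed
qed

text \<open>A completion of \<open>S\<close> can be chosen among the factors of \<open>m\<close>.
  Its \<open>kappa S\<close> elements are distinct atoms below \<open>p\<close>, hence counted by
  \<open>nb\<close>.\<close>

lemma nb_kappa:
  assumes "set_mset m \<subseteq> H'" "spans p (S \<union> set_mset m)"
  obtains B where "completes S B" "mset_set B \<subseteq># m" "card B = kappa S" "kappa S \<le> nb m"
    "B \<subseteq> atoms_in p (set_mset m)"
proof -
  obtain B where B: "B \<subseteq> atoms_in p (set_mset m)" "completes S B" using completes_exists[OF assms(2)] .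
  note b = completesD[OF B(2)]
  have sub: "mset_set B \<subseteq># {#g \<in># m. g \<sqsubseteq> p \<and> g \<noteq> p#}"
  proof (rule mset_subset_eqI)
    fix x show "count (mset_set B) x \<le> count {#g \<in># m. g \<sqsubseteq> p \<and> g \<noteq> p#} x"
      using B(1) b(2) p_not_atom by (cases "x \<in> B") (auto simp: atoms_in_def)
  qed
  have "card B = kappa S"
    unfolding kappa_def by (rule completes_card[OF B(2) completes_completion])
  moreover have "card B \<le> nb m" using size_mset_mono[OF sub] by (simp add: nb_def)
  moreover have "mset_set B \<subseteq># m" using sub multiset_filter_subset subset_mset.order_trans by blast
  ultimately show thesis using that B by simp
qed

end

lemma scale_diff: "scale c (f - g) = scale c f - scale c g"
  by (rule poly_mapping_eqI) (simp add: lookup_scale lookup_minus algebra_simps)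

lemma uminus_power_scale: "(- f) ^ n = scale ((-1) ^ n) (f ^ n :: 'b pol)"
  by (induction n) (simp_all add: scale_mult_right scale_uminus)

context blow_order
begin

section \<open>The left inverse maps relations to relations\<close>

lemma kill_p_xm: "kill_p (xm m) = (if p \<in># m then 0 else xm m)"
proof (induction m)
  case (add g m)
  then show ?case unfolding kill_p_def xm_insert[of g m] subst_mult by auto
qed (simp add: kill_p_def)

lemma ups_xm: "ups (xm m) = (if nb m = 0 then (- cp) ^ count m p * xm (rest m) else 0)"
proof (induction m)
  case (add g m)
  have e: "ups (xm (add_mset g m)) = (if g = p then - cp else if g \<sqsubseteq> p then 0 else xm {#g#}) * ups (xm m)"
    unfolding ups_def xm_insert[of g m] subst_mult by simp
  consider "g = p" | "g \<noteq> p" "g \<sqsubseteq> p" | "g \<noteq> p" "\<not> g \<sqsubseteq> p" by blast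
  then show ?case
  proof cases
    case 1
    then have "nb (add_mset g m) = nb m" "rest (add_mset g m) = rest m" "count (add_mset g m) p = Suc (count m p)"
      by (auto simp: nb_def rest_def)
    then show ?thesis using 1 e add by simp
  next
    case 2
    then have "nb (add_mset g m) \<noteq> 0" by (auto simp: nb_def)
    then show ?thesis unfolding e using 2 by simp
  next
    case 3
    then have "nb (add_mset g m) = nb m" "rest (add_mset g m) = add_mset g (rest m)"
      "count (add_mset g m) p = count m p" by (auto simp: nb_def rest_def)
    then show ?thesis unfolding e add using 3 by (simp add: xm_insert[of g "rest m"] ac_simps)
  qed
qed (simp add: ups_def nb_def rest_def)

lemma spans_completion: "spans p (S \<union> completion S)"
  using completesD(3)[OF completes_completion] .

lemma completion_J:
  assumes S: "S \<subseteq> H" "set_mset m \<subseteq> H" and f: "f \<in> polys H"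
    and nn: "S \<union> completion S \<union> set_mset m \<notin> nested L H"
  shows "iota S (xs (completion S) * (xm m * f)) \<in> J"
proof -
  note c = completesD[OF completes_completion[of S]]
  have eq: "xs (completion S) * (xm m * f) = xm (mset_set (completion S) + m) * f"
    by (simp add: xs_def xm_add mult.assoc)
  have "S \<union> set_mset (mset_set (completion S) + m) = S \<union> completion S \<union> set_mset m"
    using c(2) by auto
  then show ?thesis unfolding eq using c S f nn by (intro rel_span_non_nested) auto
qed

text \<open>Adding the completion makes \<open>S\<close> span \<open>p\<close>. Hence
  \<open>not_nested_spanning\<close> can dispense with \<open>p\<close> and with the factors of
  \<open>m\<close> below it, which \<open>tau\<close> has traded away; the other factors survive in
  \<open>rest m\<close>.\<close>

lemma Psi0_tau_J:
  assumes S: "S \<subseteq> H" "set_mset m \<subseteq> H'"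
    and V: "V \<subseteq> insert p (S \<union> set_mset m)" "2 \<le> card V" "antichain L V" "\<Squnion>V \<in> H'" "\<Squnion>V \<noteq> p"
  shows "iota S (xs (completion S) * tau k (xm m)) \<in> J"
proof -
  have "S \<union> completion S \<union> set_mset (rest m) \<notin> nested L H"
  proof (rule not_nested_spanning[OF _ V(2-5)])
    show "V \<subseteq> H'" using V(1) S by auto
    show "spans p (S \<union> completion S \<union> set_mset (rest m))" by (rule spans_mono[OF spans_completion]) auto
    show "{v \<in> V. \<not> v \<sqsubseteq> p} \<subseteq> S \<union> completion S \<union> set_mset (rest m)" using V(1) by (auto simp: rest_def)
  qed
  then have "iota S (xs (completion S) * (xm (rest m) * cp ^ (nb m + count m p - k))) \<in> J"
    by (intro completion_J S(1) rest_subset S(2) polys_power cp_polys)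
  then show ?thesis unfolding tau_xm scale_mult_right iota_simps by (rule lspan.scale)
qed

lemma polys_iota_induct:
  assumes f: "f \<in> polys H'" and F: "linear_map F" and xm: "\<And>n. set_mset n \<subseteq> H' \<Longrightarrow> F (xm n) \<in> J"
  shows "F f \<in> J"
  using f by (induction rule: polys_induct)
    (auto simp: linear_map_add[OF F] linear_map_scale[OF F] linear_map_zero[OF F] intro: lspan.intros xm)

text \<open>The case behind the correction term is that \<open>S\<close> and \<open>m\<close> avoid
  \<open>p\<close> and are nested for \<open>H\<close>. Then they span \<open>p\<close>, and
  \<open>Psi0\<close> subtracts from the monomial its own normal form. In the other cases each
  summand is zero or lies in \<open>J\<close> by itself.\<close>

lemma Psi0_non_nested:
  assumes S: "S \<subseteq> H'" "set_mset m \<subseteq> H'" and nn: "S \<union> set_mset m \<notin> nested L H'"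
  shows "Psi0 S (xm m) \<in> J"
proof (cases "p \<in> S")
  case True
  define S0 where "S0 = S - {p}"
  have S0: "S0 \<subseteq> H" "S = insert p S0" using S True by (auto simp: S0_def)
  have "PsiE S0 (ups (xm m)) \<in> J"
  proof (rule PsiE_J)
    assume sp: "spans p (insert a0 S0)" and a0S: "a0 \<notin> S0"
    show "iota (insert a0 S0) (ups (xm m)) \<in> J"
    proof (cases "nb m = 0")
      case False
      then show ?thesis by (simp add: ups_xm iota_simps lspan.zero)
    next
      case True
      \<comment> \<open>No factor except \<open>x_p\<close> lies below \<open>p\<close>, so that
        \<open>rest m\<close> loses nothing but \<open>p\<close>.\<close>
      then have nob: "\<not> g \<sqsubseteq> p" if "g \<in># m" "g \<noteq> p" for g
        using that by (auto simp: nb_def filter_mset_eq_mempty_iff)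
      let ?M = "set_mset (rest m)"
      have restH: "?M \<subseteq> H" by (rule rest_subset[OF S(2)])
      have Meq: "insert p (S0 \<union> ?M) = S \<union> set_mset m"
        using nob S0 by (auto simp: rest_def)
      have val: "ups (xm m) = xm (rest m) * (- cp) ^ count m p" using True by (simp add: ups_xm mult.commute)
      have cpw: "(- cp) ^ count m p \<in> polys H" by (intro polys_power polys_uminus cp_polys)
      have "S0 \<union> ?M \<subseteq> H" "insert p (S0 \<union> ?M) \<notin> nested L H'" using S0 restH nn Meq by auto
      then show ?thesis
      proof (rule not_nested_with_p_cases)
        assume "spans p (S0 \<union> ?M)"
        moreover have "atoms_in p (S0 \<union> ?M) = atoms_in p S0" by (auto simp: atoms_in_def rest_def)
        ultimately have "spans p S0" by (simp add: spans_def)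
        then show ?thesis unfolding val
          using S0 restH cpw by (intro dependent_spanning_J a0 a0S polys_mult polys_xm)
      next
        fix V assume V: "V \<subseteq> insert p (S0 \<union> ?M)" "2 \<le> card V" "antichain L V" "\<Squnion>V \<in> H'" "\<Squnion>V \<noteq> p"
        have "insert a0 S0 \<union> ?M \<notin> nested L H"
        proof (rule not_nested_spanning[OF _ V(2-5)])
          show "V \<subseteq> H'" using V(1) S0 restH by auto
          show "spans p (insert a0 S0 \<union> ?M)" by (rule spans_mono[OF sp]) auto
          show "{v \<in> V. \<not> v \<sqsubseteq> p} \<subseteq> insert a0 S0 \<union> ?M" using V(1) by auto
        qed
        then show ?thesis unfolding val
          using S0 restH cpw a0 by (intro rel_span_non_nested) auto
      qed
    qed
  qed
  then show ?thesis using True by (simp add: Psi0_def S0_def)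
next
  case pS: False
  then have SH: "S \<subseteq> H" using S by auto
  note c = completesD[OF completes_completion[of S]]
  show ?thesis
  proof (cases "p \<in># m")
    case True
    define M where "M = S \<union> (set_mset m - {p})"
    have M: "M \<subseteq> H" "insert p M = S \<union> set_mset m" using SH S True by (auto simp: M_def)
    have "iota S (xs (completion S) * tau (kappa S) (xm m)) \<in> J"
      using M(1) nn[folded M(2)]
    proof (rule not_nested_with_p_cases)
      assume "spans p M"
      then have "spans p (S \<union> set_mset m)" by (rule spans_mono) (auto simp: M_def)
      \<comment> \<open>The completion is found among the factors of \<open>m\<close>, so
        \<open>theta_large\<close> applies; the factor \<open>x_p\<close> makes its last argument
        positive.\<close>
      then have "kappa S \<le> nb m" using nb_kappa[OF S(2)] by blast
      then have "theta (kappa S) (nb m) (count m p) = 0"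
        using True theta_large[of "kappa S" "nb m" "count m p - 1"] by (auto simp: Suc_diff_1)
      then show ?thesis by (simp add: tau_xm iota_simps lspan.zero)
    next
      fix V assume V: "V \<subseteq> insert p M" "2 \<le> card V" "antichain L V" "\<Squnion>V \<in> H'" "\<Squnion>V \<noteq> p"
      show ?thesis by (rule Psi0_tau_J[OF SH S(2) _ V(2-5)]) (use V(1) M in auto)
    qed
    then show ?thesis using True pS by (simp add: Psi0_def kill_p_xm iota_simps lspan_uminus)
  next
    case False
    then have mH: "set_mset m \<subseteq> H" using S by auto
    have k: "kill_p (xm m) = xm m" using False by (simp add: kill_p_xm)
    have U: "S \<union> set_mset m \<subseteq> H" using SH mH by simp
    show ?thesis
    proof (cases "S \<union> set_mset m \<in> nested L H")
      case nH: False
      obtain V where V: "V \<subseteq> S \<union> set_mset m" "2 \<le> card V" "antichain L V" "\<Squnion>V \<in> H"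
        using not_nestedE[OF nH U] by blast
      have "iota S (xs (completion S) * tau (kappa S) (xm m)) \<in> J"
        by (rule Psi0_tau_J[OF SH S(2) _ V(2,3)]) (use V p_notin in auto)
      moreover have "iota S (xm m * 1) \<in> J" using SH mH nH by (intro rel_span_non_nested) auto
      ultimately show ?thesis using pS by (simp add: Psi0_def k lspan_diff)
    next
      case True
      then have sp: "spans p (S \<union> set_mset m)" using not_nested_H'_cases[OF U nn] by simp
      obtain B where B: "completes S B" "mset_set B \<subseteq># m" "card B = kappa S" "kappa S \<le> nb m"
        using nb_kappa[OF S(2) sp] by metis
      note b = completesD[OF B(1)]
      define m1 where "m1 = m - mset_set B"
      have m: "m = mset_set B + m1" using B(2) by (simp add: m1_def)
      have m1H: "set_mset m1 \<subseteq> H" using mH by (auto simp: m1_def dest: in_diffD)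
      have Bm: "set_mset (mset_set B) = B" using b(2) by simp
      have "rest (mset_set B) = {#}" "nb (mset_set B) = card B"
      proof -
        show "rest (mset_set B) = {#}" unfolding rest_def filter_mset_eq_mempty_iff using b(2,5) by simp
        have "filter_mset (\<lambda>g. g \<sqsubseteq> p \<and> g \<noteq> p) (mset_set B) = mset_set B"
          using b p_not_atom by (subst filter_mset_eq_conv) auto
        then show "nb (mset_set B) = card B" by (simp add: nb_def)
      qed
      then have nr: "nb m1 = nb m - kappa S" "rest m1 = rest m" using B m by auto
      let ?w = "(- cp) ^ nb m1 * xm (rest m)"
      have wH: "?w \<in> polys H" by (intro polys_mult polys_power polys_uminus cp_polys polys_xm rest_subset S(2))
      have "iota S (xm (mset_set B) * xm m1 * 1) - iota S (xm (mset_set B) * ((- cp) ^ nb m1 * xm (rest m1)) * 1) \<in> J"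
        using SH b Bm m1H by (intro spanning_rewrite) auto
      moreover have "xm (mset_set B) * xm m1 * 1 = xm m" using m by (simp add: xm_add[symmetric])
      ultimately have 1: "iota S (xm m) - iota S (xs B * ?w) \<in> J" by (simp add: xs_def nr(2))
      have 2: "iota S (xs B * ?w) - iota S (xs (completion S) * ?w) \<in> J"
        using completes_unique[OF wH B(1) completes_completion] SH by blast
      have "count m p = 0" using False by (simp add: count_eq_zero_iff)
      \<comment> \<open>Without factors \<open>x_p\<close> the coefficient is the value of
        \<open>theta\<close> at 0, which is the sign of \<open>(- cp) ^ nb m1\<close>.\<close>
      then have "tau (kappa S) (xm m) = scale ((-1) ^ (nb m - kappa S)) (xm (rest m) * cp ^ (nb m - kappa S))"
        using B(4) by (simp add: tau_xm)
      also have "\<dots> = ?w" unfolding nr(1)[symmetric]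
        by (simp only: uminus_power_scale[of cp] scale_mult_left) (simp only: mult.commute)
      finally have "iota S (xm m) - iota S (xs (completion S) * tau (kappa S) (xm m)) \<in> J"
        using lspan.add[OF 1 2] by simp
      then show ?thesis using pS by (simp add: Psi0_def k)
    qed
  qed
qed

lemma circuit_H'_imp: "circuit L H' C \<Longrightarrow> circuit L H C"
  using nested_H'_imp lcircuit_atoms atoms_H unfolding circuit_def by blast

lemma circuit_H'_subset: "circuit L H' C \<Longrightarrow> C \<subseteq> H"
  using circuit_H'_imp circuitD(3) by blast

lemma J_mul_a0: "w \<in> J \<Longrightarrow> mul r (iota {a0} 1) w \<in> J"
  using a0 by (intro rel_span_mul_left[OF r finite_H] iota_in_carrier) auto

text \<open>Every term of \<open>Psi0 D f\<close> is a multiple of the product of the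
  \<open>e_g\<close> with \<open>g \<in> D - {p}\<close>, and these contain the circuit because
  \<open>C \<subseteq> H\<close>.\<close>

lemma Psi0_dependent:
  assumes C: "circuit L H' C" "C \<subseteq> D" "D \<subseteq> H'" and f: "f \<in> polys H'"
  shows "Psi0 D f \<in> J"
proof -
  have CH: "circuit L H C" "C \<subseteq> H" using C(1) circuit_H'_imp circuit_H'_subset by auto
  show ?thesis
  proof (cases "p \<in> D")
    case True
    have "iota (D - {p}) (ups f) \<in> J"
      by (rule dependent_rel_span[OF CH(1)]) (use C CH p_notin ups_polys[OF f] in auto)
    then have "PsiE (D - {p}) (ups f) \<in> J" by (simp add: PsiE_def J_mul_a0 lspan.zero)
    then show ?thesis using True by (simp add: Psi0_def)
  next
    case False
    then have "D \<subseteq> H" using C by auto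
    then have "iota D (kill_p f) \<in> J" "iota D (xs (completion D) * tau (kappa D) f) \<in> J"
      using C f by (auto intro!: dependent_rel_span[OF CH(1)] kill_p_polys completion_mult_polys tau_polys)
    then show ?thesis using False by (simp add: Psi0_def lspan_diff)
  qed
qed

text \<open>If \<open>C\<close> lies below \<open>p\<close>, then \<open>g\<close> is below the join
  of the other members; if no member of \<open>C\<close> is below \<open>p\<close>, then
  \<open>g\<close> is not counted at all. So all summands of a contraction along \<open>C\<close>
  share one completion and one spanning condition.\<close>

lemma atoms_in_remove_circuit:
  assumes C: "circuit L H C" "C \<subseteq> D" "g \<in> C" and "C \<subseteq> below \<or> C \<inter> below = {}"
  shows "\<Squnion>(atoms_in p (D - {g})) = \<Squnion>(atoms_in p D)"
  using assms(4)
proof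
  assume "C \<inter> below = {}"
  then have "atoms_in p (D - {g}) = atoms_in p D" using C by (auto simp: atoms_in_def below_def)
  then show ?thesis by simp
next
  assume b: "C \<subseteq> below"
  note c = circuitD[OF C(1)]
  have sub: "C - {g} \<subseteq> atoms_in p (D - {g})" using C b c by (auto simp: atoms_in_def below_def)
  have gc: "g \<in> carrier L" using C c atoms_subset by auto
  have "g \<sqsubseteq> \<Squnion>(C - {g})" by (rule lcircuit_le[OF c(1) C(3)])
  moreover have "\<Squnion>(C - {g}) \<sqsubseteq> \<Squnion>(atoms_in p (D - {g}))" using sub by (intro Sup_mono) auto
  moreover have "C - {g} \<subseteq> carrier L" using sub atoms_in_carrier by (rule subset_trans)
  ultimately have g: "g \<sqsubseteq> \<Squnion>(atoms_in p (D - {g}))" using le_trans gc by simp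
  show ?thesis
  proof (rule Sup_eqI)
    fix a assume a: "a \<in> atoms_in p D"
    show "a \<sqsubseteq> \<Squnion>(atoms_in p (D - {g}))"
    proof (cases "a = g")
      case False
      then have "a \<in> atoms_in p (D - {g})" using a by (auto simp: atoms_in_def)
      then show ?thesis by (intro Sup_upper) auto
    qed (use g in simp)
  next
    fix a assume "a \<in> atoms_in p (D - {g})"
    then have "a \<in> atoms_in p D" by (auto simp: atoms_in_def)
    then show "a \<sqsubseteq> \<Squnion>(atoms_in p D)" by (intro Sup_upper) auto
  qed auto
qed

text \<open>Unless \<open>C\<close> is mixed, completion and spanning condition do not depend on the
  deleted \<open>g\<close>, so contractions go to combinations of contractions along the same
  \<open>C\<close>, or to zero. For mixed \<open>C\<close> the correction terms and the residues are
  non-nested one by one.\<close>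

lemma Psi_contraction:
  assumes C: "circuit L H' C" "C \<subseteq> D" "D \<subseteq> H'" and f: "f \<in> polys H'"
  shows "Psi (contraction r0 C D f) \<in> J"
proof -
  have CH: "circuit L H C" "C \<subseteq> H" using C(1) circuit_H'_imp circuit_H'_subset by auto
  have Psi: "Psi (contraction r0 C D f) = (\<Sum>g\<in>C. scale ((-1) ^ inversions r0 {g} D) (Psi0 (D - {g}) f))"
    by (simp add: contraction_def Psi_simps Psi_iota)
  show ?thesis
  proof (cases "p \<in> D")
    case True
    define D0 where "D0 = D - {p}"
    have D0: "D = insert p D0" "D0 \<subseteq> H" "C \<subseteq> D0" using True C CH p_notin by (auto simp: D0_def)
    have uf: "ups f \<in> polys H" using f by (rule ups_polys)
    have val: "Psi0 (D - {g}) f = PsiE (D0 - {g}) (ups f)" if "g \<in> C" for g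
    proof -
      have "D - {g} - {p} = D0 - {g}" "p \<in> D - {g}" using that True CH p_notin by (auto simp: D0_def)
      then show ?thesis by (simp add: Psi0_def)
    qed
    show ?thesis
    proof (cases "mixed C")
      case True
      have "PsiE (D0 - {g}) (ups f) \<in> J" if g: "g \<in> C" for g
      proof (rule PsiE_J)
        assume sp: "spans p (insert a0 (D0 - {g}))"
        have nn: "insert a0 (D0 - {g}) \<notin> nested L H"
          by (rule mixed_not_nested_spanning[OF True sp, of g]) (use D0 in auto)
        have "iota (insert a0 (D0 - {g})) (xm {#} * ups f) \<in> J"
          using nn D0 a0 uf by (intro rel_span_non_nested) auto
        then show "iota (insert a0 (D0 - {g})) (ups f) \<in> J" by simp
      qed
      then show ?thesis unfolding Psi by (intro lspan_sum lspan.scale) (simp add: val)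
    next
      case False
      then have C01: "C \<subseteq> below \<or> C \<inter> below = {}" using circuit_cases[OF CH(1)] by blast
      have sp: "spans p (insert a0 (D0 - {g})) \<longleftrightarrow> spans p (insert a0 D0)" if "g \<in> C" for g
        using spans_cong[OF atoms_in_remove_circuit[OF CH(1) D0(3) that C01] p_closed, of "{a0}"]
        by (simp add: insert_is_Un[symmetric] Un_commute)
      show ?thesis
      proof (cases "spans p (insert a0 D0)")
        case True
        have "Psi (contraction r0 C D f) = (\<Sum>g\<in>C. - scale ((-1) ^ inversions r {g} D0) (mul r (iota {a0} 1) (iota (D0 - {g}) (ups f))))"
          unfolding Psi
        proof (rule sum.cong[OF refl])
          fix g assume g: "g \<in> C"
          have "inversions r0 {g} D = Suc (inversions r {g} D0)"
            unfolding D0(1) by (rule inv_r0_insert) (use g CH D0 in auto)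
          then show "scale ((-1) ^ inversions r0 {g} D) (Psi0 (D - {g}) f)
            = - scale ((-1) ^ inversions r {g} D0) (mul r (iota {a0} 1) (iota (D0 - {g}) (ups f)))"
            using g sp True by (simp add: val PsiE_def scale_uminus)
        qed
        also have "\<dots> = - mul r (iota {a0} 1) (contraction r C D0 (ups f))"
          unfolding contraction_def linear_map_sum[OF linear_mul(1)] linear_map_scale[OF linear_mul(1)]
          by (rule sum_negf)
        also have "\<dots> \<in> J" using D0 uf
          by (intro lspan_uminus J_mul_a0 contraction_circuit_rel_span[OF CH(1)])
        finally show ?thesis .
      next
        case False
        then show ?thesis unfolding Psi using sp
          by (intro lspan_sum lspan.scale) (simp add: val PsiE_def lspan.zero)
      qed
    qed
  next
    case False
    then have DH: "D \<subseteq> H" using C by auto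
    have kf: "kill_p f \<in> polys H" and tf: "tau k f \<in> polys H" for k
      using f kill_p_polys tau_polys by auto
    have "Psi (contraction r0 C D f) = (\<Sum>g\<in>C. scale ((-1) ^ inversions r {g} D) (iota (D - {g}) (kill_p f)
        - iota (D - {g}) (xs (completion (D - {g})) * tau (kappa (D - {g})) f)))"
      unfolding Psi using False CH DH by (intro sum.cong refl) (auto simp: Psi0_def inv_r0 subset_iff)
    also have "\<dots> = contraction r C D (kill_p f) - (\<Sum>g\<in>C. scale ((-1) ^ inversions r {g} D)
        (iota (D - {g}) (xs (completion (D - {g})) * tau (kappa (D - {g})) f)))"
      unfolding contraction_def scale_diff by (rule sum_subtractf)
    finally have eq: "Psi (contraction r0 C D f) = contraction r C D (kill_p f) - (\<Sum>g\<in>C. scale ((-1) ^ inversions r {g} D)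
        (iota (D - {g}) (xs (completion (D - {g})) * tau (kappa (D - {g})) f)))" .
    have "(\<Sum>g\<in>C. scale ((-1) ^ inversions r {g} D)
        (iota (D - {g}) (xs (completion (D - {g})) * tau (kappa (D - {g})) f))) \<in> J"
    proof (cases "mixed C")
      case True
      show ?thesis
      proof (intro lspan_sum lspan.scale)
        fix g assume g: "g \<in> C"
        have "iota (D - {g}) (xs (completion (D - {g})) * (xm {#} * tau (kappa (D - {g})) f)) \<in> J"
        proof (rule completion_J[OF _ _ tf])
          show "D - {g} \<union> completion (D - {g}) \<union> set_mset {#} \<notin> nested L H"
            using mixed_not_nested_spanning[OF True spans_completion[of "D - {g}"], of g] C by auto
        qed (use DH in auto)
        then show "iota (D - {g}) (xs (completion (D - {g})) * tau (kappa (D - {g})) f) \<in> J" by simp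
      qed
    next
      case False
      then have C01: "C \<subseteq> below \<or> C \<inter> below = {}" using circuit_cases[OF CH(1)] by blast
      have "completion (D - {g}) = completion D" if "g \<in> C" for g
        by (rule completion_cong[OF atoms_in_remove_circuit[OF CH(1) C(2) that C01]])
      then have "(\<Sum>g\<in>C. scale ((-1) ^ inversions r {g} D)
          (iota (D - {g}) (xs (completion (D - {g})) * tau (kappa (D - {g})) f)))
        = contraction r C D (xs (completion D) * tau (kappa D) f)"
        unfolding contraction_def kappa_def by (intro sum.cong refl) simp
      also have "\<dots> \<in> J" using C DH tf
        by (intro contraction_circuit_rel_span[OF CH(1)] completion_mult_polys)
      finally show ?thesis .
    qed
    then show ?thesis unfolding eq using C DH kf
      by (intro lspan_diff contraction_circuit_rel_span[OF CH(1)])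
  qed
qed

lemma csum_H'_split:
  assumes g: "g \<in> atoms L" "g \<sqsubseteq> p"
  shows "csum L H' g = xm {#g#} + xm {#p#} + (\<Sum>h\<in>{h \<in> H. g \<sqsubseteq> h} - {g}. xm {#h#})"
    and "(\<Sum>h\<in>{h \<in> H. g \<sqsubseteq> h} - {g}. xm {#h#}) = csum L H g - xm {#g#}"
    and "\<And>h. h \<in> {h \<in> H. g \<sqsubseteq> h} - {g} \<Longrightarrow> \<not> h \<sqsubseteq> p \<and> h \<noteq> p"
proof -
  let ?A = "{h \<in> H. g \<sqsubseteq> h}"
  have gA: "g \<in> ?A" "finite ?A" using g atoms_H finite_H by auto
  have "{h \<in> H'. g \<sqsubseteq> h} = insert p ?A" using g by auto
  then have "csum L H' g = xm {#p#} + (\<Sum>h\<in>?A. xm {#h#})" using gA p_notin by (simp add: csum_def)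
  then show "csum L H' g = xm {#g#} + xm {#p#} + (\<Sum>h\<in>?A - {g}. xm {#h#})"
    using sum.remove[OF gA(2,1), of "\<lambda>h. xm {#h#}"] by (simp add: ac_simps)
  show "(\<Sum>h\<in>?A - {g}. xm {#h#}) = csum L H g - xm {#g#}"
    using sum.remove[OF gA(2,1), of "\<lambda>h. xm {#h#}"] by (simp add: csum_def)
  show "\<not> h \<sqsubseteq> p \<and> h \<noteq> p" if "h \<in> ?A - {g}" for h
    using that H_le_p atom_le_atom[OF g(1)] p_notin by auto
qed

lemma csum_H'_not_below:
  assumes g: "g \<in> atoms L" "\<not> g \<sqsubseteq> p"
  shows "csum L H' g = csum L H g" and "\<And>h. h \<in> {h \<in> H. g \<sqsubseteq> h} \<Longrightarrow> \<not> h \<sqsubseteq> p \<and> h \<noteq> p"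
proof -
  have "{h \<in> H'. g \<sqsubseteq> h} = {h \<in> H. g \<sqsubseteq> h}" using g by auto
  then show "csum L H' g = csum L H g" by (simp add: csum_def)
  fix h assume h: "h \<in> {h \<in> H. g \<sqsubseteq> h}"
  then have "h \<in> carrier L" using H_carrier by auto
  then show "\<not> h \<sqsubseteq> p \<and> h \<noteq> p" using h g le_trans[of g h p] p_notin by auto
qed

lemma kill_p_csum: assumes g: "g \<in> atoms L" shows "kill_p (csum L H' g) = csum L H g"
proof -
  have fin: "finite {h \<in> H. g \<sqsubseteq> h}" using finite_H by simp
  have "kill_p (csum L H g) = csum L H g"
    unfolding csum_def kill_p_def subst_simps by (intro sum.cong refl) (use p_notin in auto)
  moreover have "csum L H' g = csum L H g + (if g \<sqsubseteq> p then xm {#p#} else 0)"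
    by (cases "g \<sqsubseteq> p") (simp_all add: csum_H'_split(1,2)[OF g] csum_H'_not_below(1)[OF g])
  moreover have "kill_p (xm {#p#}) = 0" by (simp add: kill_p_def)
  ultimately show ?thesis by (simp add: kill_p_def subst_simps)
qed

text \<open>The map \<open>kill_p\<close> sends the \<open>c_g\<close> of \<open>H'\<close> to that
  of \<open>H\<close>. Under \<open>ups\<close> and \<open>tau\<close> the part
  \<open>x_g + x_p\<close>, present if \<open>g \<le> p\<close>, becomes \<open>- c_p\<close>. The
  result differs from a multiple of \<open>c_g\<close> by a multiple of \<open>x_g + c_p\<close>
  next to a spanning set, which lies in \<open>J\<close>.\<close>

lemma Psi0_lin:
  assumes g: "g \<in> atoms L" and S: "S \<subseteq> H'" and f: "f \<in> polys H'"
  shows "Psi0 S (csum L H' g * f) \<in> J"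
proof -
  let ?N = "{h \<in> H. g \<sqsubseteq> h} - {g}"
  have lin: "iota S (csum L H g * f) \<in> J" if "S \<subseteq> H" "f \<in> polys H" for S f
    using that g by (intro lspan.base rel_gens.lin)
  have gH: "g \<in> H" using g atoms_H by auto
  show ?thesis
  proof (cases "p \<in> S")
    case True
    define S0 where "S0 = S - {p}"
    have S0: "S0 \<subseteq> H" using S True by (auto simp: S0_def)
    have uf: "ups f \<in> polys H" by (rule ups_polys[OF f])
    have um: "ups (csum L H' g * f) = ups (csum L H' g) * ups f" by (simp add: ups_def subst_mult)
    have "PsiE S0 (ups (csum L H' g) * ups f) \<in> J"
    proof (cases "g \<sqsubseteq> p")
      case False
      have "ups (csum L H' g) = csum L H g"
        unfolding csum_H'_not_below(1)[OF g False] unfolding csum_def ups_def subst_simps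
        by (intro sum.cong refl) (use csum_H'_not_below(2)[OF g False] in auto)
      then show ?thesis using lin[OF S0 uf] by (simp add: PsiE_def J_mul_a0 lspan.zero)
    next
      case True
      have "ups (\<Sum>h\<in>?N. xm {#h#}) = (\<Sum>h\<in>?N. xm {#h#})"
        unfolding ups_def subst_simps by (intro sum.cong refl) (use csum_H'_split(3)[OF g True] in auto)
      moreover have "ups (xm {#g#}) = 0" "ups (xm {#p#}) = - cp"
        using True gH p_notin by (auto simp: ups_def)
      ultimately have "ups (csum L H' g) = csum L H g - (xm {#g#} + cp)"
        unfolding csum_H'_split(1)[OF g True] by (simp add: ups_def subst_simps csum_H'_split(2)[OF g True])
      then have val: "ups (csum L H' g) * ups f = csum L H g * ups f - xm {#} * (xm {#g#} + cp) * ups f"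
        by (simp add: left_diff_distrib)
      show ?thesis
      proof (rule PsiE_J)
        assume sp: "spans p (insert a0 S0)"
        have "iota (insert a0 S0) (xm {#} * (xm {#g#} + cp) * ups f) \<in> J"
          using S0 a0 uf by (intro spanning_cp[OF g True] spans_mono[OF sp]) auto
        moreover have "iota (insert a0 S0) (csum L H g * ups f) \<in> J" using S0 a0 uf by (intro lin) auto
        ultimately show "iota (insert a0 S0) (ups (csum L H' g) * ups f) \<in> J"
          unfolding val iota_simps by (intro lspan_diff)
      qed
    qed
    then show ?thesis using True um by (simp add: Psi0_def S0_def)
  next
    case False
    then have SH: "S \<subseteq> H" using S by auto
    note c = completesD[OF completes_completion[of S]]
    let ?T = "xs (completion S)" and ?t = "tau (kappa S) f"
    have TH: "?T \<in> polys H" using c by (intro xs_polys)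
    have tf: "?t \<in> polys H" by (rule tau_polys[OF f])
    have "kill_p (csum L H' g * f) = csum L H g * kill_p f"
      using kill_p_csum[OF g] by (simp add: kill_p_def subst_mult)
    then have first: "iota S (kill_p (csum L H' g * f)) \<in> J" using lin[OF SH kill_p_polys[OF f]] by simp
    have second: "iota S (?T * tau (kappa S) (csum L H' g * f)) \<in> J"
    proof (cases "g \<sqsubseteq> p")
      case gp: False
      have "tau (kappa S) (csum L H' g * f) = csum L H g * ?t"
        unfolding csum_H'_not_below(1)[OF g gp] unfolding csum_def sum_distrib_right tau_simps
        by (intro sum.cong refl tau_mult_not_below) (use csum_H'_not_below(2)[OF g gp] in auto)
      then have "?T * tau (kappa S) (csum L H' g * f) = csum L H g * (?T * ?t)" by (simp add: ac_simps)
      then show ?thesis using lin[OF SH polys_mult[OF TH tf]] by simp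
    next
      case True
      have gp: "g \<noteq> p" using g p_not_atom by auto
      have "tau (kappa S) ((\<Sum>h\<in>?N. xm {#h#}) * f) = (\<Sum>h\<in>?N. xm {#h#}) * ?t"
        unfolding sum_distrib_right tau_simps
        by (intro sum.cong refl tau_mult_not_below) (use csum_H'_split(3)[OF g True] in auto)
      moreover have "tau (kappa S) (csum L H' g * f)
        = (tau (kappa S) (xm {#g#} * f) + tau (kappa S) (xm {#p#} * f)) + tau (kappa S) ((\<Sum>h\<in>?N. xm {#h#}) * f)"
        unfolding csum_H'_split(1)[OF g True] by (simp add: distrib_right tau_simps)
      ultimately have teq: "tau (kappa S) (csum L H' g * f) = - cp * ?t + (csum L H g - xm {#g#}) * ?t"
        unfolding tau_mult_below[OF True gp] csum_H'_split(2)[OF g True] by simp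
      have val: "?T * tau (kappa S) (csum L H' g * f)
        = csum L H g * (?T * ?t) - xm (mset_set (completion S)) * (xm {#g#} + cp) * ?t"
        unfolding teq by (simp add: xs_def algebra_simps)
      have "iota S (xm (mset_set (completion S)) * (xm {#g#} + cp) * ?t) \<in> J"
        using c SH tf by (intro spanning_cp[OF g True] spans_mono[OF c(3)]) auto
      then show ?thesis unfolding val iota_simps using lin[OF SH polys_mult[OF TH tf]] by (intro lspan_diff)
    qed
    show ?thesis using False first second by (simp add: Psi0_def lspan_diff)
  qed
qed

lemma Psi_rel_span:
  assumes "w \<in> rel_span L H' r0" shows "Psi w \<in> J"
proof (rule lspan_linear[OF linear_Psi assms])
  fix y assume "y \<in> rel_gens L H' r0"
  then show "Psi y \<in> J"
  proof cases
    case (non_nested S m f)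
    have "Psi0 S (xm m * f) \<in> J"
    \<comment> \<open>As \<open>Psi\<close> is not multiplicative, the factor \<open>f\<close> is
      split into monomials, each of which is absorbed into \<open>m\<close>.\<close>
    proof (rule polys_iota_induct[OF non_nested(4)])
      show "linear_map (\<lambda>f. Psi0 S (xm m * f))"
        by (rule linear_map_comp[OF linear_Psi0 linear_map_mult(1)])
      fix n assume n: "set_mset n \<subseteq> H'"
      have "S \<union> set_mset (m + n) \<notin> nested L H'"
        by (rule not_nested_mono[OF non_nested(5)]) auto
      then show "Psi0 S (xm m * xm n) \<in> J"
        unfolding xm_add[symmetric] using non_nested n by (intro Psi0_non_nested) auto
    qed
    then show ?thesis using non_nested by (simp add: Psi_iota)
  next
    case (dependent C D f)
    then show ?thesis using Psi0_dependent by (simp add: Psi_iota)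
  next
    case (circ C D f)
    then show ?thesis using Psi_contraction by simp
  next
    case (lin g S f)
    then show ?thesis using Psi0_lin by (simp add: Psi_iota)
  qed
qed

end

section \<open>The composition of \<open>Psi\<close> with \<open>Phi\<close>\<close>

lemma scale_sign_square: "scale ((-1) ^ n) (scale ((-1) ^ n) f) = f"
  by (simp add: scale_scale flip: power_add mult_2)

context blow_order
begin

lemma kill_p_sigma:
  assumes "set_mset m \<subseteq> H" shows "kill_p (sigma (xm m)) = xm m"
  using assms
proof (induction m)
  case (add g m)
  have "kill_p (shift g) = xm {#g#}"
    using add.prems p_notin by (auto simp: kill_p_def shift_def subst_simps)
  moreover have "kill_p (sigma (xm (add_mset g m))) = kill_p (shift g) * kill_p (sigma (xm m))"
    unfolding xm_insert[of g m] kill_p_def subst_mult by simp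
  ultimately show ?case using add xm_insert[of g m] by simp
qed (simp add: kill_p_def)

lemma ups_sigma:
  assumes "set_mset m \<subseteq> H" shows "ups (sigma (xm m)) = (- cp) ^ nb m * xm (rest m)"
  using assms
proof (induction m)
  case (add g m)
  have gp: "g \<noteq> p" using add.prems p_notin by auto
  have e: "ups (sigma (xm (add_mset g m))) = ups (shift g) * ups (sigma (xm m))"
    unfolding xm_insert[of g m] ups_def subst_mult by simp
  have IH: "ups (sigma (xm m)) = (- cp) ^ nb m * xm (rest m)" using add by simp
  show ?case
  proof (cases "g \<sqsubseteq> p")
    case True
    then have "ups (shift g) = - cp" using gp by (simp add: ups_def shift_def subst_simps)
    moreover have "nb (add_mset g m) = Suc (nb m)" "rest (add_mset g m) = rest m"
      using True gp by (auto simp: nb_def rest_def)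
    ultimately show ?thesis unfolding e IH by (simp add: mult.assoc)
  next
    case False
    then have "ups (shift g) = xm {#g#}" using gp by (simp add: ups_def shift_def)
    moreover have "nb (add_mset g m) = nb m" "rest (add_mset g m) = add_mset g (rest m)"
      using False gp by (auto simp: nb_def rest_def)
    ultimately show ?thesis unfolding e IH by (simp add: xm_insert[of g "rest m"] ac_simps)
  qed
qed (simp add: ups_def nb_def rest_def)

text \<open>On the image of \<open>sigma\<close> each factor below \<open>p\<close> acts as
  \<open>- c_p\<close>, which finally leaves \<open>tau k 1\<close>, zero unless
  \<open>k = 0\<close>. Thus the correction term vanishes on the image of \<open>Phi\<close> if
  \<open>S\<close> does not span \<open>p\<close>.\<close>

lemma tau_sigma:
  assumes "set_mset m \<subseteq> H"
  shows "tau k (sigma (xm m)) = (if k = 0 then (- cp) ^ nb m * xm (rest m) else 0)"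
  using assms
proof (induction m)
  case empty
  then show ?case by (simp add: tau_one nb_def rest_def)
next
  case (add g m)
  have gp: "g \<noteq> p" using add.prems p_notin by auto
  have e: "sigma (xm (add_mset g m)) = shift g * sigma (xm m)"
    unfolding xm_insert[of g m] subst_mult by simp
  have IH: "tau k (sigma (xm m)) = (if k = 0 then (- cp) ^ nb m * xm (rest m) else 0)" using add by simp
  show ?case
  proof (cases "g \<sqsubseteq> p")
    case True
    then have "tau k (sigma (xm (add_mset g m))) = - cp * tau k (sigma (xm m))"
      unfolding e using tau_mult_below[OF True gp, of k "sigma (xm m)"]
      by (simp add: shift_def distrib_right tau_simps)
    moreover have "nb (add_mset g m) = Suc (nb m)" "rest (add_mset g m) = rest m"
      using True gp by (auto simp: nb_def rest_def)
    ultimately show ?thesis unfolding IH by (simp add: mult.assoc)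
  next
    case False
    then have "tau k (sigma (xm (add_mset g m))) = xm {#g#} * tau k (sigma (xm m))"
      unfolding e by (simp add: shift_def tau_mult_not_below)
    moreover have "nb (add_mset g m) = nb m" "rest (add_mset g m) = add_mset g (rest m)"
      using False gp by (auto simp: nb_def rest_def)
    ultimately show ?thesis unfolding IH by (simp add: xm_insert[of g "rest m"] ac_simps)
  qed
qed

text \<open>If \<open>s\<close> were independent of the other atoms of \<open>S\<close> below
  \<open>p\<close>, it could be exchanged for \<open>a0\<close>, and \<open>S\<close> would span
  \<open>p\<close>.\<close>

lemma remove_spanning_exchange:
  assumes S: "S \<subseteq> H" and s: "s \<in> atoms L" "s \<sqsubseteq> p" and sp: "spans p (insert a0 (S - {s}))" and ns: "\<not> spans p S"
    and sS: "s \<in> S"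
  obtains C where "circuit L H C" "C \<subseteq> S"
proof -
  have "s \<sqsubseteq> \<Squnion>(atoms_in p (S - {s}))"
  proof (rule ccontr)
    assume n: "\<not> ?thesis"
    have "spans p (insert s (S - {s}))" by (rule spans_insert_exchange[OF p_closed a0(1,2) s sp n])
    then show False using ns sS by (simp add: insert_absorb)
  qed
  moreover have "atoms_in p (S - {s}) = atoms_in p S - {s}" by (auto simp: atoms_in_def)
  ultimately have "s \<sqsubseteq> \<Squnion>(atoms_in p S - {s})" by simp
  moreover have "atoms_in p S \<subseteq> atoms L" "s \<in> atoms_in p S" using s sS by (auto simp: atoms_in_def)
  ultimately obtain C where C: "C \<subseteq> atoms_in p S" "lcircuit L C" using dependent_has_lcircuit by blast
  then have "C \<subseteq> below" by (auto simp: atoms_in_def below_def)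
  then show thesis using that lcircuit_below_nested C by (auto simp: atoms_in_def)
qed

text \<open>If \<open>a0 \<notin> S\<close>, this is the contraction of \<open>e\<^sub>a e\<^sub>S\<close> along a circuit through \<open>a = a0\<close>, solved for \<open>e\<^sub>S\<close>; the summands with
  \<open>s\<close> outside the circuit vanish.\<close>

lemma PsiE_sum:
  assumes S: "S \<subseteq> H" "spans p S" and indep: "\<And>C. circuit L H C \<Longrightarrow> \<not> C \<subseteq> S" and k: "k \<in> polys H"
  shows "(\<Sum>s\<in>S \<inter> below. scale ((-1) ^ inversions r {s} S) (PsiE (S - {s}) k)) - iota S k \<in> J"
proof (cases "a0 \<in> S")
  case True
  have a0b: "a0 \<in> S \<inter> below" using True a0 by (simp add: below_def)
  have fin: "finite (S \<inter> below)" using S finite_H_sub by auto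
  \<comment> \<open>The generator \<open>e\<close> of \<open>a0\<close> squares to zero, so only the
    summand that has lost \<open>a0\<close> survives.\<close>
  have z: "PsiE (S - {s}) k = 0" if "s \<noteq> a0" for s
    using that True by (simp add: PsiE_def mul_iota)
  have "PsiE (S - {a0}) k = scale ((-1) ^ inversions r {a0} (S - {a0})) (iota S k)"
    using S True by (simp add: PsiE_def mul_iota insert_absorb)
  moreover have "inversions r {a0} S = inversions r {a0} (S - {a0})"
    using inversions_remove_right[of "{a0}" S a0 r] True finite_H_sub[OF S(1)] by simp
  ultimately have a: "scale ((-1) ^ inversions r {a0} S) (PsiE (S - {a0}) k) = iota S k"
    by (simp add: scale_sign_square)
  have "(\<Sum>s\<in>S \<inter> below. scale ((-1) ^ inversions r {s} S) (PsiE (S - {s}) k))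
    = iota S k + (\<Sum>s\<in>S \<inter> below - {a0}. scale ((-1) ^ inversions r {s} S) (PsiE (S - {s}) k))"
    by (subst sum.remove[OF fin a0b]) (simp only: a)
  also have "\<dots> = iota S k" by (simp add: z)
  finally show ?thesis by (simp add: lspan.zero)
next
  case False
  let ?sg = "\<lambda>s. (-1) ^ inversions r {s} S :: rat"
  obtain C where C: "circuit L H C" "C \<subseteq> insert a0 (atoms_in p S)"
    using dependent_spanning[OF S a0(1,2) False] .
  note c = circuitD[OF C(1)]
  have CS: "C - {a0} \<subseteq> S" using C by (auto simp: atoms_in_def)
  have a0C: "a0 \<in> C"
  proof (rule ccontr)
    assume "a0 \<notin> C"
    then have "C \<subseteq> S" using CS by blast
    then show False using indep C(1) by blast
  qed
  have Cb: "C \<subseteq> below" using C a0 by (auto simp: atoms_in_def below_def)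
  let ?D = "insert a0 S"
  have DH: "?D \<subseteq> H" "finite ?D" using S a0 finite_H_sub by auto
  have CD: "C \<subseteq> ?D" using CS by auto
  have fin: "finite (S \<inter> below)" using S finite_H_sub by auto
  have sub: "C - {a0} \<subseteq> S \<inter> below" using CS Cb by auto
  let ?B = "S \<inter> below - (C - {a0})"
  have split: "(\<Sum>s\<in>S \<inter> below. scale (?sg s) (PsiE (S - {s}) k))
    = (\<Sum>s\<in>?B. scale (?sg s) (PsiE (S - {s}) k)) + (\<Sum>s\<in>C - {a0}. scale (?sg s) (PsiE (S - {s}) k))"
    by (rule sum.subset_diff[OF sub fin])
  \<comment> \<open>Deleting such an \<open>s\<close>, which is not in the circuit, leaves all of
    \<open>C\<close> inside \<open>insert a0 (S - {s})\<close>.\<close>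
  have B: "(\<Sum>s\<in>?B. scale (?sg s) (PsiE (S - {s}) k)) \<in> J"
  proof (intro lspan_sum lspan.scale PsiE_J)
    fix s assume s: "s \<in> ?B"
    show "iota (insert a0 (S - {s})) k \<in> J"
      by (rule dependent_rel_span[OF C(1) _ _ k]) (use s CD DH False in auto)
  qed
  \<comment> \<open>Deleting \<open>a0\<close> and \<open>s\<close> from \<open>?D\<close> in the
    other order produces the minus sign; the sign that belongs to \<open>a0\<close> is common to all
    summands.\<close>
  have summand: "scale (?sg s) (PsiE (S - {s}) k)
    = - scale ((-1) ^ inversions r {a0} ?D) (scale ((-1) ^ inversions r {s} ?D) (iota (?D - {s}) k))"
    if s: "s \<in> C - {a0}" for s
  proof -
    have sS: "s \<in> S" "s \<noteq> a0" using s CS by auto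
    have Deq: "?D - {a0} = S" "?D - {s} = insert a0 (S - {s})" using False sS by auto
    have "\<Squnion>(atoms_in p (?D - {s})) = \<Squnion>(atoms_in p ?D)"
      by (rule atoms_in_remove_circuit[OF C(1) CD]) (use s Cb in auto)
    then have "spans p (?D - {s})" using spans_mono[OF S(2), of ?D] by (auto simp: spans_def)
    then have sp: "spans p (insert a0 (S - {s}))" unfolding Deq .
    have P: "PsiE (S - {s}) k = scale ((-1) ^ inversions r {a0} (S - {s})) (iota (?D - {s}) k)"
      using sp False unfolding Deq by (simp add: PsiE_def mul_iota)
    have "inversions r {a0} (?D - {s}) = inversions r {a0} (S - {s})"
      using inversions_remove_right[of "{a0}" "?D - {s}" a0 r] DH sS False
      by (simp add: insert_Diff_if)
    moreover have "(-1) ^ inversions r {a0} ?D * (-1) ^ inversions r {s} (?D - {a0})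
      = - ((-1) ^ inversions r {s} ?D * (-1) ^ inversions r {a0} (?D - {s}) :: rat)"
      by (rule inversions_remove_swap[OF r DH(2,1)]) (use sS in auto)
    ultimately have sw: "(-1) ^ inversions r {a0} ?D * ?sg s
      = - ((-1) ^ inversions r {s} ?D * (-1) ^ inversions r {a0} (S - {s}) :: rat)"
      unfolding Deq(1) by simp
    have sq: "(-1) ^ n * ((-1) ^ n * x) = (x :: rat)" for n x
      by (simp flip: power_add mult_2 mult.assoc)
    have "?sg s * (-1) ^ inversions r {a0} (S - {s})
      = (-1) ^ inversions r {a0} ?D * ((-1) ^ inversions r {a0} ?D * ?sg s) * (-1) ^ inversions r {a0} (S - {s})"
      by (simp only: sq)
    also have "\<dots> = - ((-1) ^ inversions r {a0} ?D * (-1) ^ inversions r {s} ?D)"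
      unfolding sw using sq[of "inversions r {a0} (S - {s})" 1] by (simp add: ac_simps)
    finally have "?sg s * (-1) ^ inversions r {a0} (S - {s})
      = - ((-1) ^ inversions r {a0} ?D * (-1) ^ inversions r {s} ?D)" .
    then show ?thesis unfolding P scale_scale by (simp only: scale_uminus)
  qed
  have "contraction r C ?D k = scale ((-1) ^ inversions r {a0} ?D) (iota (?D - {a0}) k)
      + (\<Sum>s\<in>C - {a0}. scale ((-1) ^ inversions r {s} ?D) (iota (?D - {s}) k))"
    unfolding contraction_def by (rule sum.remove[OF c(5) a0C])
  moreover have Deq: "?D - {a0} = S" using False by auto
  ultimately have rest: "(\<Sum>s\<in>C - {a0}. scale ((-1) ^ inversions r {s} ?D) (iota (?D - {s}) k))
    = contraction r C ?D k - scale ((-1) ^ inversions r {a0} ?D) (iota S k)" by simp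
  have "(\<Sum>s\<in>C - {a0}. scale (?sg s) (PsiE (S - {s}) k))
    = (\<Sum>s\<in>C - {a0}. - scale ((-1) ^ inversions r {a0} ?D) (scale ((-1) ^ inversions r {s} ?D) (iota (?D - {s}) k)))"
    by (intro sum.cong refl) (rule summand)
  also have "\<dots> = - scale ((-1) ^ inversions r {a0} ?D)
      (\<Sum>s\<in>C - {a0}. scale ((-1) ^ inversions r {s} ?D) (iota (?D - {s}) k))"
    unfolding scale_sum by (rule sum_negf)
  also have "\<dots> = iota S k - scale ((-1) ^ inversions r {a0} ?D) (contraction r C ?D k)"
    unfolding rest scale_diff scale_sign_square by simp
  finally have "(\<Sum>s\<in>S \<inter> below. scale (?sg s) (PsiE (S - {s}) k)) - iota S k
    = (\<Sum>s\<in>?B. scale (?sg s) (PsiE (S - {s}) k)) - scale ((-1) ^ inversions r {a0} ?D) (contraction r C ?D k)"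
    unfolding split by simp
  moreover have "contraction r C ?D k \<in> J"
    by (rule contraction_circuit_rel_span[OF C(1) CD DH(1) k])
  ultimately show ?thesis using B by (simp add: lspan_diff lspan.scale)
qed

text \<open>If \<open>S\<close> is non-nested or contains a circuit, everything lies in
  \<open>J\<close>. Otherwise, if \<open>S\<close> spans \<open>p\<close>, its completion is empty,
  and the correction cancels against the residues by \<open>PsiE_sum\<close>. If it does not, the
  correction vanishes by \<open>tau_sigma\<close> and the residues by
  \<open>remove_spanning_exchange\<close>.\<close>

lemma Psi_Phi_iota:
  assumes S: "S \<subseteq> H" and m: "set_mset m \<subseteq> H"
  shows "Psi (Phi (iota S (xm m))) - iota S (xm m) \<in> J"
proof (cases "S \<notin> nested L H \<or> (\<exists>C. circuit L H C \<and> C \<subseteq> S)")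
  case True
  have xmH: "xm m \<in> polys H" using m by (rule polys_xm)
  have "iota S (xm m) \<in> J"
    using True
  proof
    assume "S \<notin> nested L H"
    then have "iota S (xm {#} * xm m) \<in> J" using S xmH by (intro rel_span_non_nested) auto
    then show ?thesis by simp
  qed (use dependent_rel_span S xmH in blast)
  then show ?thesis by (intro lspan_diff Psi_rel_span Phi_rel_span)
next
  case False
  then have indep: "\<not> C \<subseteq> S" if "circuit L H C" for C using that by blast
  have pS: "p \<notin> S" using S p_notin by auto
  let ?k = "(- cp) ^ nb m * xm (rest m)"
  have kH: "?k \<in> polys H"
    using m by (intro polys_mult polys_power polys_uminus cp_polys polys_xm rest_subset) auto
  have insert_val: "Psi (iota (insert p (S - {s})) (sigma (xm m))) = PsiE (S - {s}) ?k" for s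
  proof -
    have "insert p (S - {s}) - {p} = S - {s}" using pS by auto
    then show ?thesis by (simp add: Psi_iota Psi0_def ups_sigma[OF m])
  qed
  have val: "Psi (Phi (iota S (xm m))) = iota S (xm m)
      - iota S (xs (completion S) * (if kappa S = 0 then ?k else 0))
      + (\<Sum>s\<in>S \<inter> below. scale ((-1) ^ inversions r {s} S) (PsiE (S - {s}) ?k))"
    unfolding Phi_iota Phi0_def Psi_simps insert_val
    using pS by (simp add: Psi_iota Psi0_def kill_p_sigma[OF m] tau_sigma[OF m])
  show ?thesis
  proof (cases "spans p S")
    case True
    then have k0: "kappa S = 0" by (simp add: kappa_zero_iff)
    then have "completion S = {}" using completesD(2)[OF completes_completion[of S]] by (simp add: kappa_def)
    then have "Psi (Phi (iota S (xm m))) - iota S (xm m)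
      = (\<Sum>s\<in>S \<inter> below. scale ((-1) ^ inversions r {s} S) (PsiE (S - {s}) ?k)) - iota S ?k"
      unfolding val using k0 by (simp add: xs_def)
    then show ?thesis using PsiE_sum[OF S True indep kH] by simp
  next
    case nsp: False
    then have k0: "kappa S \<noteq> 0" by (simp add: kappa_zero_iff)
    have "PsiE (S - {s}) ?k = 0" if s: "s \<in> S \<inter> below" for s
    proof -
      have "s \<sqsubseteq> p" "s \<in> S" using s by (auto simp: below_def)
      moreover have "s \<in> atoms L" using calculation S H_le_p by auto
      ultimately have "\<not> spans p (insert a0 (S - {s}))"
        using remove_spanning_exchange[OF S _ _ _ nsp] indep by metis
      then show ?thesis by (simp add: PsiE_def)
    qed
    then have "Psi (Phi (iota S (xm m))) - iota S (xm m) = 0"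
      unfolding val using k0 by (simp add: iota_simps)
    then show ?thesis by (simp add: lspan.zero)
  qed
qed

lemma Psi_Phi:
  assumes "z \<in> carrier (free_gca H r)" shows "Psi (Phi z) - z \<in> J"
  using assms
proof (induction rule: carrier_induct)
  case (mono S m)
  then show ?case by (intro Psi_Phi_iota)
next
  case (add f g)
  have eq: "Psi (Phi (f + g)) - (f + g) = (Psi (Phi f) - f) + (Psi (Phi g) - g)"
    by (simp add: Phi_simps Psi_simps)
  show ?case unfolding eq by (rule lspan.add[OF add])
next
  case (scale c f)
  have eq: "Psi (Phi (scale c f)) - scale c f = scale c (Psi (Phi f) - f)"
    by (simp add: Phi_simps Psi_simps scale_diff)
  show ?case unfolding eq by (rule lspan.scale[OF scale])
qed (simp add: Phi_simps Psi_simps lspan.zero)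

text \<open>Modulo the relations \<open>z\<close> is recovered as \<open>Psi (Phi z)\<close>; this
  is injectivity on the quotient.\<close>

lemma Phi_kernel:
  assumes "z \<in> carrier (free_gca H r)" shows "Phi z \<in> rel_span L H' r0 \<longleftrightarrow> z \<in> rel_span L H r"
proof
  assume "Phi z \<in> rel_span L H' r0"
  then have "Psi (Phi z) \<in> J" by (rule Psi_rel_span)
  then show "z \<in> J" using lspan_diff[OF _ Psi_Phi[OF assms], of "Psi (Phi z)"] by simp
qed (rule Phi_rel_span)

end

section \<open>Circuits in iterated blowups\<close>

text \<open>An element of an iterated blowup is determined by its base in \<open>L\<close> and the set of blown up
  elements it lies over; the order is the product order.\<close>

primrec base :: "'a blowup_elem \<Rightarrow> 'a" where
  "base (Base x) = x"
| "base (Exc q u) = base u"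

primrec exc :: "'a blowup_elem \<Rightarrow> 'a set" where
  "exc (Base x) = {}"
| "exc (Exc q u) = insert (base q) (exc u)"

context geom
begin

text \<open>An invariant kept by successive blowups. Which pairs of coordinates occur is not
  recorded, only that they form a down-set whose bases lie above no blown up element and which
  contains the elements needed for the atoms. This suffices to compute joins coordinatewise.\<close>

definition coords :: "'a set \<Rightarrow> 'a blowup_elem gorder \<Rightarrow> bool" where
  "coords Q P \<longleftrightarrow> eq P = (=)
    \<and> (\<forall>u\<in>carrier P. \<forall>v\<in>carrier P. le P u v \<longleftrightarrow> base u \<sqsubseteq> base v \<and> exc u \<subseteq> exc v)
    \<and> (\<forall>u\<in>carrier P. base u \<in> carrier L \<and> exc u \<subseteq> Q \<and> (\<forall>q\<in>Q. \<not> q \<sqsubseteq> base u))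
    \<and> (\<forall>u\<in>carrier P. \<forall>v\<in>carrier P. base u = base v \<longrightarrow> exc u = exc v \<longrightarrow> u = v)
    \<and> (\<forall>u\<in>carrier P. \<forall>x\<in>carrier L. \<forall>N. x \<sqsubseteq> base u \<longrightarrow> N \<subseteq> exc u \<longrightarrow> (\<exists>v\<in>carrier P. base v = x \<and> exc v = N))
    \<and> (\<forall>x\<in>carrier L. (\<forall>q\<in>Q. \<not> q \<sqsubseteq> x) \<longrightarrow> Base x \<in> carrier P)
    \<and> (\<forall>q\<in>Q. Exc (Base q) (Base \<bottom>) \<in> carrier P)"

lemma coordsD:
  assumes "coords Q P"
  shows "eq P = (=)"
    and "\<And>u v. u \<in> carrier P \<Longrightarrow> v \<in> carrier P \<Longrightarrow> le P u v \<longleftrightarrow> base u \<sqsubseteq> base v \<and> exc u \<subseteq> exc v"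
    and "\<And>u. u \<in> carrier P \<Longrightarrow> base u \<in> carrier L" and "\<And>u. u \<in> carrier P \<Longrightarrow> exc u \<subseteq> Q"
    and "\<And>u q. u \<in> carrier P \<Longrightarrow> q \<in> Q \<Longrightarrow> \<not> q \<sqsubseteq> base u"
    and "\<And>u v. u \<in> carrier P \<Longrightarrow> v \<in> carrier P \<Longrightarrow> base u = base v \<Longrightarrow> exc u = exc v \<Longrightarrow> u = v"
    and "\<And>u x N. u \<in> carrier P \<Longrightarrow> x \<in> carrier L \<Longrightarrow> x \<sqsubseteq> base u \<Longrightarrow> N \<subseteq> exc u \<Longrightarrow> \<exists>v\<in>carrier P. base v = x \<and> exc v = N"
    and "\<And>x. x \<in> carrier L \<Longrightarrow> (\<And>q. q \<in> Q \<Longrightarrow> \<not> q \<sqsubseteq> x) \<Longrightarrow> Base x \<in> carrier P"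
    and "\<And>q. q \<in> Q \<Longrightarrow> Exc (Base q) (Base \<bottom>) \<in> carrier P"
  using assms by (simp_all add: coords_def)

lemma coords_base: "coords {} (base_poset L)"
  unfolding coords_def base_poset_def by auto

text \<open>That no blown up element lies below \<open>q\<close> is guaranteed by blowing up larger
  elements first; it ensures that \<open>q\<close> has not been removed before its turn.\<close>

lemma coords_Bl:
  assumes P: "coords Q P" and q: "q \<in> carrier L" "q \<noteq> \<bottom>" "q \<notin> Q" "\<And>q'. q' \<in> Q \<Longrightarrow> \<not> q' \<sqsubseteq> q"
  shows "coords (insert q Q) (Bl (Base q) P)"
proof -
  note c = coordsD[OF P]
  have qP: "Base q \<in> carrier P" using c(8)[OF q(1)] q(4) by blast
  have q_le: "le P (Base q) u \<longleftrightarrow> q \<sqsubseteq> base u" if "u \<in> carrier P" for u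
    using c(2)[OF qP that] by simp
  define old where "old = {u \<in> carrier P. \<not> q \<sqsubseteq> base u}"
  define new where "new = {u \<in> old. \<exists>w\<in>carrier P. base w = \<Squnion>{q, base u} \<and> exc w = exc u}"
  \<comment> \<open>By down-closure, a common upper bound yields the element whose base is the join
    of \<open>q\<close> and \<open>base u\<close> and whose second coordinate is unchanged; this one
    is the least upper bound.\<close>
  have lub: "(\<exists>j. is_lub P j {Base q, u}) \<longleftrightarrow> (\<exists>w\<in>carrier P. base w = \<Squnion>{q, base u} \<and> exc w = exc u)"
    if u: "u \<in> carrier P" for u
  proof -
    have bu: "base u \<in> carrier L" using c(3)[OF u] .
    have quc: "{q, base u} \<subseteq> carrier L" using bu q by simp
    show ?thesis
    proof
      assume "\<exists>j. is_lub P j {Base q, u}"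
      then obtain j where j: "is_lub P j {Base q, u}" ..
      then have jP: "j \<in> carrier P" and "le P (Base q) j" "le P u j"
        using qP u by (auto simp: least_def Upper_def)
      then have "q \<sqsubseteq> base j" "base u \<sqsubseteq> base j" "exc u \<subseteq> exc j" using q_le c(2) u by auto
      moreover from this have "\<Squnion>{q, base u} \<sqsubseteq> base j" using quc c(3)[OF jP] by (simp add: Sup_le_iff)
      ultimately show "\<exists>w\<in>carrier P. base w = \<Squnion>{q, base u} \<and> exc w = exc u"
        using c(7)[OF jP] quc by simp
    next
      assume "\<exists>w\<in>carrier P. base w = \<Squnion>{q, base u} \<and> exc w = exc u"
      then obtain w where w: "w \<in> carrier P" "base w = \<Squnion>{q, base u}" "exc w = exc u" by blast
      have "q \<sqsubseteq> base w" "base u \<sqsubseteq> base w" unfolding w(2) using quc by auto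
      then have "w \<in> Upper P {Base q, u}" using w q_le c(2) u qP by (auto simp: Upper_def)
      moreover have "le P w z" if "z \<in> Upper P {Base q, u}" for z
      proof -
        have z: "z \<in> carrier P" "le P (Base q) z" "le P u z" using that qP u by (auto simp: Upper_def)
        then have "\<Squnion>{q, base u} \<sqsubseteq> base z" using q_le c(2,3) u quc by (simp add: Sup_le_iff)
        then show ?thesis using c(2)[OF w(1) z(1)] c(2)[OF u z(1)] z w by simp
      qed
      ultimately have "is_lub P w {Base q, u}" by (auto simp: least_def Upper_def)
      then show "\<exists>j. is_lub P j {Base q, u}" ..
    qed
  qed
  have old_eq: "{x \<in> carrier P. \<not> le P (Base q) x} = old" using q_le by (auto simp: old_def)
  have new_eq: "joinable P (Base q) = new"
    using q_le lub by (auto simp: joinable_def new_def old_def)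
  have Bl: "carrier (Bl (Base q) P) = old \<union> Exc (Base q) ` new"
    "le (Bl (Base q) P) = (\<lambda>u v. u \<in> old \<and> v \<in> old \<and> le P u v
         \<or> (\<exists>x\<in>new. \<exists>y\<in>new. u = Exc (Base q) x \<and> v = Exc (Base q) y \<and> le P x y)
         \<or> (\<exists>y\<in>new. u \<in> old \<and> v = Exc (Base q) y \<and> le P u y))"
    "eq (Bl (Base q) P) = (=)"
    unfolding Bl_def Let_def old_eq new_eq by simp_all
  have oldP: "u \<in> carrier P" "\<not> q \<sqsubseteq> base u" "q \<notin> exc u" if "u \<in> old" for u
    using that c(4) q(3) by (auto simp: old_def)
  have newold: "u \<in> old" if "u \<in> new" for u using that by (simp add: new_def)
  have Exc_old: "Exc (Base q) u \<notin> old" for u using oldP(3)[of "Exc (Base q) u"] by auto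
  have new_down: "v \<in> new" if "u \<in> new" "v \<in> carrier P" "base v \<sqsubseteq> base u" "exc v \<subseteq> exc u" for u v
  proof -
    have uP: "u \<in> carrier P" "\<not> q \<sqsubseteq> base u" using oldP newold that by auto
    have bc: "base u \<in> carrier L" "base v \<in> carrier L" using c(3) uP that by auto
    have vold: "v \<in> old" using that uP le_trans[of q "base v" "base u"] bc q by (auto simp: old_def)
    obtain w where w: "w \<in> carrier P" "base w = \<Squnion>{q, base u}" "exc w = exc u"
      using \<open>u \<in> new\<close> by (auto simp: new_def)
    have sub: "{q, base u} \<subseteq> carrier L" "{q, base v} \<subseteq> carrier L" using bc q by auto
    have "q \<sqsubseteq> \<Squnion>{q, base u}" "base v \<sqsubseteq> \<Squnion>{q, base u}"
      using Sup_upper[OF sub(1), of q] le_Sup_trans[OF sub(1), of "base u" "base v"] that bc by auto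
    then have "\<Squnion>{q, base v} \<sqsubseteq> base w" unfolding w(2) using sub by (simp add: Sup_le_iff)
    then obtain w' where "w' \<in> carrier P" "base w' = \<Squnion>{q, base v}" "exc w' = exc v"
      using c(7)[OF w(1), of "\<Squnion>{q, base v}" "exc v"] sub w \<open>exc v \<subseteq> exc u\<close> by auto
    then show ?thesis using vold by (auto simp: new_def)
  qed
  have bot_old: "u \<in> old" if "u \<in> carrier P" "base u = \<bottom>" for u
    using that q le_bottom by (simp add: old_def)
  have botP: "Base \<bottom> \<in> carrier P"
  proof -
    obtain v where v: "v \<in> carrier P" "base v = \<bottom>" "exc v = {}"
      using c(7)[OF qP, of \<bottom> "{}"] q(1) by auto
    then show ?thesis by (cases v) auto
  qed
  have bot_new: "Base \<bottom> \<in> new"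
  proof -
    have "\<Squnion>{q, \<bottom>} = q" using q by (intro le_antisym) (auto simp: Sup_le_iff)
    then have "\<exists>w\<in>carrier P. base w = \<Squnion>{q, base (Base \<bottom>)} \<and> exc w = exc (Base \<bottom>)"
      using qP by (intro bexI[of _ "Base q"]) simp_all
    then show ?thesis using bot_old[OF botP] by (simp add: new_def)
  qed
  show ?thesis
    unfolding coords_def Bl(1)
  proof (intro conjI)
    show "eq (Bl (Base q) P) = (=)" by (rule Bl(3))
    show "\<forall>u\<in>old \<union> Exc (Base q) ` new. \<forall>v\<in>old \<union> Exc (Base q) ` new.
      le (Bl (Base q) P) u v \<longleftrightarrow> base u \<sqsubseteq> base v \<and> exc u \<subseteq> exc v"
    proof (intro ballI)
      fix u v assume u: "u \<in> old \<union> Exc (Base q) ` new" and v: "v \<in> old \<union> Exc (Base q) ` new"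
      consider "u \<in> old" "v \<in> old" | y where "u \<in> old" "y \<in> new" "v = Exc (Base q) y"
        | x where "x \<in> new" "u = Exc (Base q) x" "v \<in> old"
        | x y where "x \<in> new" "u = Exc (Base q) x" "y \<in> new" "v = Exc (Base q) y" using u v by blast
      then show "le (Bl (Base q) P) u v \<longleftrightarrow> base u \<sqsubseteq> base v \<and> exc u \<subseteq> exc v"
      proof cases
        case 1
        then show ?thesis unfolding Bl(2) using c(2) oldP Exc_old by auto
      next
        case 2
        then show ?thesis unfolding Bl(2) using c(2)[of u y] oldP[of u] oldP[of y] newold[of y] Exc_old by auto
      next
        case 3
        then show ?thesis unfolding Bl(2) using oldP[of v] Exc_old by auto
      next
        case 4
        then show ?thesis unfolding Bl(2)
          using c(2)[of x y] oldP[of x] oldP[of y] newold[of x] newold[of y] Exc_old by auto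
      qed
    qed
    show "\<forall>u\<in>old \<union> Exc (Base q) ` new. base u \<in> carrier L \<and> exc u \<subseteq> insert q Q \<and> (\<forall>q\<in>insert q Q. \<not> q \<sqsubseteq> base u)"
      using c(3,4,5) oldP newold by (auto dest!: newold) (use c(4) oldP in blast)+
    show "\<forall>u\<in>old \<union> Exc (Base q) ` new. \<forall>v\<in>old \<union> Exc (Base q) ` new. base u = base v \<longrightarrow> exc u = exc v \<longrightarrow> u = v"
    proof (intro ballI impI)
      fix u v assume u: "u \<in> old \<union> Exc (Base q) ` new" and v: "v \<in> old \<union> Exc (Base q) ` new"
        and e: "base u = base v" "exc u = exc v"
      consider "u \<in> old" "v \<in> old" | "u \<in> old" "v \<in> Exc (Base q) ` new" | "u \<in> Exc (Base q) ` new" "v \<in> old"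
        | x y where "x \<in> new" "u = Exc (Base q) x" "y \<in> new" "v = Exc (Base q) y" using u v by blast
      then show "u = v"
      proof cases
        case 1
        then show ?thesis using c(6) oldP e by blast
      next
        case 4
        have "x \<in> carrier P" "y \<in> carrier P" "q \<notin> exc x" "q \<notin> exc y" using 4 oldP newold by auto
        moreover have "base x = base y" "insert q (exc x) = insert q (exc y)" using e 4 by auto
        ultimately have "x = y" by (intro c(6)) auto
        then show ?thesis using 4 by simp
      next
        case 2
        then have "q \<in> exc v" "q \<notin> exc u" using oldP by auto
        then show ?thesis using e by simp
      next
        case 3
        then have "q \<in> exc u" "q \<notin> exc v" using oldP by auto
        then show ?thesis using e by simp
      qed
    qed
    show "\<forall>u\<in>old \<union> Exc (Base q) ` new. \<forall>x\<in>carrier L. \<forall>N. x \<sqsubseteq> base u \<longrightarrow> N \<subseteq> exc u \<longrightarrow>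
      (\<exists>v\<in>old \<union> Exc (Base q) ` new. base v = x \<and> exc v = N)"
    proof (intro ballI allI impI)
      fix u x N assume u: "u \<in> old \<union> Exc (Base q) ` new" and x: "x \<in> carrier L" "x \<sqsubseteq> base u" and N: "N \<subseteq> exc u"
      \<comment> \<open>Strips the outermost \<open>Exc (Base q)\<close>, if there is one, so that
        the down-closure of \<open>P\<close> can be used.\<close>
      define y where "y = (if u \<in> old then u else (THE y. u = Exc (Base q) y))"
      have y: "y \<in> old" "base y = base u" "u \<notin> old \<Longrightarrow> y \<in> new" "u \<notin> old \<Longrightarrow> u = Exc (Base q) y" "u \<in> old \<Longrightarrow> u = y"
        using u newold by (auto simp: y_def)
      have yP: "y \<in> carrier P" "\<not> q \<sqsubseteq> base y" using oldP[OF y(1)] by auto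
      have "N - {q} \<subseteq> exc y" using N y by (cases "u \<in> old") auto
      then obtain v where v: "v \<in> carrier P" "base v = x" "exc v = N - {q}"
        using c(7)[OF yP(1) x(1), of "N - {q}"] x(2) y(2) by auto
      have vold: "v \<in> old" using v x yP le_trans[of q x "base u"] y(2) q(1) c(3)[OF yP(1)] by (auto simp: old_def)
      show "\<exists>v\<in>old \<union> Exc (Base q) ` new. base v = x \<and> exc v = N"
      proof (cases "q \<in> N")
        case False
        then show ?thesis using v vold by (intro bexI[of _ v]) auto
      next
        case True
        then have "u \<notin> old" using N oldP(3) by blast
        have "base v \<sqsubseteq> base y" "exc v \<subseteq> exc y" unfolding v(2,3) y(2) using x(2) \<open>N - {q} \<subseteq> exc y\<close> by simp_all
        then have "v \<in> new" using new_down[OF y(3)[OF \<open>u \<notin> old\<close>] v(1)] by simp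
        then show ?thesis using v True by (intro bexI[of _ "Exc (Base q) v"]) auto
      qed
    qed
    show "\<forall>x\<in>carrier L. (\<forall>q\<in>insert q Q. \<not> q \<sqsubseteq> x) \<longrightarrow> Base x \<in> old \<union> Exc (Base q) ` new"
      using c(8) by (auto simp: old_def)
    show "\<forall>q'\<in>insert q Q. Exc (Base q') (Base \<bottom>) \<in> old \<union> Exc (Base q) ` new"
      using bot_new c(9) bot_old by auto
  qed
qed

end

context pbs
begin

text \<open>Induction on the prefixes of \<open>ps\<close>: as larger elements come first, no
  element of a prefix lies below the next one.\<close>

lemma coords_iterated_blowup:
  assumes ps: "blowup_sequence L H ps"
  shows "coords (H - atoms L) (iterated_blowup L ps)"
proof -
  have psH: "set ps = H - atoms L" "distinct ps"
    and ord: "\<And>i j. i < length ps \<Longrightarrow> j < length ps \<Longrightarrow> ps ! j \<sqsubseteq> ps ! i \<Longrightarrow> i \<le> j"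
    using ps by (auto simp: blowup_sequence_def)
  have "coords (set (take n ps)) (iterated_blowup L (take n ps))" if "n \<le> length ps" for n
    using that
  proof (induction n)
    case 0
    then show ?case using coords_base by (simp add: iterated_blowup_def)
  next
    case (Suc n)
    let ?q = "ps ! n"
    have n: "n < length ps" using Suc by simp
    have take: "take (Suc n) ps = take n ps @ [?q]" using n by (rule take_Suc_conv_app_nth)
    have qH: "?q \<in> H" using n psH nth_mem by blast
    have "coords (insert ?q (set (take n ps))) (Bl (Base ?q) (iterated_blowup L (take n ps)))"
    proof (rule coords_Bl)
      show "coords (set (take n ps)) (iterated_blowup L (take n ps))" using Suc by simp
      show "?q \<in> carrier L" "?q \<noteq> \<bottom>" using qH H_carrier H_G G_not_bottom by auto
      show "?q \<notin> set (take n ps)"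
        using n psH(2) by (auto simp: in_set_conv_nth nth_eq_iff_index_eq)
      show "\<not> q' \<sqsubseteq> ?q" if q': "q' \<in> set (take n ps)" for q'
      proof
        assume le: "q' \<sqsubseteq> ?q"
        obtain i where i: "i < n" "q' = ps ! i" using q' n by (auto simp: in_set_conv_nth)
        then have "n \<le> i" using ord[of n i] n le by simp
        then show False using i by simp
      qed
    qed
    moreover have "iterated_blowup L (take (Suc n) ps) = Bl (Base ?q) (iterated_blowup L (take n ps))"
      unfolding take by (simp add: iterated_blowup_def)
    moreover have "set (take (Suc n) ps) = insert ?q (set (take n ps))" unfolding take by simp
    ultimately show ?case by simp
  qed
  from this[of "length ps"] show ?thesis using psH by simp
qed

text \<open>In coordinates, a bounded set of atoms of the blowup has as join the join in
  \<open>L\<close> of the original atoms, paired with the set of the new ones. Hence a new atom is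
  never in the closure of other atoms and never in a circuit, while original atoms depend on each
  other as in \<open>L\<close>. Conversely, a nested circuit of \<open>L\<close> has a join in the
  blowup, because no blown up element lies below \<open>\<Squnion>S\<close>.\<close>

lemma nested_circuit_iff:
  assumes ps: "blowup_sequence L H ps"
  shows "nested_circuit L H ps S \<longleftrightarrow> circuit L H S"
proof -
  define P where "P = iterated_blowup L ps"
  let ?Q = "H - atoms L"
  have P: "coords ?Q P" unfolding P_def by (rule coords_iterated_blowup[OF ps])
  note c = coordsD[OF P]
  have Q_above: "\<not> q \<sqsubseteq> x" if "q \<in> ?Q" "x \<in> atoms L \<or> x = \<bottom>" for q x
  proof
    assume "q \<sqsubseteq> x"
    moreover have "q \<in> carrier L" "q \<noteq> \<bottom>" using that H_carrier H_G G_not_bottom by auto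
    ultimately show False using that le_atom[of x q] le_bottom[of q] by auto
  qed
  have botP: "Base \<bottom> \<in> carrier P" using Q_above by (intro c(8)) auto
  have bot: "\<bottom>\<^bsub>P\<^esub> = Base \<bottom>"
  proof -
    have l: "least P (Base \<bottom>) (carrier P)" using botP c(2,3) by (auto simp: least_def)
    then have "least P \<bottom>\<^bsub>P\<^esub> (carrier P)" unfolding bottom_def by (rule someI)
    then have b: "\<bottom>\<^bsub>P\<^esub> \<in> carrier P" "le P \<bottom>\<^bsub>P\<^esub> (Base \<bottom>)" using botP by (auto simp: least_def)
    then have "base \<bottom>\<^bsub>P\<^esub> \<sqsubseteq> \<bottom>" "exc \<bottom>\<^bsub>P\<^esub> = {}" using c(2)[OF b(1) botP] by auto
    then show ?thesis using c(3)[OF b(1)] le_bottom by (intro c(6)[OF b(1) botP]) auto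
  qed
  have atom_coords: "atom_of L g \<in> carrier P" "base (atom_of L g) = (if g \<in> atoms L then g else \<bottom>)"
    "exc (atom_of L g) = (if g \<in> atoms L then {} else {g})" if "g \<in> H" for g
    using that Q_above c(8)[of g] c(9)[of g] by (auto simp: atom_of_def)
  have atomsP: "atom_of L g \<in> atoms P" if g: "g \<in> H" for g
  proof -
    note a = atom_coords[OF g]
    have "u = Base \<bottom> \<or> u = atom_of L g" if u: "u \<in> carrier P" "le P u (atom_of L g)" for u
    proof -
      have uc: "base u \<sqsubseteq> base (atom_of L g)" "exc u \<subseteq> exc (atom_of L g)" using c(2)[OF u(1) a(1)] u by auto
      have "base u = \<bottom> \<and> exc u = {} \<or> base u = base (atom_of L g) \<and> exc u = exc (atom_of L g)"
        using uc a(2,3) le_atom[of g "base u"] le_bottom[of "base u"] c(3)[OF u(1)] by (auto split: if_splits)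
      then show ?thesis using c(6)[OF u(1) botP] c(6)[OF u(1) a(1)] by auto
    qed
    moreover have "le P (Base \<bottom>) (atom_of L g)" using c(2)[OF botP a(1)] c(3)[OF a(1)] by simp
    moreover have "Base \<bottom> \<noteq> atom_of L g"
      using a(2,3) atom_not_bot[of g] by (metis base.simps(1) exc.simps(1) insert_not_empty)
    ultimately show ?thesis using a(1) botP
      by (auto simp: atoms_def covers_def lless_def c(1) bot)
  qed
  have inj: "inj_on (atom_of L) H" by (auto simp: inj_on_def atom_of_def split: if_splits)
  have le_atom_of: "le P (atom_of L g) y \<longleftrightarrow> (if g \<in> atoms L then g \<sqsubseteq> base y else g \<in> exc y)"
    if "g \<in> H" "y \<in> carrier P" for g y
    using c(2)[OF atom_coords(1)[OF that(1)] that(2)] atom_coords(2,3)[OF that(1)] c(3)[OF that(2)] by simp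
  have closure: "atom_of L g \<in> matroid_closure P j (atom_of L ` T)
      \<longleftrightarrow> (if g \<in> atoms L then g \<sqsubseteq> \<Squnion>(T \<inter> atoms L) else g \<in> T)"
    if j: "j \<in> carrier P" "\<And>t. t \<in> T \<Longrightarrow> le P (atom_of L t) j" and T: "T \<subseteq> H" and g: "g \<in> H" for g j T
  proof -
    have Tc: "T \<inter> atoms L \<subseteq> carrier L" using atoms_subset by auto
    have tj: "if t \<in> atoms L then t \<sqsubseteq> base j else t \<in> exc j" if "t \<in> T" for t
      using j(2)[OF that] le_atom_of[OF _ j(1), of t] T that by auto
    have "\<forall>t\<in>T \<inter> atoms L. t \<sqsubseteq> base j" using tj by auto
    then have "\<Squnion>(T \<inter> atoms L) \<sqsubseteq> base j" using Sup_le_iff[OF Tc c(3)[OF j(1)]] by simp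
    moreover have "T - atoms L \<subseteq> exc j"
    proof
      fix t assume "t \<in> T - atoms L"
      then show "t \<in> exc j" using tj[of t] by simp
    qed
    ultimately have "\<Squnion>(T \<inter> atoms L) \<sqsubseteq> base j" "T - atoms L \<subseteq> exc j" by auto
    \<comment> \<open>This is the join of the atoms in \<open>T\<close>; it exists because
      \<open>j\<close> bounds them and the coordinates form a down-set.\<close>
    then obtain y where y: "y \<in> carrier P" "base y = \<Squnion>(T \<inter> atoms L)" "exc y = T - atoms L"
      using c(7)[OF j(1), of "\<Squnion>(T \<inter> atoms L)" "T - atoms L"] Tc by auto
    have yj: "le P y j"
      using c(2)[OF y(1) j(1)] y \<open>\<Squnion>(T \<inter> atoms L) \<sqsubseteq> base j\<close> \<open>T - atoms L \<subseteq> exc j\<close> by simp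
    have sub: "atom_of L ` T \<subseteq> flat P y"
    proof -
      have "le P (atom_of L t) y" if "t \<in> T" for t
        using that T le_atom_of[of t y] y Sup_upper[OF Tc, of t] by auto
      then show ?thesis using T atomsP by (auto simp: flat_def)
    qed
    have min: "le P y z" if "z \<in> carrier P" "atom_of L ` T \<subseteq> flat P z" for z
    proof -
      have t: "le P (atom_of L t) z" if "t \<in> T" for t using \<open>atom_of L ` T \<subseteq> flat P z\<close> that by (auto simp: flat_def)
      have tz: "if t \<in> atoms L then t \<sqsubseteq> base z else t \<in> exc z" if "t \<in> T" for t
        using t[OF that] le_atom_of[OF _ \<open>z \<in> carrier P\<close>, of t] T that by auto
      have "\<forall>t\<in>T \<inter> atoms L. t \<sqsubseteq> base z" using tz by auto
      then have "\<Squnion>(T \<inter> atoms L) \<sqsubseteq> base z" using Sup_le_iff[OF Tc c(3)[OF that(1)]] by simp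
      moreover have "T - atoms L \<subseteq> exc z"
      proof
        fix t assume "t \<in> T - atoms L"
        then show "t \<in> exc z" using tz[of t] by simp
      qed
      ultimately have "\<Squnion>(T \<inter> atoms L) \<sqsubseteq> base z" "T - atoms L \<subseteq> exc z" by auto
      then show ?thesis using c(2)[OF y(1) that(1)] y by simp
    qed
    have "atom_of L g \<in> matroid_closure P j (atom_of L ` T) \<longleftrightarrow> le P (atom_of L g) y"
    proof
      assume "atom_of L g \<in> matroid_closure P j (atom_of L ` T)"
      then have "atom_of L g \<in> flat P y" using y yj sub unfolding matroid_closure_def by blast
      then show "le P (atom_of L g) y" by (simp add: flat_def)
    next
      assume gy: "le P (atom_of L g) y"
      have "atom_of L g \<in> flat P z" if z: "z \<in> carrier P" "atom_of L ` T \<subseteq> flat P z" for z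
      proof -
        have "le P y z" by (rule min[OF z])
        then have yz: "base y \<sqsubseteq> base z" "exc y \<subseteq> exc z" using c(2)[OF y(1) z(1)] by auto
        have "le P (atom_of L g) z"
          using gy yz le_atom_of[OF g y(1)] le_atom_of[OF g z(1)] le_trans[of g "base y" "base z"]
            c(3)[OF y(1)] c(3)[OF z(1)] by (auto split: if_splits)
        then show ?thesis using atomsP[OF g] by (simp add: flat_def)
      qed
      then show "atom_of L g \<in> matroid_closure P j (atom_of L ` T)" by (auto simp: matroid_closure_def)
    qed
    also have "\<dots> \<longleftrightarrow> (if g \<in> atoms L then g \<sqsubseteq> \<Squnion>(T \<inter> atoms L) else g \<in> T)"
      using le_atom_of[OF g y(1)] y by simp
    finally show ?thesis .
  qed
  have indep: "matroid_indep P j (atom_of L ` T) \<longleftrightarrow> (\<forall>g\<in>T \<inter> atoms L. \<not> g \<sqsubseteq> \<Squnion>((T - {g}) \<inter> atoms L))"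
    if j: "j \<in> carrier P" "\<And>t. t \<in> T \<Longrightarrow> le P (atom_of L t) j" and T: "T \<subseteq> H" for j T
  proof -
    have "atom_of L ` T \<subseteq> flat P j" using j T atomsP by (auto simp: flat_def)
    moreover have "atom_of L ` T - {atom_of L g} = atom_of L ` (T - {g})" if "g \<in> T" for g
      using inj_on_image_set_diff[OF inj, of T "{g}"] T that by auto
    ultimately have "matroid_indep P j (atom_of L ` T)
      \<longleftrightarrow> (\<forall>g\<in>T. atom_of L g \<notin> matroid_closure P j (atom_of L ` (T - {g})))"
      by (auto simp: matroid_indep_def)
    also have "\<dots> \<longleftrightarrow> (\<forall>g\<in>T. \<not> (if g \<in> atoms L then g \<sqsubseteq> \<Squnion>((T - {g}) \<inter> atoms L) else g \<in> T - {g}))"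
    proof (intro ball_cong refl arg_cong[of _ _ Not])
      fix g assume "g \<in> T"
      then show "(atom_of L g \<in> matroid_closure P j (atom_of L ` (T - {g})))
        \<longleftrightarrow> (if g \<in> atoms L then g \<sqsubseteq> \<Squnion>((T - {g}) \<inter> atoms L) else g \<in> T - {g})"
        using j T by (intro closure) auto
    qed
    also have "\<dots> \<longleftrightarrow> (\<forall>g\<in>T \<inter> atoms L. \<not> g \<sqsubseteq> \<Squnion>((T - {g}) \<inter> atoms L))" by auto
    finally show ?thesis .
  qed
  have circ: "matroid_circuit P j (atom_of L ` S) \<longleftrightarrow> lcircuit L S"
    if j: "j \<in> carrier P" "\<And>t. t \<in> S \<Longrightarrow> le P (atom_of L t) j" and S: "S \<subseteq> H" for j
  proof -
    have sub: "atom_of L ` S \<subseteq> flat P j" using j S atomsP by (auto simp: flat_def)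
    have D: "(\<forall>D. D \<subset> atom_of L ` S \<longrightarrow> matroid_indep P j D) \<longleftrightarrow> (\<forall>T. T \<subset> S \<longrightarrow> matroid_indep P j (atom_of L ` T))"
    proof (intro iffI allI impI)
      fix T assume *: "\<forall>D. D \<subset> atom_of L ` S \<longrightarrow> matroid_indep P j D" and T: "T \<subset> S"
      have "atom_of L ` T \<subset> atom_of L ` S"
        using T S inj by (metis inj_on_image_eq_iff inj_on_subset psubset_eq image_mono subset_refl order_trans)
      then show "matroid_indep P j (atom_of L ` T)" using * by blast
    next
      fix D assume *: "\<forall>T. T \<subset> S \<longrightarrow> matroid_indep P j (atom_of L ` T)" and D: "D \<subset> atom_of L ` S"
      then obtain T where "T \<subseteq> S" "D = atom_of L ` T" by (auto simp: subset_image_iff psubset_eq)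
      then show "matroid_indep P j D" using * D by (cases "T = S") auto
    qed
    have ind: "matroid_indep P j (atom_of L ` T) \<longleftrightarrow> (\<forall>g\<in>T \<inter> atoms L. \<not> g \<sqsubseteq> \<Squnion>((T - {g}) \<inter> atoms L))"
      if "T \<subseteq> S" for T using that j S by (intro indep) auto
    show ?thesis
    proof
      assume "matroid_circuit P j (atom_of L ` S)"
      then have dep: "\<exists>g\<in>S \<inter> atoms L. g \<sqsubseteq> \<Squnion>((S - {g}) \<inter> atoms L)"
        and min: "\<And>T. T \<subset> S \<Longrightarrow> \<forall>g\<in>T \<inter> atoms L. \<not> g \<sqsubseteq> \<Squnion>((T - {g}) \<inter> atoms L)"
        unfolding matroid_circuit_def D using ind by auto
      have "S \<inter> atoms L = S"
      proof (rule ccontr)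
        assume "S \<inter> atoms L \<noteq> S"
        \<comment> \<open>Discarding the new atoms would leave a smaller set that is still
          dependent.\<close>
        then have "S \<inter> atoms L \<subset> S" by auto
        from min[OF this] have "\<forall>g\<in>S \<inter> atoms L. \<not> g \<sqsubseteq> \<Squnion>((S \<inter> atoms L - {g}) \<inter> atoms L)" by auto
        moreover have "(S \<inter> atoms L - {g}) \<inter> atoms L = (S - {g}) \<inter> atoms L" for g by auto
        ultimately show False using dep by simp
      qed
      then have SA: "S \<subseteq> atoms L" by auto
      then have "(T - {g}) \<inter> atoms L = T - {g}" "T \<inter> atoms L = T" if "T \<subseteq> S" for T g using that by auto
      then show "lcircuit L S" using SA dep min unfolding lcircuit_def by (metis psubsetE subset_refl)
    next
      assume l: "lcircuit L S"
      then have SA: "S \<subseteq> atoms L" by (rule lcircuit_atoms)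
      then have eq: "(T - {g}) \<inter> atoms L = T - {g}" "T \<inter> atoms L = T" if "T \<subseteq> S" for T g using that by auto
      have "\<not> matroid_indep P j (atom_of L ` S)" using l eq[of S] ind[of S] by (auto simp: lcircuit_def)
      moreover have "matroid_indep P j (atom_of L ` T)" if T: "T \<subset> S" for T
        using l eq[of T] ind[of T] T by (auto simp: lcircuit_def)
      ultimately show "matroid_circuit P j (atom_of L ` S)" unfolding matroid_circuit_def D using sub by blast
    qed
  qed
  have lubD: "j \<in> carrier P" "\<And>t. t \<in> S \<Longrightarrow> le P (atom_of L t) j" if "is_lub P j (atom_of L ` S)" "S \<subseteq> H" for j
    using that atom_coords(1) by (auto simp: least_def Upper_def)
  show ?thesis
  proof
    assume "nested_circuit L H ps S"
    then obtain j where S: "S \<in> nested L H" and j: "is_lub P j (atom_of L ` S)" "matroid_circuit P j (atom_of L ` S)"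
      unfolding nested_circuit_def Let_def P_def by blast
    have SH: "S \<subseteq> H" using S by (simp add: nested_iff)
    then show "circuit L H S" using circ[OF lubD[OF j(1)]] j S by (simp add: circuit_def)
  next
    assume C: "circuit L H S"
    note s = circuitD[OF C]
    have Sc: "S \<subseteq> carrier L" using s atoms_subset by auto
    have jP: "Base (\<Squnion>S) \<in> carrier P" using Sc lcircuit_no_H_below[OF s(1,2)] by (intro c(8)) auto
    have up: "le P (atom_of L t) (Base (\<Squnion>S))" if "t \<in> S" for t
    proof -
      have "t \<in> H" "t \<in> atoms L" "t \<sqsubseteq> \<Squnion>S" using that s Sup_upper[OF Sc] by auto
      then show ?thesis using le_atom_of[of t, OF _ jP] by simp
    qed
    have "is_lub P (Base (\<Squnion>S)) (atom_of L ` S)"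
      unfolding least_def
    proof (intro conjI ballI)
      show "Upper P (atom_of L ` S) \<subseteq> carrier P" by (auto simp: Upper_def)
      show "Base (\<Squnion>S) \<in> Upper P (atom_of L ` S)" using jP up by (auto simp: Upper_def)
      fix z assume z: "z \<in> Upper P (atom_of L ` S)"
      then have zP: "z \<in> carrier P" by (simp add: Upper_def)
      have "t \<sqsubseteq> base z" if "t \<in> S" for t
      proof -
        have t: "t \<in> H" "t \<in> atoms L" using that s by auto
        then have "le P (atom_of L t) z" using z that atom_coords(1)[OF t(1)] by (auto simp: Upper_def)
        then show ?thesis using le_atom_of[OF t(1) zP] t by simp
      qed
      then have "\<Squnion>S \<sqsubseteq> base z" using Sc c(3)[OF zP] by (simp add: Sup_le_iff)
      then show "le P (Base (\<Squnion>S)) z" using c(2)[OF jP zP] by simp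
    qed
    moreover have "matroid_circuit P (Base (\<Squnion>S)) (atom_of L ` S)" using circ[OF jP up s(3)] s(1) by simp
    ultimately show "nested_circuit L H ps S" unfolding nested_circuit_def Let_def P_def[symmetric] using s(2) by blast
  qed
qed

end

section \<open>Change of order and passage to the quotients\<close>

text \<open>\<open>(-1) ^ disc r1 r2 S\<close> is the sign of the permutation between the two sorted enumerations of \<open>S\<close>.\<close>

definition disc :: "'a rel \<Rightarrow> 'a rel \<Rightarrow> 'a set \<Rightarrow> nat" where
  "disc r1 r2 S = card {(s, t) \<in> S \<times> S. s \<noteq> t \<and> (s, t) \<in> r1 \<and> (t, s) \<in> r2}"

text \<open>The identity of the free algebra, written in the bases of monomials sorted by
  \<open>r1\<close> and by \<open>r2\<close>.\<close>

definition reorder :: "'a rel \<Rightarrow> 'a rel \<Rightarrow> 'a gca \<Rightarrow> 'a gca" where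
  "reorder r1 r2 = lin_ext (\<lambda>(S, m). scale ((-1) ^ disc r1 r2 S) (iota S (xm m)))"

lemma linear_reorder: "linear_map (reorder r1 r2)"
  unfolding reorder_def by (rule linear_lin_ext)

lemmas reorder_simps = linear_map_add[OF linear_reorder] linear_map_scale[OF linear_reorder]
  linear_map_zero[OF linear_reorder] linear_map_sum[OF linear_reorder]

lemma reorder_iota: "reorder r1 r2 (iota S f) = scale ((-1) ^ disc r1 r2 S) (iota S f)"
  unfolding reorder_def by (rule lin_ext_iota[where h = "\<lambda>S f. scale ((-1) ^ disc r1 r2 S) (iota S f)"])
    (intro linear_map_scale_fun linear_iota)

lemma disc_swap: "disc r2 r1 S = disc r1 r2 S"
  unfolding disc_def by (rule bij_betw_same_card[of prod.swap]) (auto simp: bij_betw_def inj_on_def image_iff)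

lemma disc_singleton [simp]: "disc r1 r2 {g} = 0" and disc_empty [simp]: "disc r1 r2 {} = 0"
proof -
  have "{(s, t) \<in> {g} \<times> {g}. s \<noteq> t \<and> (s, t) \<in> r1 \<and> (t, s) \<in> r2} = {}" by auto
  then show "disc r1 r2 {g} = 0" by (simp only: disc_def card.empty)
qed (simp add: disc_def)

text \<open>Pairs in \<open>S \<times> T\<close> that are reversed in exactly one of the orders are
  counted once by \<open>disc\<close> of the union and once as an inversion; those reversed in both
  are inversions twice. Pairs inside \<open>S\<close> or \<open>T\<close> are also counted
  twice.\<close>

lemma disc_Un:
  assumes r: "linear_order_on K r1" "linear_order_on K r2"
    and ST: "S \<subseteq> K" "T \<subseteq> K" "finite S" "finite T" "S \<inter> T = {}"
  shows "even (disc r1 r2 (S \<union> T) + disc r1 r2 S + disc r1 r2 T + inversions r1 S T + inversions r2 S T)"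
proof -
  have tot: "(s, t) \<in> r1 \<longleftrightarrow> (t, s) \<notin> r1" "(s, t) \<in> r2 \<longleftrightarrow> (t, s) \<notin> r2" if "s \<in> S" "t \<in> T" for s t
  proof -
    have "s \<in> K" "t \<in> K" "s \<noteq> t" using that ST by auto
    then show "(s, t) \<in> r1 \<longleftrightarrow> (t, s) \<notin> r1" "(s, t) \<in> r2 \<longleftrightarrow> (t, s) \<notin> r2"
      using r unfolding order_on_defs total_on_def antisym_def by blast+
  qed
  let ?D = "\<lambda>S. {(s, t) \<in> S \<times> S. s \<noteq> t \<and> (s, t) \<in> r1 \<and> (t, s) \<in> r2}"
  let ?X = "{(s, t) \<in> S \<times> T. (s, t) \<in> r1 \<and> (t, s) \<in> r2}"
  let ?Y = "{(s, t) \<in> S \<times> T. (t, s) \<in> r1 \<and> (s, t) \<in> r2}"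
  let ?Y' = "{(t, s) \<in> T \<times> S. (t, s) \<in> r1 \<and> (s, t) \<in> r2}"
  let ?Z = "{(s, t) \<in> S \<times> T. (t, s) \<in> r1 \<and> (t, s) \<in> r2}"
  have fin: "finite ?X" "finite ?Y" "finite ?Y'" "finite ?Z" "finite (?D S)" "finite (?D T)"
    using ST by (auto intro: finite_subset[of _ "S \<times> T"] finite_subset[of _ "T \<times> S"]
        finite_subset[of _ "S \<times> S"] finite_subset[of _ "T \<times> T"])
  have "?D (S \<union> T) = (?D S \<union> ?D T) \<union> (?X \<union> ?Y')" using ST(5) by auto
  moreover have "(?D S \<union> ?D T) \<inter> (?X \<union> ?Y') = {}" "?D S \<inter> ?D T = {}" "?X \<inter> ?Y' = {}" using ST(5) by auto
  ultimately have "card (?D (S \<union> T)) = card (?D S) + card (?D T) + (card ?X + card ?Y')"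
    using fin by (simp add: card_Un_disjoint)
  moreover have "card ?Y' = card ?Y"
    by (rule bij_betw_same_card[of prod.swap]) (auto simp: bij_betw_def inj_on_def image_iff)
  moreover have "inversions r1 S T = card ?Y + card ?Z"
  proof -
    have "{(s, t) \<in> S \<times> T. s \<noteq> t \<and> (t, s) \<in> r1} = ?Y \<union> ?Z" "?Y \<inter> ?Z = {}" using tot ST(5) by auto
    then show ?thesis unfolding inversions_def using fin by (simp add: card_Un_disjoint)
  qed
  moreover have "inversions r2 S T = card ?X + card ?Z"
  proof -
    have "{(s, t) \<in> S \<times> T. s \<noteq> t \<and> (t, s) \<in> r2} = ?X \<union> ?Z" "?X \<inter> ?Z = {}" using tot ST(5) by auto
    then show ?thesis unfolding inversions_def using fin by (simp add: card_Un_disjoint)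
  qed
  ultimately have eq: "disc r1 r2 (S \<union> T) + disc r1 r2 S + disc r1 r2 T + inversions r1 S T + inversions r2 S T
    = 2 * (card (?D S) + card (?D T) + card ?X + card ?Y + card ?Z)" unfolding disc_def by presburger
  show ?thesis unfolding eq by (rule dvd_triv_left)
qed

lemma disc_remove:
  assumes r: "linear_order_on K r1" "linear_order_on K r2" and S: "S \<subseteq> K" "finite S" "g \<in> S"
  shows "(-1) ^ inversions r1 {g} S * (-1) ^ disc r1 r2 (S - {g})
    = ((-1) ^ disc r1 r2 S * (-1) ^ inversions r2 {g} S :: rat)"
proof -
  have "even (disc r1 r2 ({g} \<union> (S - {g})) + disc r1 r2 {g} + disc r1 r2 (S - {g})
    + inversions r1 {g} (S - {g}) + inversions r2 {g} (S - {g}))"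
    by (rule disc_Un[OF r]) (use S in auto)
  moreover have "{g} \<union> (S - {g}) = S" using S by auto
  moreover have "inversions r' {g} S = inversions r' {g} (S - {g})" for r'
    using inversions_remove_right[of "{g}" S g r'] S by simp
  ultimately have "even (inversions r1 {g} S + disc r1 r2 (S - {g}) + (disc r1 r2 S + inversions r2 {g} S))"
    by (simp add: ac_simps)
  then show ?thesis unfolding power_add[symmetric] by (rule minus_one_power_even)
qed

lemma reorder_involution: "reorder r1 r2 (reorder r1 r2 f) = f"
proof -
  have "reorder r1 r2 (reorder r1 r2 f) = lin_ext (\<lambda>u. reorder r1 r2 (case u of (S, m) \<Rightarrow> scale ((-1) ^ disc r1 r2 S) (iota S (xm m)))) f"
    by (simp add: reorder_def[of r1 r2] lin_ext_lin_ext)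
  also have "\<dots> = lin_ext (\<lambda>(S, m). monom_ex S m) f"
    by (rule lin_ext_cong)
      (auto simp: reorder_simps reorder_iota scale_scale simp flip: iota_xm power_add mult_2)
  finally show ?thesis by (simp add: lin_ext_id)
qed

lemma reorder_contraction:
  assumes r: "linear_order_on K r1" "linear_order_on K r2" and D: "D \<subseteq> K" "finite D" "C \<subseteq> D"
  shows "reorder r1 r2 (contraction r1 C D f) = scale ((-1) ^ disc r1 r2 D) (contraction r2 C D f)"
  unfolding contraction_def reorder_simps reorder_iota scale_sum scale_scale
  by (intro sum.cong refl arg_cong2[of _ _ _ _ scale] disc_remove[OF r D(1,2)]) (use D in auto)

lemma reorder_dif:
  assumes r: "linear_order_on K r1" "linear_order_on K r2"
  shows "u \<in> carrier (free_gca K r1) \<Longrightarrow> reorder r1 r2 (dif r1 u) = dif r2 (reorder r1 r2 u)"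
proof (induction rule: carrier_induct)
  case (mono S m)
  show ?case
    unfolding dif_iota reorder_simps reorder_iota linear_map_scale[OF linear_dif] scale_sum scale_scale
    by (intro sum.cong refl arg_cong2[of _ _ _ _ scale] disc_remove[OF r mono(2,1)])
qed (simp_all add: reorder_simps linear_map_add[OF linear_dif] linear_map_scale[OF linear_dif] linear_map_zero[OF linear_dif])

lemma reorder_mul:
  assumes r: "linear_order_on K r1" "linear_order_on K r2"
    and uv: "u \<in> carrier (free_gca K r1)" "v \<in> carrier (free_gca K r1)"
  shows "reorder r1 r2 (mul r1 u v) = mul r2 (reorder r1 r2 u) (reorder r1 r2 v)"
  using uv(1)
proof (induction rule: carrier_induct)
  case (mono S m)
  show ?case using uv(2)
  proof (induction rule: carrier_induct)
    case (mono T n)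
    show ?case
    proof (cases "S \<inter> T = {}")
      case True
      have "even (disc r1 r2 (S \<union> T) + disc r1 r2 S + disc r1 r2 T + inversions r1 S T + inversions r2 S T)"
        by (rule disc_Un[OF r]) (use True mono \<open>finite S\<close> \<open>S \<subseteq> K\<close> in auto)
      then have "even (inversions r1 S T + disc r1 r2 (S \<union> T) + (disc r1 r2 S + disc r1 r2 T + inversions r2 S T))"
        by (simp add: ac_simps)
      then have "(-1) ^ (inversions r1 S T + disc r1 r2 (S \<union> T))
        = ((-1) ^ (disc r1 r2 S + disc r1 r2 T + inversions r2 S T) :: rat)" by (rule minus_one_power_even)
      then show ?thesis using True
        by (simp add: mul_iota reorder_simps reorder_iota linear_map_scale[OF linear_mul(1)]
            linear_map_scale[OF linear_mul(2)] scale_scale power_add ac_simps)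
    next
      case False
      then show ?thesis
        by (simp add: mul_iota reorder_simps reorder_iota linear_map_scale[OF linear_mul(1)]
            linear_map_scale[OF linear_mul(2)])
    qed
  qed (simp_all add: reorder_simps linear_map_add[OF linear_mul(1)] linear_map_scale[OF linear_mul(1)]
      linear_map_zero[OF linear_mul(1)])
qed (simp_all add: reorder_simps linear_map_add[OF linear_mul(2)] linear_map_scale[OF linear_mul(2)]
    linear_map_zero[OF linear_mul(2)])

lemma reorder_rel_span:
  assumes r: "linear_order_on K r1" "linear_order_on K r2" and fin: "finite K"
    and w: "w \<in> rel_span L K r1"
  shows "reorder r1 r2 w \<in> rel_span L K r2"
proof (rule lspan_linear[OF linear_reorder w])
  fix y assume "y \<in> rel_gens L K r1"
  then show "reorder r1 r2 y \<in> rel_span L K r2"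
  proof cases
    case (circ C D f)
    have "reorder r1 r2 y = scale ((-1) ^ disc r1 r2 D) (contraction r2 C D f)"
      unfolding circ(1) by (rule reorder_contraction[OF r]) (use circ fin finite_subset in auto)
    then show ?thesis using circ by (simp add: lspan.scale[OF lspan.base[OF rel_gens.circ]])
  next
    case (non_nested S m f)
    then show ?thesis by (simp add: reorder_iota lspan.scale[OF lspan.base[OF rel_gens.non_nested]])
  next
    case (dependent C D f)
    then show ?thesis by (simp add: reorder_iota lspan.scale[OF lspan.base[OF rel_gens.dependent]])
  next
    case (lin g S f)
    then show ?thesis by (simp add: reorder_iota lspan.scale[OF lspan.base[OF rel_gens.lin]])
  qed
qed

lemma reorder_rel_span_iff:
  assumes r: "linear_order_on K r1" "linear_order_on K r2" and fin: "finite K"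
  shows "reorder r1 r2 w \<in> rel_span L K r2 \<longleftrightarrow> w \<in> rel_span L K r1"
proof
  have eq: "reorder r2 r1 = reorder r1 r2" by (simp add: reorder_def disc_swap)
  assume "reorder r1 r2 w \<in> rel_span L K r2"
  then have "reorder r2 r1 (reorder r1 r2 w) \<in> rel_span L K r1"
    by (rule reorder_rel_span[OF r(2,1) fin])
  then show "w \<in> rel_span L K r1" by (simp add: eq reorder_involution)
qed (rule reorder_rel_span[OF r fin])

lemma reorder_carrier:
  "u \<in> carrier (free_gca K r1) \<Longrightarrow> reorder r1 r2 u \<in> carrier (free_gca K r2)"
  by (induction rule: carrier_induct)
    (auto simp: reorder_simps reorder_iota intro!: carrier_add carrier_scale carrier_zero iota_in_carrier polys_xm)

section \<open>Bidegrees\<close>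

definition basis_monomials :: "'a set \<Rightarrow> nat \<Rightarrow> nat \<Rightarrow> 'a gca set" where
  "basis_monomials H i j = {iota S (xm m) | S m. finite S \<and> S \<subseteq> H \<and> set_mset m \<subseteq> H \<and> 2 * size m = i \<and> card S = j}"

lemma bidegree_eq: "bidegree (free_gca H r) i j = lspan (basis_monomials H i j)"
proof
  show "bidegree (free_gca H r) i j \<subseteq> lspan (basis_monomials H i j)"
  proof
    fix f assume f: "f \<in> bidegree (free_gca H r) i j"
    have "iota S (xm m) \<in> basis_monomials H i j" if "(S, m) \<in> Poly_Mapping.keys f" for S m
      unfolding basis_monomials_def
      by (intro CollectI exI[of _ S] exI[of _ m]) (use f that in \<open>auto simp: free_gca_def\<close>)
    then have "(\<Sum>(S, m)\<in>Poly_Mapping.keys f. scale (Poly_Mapping.lookup f (S, m)) (iota S (xm m))) \<in> lspan (basis_monomials H i j)"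
      by (intro lspan_sum) (auto intro!: lspan.scale[OF lspan.base])
    then show "f \<in> lspan (basis_monomials H i j)" by (subst gca_expand[of f])
  qed
  have "f \<in> bidegree (free_gca H r) i j" if "f \<in> lspan (basis_monomials H i j)" for f
    using that
  proof induction
    case (base x)
    then show ?case by (auto simp: basis_monomials_def free_gca_def iota_xm monom_ex_def)
  next
    case (add x y)
    then show ?case using Poly_Mapping.keys_add[of x y] by (auto simp: free_gca_def dest!: subsetD)
  next
    case (scale x c)
    then show ?case using keys_scale[of c x] by (auto simp: free_gca_def dest!: subsetD)
  qed (simp add: free_gca_def)
  then show "lspan (basis_monomials H i j) \<subseteq> bidegree (free_gca H r) i j" by blast
qed

lemma reorder_bidegree:
  assumes "f \<in> bidegree (free_gca K r1) i j" shows "reorder r1 r2 f \<in> bidegree (free_gca K r2) i j"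
  using assms unfolding bidegree_eq
proof (rule lspan_linear[OF linear_reorder])
  fix y assume y: "y \<in> basis_monomials K i j"
  then obtain S m where "y = iota S (xm m)" by (auto simp: basis_monomials_def)
  then have "reorder r1 r2 y = scale ((-1) ^ disc r1 r2 S) y" by (simp add: reorder_iota)
  then show "reorder r1 r2 y \<in> lspan (basis_monomials K i j)" using y by (simp add: lspan.scale[OF lspan.base])
qed

lemma (in blow_order) Phi_bidegree:
  assumes "f \<in> bidegree (free_gca H r) i j" shows "Phi f \<in> bidegree (free_gca H' r0) i j"
  using assms unfolding bidegree_eq
proof (rule lspan_linear[OF linear_Phi])
  fix y assume "y \<in> basis_monomials H i j"
  then obtain S m where y: "y = iota S (xm m)" "finite S" "S \<subseteq> H" "set_mset m \<subseteq> H" "2 * size m = i" "card S = j"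
    by (auto simp: basis_monomials_def)
  have *: "iota T (sigma (xm m)) \<in> lspan (basis_monomials H' i j)" if T: "T \<subseteq> H'" "finite T" "card T = j" for T
  proof (rule lspan_linear[OF linear_iota sigma_xm])
    fix z assume "z \<in> xm ` replaced m"
    then obtain n where n: "z = xm n" "n \<in> replaced m" by auto
    then have "size n = size m" "set_mset n \<subseteq> H'" using y(4) by (auto simp: replaced_def)
    then have "iota T z \<in> basis_monomials H' i j" unfolding n(1) basis_monomials_def using T y
      by (intro CollectI exI[of _ T] exI[of _ n]) auto
    then show "iota T z \<in> lspan (basis_monomials H' i j)" by (rule lspan.base)
  qed
  have "card (insert p (S - {s})) = j" if "s \<in> S" for s
  proof -
    have "p \<notin> S - {s}" "finite (S - {s})" using y p_notin by auto
    then show ?thesis using y that card_Suc_Diff1[OF y(2) that] by (simp del: card_Diff_insert)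
  qed
  then show "Phi y \<in> lspan (basis_monomials H' i j)" unfolding y(1) Phi_iota Phi0_def
    using y by (intro lspan.add lspan_sum lspan.scale *) auto
qed

section \<open>Cosets and the induced map of quotient algebras\<close>

lemma coset_def': "I +>\<^bsub>free_gca H r\<^esub> x = {i + x | i. i \<in> I}"
  by (auto simp: a_r_coset_def' )

lemma coset_eq:
  assumes "y - x \<in> lspan X" shows "lspan X +>\<^bsub>free_gca H r\<^esub> y = lspan X +>\<^bsub>free_gca H r\<^esub> x"
proof -
  have "lspan X +>\<^bsub>free_gca H r\<^esub> y \<subseteq> lspan X +>\<^bsub>free_gca H r\<^esub> x" if yx: "y - x \<in> lspan X" for x y
  proof
    fix z assume "z \<in> lspan X +>\<^bsub>free_gca H r\<^esub> y"
    then obtain i where i: "i \<in> lspan X" "z = i + y" by (auto simp: coset_def')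
    then have "z = (i + (y - x)) + x" by simp
    moreover have "i + (y - x) \<in> lspan X" using i yx by (intro lspan.add)
    ultimately show "z \<in> lspan X +>\<^bsub>free_gca H r\<^esub> x" unfolding coset_def' by blast
  qed
  from this[OF assms] this[of x y] lspan_uminus[OF assms] show ?thesis by auto
qed

text \<open>For a map that preserves the ideal, the unions in the definition of
  \<open>quotient_cdga\<close> run over equal cosets.\<close>

lemma coset_Union:
  assumes F: "linear_map F" and X: "\<And>x. x \<in> lspan X \<Longrightarrow> F x \<in> lspan X"
  shows "(\<Union>a\<in>lspan X +>\<^bsub>free_gca H r\<^esub> x. lspan X +>\<^bsub>free_gca H r\<^esub> F a) = lspan X +>\<^bsub>free_gca H r\<^esub> F x"
proof -
  have "lspan X +>\<^bsub>free_gca H r\<^esub> F a = lspan X +>\<^bsub>free_gca H r\<^esub> F x" if "a \<in> lspan X +>\<^bsub>free_gca H r\<^esub> x" for a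
  proof -
    have "\<exists>i. i \<in> lspan X \<and> a = i + x" using that by (auto simp: coset_def')
    then obtain i where "i \<in> lspan X" "a = i + x" by blast
    then show ?thesis using X by (intro coset_eq) (simp add: linear_map_add[OF F])
  qed
  moreover have "0 + x \<in> lspan X +>\<^bsub>free_gca H r\<^esub> x" using lspan.zero unfolding coset_def' by blast
  ultimately show ?thesis by blast
qed

lemma quotient_cdga_simps [simp]:
  "carrier (quotient_cdga A I) = carrier (A Quot I)"
  "X \<otimes>\<^bsub>quotient_cdga A I\<^esub> Y = X \<otimes>\<^bsub>A Quot I\<^esub> Y" "X \<oplus>\<^bsub>quotient_cdga A I\<^esub> Y = X \<oplus>\<^bsub>A Quot I\<^esub> Y"
  "\<one>\<^bsub>quotient_cdga A I\<^esub> = \<one>\<^bsub>A Quot I\<^esub>" "\<zero>\<^bsub>quotient_cdga A I\<^esub> = \<zero>\<^bsub>A Quot I\<^esub>"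
  "bidegree (quotient_cdga A I) i j = (\<lambda>a. I +>\<^bsub>A\<^esub> a) ` bidegree A i j"
  by (simp_all add: quotient_cdga_def)

lemma ring_quotient_cdga:
  assumes "ideal I A" shows "ring (quotient_cdga A I)"
proof -
  interpret Q: ring "A Quot I" using assms by (rule ideal.quotient_is_ring)
  show ?thesis
  proof (rule ringI)
    show "abelian_group (quotient_cdga A I)"
    proof (rule abelian_groupI)
      fix x assume "x \<in> carrier (quotient_cdga A I)"
      then show "\<exists>y\<in>carrier (quotient_cdga A I). y \<oplus>\<^bsub>quotient_cdga A I\<^esub> x = \<zero>\<^bsub>quotient_cdga A I\<^esub>"
        using Q.l_neg[of x] by (intro bexI[of _ "\<ominus>\<^bsub>A Quot I\<^esub> x"]) simp_all
    next
      fix x y assume "x \<in> carrier (quotient_cdga A I)" "y \<in> carrier (quotient_cdga A I)"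
      then show "x \<oplus>\<^bsub>quotient_cdga A I\<^esub> y = y \<oplus>\<^bsub>quotient_cdga A I\<^esub> x"
        using Q.a_comm[of x y] by simp
    qed (simp_all add: Q.a_assoc)
    show "Group.monoid (quotient_cdga A I)"
      by (rule Group.monoidI) (auto simp: Q.m_assoc)
  qed (auto simp: Q.l_distr Q.r_distr)
qed

locale blow_orders = blow_order L G H p r for L :: "'a gorder" (structure) and G H p r +
  fixes r' :: "'a rel"
  assumes r': "linear_order_on (insert p H) r'"
begin

abbreviation "R \<equiv> free_gca H r"
abbreviation "R' \<equiv> free_gca H' r'"
abbreviation "J' \<equiv> rel_span L H' r'"

definition Phi' :: "'a gca \<Rightarrow> 'a gca" where "Phi' f = reorder r0 r' (Phi f)"

lemma linear_Phi': "linear_map Phi'"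
  unfolding Phi'_def by (rule linear_map_comp[OF linear_reorder linear_Phi])

lemma Phi'_carrier: "f \<in> carrier R \<Longrightarrow> Phi' f \<in> carrier R'"
  unfolding Phi'_def by (intro reorder_carrier Phi_carrier)

lemma Phi'_kernel: "f \<in> carrier R \<Longrightarrow> Phi' f \<in> J' \<longleftrightarrow> f \<in> J"
  unfolding Phi'_def using reorder_rel_span_iff[OF linear_r0 r' finite_H'] Phi_kernel by simp

lemma Phi'_gens:
  "Phi' (iota {g} 1) = (if g \<sqsubseteq> p then iota {g} 1 + iota {p} 1 else iota {g} 1)"
  "Phi' (iota {} (xm {#g#})) = (if g \<sqsubseteq> p then iota {} (xm {#g#}) + iota {} (xm {#p#}) else iota {} (xm {#g#}))"
  "Phi' (iota {} 1) = iota {} 1"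
  unfolding Phi'_def Phi_e Phi_x Phi_one by (simp_all add: reorder_simps reorder_iota)

lemma Phi'_ring_hom: "Phi' \<in> ring_hom R R'"
proof (rule ring_hom_memI)
  fix f g assume fg: "f \<in> carrier R" "g \<in> carrier R"
  show "Phi' f \<in> carrier R'" using fg Phi'_carrier by simp
  show "Phi' (f \<otimes>\<^bsub>R\<^esub> g) = Phi' f \<otimes>\<^bsub>R'\<^esub> Phi' g"
    using fg Phi_carrier by (simp add: Phi'_def Phi_mul reorder_mul[OF linear_r0 r'])
  show "Phi' (f \<oplus>\<^bsub>R\<^esub> g) = Phi' f \<oplus>\<^bsub>R'\<^esub> Phi' g" by (simp add: linear_map_add[OF linear_Phi'])
qed (simp add: Phi'_gens)

lemma Phi'_dif: "f \<in> carrier R \<Longrightarrow> Phi' (dif r f) = dif r' (Phi' f)"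
  unfolding Phi'_def by (simp add: Phi_dif reorder_dif[OF linear_r0 r'] Phi_carrier)

lemma Phi'_bidegree: "f \<in> bidegree R i j \<Longrightarrow> Phi' f \<in> bidegree R' i j"
  unfolding Phi'_def by (intro reorder_bidegree Phi_bidegree)

lemma ideal_J: "ideal J R" and ideal_J': "ideal J' R'"
  using ideal_rel_span[OF r finite_H] ideal_rel_span[OF r' finite_H'] by auto

abbreviation "A \<equiv> quotient_cdga R J"
abbreviation "A' \<equiv> quotient_cdga R' J'"

definition psi :: "'a gca \<Rightarrow> 'a gca set" where "psi f = J' +>\<^bsub>R'\<^esub> Phi' f"

text \<open>The map of the first isomorphism theorem: \<open>psi\<close> is constant on the cosets
  of its kernel, which is \<open>J\<close> by \<open>psi_kernel\<close>.\<close>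

definition phi :: "'a gca set \<Rightarrow> 'a gca set" where "phi X = the_elem (psi ` X)"

lemma psi_ring_hom: "ring_hom_ring R (R' Quot J') psi"
proof (rule ring_hom_ringI2)
  interpret J': ideal J' R' by (rule ideal_J')
  show "ring R" by (rule ring_free_gca)
  show "ring (R' Quot J')" by (rule J'.quotient_is_ring)
  have "(+>\<^bsub>R'\<^esub>) J' \<circ> Phi' \<in> ring_hom R (R' Quot J')"
    using Phi'_ring_hom J'.rcos_ring_hom by (rule ring_hom_trans)
  then show "psi \<in> ring_hom R (R' Quot J')" by (simp add: psi_def[abs_def] comp_def)
qed

lemma psi_kernel: "a_kernel R (R' Quot J') psi = J"
proof -
  interpret J': ideal J' R' by (rule ideal_J')
  have "psi f = \<zero>\<^bsub>R' Quot J'\<^esub> \<longleftrightarrow> f \<in> J" if f: "f \<in> carrier R" for f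
  proof -
    have "psi f = \<zero>\<^bsub>R' Quot J'\<^esub> \<longleftrightarrow> J' +>\<^bsub>R'\<^esub> Phi' f = J'" by (simp add: psi_def FactRing_def)
    also have "\<dots> \<longleftrightarrow> Phi' f \<in> J'"
    proof
      assume "J' +>\<^bsub>R'\<^esub> Phi' f = J'"
      moreover have "0 + Phi' f \<in> J' +>\<^bsub>R'\<^esub> Phi' f" using lspan.zero unfolding coset_def' by blast
      ultimately show "Phi' f \<in> J'" by simp
    next
      assume "Phi' f \<in> J'"
      then have "J' +>\<^bsub>R'\<^esub> Phi' f = J' +>\<^bsub>R'\<^esub> 0" by (intro coset_eq) simp
      then show "J' +>\<^bsub>R'\<^esub> Phi' f = J'" by (simp add: coset_def')
    qed
    finally show ?thesis using Phi'_kernel[OF f] by simp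
  qed
  then show ?thesis unfolding a_kernel_def' using rel_span_carrier[OF finite_H] by auto
qed

lemma A_coset:
  assumes "X \<in> carrier A" obtains x where "x \<in> carrier R" "X = J +>\<^bsub>R\<^esub> x"
  using ring_hom_ring.quot_mem[OF psi_ring_hom, of X] assms psi_kernel by auto

lemma phi_coset: "x \<in> carrier R \<Longrightarrow> phi (J +>\<^bsub>R\<^esub> x) = J' +>\<^bsub>R'\<^esub> Phi' x"
  unfolding phi_def using ring_hom_ring.the_elem_simp[OF psi_ring_hom] psi_kernel by (simp add: psi_def)

lemma phi_inj: "inj_on phi (carrier A)"
  unfolding phi_def using ring_hom_ring.the_elem_inj[OF psi_ring_hom] psi_kernel by (auto simp: inj_on_def)

lemma phi_ring_hom: "phi \<in> ring_hom A A'"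
proof -
  have "phi \<in> ring_hom (R Quot J) (R' Quot J')"
    using ring_hom_ring.the_elem_hom[OF psi_ring_hom] psi_kernel by (simp add: phi_def[abs_def])
  then show ?thesis by (simp add: ring_hom_def)
qed

lemma smult_coset: "smult A c (J +>\<^bsub>R\<^esub> x) = J +>\<^bsub>R\<^esub> scale c x"
  and smult_coset': "smult A' c (J' +>\<^bsub>R'\<^esub> x') = J' +>\<^bsub>R'\<^esub> scale c x'"
  using coset_Union[OF linear_map_scale_fun[OF linear_map_id], of "rel_gens L H r" c]
    coset_Union[OF linear_map_scale_fun[OF linear_map_id], of "rel_gens L H' r'" c]
  by (simp_all add: quotient_cdga_def lspan.scale)

lemma dif_coset: "differential A (J +>\<^bsub>R\<^esub> x) = J +>\<^bsub>R\<^esub> dif r x"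
  and dif_coset': "differential A' (J' +>\<^bsub>R'\<^esub> x') = J' +>\<^bsub>R'\<^esub> dif r' x'"
  using coset_Union[OF linear_dif, of "rel_gens L H r"] coset_Union[OF linear_dif, of "rel_gens L H' r'"]
    dif_rel_span[OF r] p'.dif_rel_span[OF r']
  by (simp_all add: quotient_cdga_def)

lemma dif_carrier: "x \<in> carrier R \<Longrightarrow> dif r x \<in> carrier R"
proof (induction rule: carrier_induct)
  case (mono S m)
  have "(\<Sum>g\<in>T. scale ((-1) ^ inversions r {g} S) (iota (S - {g}) (xm {#g#} * xm m))) \<in> carrier R" if "T \<subseteq> S" for T
    using finite_subset[OF that mono(1)] that mono
    by (induction T) (auto intro!: carrier_zero carrier_add carrier_scale iota_in_carrier polys_mult polys_xm)
  then show ?case unfolding dif_iota by blast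
qed (auto simp: linear_map_add[OF linear_dif] linear_map_scale[OF linear_dif] linear_map_zero[OF linear_dif]
    intro: carrier_add carrier_scale carrier_zero)

lemma phi_smult: "X \<in> carrier A \<Longrightarrow> phi (smult A c X) = smult A' c (phi X)"
  by (erule A_coset) (simp add: smult_coset smult_coset' phi_coset carrier_scale linear_map_scale[OF linear_Phi'])

lemma phi_dif: "X \<in> carrier A \<Longrightarrow> phi (differential A X) = differential A' (phi X)"
  by (erule A_coset) (simp add: dif_coset dif_coset' phi_coset dif_carrier Phi'_dif)

lemma phi_bidegree: "phi ` bidegree A i j \<subseteq> bidegree A' i j"
proof -
  have "f \<in> carrier R" if "f \<in> bidegree R i j" for f
    using that by (auto simp: free_gca_def)
  then show ?thesis using Phi'_bidegree by (auto simp: phi_coset)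
qed

lemma phi_cdga_hom: "phi \<in> cdga_hom A A'"
  unfolding cdga_hom_def using phi_ring_hom phi_smult phi_dif phi_bidegree by blast

abbreviation "e g \<equiv> J +>\<^bsub>R\<^esub> e_gen g"
abbreviation "x g \<equiv> J +>\<^bsub>R\<^esub> x_gen g"
abbreviation "e' g \<equiv> J' +>\<^bsub>R'\<^esub> e_gen g"
abbreviation "x' g \<equiv> J' +>\<^bsub>R'\<^esub> x_gen g"

lemma gens_carrier:
  "g \<in> H \<Longrightarrow> e_gen g \<in> carrier R" "g \<in> H \<Longrightarrow> x_gen g \<in> carrier R"
  "g \<in> H' \<Longrightarrow> e_gen g \<in> carrier R'" "g \<in> H' \<Longrightarrow> x_gen g \<in> carrier R'"
  unfolding e_gen_iota x_gen_iota by (auto intro!: iota_in_carrier polys_xm)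

lemma add_coset':
  "a \<in> carrier R' \<Longrightarrow> b \<in> carrier R' \<Longrightarrow> (J' +>\<^bsub>R'\<^esub> a) \<oplus>\<^bsub>R' Quot J'\<^esub> (J' +>\<^bsub>R'\<^esub> b) = J' +>\<^bsub>R'\<^esub> (a + b)"
  using ring_hom_add[OF ideal.rcos_ring_hom[OF ideal_J'], of a b] by simp

lemma phi_e: "g \<in> H \<Longrightarrow> phi (e g) = (if g \<sqsubseteq> p then e' g \<oplus>\<^bsub>A'\<^esub> e' p else e' g)"
  using gens_carrier by (auto simp: phi_coset add_coset' e_gen_iota Phi'_gens)

lemma phi_x: "g \<in> H \<Longrightarrow> phi (x g) = (if g \<sqsubseteq> p then x' g \<oplus>\<^bsub>A'\<^esub> x' p else x' g)"
  using gens_carrier by (auto simp: phi_coset add_coset' x_gen_iota Phi'_gens)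

lemma ring_A: "ring A" and ring_A': "ring A'"
  using ring_quotient_cdga[OF ideal_J] ring_quotient_cdga[OF ideal_J'] by auto

lemma coset_carrier: "a \<in> carrier R \<Longrightarrow> J +>\<^bsub>R\<^esub> a \<in> carrier A"
  using ring_hom_closed[OF ideal.rcos_ring_hom[OF ideal_J]] by simp

section \<open>Restriction to the subalgebras\<close>

abbreviation "gensB \<equiv> x ` H \<union> e ` (H - {\<top>})"
abbreviation "gensB' \<equiv> x' ` H' \<union> e' ` (H' - {\<top>})"
abbreviation "B \<equiv> subalgebra_gen A gensB"
abbreviation "B' \<equiv> subalgebra_gen A' gensB'"

text \<open>As \<open>\<top>\<close> is in \<open>H\<close> and \<open>p\<close> is not,
  \<open>p\<close> differs from \<open>\<top>\<close>. So \<open>e_p\<close> is among the generators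
  of the target, and each \<open>x_g\<close> and each \<open>e_g\<close> in question goes to a sum
  of generators.\<close>

lemma phi_B:
  assumes top: "\<top> \<in> H" and b: "b \<in> B" shows "b \<in> carrier A \<and> phi b \<in> B'"
proof -
  interpret h: ring_hom_ring A A' phi
    using ring_A ring_A' phi_ring_hom by (rule ring_hom_ringI2)
  have one: "\<one>\<^bsub>A\<^esub> = J +>\<^bsub>R\<^esub> iota {} 1" "\<one>\<^bsub>A'\<^esub> = J' +>\<^bsub>R'\<^esub> iota {} 1"
    by (simp_all add: FactRing_def)
  have oneR: "iota {} 1 \<in> carrier R" by (intro iota_in_carrier) auto
  have ptop: "p \<noteq> \<top>" using top p_notin by auto
  show ?thesis
    using b unfolding subalgebra_gen_def
  proof (induction rule: generate_ring.induct)
    case one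
    then show ?case using generate_ring.one[of A'] by (simp only: h.R.one_closed h.hom_one simp_thms)
  next
    case (incl b)
    then consider g where "g \<in> H" "b = x g" | g where "g \<in> H" "g \<noteq> \<top>" "b = e g" | c where "b = c \<odot>\<^bsub>A\<^esub> \<one>\<^bsub>A\<^esub>"
      by auto
    then show ?case
    proof cases
      case 1
      have "x' k \<in> generate_ring A' (gensB' \<union> {c \<odot>\<^bsub>A'\<^esub> \<one>\<^bsub>A'\<^esub> | c. True})" if "k \<in> H'" for k
        using that by (intro generate_ring.incl) auto
      then have "phi b \<in> generate_ring A' (gensB' \<union> {c \<odot>\<^bsub>A'\<^esub> \<one>\<^bsub>A'\<^esub> | c. True})"
        unfolding 1(2) phi_x[OF 1(1)] using 1(1) by (cases "g \<sqsubseteq> p") (simp_all add: generate_ring.eng_add del: quotient_cdga_simps)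
      moreover have "b \<in> carrier A" unfolding 1(2) using 1(1) by (intro coset_carrier gens_carrier)
      ultimately show ?thesis by blast
    next
      case 2
      have "e' k \<in> generate_ring A' (gensB' \<union> {c \<odot>\<^bsub>A'\<^esub> \<one>\<^bsub>A'\<^esub> | c. True})" if "k \<in> H'" "k \<noteq> \<top>" for k
        using that by (intro generate_ring.incl) auto
      then have "phi b \<in> generate_ring A' (gensB' \<union> {c \<odot>\<^bsub>A'\<^esub> \<one>\<^bsub>A'\<^esub> | c. True})"
        unfolding 2(3) phi_e[OF 2(1)] using 2(1,2) ptop by (cases "g \<sqsubseteq> p") (simp_all add: generate_ring.eng_add del: quotient_cdga_simps)
      moreover have "b \<in> carrier A" unfolding 2(3) using 2(1) by (intro coset_carrier gens_carrier)
      ultimately show ?thesis by blast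
    next
      case 3
      have "b = J +>\<^bsub>R\<^esub> scale c (iota {} 1)" unfolding 3 one smult_coset ..
      then have "b \<in> carrier A" by (simp only: coset_carrier[OF carrier_scale[OF oneR]])
      moreover have "phi b = c \<odot>\<^bsub>A'\<^esub> \<one>\<^bsub>A'\<^esub>"
        unfolding 3 using phi_smult[OF h.R.one_closed] h.hom_one by simp
      ultimately show ?thesis by (auto intro: generate_ring.incl)
    qed
  next
    case (a_inv b)
    then show ?case using h.hom_a_inv[of b] generate_ring.a_inv[of "phi b" A'] by (simp only: h.R.a_inv_closed simp_thms)
  next
    case (eng_add b c)
    then show ?case using h.hom_add[of b c] generate_ring.eng_add[of "phi b" A' _ "phi c"]
      by (simp only: h.R.a_closed simp_thms)
  next
    case (eng_mult b c)
    then show ?case using h.hom_mult[of b c] generate_ring.eng_mult[of "phi b" A' _ "phi c"]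
      by (simp only: h.R.m_closed simp_thms)
  qed
qed

lemma phi_cdga_hom_B:
  assumes "\<top> \<in> H" shows "phi \<in> cdga_hom (restrict_cdga A B) (restrict_cdga A' B')"
proof -
  have BA: "b \<in> carrier A" "phi b \<in> B'" if "b \<in> B" for b using phi_B[OF assms that] by auto
  have "phi \<in> ring_hom (restrict_cdga A B) (restrict_cdga A' B')"
    using phi_ring_hom BA by (auto simp: ring_hom_def restrict_cdga_def)
  moreover have "phi ` (bidegree A i j \<inter> B) \<subseteq> bidegree A' i j \<inter> B'" for i j
    using phi_bidegree[of i j] BA by blast
  ultimately show ?thesis
    using phi_smult phi_dif BA unfolding cdga_hom_def by (auto simp: restrict_cdga_def)
qed

end

theorem theorem5p5p6:
  fixes L :: "'a gorder" and G H :: "'a set" and p :: 'a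
    and ps ps' :: "'a list" and r r' :: "'a rel"
  assumes "geometric_lattice L"
    and "building_set L G"
    and "partial_building_set L G H"
    and "p \<notin> H"
    and "partial_building_set L G (insert p H)"
    and "blowup_sequence L H ps"
    and "blowup_sequence L (insert p H) ps'"
    and "admissible_order L H r"
    and "admissible_order L (insert p H) r'"
  defines "A \<equiv> B_hat L H ps r" and "A' \<equiv> B_hat L (insert p H) ps' r'"
    and "e \<equiv> e_cls L H ps r" and "e' \<equiv> e_cls L (insert p H) ps' r'"
    and "x \<equiv> x_cls L H ps r" and "x' \<equiv> x_cls L (insert p H) ps' r'"
  shows "\<exists>\<phi> \<in> cdga_hom A A'. inj_on \<phi> (carrier A)
    \<and> (\<forall>g\<in>H. \<phi> (e g) = (if g \<sqsubseteq>\<^bsub>L\<^esub> p then e' g \<oplus>\<^bsub>A'\<^esub> e' p else e' g))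
    \<and> (\<forall>g\<in>H. \<phi> (x g) = (if g \<sqsubseteq>\<^bsub>L\<^esub> p then x' g \<oplus>\<^bsub>A'\<^esub> x' p else x' g))
    \<and> (\<top>\<^bsub>L\<^esub> \<in> H \<longrightarrow>
        (\<exists>\<phi>B \<in> cdga_hom (B_alg L H ps r) (B_alg L (insert p H) ps' r').
          inj_on \<phi>B (carrier (B_alg L H ps r))
          \<and> (\<forall>b\<in>carrier (B_alg L H ps r). \<phi>B b = \<phi> b)))"
proof -
  interpret geom L by unfold_locales (rule assms(1))
  have "pbs L G H" "pbs L G (insert p H)"
    using assms geom_axioms by (auto simp: pbs_def pbs_axioms_def)
  then interpret M: blow_orders L G H p r r'
    using assms geom_axioms
    by unfold_locales (auto simp: admissible_order_def)
  \<comment> \<open>With the circuits described in \<open>L\<close>, the ideal no longer depends on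
    the enumeration \<open>ps\<close>.\<close>
  have I: "rel_ideal L H ps r = rel_span L H r"
    by (rule rel_ideal_eq[OF M.r M.finite_H M.nested_circuit_iff[OF assms(6)]])
  have I': "rel_ideal L (insert p H) ps' r' = rel_span L (insert p H) r'"
    by (rule rel_ideal_eq[OF M.r' M.finite_H' M.p'.nested_circuit_iff[OF assms(7)]])
  have A: "A = M.A" "A' = M.A'" unfolding A_def A'_def B_hat_def I I' by auto
  have ex: "e = M.e" "x = M.x" "e' = M.e'" "x' = M.x'"
    unfolding e_def x_def e'_def x'_def e_cls_def[abs_def] x_cls_def[abs_def] I I' by auto
  have B: "B_alg L H ps r = restrict_cdga M.A M.B" "B_alg L (insert p H) ps' r' = restrict_cdga M.A' M.B'"
    unfolding B_alg_def A_def[symmetric] A'_def[symmetric] A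
      e_def[symmetric] x_def[symmetric] e'_def[symmetric] x'_def[symmetric] ex by auto
  have "\<exists>\<phi>B \<in> cdga_hom (restrict_cdga M.A M.B) (restrict_cdga M.A' M.B').
      inj_on \<phi>B (carrier (restrict_cdga M.A M.B)) \<and> (\<forall>b\<in>carrier (restrict_cdga M.A M.B). \<phi>B b = M.phi b)"
    if top: "\<top>\<^bsub>L\<^esub> \<in> H"
  proof (intro bexI conjI ballI)
    show "M.phi \<in> cdga_hom (restrict_cdga M.A M.B) (restrict_cdga M.A' M.B')" by (rule M.phi_cdga_hom_B[OF top])
    have "carrier (restrict_cdga M.A M.B) \<subseteq> carrier M.A"
      using M.phi_B[OF top] by (auto simp: restrict_cdga_def)
    then show "inj_on M.phi (carrier (restrict_cdga M.A M.B))" by (rule inj_on_subset[OF M.phi_inj])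
  qed simp
  then show ?thesis
    unfolding A ex B using M.phi_cdga_hom M.phi_inj M.phi_e M.phi_x by blast
qed

end
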